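(* Let $i\ge 1$. There is a surjective $\mathrm{GL}(\infty,\mathbb{Q})$-homomorphism $$H^A_i(\mathrm{IA}_\infty,\mathbb{Q})\twoheadrightarrow \Bigl(\bigwedge^{i+1}\mathbf{H}\Bigr)\otimes \mathbf{H}^*.$$ In particular, $\dim_{\mathbb{Q}}(H^A_i(\mathrm{IA}_\infty,\mathbb{Q}))=\dim_{\mathbb{Q}}(H_i(\mathrm{IA}_\infty,\mathbb{Q}))=\infty$.
   Context: $F_n=\langle x_1,\dots,x_n\rangle$ is the free group of rank $n$, and $\mathrm{IA}_n$ is the kernel of $\mathrm{Aut}(F_n)\to \mathrm{GL}(n,\mathbb{Z})$. Let $H_n=H_1(F_n,\mathbb{Q})$ with basis $e_1,\dots,e_n$, and $H_n^*=\mathrm{Hom}_{\mathbb{Q}}(H_n,\mathbb{Q})$ with dual basis $e_1^*,\dots,e_n^*$. Inclusions: $\mathrm{IA}_n\hookrightarrow \mathrm{IA}_{n+1}$ extends an automorphism by fixing $x_{n+1}$; $H_n\hookrightarrow H_{n+1}$ sends $e_j\mapsto e_j$; $H_n^*\hookrightarrow H_{n+1}^*$ sends $e_j^*\mapsto e_j^*$; $\mathrm{GL}(n,\mathbb{Q})\hookrightarrow \mathrm{GL}(n+1,\mathbb{Q})$ sends $A\mapsto A\oplus 1$. Put $\mathrm{IA}_\infty=\varinjlim_n \mathrm{IA}_n$, $\mathrm{GL}(\infty,\mathbb{Q})=\varinjlim_n\mathrm{GL}(n,\mathbb{Q})$, $\mathbf{H}=\varinjlim_n H_n$, $\mathbf{H}^*=\varinjlim_n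 (H_n^* )$. For a group $G$ with abelianization map $\pi:G\to H_1(G,\mathbb{Z})$, the Albanese homology is $H^A_i(G,\mathbb{Q})=\mathrm{im}(\pi_*:H_i(G,\mathbb{Q})\to H_i(H_1(G,\mathbb{Z}),\mathbb{Q}))$. Via the Johnson isomorphism $H_1(\mathrm{IA}_n,\mathbb{Q})\cong U=\mathrm{Hom}(H_n,\bigwedge^2H_n)$ (induced by sending $f\in\mathrm{IA}_n$ to $[x]\mapsto x^{-1}f(x)$ modulo the third term of the lower central series), $H^A_i(\mathrm{IA}_n,\mathbb{Q})$ is a subrepresentation of the algebraic $\mathrm{GL}(n,\mathbb{Q})$-representation $\bigwedge^iU$. One has $H^A_i(\mathrm{IA}_\infty,\mathbb{Q})\cong\varinjlim_n H^A_i(\mathrm{IA}_n,\mathbb{Q})$, and the $\mathrm{GL}(\infty,\mathbb{Q})$-action on it is the one induced by the $\mathrm{GL}(n,\mathbb{Q})$-actions. *)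

theory Defs
  imports
    "Jordan_Normal_Form.VS_Connect"
    "HOL-Library.Poly_Mapping"
    "HOL-Library.Extended_Nat"
    "HOL-Algebra.AbelCoset"
    "HOL-Algebra.Bij"
    "HOL-Algebra.Generated_Groups"
begin

section \<open>Rational vector spaces\<close>

text \<open>Vector spaces are module records over the field \<open>rat_field\<close>. Their ring fields
  \<^const>\<open>mult\<close> and \<^const>\<open>one\<close> carry no information and are filled arbitrarily.\<close>

abbreviation rat_field :: "rat ring" where
  "rat_field \<equiv> class_ring"

definition rat_line :: "(rat, rat) module" where
  "rat_line = \<lparr>carrier = UNIV, mult = (*), one = 1, zero = 0, add = (+), smult = (*)\<rparr>"

definition free_space :: "'i set \<Rightarrow> (rat, 'i \<Rightarrow>\<^sub>0 rat) module" where
  "free_space I = \<lparr>carrier = {c. Poly_Mapping.keys c \<subseteq> I}, mult = (\<lambda>_ _. 0), one = 0,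
     zero = 0, add = (+), smult = (\<lambda>a. Poly_Mapping.map ((*) a))\<rparr>"

definition lin_ext :: "('i \<Rightarrow> ('j \<Rightarrow>\<^sub>0 rat)) \<Rightarrow> ('i \<Rightarrow>\<^sub>0 rat) \<Rightarrow> ('j \<Rightarrow>\<^sub>0 rat)" where
  "lin_ext F c =
     (\<Sum>x\<in>Poly_Mapping.keys c. Poly_Mapping.map ((*) (Poly_Mapping.lookup c x)) (F x))"

definition quot_space :: "(rat, 'v) module \<Rightarrow> 'v set \<Rightarrow> (rat, 'v set) module" where
  "quot_space V S = \<lparr>carrier = a_rcosets\<^bsub>V\<^esub> S, mult = (\<lambda>_ _. S), one = S,
     zero = S, add = (\<lambda>X Y. X <+>\<^bsub>V\<^esub> Y),
     smult = (\<lambda>a X. \<Union>x\<in>X. S +>\<^bsub>V\<^esub> (a \<odot>\<^bsub>V\<^esub> x))\<rparr>"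

text \<open>The map into the quotient of \<open>W\<close> by \<open>T\<close> that is induced on cosets by \<open>g\<close>; for a
  well-defined induced map all members of the union coincide.\<close>

definition quot_map :: "(rat, 'w) module \<Rightarrow> 'w set \<Rightarrow> ('v \<Rightarrow> 'w) \<Rightarrow> 'v set \<Rightarrow> 'w set" where
  "quot_map W T g X = (\<Union>x\<in>X. T +>\<^bsub>W\<^esub> g x)"

definition vdim :: "(rat, 'v) module \<Rightarrow> enat" where
  "vdim V = (if vectorspace.fin_dim rat_field V then enat (vectorspace.dim rat_field V) else \<infinity>)"

section \<open>Exterior powers and tensor products\<close>

definition ext_free :: "nat \<Rightarrow> (rat, 'v) module \<Rightarrow> (rat, 'v list \<Rightarrow>\<^sub>0 rat) module" where
  "ext_free k V = free_space {l. length l = k \<and> set l \<subseteq> carrier V}"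

definition ext_rel :: "nat \<Rightarrow> (rat, 'v) module \<Rightarrow> ('v list \<Rightarrow>\<^sub>0 rat) set" where
  "ext_rel k V = LinearCombinations.module.span rat_field (ext_free k V)
     ({Poly_Mapping.single (l[j := x \<oplus>\<^bsub>V\<^esub> y]) 1 - Poly_Mapping.single (l[j := x]) 1
         - Poly_Mapping.single (l[j := y]) 1 | l j x y.
         length l = k \<and> set l \<subseteq> carrier V \<and> j < k \<and> x \<in> carrier V \<and> y \<in> carrier V}
    \<union> {Poly_Mapping.single (l[j := a \<odot>\<^bsub>V\<^esub> x]) 1 - Poly_Mapping.single (l[j := x]) a | l j a x.
         length l = k \<and> set l \<subseteq> carrier V \<and> j < k \<and> x \<in> carrier V}
    \<union> {Poly_Mapping.single l 1 | l. length l = k \<and> set l \<subseteq> carrier V \<and> \<not> distinct l})"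

definition ext_pow :: "nat \<Rightarrow> (rat, 'v) module \<Rightarrow> (rat, ('v list \<Rightarrow>\<^sub>0 rat) set) module" where
  "ext_pow k V = quot_space (ext_free k V) (ext_rel k V)"

definition wedge :: "(rat, 'v) module \<Rightarrow> 'v list \<Rightarrow> ('v list \<Rightarrow>\<^sub>0 rat) set" where
  "wedge V l =
     ext_rel (length l) V +>\<^bsub>ext_free (length l) V\<^esub> Poly_Mapping.single l 1"

definition ext_map :: "nat \<Rightarrow> (rat, 'w) module \<Rightarrow> ('v \<Rightarrow> 'w)
    \<Rightarrow> ('v list \<Rightarrow>\<^sub>0 rat) set \<Rightarrow> ('w list \<Rightarrow>\<^sub>0 rat) set" where
  "ext_map k W f = quot_map (ext_free k W) (ext_rel k W)
     (lin_ext (\<lambda>l. Poly_Mapping.single (map f l) 1))"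

definition tensor_free :: "(rat, 'v) module \<Rightarrow> (rat, 'w) module
    \<Rightarrow> (rat, 'v \<times> 'w \<Rightarrow>\<^sub>0 rat) module" where
  "tensor_free V W = free_space (carrier V \<times> carrier W)"

definition tensor_rel :: "(rat, 'v) module \<Rightarrow> (rat, 'w) module \<Rightarrow> ('v \<times> 'w \<Rightarrow>\<^sub>0 rat) set" where
  "tensor_rel V W = LinearCombinations.module.span rat_field (tensor_free V W)
     ({Poly_Mapping.single (x \<oplus>\<^bsub>V\<^esub> x', y) 1 - Poly_Mapping.single (x, y) 1
         - Poly_Mapping.single (x', y) 1 | x x' y.
         x \<in> carrier V \<and> x' \<in> carrier V \<and> y \<in> carrier W}
    \<union> {Poly_Mapping.single (x, y \<oplus>\<^bsub>W\<^esub> y') 1 - Poly_Mapping.single (x, y) 1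
         - Poly_Mapping.single (x, y') 1 | x y y'.
         x \<in> carrier V \<and> y \<in> carrier W \<and> y' \<in> carrier W}
    \<union> {Poly_Mapping.single (a \<odot>\<^bsub>V\<^esub> x, y) 1 - Poly_Mapping.single (x, y) a | a x y.
         x \<in> carrier V \<and> y \<in> carrier W}
    \<union> {Poly_Mapping.single (x, a \<odot>\<^bsub>W\<^esub> y) 1 - Poly_Mapping.single (x, y) a | a x y.
         x \<in> carrier V \<and> y \<in> carrier W})"

definition tensor :: "(rat, 'v) module \<Rightarrow> (rat, 'w) module
    \<Rightarrow> (rat, ('v \<times> 'w \<Rightarrow>\<^sub>0 rat) set) module" where
  "tensor V W = quot_space (tensor_free V W) (tensor_rel V W)"

definition tensor_map :: "(rat, 'v2) module \<Rightarrow> (rat, 'w2) module \<Rightarrow> ('v1 \<Rightarrow> 'v2) \<Rightarrow> ('w1 \<Rightarrow> 'w2)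
    \<Rightarrow> ('v1 \<times> 'w1 \<Rightarrow>\<^sub>0 rat) set \<Rightarrow> ('v2 \<times> 'w2 \<Rightarrow>\<^sub>0 rat) set" where
  "tensor_map V W f g = quot_map (tensor_free V W) (tensor_rel V W)
     (lin_ext (\<lambda>(x, y). Poly_Mapping.single (f x, g y) 1))"

section \<open>Group homology with rational coefficients and Albanese homology\<close>

text \<open>Homology with trivial coefficients, computed by the inhomogeneous (unnormalized) bar
  complex: a basis element \<open>[g\<^sub>1|...|g\<^sub>n]\<close> is a list of group elements.\<close>

definition bar_face :: "('g, 'b) monoid_scheme \<Rightarrow> nat \<Rightarrow> 'g list \<Rightarrow> 'g list" where
  "bar_face G j l =
     (if j = 0 then tl l
      else if j = length l then butlast l
      else take (j - 1) l @ [l ! (j - 1) \<otimes>\<^bsub>G\<^esub> l ! j] @ drop (j + 1) l)"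

definition bar_boundary :: "('g, 'b) monoid_scheme \<Rightarrow> ('g list \<Rightarrow>\<^sub>0 rat) \<Rightarrow> ('g list \<Rightarrow>\<^sub>0 rat)" where
  "bar_boundary G = lin_ext (\<lambda>l. if l = [] then 0
     else (\<Sum>j\<le>length l. Poly_Mapping.single (bar_face G j l) ((-1) ^ j)))"

definition bar_chains :: "('g, 'b) monoid_scheme \<Rightarrow> nat \<Rightarrow> (rat, 'g list \<Rightarrow>\<^sub>0 rat) module" where
  "bar_chains G n = free_space {l. length l = n \<and> set l \<subseteq> carrier G}"

definition bar_cycles :: "('g, 'b) monoid_scheme \<Rightarrow> nat \<Rightarrow> (rat, 'g list \<Rightarrow>\<^sub>0 rat) module" where
  "bar_cycles G n =
     (bar_chains G n)\<lparr>carrier := {c \<in> carrier (bar_chains G n). bar_boundary G c = 0}\<rparr>"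

definition bar_boundaries :: "('g, 'b) monoid_scheme \<Rightarrow> nat \<Rightarrow> ('g list \<Rightarrow>\<^sub>0 rat) set" where
  "bar_boundaries G n = bar_boundary G ` carrier (bar_chains G (Suc n))"

definition homology :: "('g, 'b) monoid_scheme \<Rightarrow> nat \<Rightarrow> (rat, ('g list \<Rightarrow>\<^sub>0 rat) set) module" where
  "homology G n = quot_space (bar_cycles G n) (bar_boundaries G n)"

definition homology_map :: "('h, 'c) monoid_scheme \<Rightarrow> nat \<Rightarrow> ('g \<Rightarrow> 'h)
    \<Rightarrow> ('g list \<Rightarrow>\<^sub>0 rat) set \<Rightarrow> ('h list \<Rightarrow>\<^sub>0 rat) set" where
  "homology_map K n f = quot_map (bar_cycles K n) (bar_boundaries K n)
     (lin_ext (\<lambda>l. Poly_Mapping.single (map f l) 1))"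

definition abelianization :: "('g, 'b) monoid_scheme \<Rightarrow> 'g set monoid" where
  "abelianization G = G Mod (derived G (carrier G))"

definition ab_proj :: "('g, 'b) monoid_scheme \<Rightarrow> 'g \<Rightarrow> 'g set" where
  "ab_proj G g = derived G (carrier G) #>\<^bsub>G\<^esub> g"

definition albanese :: "('g, 'b) monoid_scheme \<Rightarrow> nat
    \<Rightarrow> (rat, ('g set list \<Rightarrow>\<^sub>0 rat) set) module" where
  "albanese G n = (homology (abelianization G) n)
     \<lparr>carrier := homology_map (abelianization G) n (ab_proj G) ` carrier (homology G n)\<rparr>"

section \<open>Free groups and IA-automorphisms\<close>

text \<open>The letter \<open>(x, True)\<close> is the generator \<open>x\<close>, and \<open>(x, False)\<close> its inverse. The elements
  of the free group are the reduced words.\<close>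

type_synonym 'a word = "('a \<times> bool) list"

definition inv_letter :: "'a \<times> bool \<Rightarrow> 'a \<times> bool" where
  "inv_letter a = (fst a, \<not> snd a)"

definition reduced :: "'a word \<Rightarrow> bool" where
  "reduced w \<longleftrightarrow> successively (\<lambda>a b. b \<noteq> inv_letter a) w"

fun push :: "'a \<times> bool \<Rightarrow> 'a word \<Rightarrow> 'a word" where
  "push a [] = [a]"
| "push a (b # w) = (if b = inv_letter a then w else a # b # w)"

definition free_grp :: "'a set \<Rightarrow> 'a word monoid" where
  "free_grp S = \<lparr>carrier = {w. reduced w \<and> fst ` set w \<subseteq> S},
     mult = (\<lambda>u v. foldr push u v), one = []\<rparr>"

text \<open>The generators are numbered from \<open>0\<close>, so \<open>F n\<close> is free on \<open>gen 0, ..., gen (n - 1)\<close> and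
  the inclusions \<open>F n \<subseteq> F (n + 1)\<close> are literal; \<open>F_inf\<close> is their union.\<close>

definition F :: "nat \<Rightarrow> nat word monoid" where
  "F n = free_grp {..<n}"

definition F_inf :: "nat word monoid" where
  "F_inf = free_grp UNIV"

definition gen :: "nat \<Rightarrow> nat word" where
  "gen j = [(j, True)]"

text \<open>\<open>GL(n, \<int>)\<close> is the automorphism group of the abelianization of \<open>F n\<close>, so the kernel consists of
  the automorphisms that fix every class in the abelianization.\<close>

definition IA :: "nat \<Rightarrow> (nat word \<Rightarrow> nat word) monoid" where
  "IA n = (AutoGroup (F n))\<lparr>carrier := {f \<in> auto (F n).
     \<forall>x\<in>carrier (F n). ab_proj (F n) (f x) = ab_proj (F n) x}\<rparr>"

text \<open>The direct limit of the \<open>IA n\<close> along the injections that extend by fixing the new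
  generator, realized as a union inside the automorphism group of \<open>F_inf\<close>.\<close>

definition IA_inf :: "(nat word \<Rightarrow> nat word) monoid" where
  "IA_inf = (AutoGroup F_inf)\<lparr>carrier := {f \<in> auto F_inf.
     \<exists>n. restrict f (carrier (F n)) \<in> carrier (IA n) \<and> (\<forall>j\<ge>n. f (gen j) = gen j)}\<rparr>"

section \<open>The stable general linear group and its representations\<close>

text \<open>\<open>H n\<close> has basis \<open>e 0, ..., e (n - 1)\<close>, and the direct limit \<open>H_inf\<close> is the union.\<close>

definition H :: "nat \<Rightarrow> (rat, nat \<Rightarrow>\<^sub>0 rat) module" where
  "H n = free_space {..<n}"

definition H_inf :: "(rat, nat \<Rightarrow>\<^sub>0 rat) module" where
  "H_inf = free_space UNIV"

definition e :: "nat \<Rightarrow> (nat \<Rightarrow>\<^sub>0 rat)" where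
  "e j = Poly_Mapping.single j 1"

text \<open>The direct limit of the \<open>GL(n, \<rat>)\<close> along \<open>A \<mapsto> A \<oplus> 1\<close>, acting on \<open>H_inf\<close>.\<close>

definition GL_inf :: "((nat \<Rightarrow>\<^sub>0 rat) \<Rightarrow> (nat \<Rightarrow>\<^sub>0 rat)) set" where
  "GL_inf = {A \<in> LinearCombinations.module_hom rat_field H_inf H_inf. bij A \<and>
     (\<exists>n. A ` carrier (H n) = carrier (H n) \<and> (\<forall>j\<ge>n. A (e j) = e j))}"

text \<open>The linear maps that vanish on almost all \<open>e j\<close>. A homomorphism from \<open>H n\<close> is extended
  to \<open>H (n + 1)\<close> by zero on \<open>e n\<close>, so \<open>H_dual\<close> is the direct limit of the duals of \<open>H n\<close> (with
  \<open>e\<^sub>j\<^sup>*\<close> sent to \<open>e\<^sub>j\<^sup>*\<close>), and \<open>U_inf\<close> that of the spaces of homomorphisms from \<open>H n\<close> to the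
  second exterior power of \<open>H n\<close>; the extension by zero matches the inclusions of the \<open>IA n\<close>.\<close>

definition fin_hom :: "(rat, 'w) module \<Rightarrow> (rat, (nat \<Rightarrow>\<^sub>0 rat) \<Rightarrow> 'w) module" where
  "fin_hom W = \<lparr>carrier = {u \<in> LinearCombinations.module_hom rat_field H_inf W. finite {j. u (e j) \<noteq> \<zero>\<^bsub>W\<^esub>}},
     mult = (\<lambda>_ _ _. \<zero>\<^bsub>W\<^esub>), one = (\<lambda>_. \<zero>\<^bsub>W\<^esub>), zero = (\<lambda>_. \<zero>\<^bsub>W\<^esub>),
     add = (\<lambda>u v x. u x \<oplus>\<^bsub>W\<^esub> v x), smult = (\<lambda>a u x. a \<odot>\<^bsub>W\<^esub> u x)\<rparr>"

definition H_dual :: "(rat, (nat \<Rightarrow>\<^sub>0 rat) \<Rightarrow> rat) module" where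
  "H_dual = fin_hom rat_line"

definition dual_act :: "((nat \<Rightarrow>\<^sub>0 rat) \<Rightarrow> (nat \<Rightarrow>\<^sub>0 rat)) \<Rightarrow> ((nat \<Rightarrow>\<^sub>0 rat) \<Rightarrow> rat)
    \<Rightarrow> (nat \<Rightarrow>\<^sub>0 rat) \<Rightarrow> rat" where
  "dual_act A u = u \<circ> inv_into UNIV A"

type_synonym U_elt = "(nat \<Rightarrow>\<^sub>0 rat) \<Rightarrow> ((nat \<Rightarrow>\<^sub>0 rat) list \<Rightarrow>\<^sub>0 rat) set"

definition U_inf :: "(rat, U_elt) module" where
  "U_inf = fin_hom (ext_pow 2 H_inf)"

definition U_act :: "((nat \<Rightarrow>\<^sub>0 rat) \<Rightarrow> (nat \<Rightarrow>\<^sub>0 rat)) \<Rightarrow> U_elt \<Rightarrow> U_elt" where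
  "U_act A u = ext_map 2 H_inf A \<circ> u \<circ> inv_into UNIV A"

definition GL_inf_hom :: "(rat, 'v) module \<Rightarrow> (((nat \<Rightarrow>\<^sub>0 rat) \<Rightarrow> (nat \<Rightarrow>\<^sub>0 rat)) \<Rightarrow> 'v \<Rightarrow> 'v)
    \<Rightarrow> (rat, 'w) module \<Rightarrow> (((nat \<Rightarrow>\<^sub>0 rat) \<Rightarrow> (nat \<Rightarrow>\<^sub>0 rat)) \<Rightarrow> 'w \<Rightarrow> 'w) \<Rightarrow> ('v \<Rightarrow> 'w) \<Rightarrow> bool" where
  "GL_inf_hom V \<rho> W \<sigma> \<phi> \<longleftrightarrow> linear_map rat_field V W \<phi> \<and>
     (\<forall>A\<in>GL_inf. \<forall>v\<in>carrier V. \<rho> A v \<in> carrier V \<and> \<phi> (\<rho> A v) = \<sigma> A (\<phi> v))"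

section \<open>The Johnson homomorphism and the action on Albanese homology\<close>

definition hclass :: "nat word \<Rightarrow> (nat \<Rightarrow>\<^sub>0 rat)" where
  "hclass w = (\<Sum>(j, b)\<leftarrow>w. Poly_Mapping.single j (if b then 1 else - 1))"

text \<open>The projection of the commutator subgroup of \<open>F_inf\<close> to its quotient by the third term of
  the lower central series, followed by the embedding of that quotient into the second exterior
  power of \<open>H_inf\<close> that sends the class of a commutator of \<open>x\<close> and \<open>y\<close> to \<open>[x] \<and> [y]\<close>. As
  commutators generate, the map is determined on the commutator subgroup by the two properties.\<close>

definition comm_class :: "nat word \<Rightarrow> ((nat \<Rightarrow>\<^sub>0 rat) list \<Rightarrow>\<^sub>0 rat) set" where
  "comm_class = (SOME \<kappa>.
     \<kappa> \<in> hom (F_inf\<lparr>carrier := derived F_inf (carrier F_inf)\<rparr>) (add_monoid (ext_pow 2 H_inf)) \<and>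
     (\<forall>x\<in>carrier F_inf. \<forall>y\<in>carrier F_inf.
        \<kappa> (x \<otimes>\<^bsub>F_inf\<^esub> y \<otimes>\<^bsub>F_inf\<^esub> inv\<^bsub>F_inf\<^esub> x \<otimes>\<^bsub>F_inf\<^esub> inv\<^bsub>F_inf\<^esub> y)
          = wedge H_inf [hclass x, hclass y]))"

definition johnson :: "(nat word \<Rightarrow> nat word) \<Rightarrow> U_elt" where
  "johnson f = (THE u. u \<in> carrier U_inf \<and>
     (\<forall>x\<in>carrier F_inf. u (hclass x) = comm_class (inv\<^bsub>F_inf\<^esub> x \<otimes>\<^bsub>F_inf\<^esub> f x)))"

text \<open>The map induced by \<open>johnson\<close> on the abelianization; it is constant on cosets.\<close>

definition johnson_ab :: "(nat word \<Rightarrow> nat word) set \<Rightarrow> U_elt" where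
  "johnson_ab C = the_elem (johnson ` C)"

text \<open>The identification of the rational homology of the abelianization of \<open>IA_inf\<close> with the
  exterior power of \<open>U_inf\<close>. The Pontryagin product sends \<open>a\<^sub>1 \<and> ... \<and> a\<^sub>i\<close> to the signed sum
  of the chains \<open>[b\<^sub>1|...|b\<^sub>i]\<close> over all permutations \<open>b\<close> of \<open>a\<close>; its inverse is induced by
  \<open>[a\<^sub>1|...|a\<^sub>i] \<mapsto> (1/i!) a\<^sub>1 \<and> ... \<and> a\<^sub>i\<close>.\<close>

definition alb_embed :: "nat \<Rightarrow> ((nat word \<Rightarrow> nat word) set list \<Rightarrow>\<^sub>0 rat) set
    \<Rightarrow> (U_elt list \<Rightarrow>\<^sub>0 rat) set" where
  "alb_embed i = quot_map (ext_free i U_inf) (ext_rel i U_inf)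
     (lin_ext (\<lambda>l. Poly_Mapping.single (map johnson_ab l) (1 / fact i)))"

text \<open>The Johnson isomorphism makes \<open>alb_embed\<close> injective, with image a subrepresentation of the
  exterior power of \<open>U_inf\<close>; the action on the Albanese homology is transported along it.\<close>

definition alb_act :: "nat \<Rightarrow> ((nat \<Rightarrow>\<^sub>0 rat) \<Rightarrow> (nat \<Rightarrow>\<^sub>0 rat))
    \<Rightarrow> ((nat word \<Rightarrow> nat word) set list \<Rightarrow>\<^sub>0 rat) set
    \<Rightarrow> ((nat word \<Rightarrow> nat word) set list \<Rightarrow>\<^sub>0 rat) set" where
  "alb_act i A c = inv_into (carrier (albanese IA_inf i)) (alb_embed i)
     (ext_map i U_inf (U_act A) (alb_embed i c))"

end

(*
  The Johnson homomorphism maps the Albanese homology to the i-th exterior power of U. There one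
  contracts: u_1 ^ ... ^ u_i goes to the alternating sum over p of
  sum_m (u_p(e_m) ^ tr u_q (q \<noteq> p)) \<otimes> e_m^*,  where tr is the trace U -> H. This commutes with
  GL(infinity, Q). Since the surjection factors through the exterior power, it does not matter
  which preimage the action on Albanese homology selects.

  The image of Albanese homology is stable under GL(infinity, Q): a transvection with integer parameter lifts to an
  automorphism of the free group, which acts on cycles by conjugation; the action is polynomial in the
  parameter, so rational parameters follow by a Vandermonde argument; the rest is Whitehead's lemma.

  Let h_q conjugate x_{c_0}, ..., x_{c_q} by x_{c_{q+1}}. These automorphisms commute, so they span a
  cycle of the bar complex, and its image is a positive multiple of
  e_{c_0} ^ ... ^ e_{c_i} \<otimes> e_{c_0}^*. Transvections give the remaining generators.
*)
theory Submission
  imports Defs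
begin

section \<open>Rational vector spaces of finitely supported functions\<close>

text \<open>The action on Albanese homology is pulled back along \<open>alb_embed\<close> by a
  choice of preimages, so it means what it should only if the image of \<open>alb_embed\<close> is
  stable; stability therefore precedes equivariance. Transvections only reach determinant one. A
  dilatation is recovered by compensating it in a coordinate that the given vector does not involve,
  and such a coordinate exists because the rank is infinite. The Johnson homomorphism becomes
  computable through half of the antisymmetrized second order Magnus term \<open>quad\<close>, which
  also proves that a map as chosen in \<open>comm_class\<close> exists. The sets of conjugated
  generators are nested for two reasons: the automorphisms commute, and the trace of
  \<open>h q\<close> is a positive multiple of a single basis vector. In the contraction all but one
  summand then repeat a vector, and the sign from sorting the survivor cancels the sign of the
  alternating sum, so the terms cannot cancel each other. Cosets are handled through linear
  projections \<open>nf\<close>, which replace congruences by equations between finitely supported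
  functions.\<close>

abbreviation keys where "keys \<equiv> Poly_Mapping.keys"
abbreviation lookup where "lookup \<equiv> Poly_Mapping.lookup"
abbreviation single where "single \<equiv> Poly_Mapping.single"

definition sc :: "rat \<Rightarrow> ('i \<Rightarrow>\<^sub>0 rat) \<Rightarrow> ('i \<Rightarrow>\<^sub>0 rat)" where
  "sc a = Poly_Mapping.map ((*) a)"

lemma lookup_sc [simp]: "lookup (sc a x) i = a * lookup x i"
  unfolding sc_def by transfer (auto simp: when_def)

lemma sc_add_right: "sc a (x + y) = sc a x + sc a y"
  and sc_add_left: "sc (a + b) x = sc a x + sc b x"
  and sc_sc [simp]: "sc a (sc b x) = sc (a * b) x"
  and sc_one [simp]: "sc 1 x = x"
  and sc_zero [simp]: "sc 0 x = 0"
  and sc_zero_right [simp]: "sc a 0 = 0"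
  and sc_minus_right: "sc a (- x) = - sc a x"
  and sc_minus_left: "sc (- a) x = - sc a x"
  and sc_diff_right: "sc a (x - y) = sc a x - sc a y"
  and sc_diff_left: "sc (a - b) x = sc a x - sc b x"
  and sc_single [simp]: "sc a (single i c) = single i (a * c)"
  by (rule poly_mapping_eqI; simp add: lookup_add lookup_minus algebra_simps lookup_single when_def)+

lemma sc_sum_right: "sc a (sum f A) = (\<Sum>i\<in>A. sc a (f i))"
  by (induction A rule: infinite_finite_induct) (auto simp: sc_add_right)

lemma sc_sum_left: "sc (sum f A) x = (\<Sum>i\<in>A. sc (f i) x)"
  by (induction A rule: infinite_finite_induct) (auto simp: sc_add_left)

text \<open>Gives access to bases and complements of subspaces, on which \<open>nf\<close>
  rests.\<close>

interpretation pm: vector_space sc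
  by unfold_locales (simp_all add: sc_add_right sc_add_left)

definition lin :: "(('i \<Rightarrow>\<^sub>0 rat) \<Rightarrow> ('j \<Rightarrow>\<^sub>0 rat)) \<Rightarrow> bool" where
  "lin f \<longleftrightarrow> (\<forall>x y. f (x + y) = f x + f y) \<and> (\<forall>a x. f (sc a x) = sc a (f x))"

lemma linI: "(\<And>x y. f (x + y) = f x + f y) \<Longrightarrow> (\<And>a x. f (sc a x) = sc a (f x)) \<Longrightarrow> lin f"
  by (simp add: lin_def)

lemma lin_add: "lin f \<Longrightarrow> f (x + y) = f x + f y"
  and lin_sc: "lin f \<Longrightarrow> f (sc a x) = sc a (f x)"
  by (simp_all add: lin_def)

lemma lin_0: "lin f \<Longrightarrow> f 0 = 0"
  using lin_sc[of f 0 0] by simp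

lemma lin_minus: "lin f \<Longrightarrow> f (- x) = - f x"
  using lin_sc[of f "- 1" x] by (simp add: sc_minus_left)

lemma lin_diff: "lin f \<Longrightarrow> f (x - y) = f x - f y"
  using lin_add[of f x "- y"] by (simp add: lin_minus)

lemma lin_sum: "lin f \<Longrightarrow> f (sum g A) = (\<Sum>i\<in>A. f (g i))"
  by (induction A rule: infinite_finite_induct) (auto simp: lin_add lin_0)

lemma lin_id: "lin (\<lambda>x. x)"
  and lin_plus: "lin f \<Longrightarrow> lin g \<Longrightarrow> lin (\<lambda>x. f x + g x)"
  and lin_minus_fun: "lin f \<Longrightarrow> lin g \<Longrightarrow> lin (\<lambda>x. f x - g x)"
  and lin_scale: "lin f \<Longrightarrow> lin (\<lambda>x. sc a (f x))"
  by (simp_all add: lin_def sc_add_right sc_diff_right mult.commute)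

lemma lin_comp: "lin f \<Longrightarrow> lin g \<Longrightarrow> lin (\<lambda>x. f (g x))"
  by (simp add: lin_def)

lemma pm_expand: "x = (\<Sum>i\<in>keys x. single i (lookup x i))"
proof (rule poly_mapping_eqI)
  fix k
  have "lookup (\<Sum>i\<in>keys x. single i (lookup x i)) k
      = (\<Sum>i\<in>keys x. if i = k then lookup x i else 0)"
    by (simp add: lookup_sum lookup_single when_def)
  then show "lookup x k = lookup (\<Sum>i\<in>keys x. single i (lookup x i)) k"
    by (simp add: in_keys_iff)
qed

lemma lin_ext_sc: "lin_ext f c = (\<Sum>x\<in>keys c. sc (lookup c x) (f x))"
  by (simp add: lin_ext_def sc_def)

lemma lin_ext_superset:
  assumes "finite A" "keys c \<subseteq> A"
  shows "lin_ext f c = (\<Sum>x\<in>A. sc (lookup c x) (f x))"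
  unfolding lin_ext_sc
  by (rule sum.mono_neutral_left) (use assms in \<open>auto simp: in_keys_iff\<close>)

lemma lin_lin_ext [simp]: "lin (lin_ext f)"
proof (rule linI)
  fix x y :: "'a \<Rightarrow>\<^sub>0 rat" and a
  let ?A = "keys x \<union> keys y"
  have "keys (x + y) \<subseteq> ?A" by (rule Poly_Mapping.keys_add)
  then show "lin_ext f (x + y) = lin_ext f x + lin_ext f y"
    by (simp add: lin_ext_superset[of ?A] lookup_add sc_add_left sum.distrib)
  have "keys (sc a x) \<subseteq> keys x"
    by (auto simp: in_keys_iff)
  then show "lin_ext f (sc a x) = sc a (lin_ext f x)"
    by (simp add: lin_ext_superset[of "keys x"] sc_sum_right)
qed

lemmas lin_ext_add = lin_add[OF lin_lin_ext]
  and lin_ext_scale = lin_sc[OF lin_lin_ext]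
  and lin_ext_diff = lin_diff[OF lin_lin_ext]
  and lin_ext_sum = lin_sum[OF lin_lin_ext]
  and lin_ext_0 [simp] = lin_0[OF lin_lin_ext]

lemma lin_ext_single [simp]: "lin_ext f (single i c) = sc c (f i)"
  by (simp add: lin_ext_sc)

text \<open>Expand \<open>c\<close> in basis vectors. Asking for agreement only on
  \<open>keys c\<close> lets each use exploit what is known about the support, such as the length of
  its lists or where their entries lie.\<close>

lemma lin_eq_on:
  assumes "lin f" "lin g" "\<And>i. i \<in> keys c \<Longrightarrow> f (single i 1) = g (single i 1)"
  shows "f c = g c"
proof -
  have *: "h c = (\<Sum>i\<in>keys c. sc (lookup c i) (h (single i 1)))"
    if "lin h" for h :: "('a \<Rightarrow>\<^sub>0 rat) \<Rightarrow> ('b \<Rightarrow>\<^sub>0 rat)"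
  proof -
    have "h c = h (\<Sum>i\<in>keys c. sc (lookup c i) (single i 1))"
      using pm_expand[of c] by simp
    also have "\<dots> = (\<Sum>i\<in>keys c. sc (lookup c i) (h (single i 1)))"
      using that by (simp only: lin_sum lin_sc)
    finally show ?thesis .
  qed
  show ?thesis using *[OF assms(1)] *[OF assms(2)] assms(3) by simp
qed

section \<open>Subspaces and linear projections along them\<close>

definition subsp :: "('i \<Rightarrow>\<^sub>0 rat) set \<Rightarrow> bool" where
  "subsp S \<longleftrightarrow> 0 \<in> S \<and> (\<forall>x\<in>S. \<forall>y\<in>S. x + y \<in> S) \<and> (\<forall>a. \<forall>x\<in>S. sc a x \<in> S)"

lemma subspI: "0 \<in> S \<Longrightarrow> (\<And>x y. x \<in> S \<Longrightarrow> y \<in> S \<Longrightarrow> x + y \<in> S)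
    \<Longrightarrow> (\<And>a x. x \<in> S \<Longrightarrow> sc a x \<in> S) \<Longrightarrow> subsp S"
  by (simp add: subsp_def)

lemma subsp_0: "subsp S \<Longrightarrow> 0 \<in> S"
  and subsp_add: "subsp S \<Longrightarrow> x \<in> S \<Longrightarrow> y \<in> S \<Longrightarrow> x + y \<in> S"
  and subsp_sc: "subsp S \<Longrightarrow> x \<in> S \<Longrightarrow> sc a x \<in> S"
  by (simp_all add: subsp_def)

lemma subsp_minus: "subsp S \<Longrightarrow> x \<in> S \<Longrightarrow> - x \<in> S"
  using subsp_sc[of S x "- 1"] by (simp add: sc_minus_left)

lemma subsp_diff: "subsp S \<Longrightarrow> x \<in> S \<Longrightarrow> y \<in> S \<Longrightarrow> x - y \<in> S"
  using subsp_add[of S x "- y"] by (simp add: subsp_minus)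

lemma subsp_sum: "subsp S \<Longrightarrow> (\<And>i. i \<in> A \<Longrightarrow> f i \<in> S) \<Longrightarrow> sum f A \<in> S"
  by (induction A rule: infinite_finite_induct) (auto simp: subsp_add subsp_0)

lemma subsp_keys [simp]: "subsp {c. keys c \<subseteq> I}"
  by (rule subspI) (auto simp: in_keys_iff lookup_add subset_iff, metis add.right_neutral)

text \<open>Serves as induction over linear combinations: \<open>S\<close> is then a preimage or the
  set of vectors with a property closed under the operations.\<close>

lemma subsp_induct:
  assumes "subsp S" "\<And>i. i \<in> keys c \<Longrightarrow> single i 1 \<in> S"
  shows "c \<in> S"
proof -
  have "(\<Sum>i\<in>keys c. sc (lookup c i) (single i 1)) \<in> S"
    by (intro subsp_sum subsp_sc assms)
  then show ?thesis using pm_expand[of c] by simp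
qed

lemma subsp_vimage: "lin f \<Longrightarrow> subsp T \<Longrightarrow> subsp (f -` T)"
  and subsp_image: "lin f \<Longrightarrow> subsp S \<Longrightarrow> subsp (f ` S)"
  and subsp_Int: "subsp S \<Longrightarrow> subsp S' \<Longrightarrow> subsp (S \<inter> S')"
proof -
  show "lin f \<Longrightarrow> subsp T \<Longrightarrow> subsp (f -` T)"
    by (auto simp: subsp_def lin_add lin_sc lin_0)
  show "subsp (f ` S)" if f: "lin f" and S: "subsp S"
  proof (rule subspI)
    show "0 \<in> f ` S" using subsp_0[OF S] lin_0[OF f] by (metis imageI)
    show "x + y \<in> f ` S" if "x \<in> f ` S" "y \<in> f ` S" for x y
    proof -
      from that obtain x' y' where "x' \<in> S" "y' \<in> S" "x = f x'" "y = f y'" by auto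
      then have "x + y = f (x' + y')" "x' + y' \<in> S" by (simp_all add: f lin_add subsp_add S)
      then show ?thesis by blast
    qed
    show "sc a x \<in> f ` S" if "x \<in> f ` S" for a x
    proof -
      from that obtain x' where "x' \<in> S" "x = f x'" by auto
      then have "sc a x = f (sc a x')" "sc a x' \<in> S" by (simp_all add: f lin_sc subsp_sc S)
      then show ?thesis by blast
    qed
  qed
  show "subsp S \<Longrightarrow> subsp S' \<Longrightarrow> subsp (S \<inter> S')" by (auto simp: subsp_def)
qed

lemma lin_ext_in: "subsp S \<Longrightarrow> (\<And>i. i \<in> keys c \<Longrightarrow> f i \<in> S) \<Longrightarrow> lin_ext f c \<in> S"
  unfolding lin_ext_sc by (intro subsp_sum subsp_sc)

text \<open>A linear projection along \<open>T\<close>: it turns congruences modulo \<open>T\<close> into equations.\<close>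

definition nf :: "('i \<Rightarrow>\<^sub>0 rat) set \<Rightarrow> ('i \<Rightarrow>\<^sub>0 rat) \<Rightarrow> ('i \<Rightarrow>\<^sub>0 rat)" where
  "nf T = (SOME p. lin p \<and> (\<forall>x. p x = 0 \<longleftrightarrow> x \<in> T) \<and> (\<forall>x. p x - x \<in> T))"

text \<open>If \<open>g\<close> is a linear retraction onto \<open>T\<close>, then
  \<open>x - g x\<close> vanishes exactly on \<open>T\<close> and differs from \<open>x\<close> by
  an element of \<open>T\<close>.\<close>

lemma nf_exists:
  assumes "subsp T"
  shows "\<exists>p :: ('i \<Rightarrow>\<^sub>0 rat) \<Rightarrow> ('i \<Rightarrow>\<^sub>0 rat). lin p \<and> (\<forall>x. p x = 0 \<longleftrightarrow> x \<in> T) \<and> (\<forall>x. p x - x \<in> T)"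
proof -
  interpret pp: vector_space_pair "sc :: rat \<Rightarrow> ('i \<Rightarrow>\<^sub>0 rat) \<Rightarrow> _" "sc :: rat \<Rightarrow> ('i \<Rightarrow>\<^sub>0 rat) \<Rightarrow> _"
    by unfold_locales
  have sub: "pm.subspace T"
    using assms by (auto simp: pm.subspace_def subsp_def)
  have "Vector_Spaces.linear sc sc (\<lambda>x :: 'i \<Rightarrow>\<^sub>0 rat. x)"
    using pm.linear_id by (simp add: id_def)
  from pp.linear_exists_left_inverse_on[OF this sub] obtain g
    where g: "range g \<subseteq> T" "Vector_Spaces.linear sc sc g" "\<And>v. v \<in> T \<Longrightarrow> g v = v"
    by (auto simp: inj_on_def)
  have lg: "lin g"
    using g(2) by (auto simp: lin_def Vector_Spaces.linear_iff)
  let ?p = "\<lambda>x. x - g x"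
  have "lin ?p" by (intro lin_minus_fun lin_id lg)
  moreover have "?p x = 0 \<longleftrightarrow> x \<in> T" for x
    using g(1) g(3)[of x] by (metis eq_iff_diff_eq_0 rangeI subsetD)
  moreover have "?p x - x \<in> T" for x
    using g(1) by (auto intro: subsp_minus[OF assms])
  ultimately show ?thesis by blast
qed

lemma lin_nf: "subsp T \<Longrightarrow> lin (nf T)"
  and nf_eq_0_iff: "subsp T \<Longrightarrow> nf T x = 0 \<longleftrightarrow> x \<in> T"
  and nf_diff_in: "subsp T \<Longrightarrow> nf T x - x \<in> T"
  using someI_ex[OF nf_exists, of T] by (auto simp: nf_def[symmetric])

lemma nf_eq_iff: "subsp T \<Longrightarrow> nf T x = nf T y \<longleftrightarrow> x - y \<in> T"
  using nf_eq_0_iff[of T "x - y"] lin_diff[OF lin_nf, of T x y] by simp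

lemma nf_nf: "subsp T \<Longrightarrow> nf T (nf T x) = nf T x"
  by (simp add: nf_eq_iff nf_diff_in)

section \<open>Quotient spaces\<close>

text \<open>\<open>quot_space\<close> and \<open>quot_map\<close> form unions over all
  representatives; well-definedness collapses such a union to one coset.\<close>

lemma UN_eq_const: "x \<in> A \<Longrightarrow> (\<And>y. y \<in> A \<Longrightarrow> f y = c) \<Longrightarrow> (\<Union>y\<in>A. f y) = c"
  by blast

abbreviation pmsp :: "('i \<Rightarrow>\<^sub>0 rat) set \<Rightarrow> (rat, 'i \<Rightarrow>\<^sub>0 rat) module" where
  "pmsp C \<equiv> \<lparr>carrier = C, mult = (\<lambda>_ _. 0), one = 0, zero = 0, add = (+), smult = sc\<rparr>"

text \<open>The coset written without the ambient carrier, on which it does not depend.\<close>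

definition cst :: "('i \<Rightarrow>\<^sub>0 rat) set \<Rightarrow> ('i \<Rightarrow>\<^sub>0 rat) \<Rightarrow> ('i \<Rightarrow>\<^sub>0 rat) set" where
  "cst S x = (\<lambda>s. s + x) ` S"

lemma free_space_pmsp: "free_space I = pmsp {c. keys c \<subseteq> I}"
  by (simp add: free_space_def sc_def[abs_def])

lemma a_r_coset_pmsp: "S +>\<^bsub>pmsp C\<^esub> x = cst S x"
  by (auto simp: a_r_coset_def r_coset_def cst_def)

lemma in_cst_iff: "y \<in> cst S x \<longleftrightarrow> y - x \<in> S"
  by (auto simp: cst_def image_iff intro!: bexI[of _ "y - x"])

lemma cst_self: "subsp S \<Longrightarrow> x \<in> cst S x"
  by (simp add: in_cst_iff subsp_0)

lemma cst_eq_iff: "subsp S \<Longrightarrow> cst S x = cst S y \<longleftrightarrow> x - y \<in> S"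
proof
  assume S: "subsp S" and "cst S x = cst S y"
  then show "x - y \<in> S" using cst_self[OF S, of x] by (simp add: in_cst_iff)
next
  assume S: "subsp S" and xy: "x - y \<in> S"
  have "z - x \<in> S \<longleftrightarrow> z - y \<in> S" for z
    using subsp_add[OF S _ xy, of "z - x"] subsp_diff[OF S _ xy, of "z - y"] by auto
  then show "cst S x = cst S y" by (auto simp: in_cst_iff)
qed

lemma cst_nf: "subsp S \<Longrightarrow> cst S (nf S x) = cst S x"
  by (simp add: cst_eq_iff nf_diff_in)

lemma cst_eq_nf: "subsp S \<Longrightarrow> cst S x = cst S y \<longleftrightarrow> nf S x = nf S y"
  by (simp add: cst_eq_iff nf_eq_iff)

lemma cst_0: "cst S 0 = S"
  by (simp add: cst_def)

text \<open>On cosets this is a linear section of the quotient map, since all members of a coset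
  have the same normal form.\<close>

definition repr :: "('i \<Rightarrow>\<^sub>0 rat) set \<Rightarrow> ('i \<Rightarrow>\<^sub>0 rat) set \<Rightarrow> ('i \<Rightarrow>\<^sub>0 rat)" where
  "repr S X = the_elem (nf S ` X)"

lemma repr_cst [simp]: "subsp S \<Longrightarrow> repr S (cst S x) = nf S x"
proof -
  assume S: "subsp S"
  have "nf S ` cst S x = {nf S x}"
    using cst_self[OF S] by (auto simp: nf_eq_iff[OF S] in_cst_iff)
  then show ?thesis by (simp add: repr_def)
qed

lemma carrier_quot_pmsp: "carrier (quot_space (pmsp C) S) = cst S ` C"
  by (auto simp: quot_space_def A_RCOSETS_def RCOSETS_def cst_def r_coset_def)

lemma zero_quot_pmsp: "\<zero>\<^bsub>quot_space V S\<^esub> = S"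
  by (simp add: quot_space_def)

lemma add_quot_pmsp:
  assumes "subsp S"
  shows "cst S x \<oplus>\<^bsub>quot_space (pmsp C) S\<^esub> cst S y = cst S (x + y)"
proof -
  have "cst S x \<oplus>\<^bsub>quot_space (pmsp C) S\<^esub> cst S y = {a + b | a b. a \<in> cst S x \<and> b \<in> cst S y}"
    by (auto simp: quot_space_def set_add_def set_mult_def)
  also have "\<dots> = cst S (x + y)"
  proof (intro Set.set_eqI iffI)
    fix z assume "z \<in> {a + b | a b. a \<in> cst S x \<and> b \<in> cst S y}"
    then obtain a b where "z = a + b" "a - x \<in> S" "b - y \<in> S" by (auto simp: in_cst_iff)
    then have "z - (x + y) = (a - x) + (b - y)" by simp
    then show "z \<in> cst S (x + y)"
      using subsp_add[OF assms \<open>a - x \<in> S\<close> \<open>b - y \<in> S\<close>] unfolding in_cst_iff by metis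
  next
    fix z assume "z \<in> cst S (x + y)"
    then have "z = (z - y) + y" "z - y \<in> cst S x" "y \<in> cst S y"
      by (simp_all add: in_cst_iff subsp_0 assms diff_diff_eq add.commute)
    then show "z \<in> {a + b | a b. a \<in> cst S x \<and> b \<in> cst S y}" by blast
  qed
  finally show ?thesis .
qed

lemma smult_quot_pmsp:
  assumes "subsp S"
  shows "a \<odot>\<^bsub>quot_space (pmsp C) S\<^esub> cst S x = cst S (sc a x)"
proof -
  have "a \<odot>\<^bsub>quot_space (pmsp C) S\<^esub> cst S x = (\<Union>y\<in>cst S x. cst S (sc a y))"
    by (simp add: quot_space_def a_r_coset_pmsp)
  also have "\<dots> = cst S (sc a x)"
  proof -
    have "cst S (sc a y) = cst S (sc a x)" if "y \<in> cst S x" for y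
      using that subsp_sc[OF assms, of "y - x" a]
      by (simp add: cst_eq_iff[OF assms] in_cst_iff sc_diff_right)
    then show ?thesis by (intro UN_eq_const[OF cst_self[OF assms]])
  qed
  finally show ?thesis .
qed

section \<open>Vector space records, spans and induced maps\<close>

lemma cring_rat: "cring (rat_field :: rat ring)" and field_rat: "field (rat_field :: rat ring)"
  using class_cring.cring_axioms class_field by auto

lemma vectorspaceI:
  fixes V :: "(rat, 'v) module"
  assumes "\<zero>\<^bsub>V\<^esub> \<in> carrier V"
    and "\<And>v w. v \<in> carrier V \<Longrightarrow> w \<in> carrier V \<Longrightarrow> v \<oplus>\<^bsub>V\<^esub> w \<in> carrier V"
    and "\<And>v. v \<in> carrier V \<Longrightarrow> \<exists>w\<in>carrier V. v \<oplus>\<^bsub>V\<^esub> w = \<zero>\<^bsub>V\<^esub>"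
    and "\<And>u v w. u \<in> carrier V \<Longrightarrow> v \<in> carrier V \<Longrightarrow> w \<in> carrier V
          \<Longrightarrow> (u \<oplus>\<^bsub>V\<^esub> v) \<oplus>\<^bsub>V\<^esub> w = u \<oplus>\<^bsub>V\<^esub> (v \<oplus>\<^bsub>V\<^esub> w)"
    and "\<And>v w. v \<in> carrier V \<Longrightarrow> w \<in> carrier V \<Longrightarrow> v \<oplus>\<^bsub>V\<^esub> w = w \<oplus>\<^bsub>V\<^esub> v"
    and "\<And>v. v \<in> carrier V \<Longrightarrow> \<zero>\<^bsub>V\<^esub> \<oplus>\<^bsub>V\<^esub> v = v"
    and "\<And>a v. v \<in> carrier V \<Longrightarrow> a \<odot>\<^bsub>V\<^esub> v \<in> carrier V"
    and "\<And>a b v. v \<in> carrier V \<Longrightarrow> (a + b) \<odot>\<^bsub>V\<^esub> v = a \<odot>\<^bsub>V\<^esub> v \<oplus>\<^bsub>V\<^esub> b \<odot>\<^bsub>V\<^esub> v"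
    and "\<And>a v w. v \<in> carrier V \<Longrightarrow> w \<in> carrier V
          \<Longrightarrow> a \<odot>\<^bsub>V\<^esub> (v \<oplus>\<^bsub>V\<^esub> w) = a \<odot>\<^bsub>V\<^esub> v \<oplus>\<^bsub>V\<^esub> a \<odot>\<^bsub>V\<^esub> w"
    and "\<And>a b v. v \<in> carrier V \<Longrightarrow> (a * b) \<odot>\<^bsub>V\<^esub> v = a \<odot>\<^bsub>V\<^esub> (b \<odot>\<^bsub>V\<^esub> v)"
    and "\<And>v. v \<in> carrier V \<Longrightarrow> 1 \<odot>\<^bsub>V\<^esub> v = v"
  shows "vectorspace rat_field V"
proof -
  have "abelian_group V"
  proof (rule abelian_groupI)
    show "\<exists>w\<in>carrier V. w \<oplus>\<^bsub>V\<^esub> v = \<zero>\<^bsub>V\<^esub>" if "v \<in> carrier V" for v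
      using assms(3)[OF that] assms(5) that by metis
  qed (use assms(1,2,4,5,6) in blast)+
  then have "Module.module rat_field V"
    using assms by (intro Module.module.intro[OF cring_rat] Module.module_axioms.intro) simp_all
  then show ?thesis by (intro vectorspace.intro field_rat)
qed

lemma vectorspace_quot:
  assumes C: "subsp C" and S: "subsp S"
  shows "vectorspace rat_field (quot_space (pmsp C) S)"
proof (rule vectorspaceI)
  let ?V = "quot_space (pmsp C) S"
  note simps = carrier_quot_pmsp add_quot_pmsp[OF S] smult_quot_pmsp[OF S] zero_quot_pmsp
  show "\<zero>\<^bsub>?V\<^esub> \<in> carrier ?V"
    unfolding simps using subsp_0[OF C] by (metis cst_0 imageI)
  fix u assume u': "u \<in> carrier ?V"
  then obtain u' where u: "u = cst S u'" "u' \<in> C" unfolding simps by auto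
  show "\<zero>\<^bsub>?V\<^esub> \<oplus>\<^bsub>?V\<^esub> u = u"
    using add_quot_pmsp[OF S, of C 0 u'] by (simp add: u zero_quot_pmsp cst_0)
  show "1 \<odot>\<^bsub>?V\<^esub> u = u" by (simp add: u simps)
  have "cst S u' \<oplus>\<^bsub>?V\<^esub> cst S (- u') = \<zero>\<^bsub>?V\<^esub>" by (simp add: simps cst_0)
  then show "\<exists>w\<in>carrier ?V. u \<oplus>\<^bsub>?V\<^esub> w = \<zero>\<^bsub>?V\<^esub>"
    using subsp_minus[OF C u(2)] by (auto simp: u(1) carrier_quot_pmsp)
  fix a b
  show "a \<odot>\<^bsub>?V\<^esub> u \<in> carrier ?V" by (simp add: u simps subsp_sc[OF C])
  show "(a + b) \<odot>\<^bsub>?V\<^esub> u = a \<odot>\<^bsub>?V\<^esub> u \<oplus>\<^bsub>?V\<^esub> b \<odot>\<^bsub>?V\<^esub> u" by (simp add: u simps sc_add_left)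
  show "(a * b) \<odot>\<^bsub>?V\<^esub> u = a \<odot>\<^bsub>?V\<^esub> (b \<odot>\<^bsub>?V\<^esub> u)" by (simp add: u simps)
  fix v assume "v \<in> carrier ?V"
  then obtain v' where v: "v = cst S v'" "v' \<in> C" unfolding simps by auto
  show "u \<oplus>\<^bsub>?V\<^esub> v \<in> carrier ?V" using u v subsp_add[OF C] by (simp add: simps)
  show "u \<oplus>\<^bsub>?V\<^esub> v = v \<oplus>\<^bsub>?V\<^esub> u" by (simp add: u v simps add.commute)
  show "a \<odot>\<^bsub>?V\<^esub> (u \<oplus>\<^bsub>?V\<^esub> v) = a \<odot>\<^bsub>?V\<^esub> u \<oplus>\<^bsub>?V\<^esub> a \<odot>\<^bsub>?V\<^esub> v" by (simp add: u v simps sc_add_right)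
  fix w assume "w \<in> carrier ?V"
  then obtain w' where w: "w = cst S w'" "w' \<in> C" unfolding simps by auto
  show "(u \<oplus>\<^bsub>?V\<^esub> v) \<oplus>\<^bsub>?V\<^esub> w = u \<oplus>\<^bsub>?V\<^esub> (v \<oplus>\<^bsub>?V\<^esub> w)" by (simp add: u v w simps add.assoc)
qed

lemma module_pmsp: "subsp C \<Longrightarrow> Module.module rat_field (pmsp C)"
proof -
  assume C: "subsp C"
  have "vectorspace rat_field (pmsp C)"
  proof (rule vectorspaceI)
    show "\<exists>w\<in>carrier (pmsp C). v \<oplus>\<^bsub>pmsp C\<^esub> w = \<zero>\<^bsub>pmsp C\<^esub>" if "v \<in> carrier (pmsp C)" for v
      using subsp_minus[OF C] that by (intro bexI[of _ "- v"]) auto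
  qed (use subsp_0[OF C] subsp_add[OF C] subsp_sc[OF C] in
      \<open>simp_all add: sc_add_left sc_add_right add_ac\<close>)
  then show ?thesis by (simp add: vectorspace_def)
qed

text \<open>The interface to the relation spaces of exterior powers and tensor products: each is the
  least subspace containing its relators and stays inside the free space.\<close>

lemma span_pmsp:
  assumes "subsp C" "X \<subseteq> C"
  shows "subsp (LinearCombinations.module.span rat_field (pmsp C) X)"
    and "X \<subseteq> LinearCombinations.module.span rat_field (pmsp C) X"
    and "LinearCombinations.module.span rat_field (pmsp C) X \<subseteq> C"
    and "subsp N \<Longrightarrow> X \<subseteq> N \<Longrightarrow> LinearCombinations.module.span rat_field (pmsp C) X \<subseteq> N"
proof -
  interpret m: Module.module rat_field "pmsp C" by (rule module_pmsp[OF assms(1)])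
  have sm: "submodule rat_field (m.span X) (pmsp C)"
    by (rule m.span_is_submodule) (use assms in simp)
  show "subsp (m.span X)"
    using sm by (auto simp: submodule_def subsp_def)
  show "X \<subseteq> m.span X" by (rule m.in_own_span) (use assms in simp)
  show "m.span X \<subseteq> C" using sm by (simp add: submodule_def)
  assume N: "subsp N" "X \<subseteq> N"
  have "submodule rat_field (N \<inter> C) (pmsp C)"
    using subsp_Int[OF N(1) assms(1)] module_pmsp[OF assms(1)]
    by (simp add: submodule_def subsp_def)
  from m.span_is_subset[OF _ this, of X] show "m.span X \<subseteq> N"
    using N(2) assms(2) by blast
qed

lemma quot_map_cst:
  assumes "subsp T" "subsp S" "lin g" "\<And>s. s \<in> S \<Longrightarrow> g s \<in> T"
  shows "quot_map (pmsp C) T g (cst S x) = cst T (g x)"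
proof -
  have "cst T (g y) = cst T (g x)" if "y \<in> cst S x" for y
    using assms(4)[of "y - x"] that
    by (simp add: cst_eq_iff[OF assms(1)] in_cst_iff lin_diff[OF assms(3)])
  then show ?thesis
    unfolding quot_map_def a_r_coset_pmsp by (intro UN_eq_const[OF cst_self[OF assms(2)]])
qed

lemma linear_mapI:
  fixes V :: "(rat, 'v) module" and W :: "(rat, 'w) module"
  assumes "vectorspace rat_field V" "vectorspace rat_field W"
    and "\<And>v. v \<in> carrier V \<Longrightarrow> f v \<in> carrier W"
    and "\<And>v w. v \<in> carrier V \<Longrightarrow> w \<in> carrier V \<Longrightarrow> f (v \<oplus>\<^bsub>V\<^esub> w) = f v \<oplus>\<^bsub>W\<^esub> f w"
    and "\<And>a v. v \<in> carrier V \<Longrightarrow> f (a \<odot>\<^bsub>V\<^esub> v) = a \<odot>\<^bsub>W\<^esub> f v"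
  shows "linear_map rat_field V W f"
  using assms unfolding linear_map_def mod_hom_def mod_hom_axioms_def vectorspace_def
  by (auto simp: LinearCombinations.module_hom_def)

text \<open>The images of finitely many vectors involve finitely many coordinates, so some
  coordinate of \<open>\<psi>\<close> vanishes on their whole span, against \<open>hit\<close>.
  Every coordinate being nonzero somewhere is enough; \<open>\<psi>\<close> may be far from
  surjective.\<close>

lemma vdim_infinite:
  fixes \<psi> :: "'v \<Rightarrow> (nat \<Rightarrow>\<^sub>0 rat)"
  assumes V: "vectorspace rat_field V"
    and add: "\<And>v w. v \<in> carrier V \<Longrightarrow> w \<in> carrier V \<Longrightarrow> \<psi> (v \<oplus>\<^bsub>V\<^esub> w) = \<psi> v + \<psi> w"
    and smult: "\<And>a v. v \<in> carrier V \<Longrightarrow> \<psi> (a \<odot>\<^bsub>V\<^esub> v) = sc a (\<psi> v)"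
    and hit: "\<And>m. \<exists>v\<in>carrier V. lookup (\<psi> v) m \<noteq> 0"
  shows "vdim V = \<infinity>"
proof -
  interpret vectorspace rat_field V by (rule V)
  have False if fd: fin_dim
  proof -
    from fd obtain A where A: "finite A" "A \<subseteq> carrier V" "span A = carrier V"
      unfolding fin_dim_def by auto
    have "finite (\<Union>a\<in>A. keys (\<psi> a))" using A(1) by auto
    then obtain m where m: "m \<notin> (\<Union>a\<in>A. keys (\<psi> a))"
      using ex_new_if_finite[OF infinite_UNIV_nat] by blast
    let ?N = "{v \<in> carrier V. lookup (\<psi> v) m = 0}"
    have z: "\<psi> \<zero>\<^bsub>V\<^esub> = 0"
      using smult[of "\<zero>\<^bsub>V\<^esub>" 0] by simp
    have "submodule rat_field ?N V"
      unfolding submodule_def using module_axioms z by (auto simp: add smult lookup_add)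
    from span_is_subset[OF _ this, of A] have "carrier V \<subseteq> ?N"
      using A m by (auto simp: in_keys_iff)
    then show False using hit[of m] by auto
  qed
  then show ?thesis by (auto simp: vdim_def)
qed

section \<open>Alternating maps and exterior powers\<close>

abbreviation vlin :: "(rat, 'v) module \<Rightarrow> (rat, 'w) module \<Rightarrow> ('v \<Rightarrow> 'w) set" where
  "vlin \<equiv> LinearCombinations.module_hom rat_field"

lemma vlinI:
  assumes "\<And>x. x \<in> carrier V \<Longrightarrow> h x \<in> carrier W"
    and "\<And>x y. x \<in> carrier V \<Longrightarrow> y \<in> carrier V \<Longrightarrow> h (x \<oplus>\<^bsub>V\<^esub> y) = h x \<oplus>\<^bsub>W\<^esub> h y"
    and "\<And>a x. x \<in> carrier V \<Longrightarrow> h (a \<odot>\<^bsub>V\<^esub> x) = a \<odot>\<^bsub>W\<^esub> h x"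
  shows "h \<in> vlin V W"
  using assms by (auto simp: LinearCombinations.module_hom_def)

lemma vlin_closed: "h \<in> vlin V W \<Longrightarrow> x \<in> carrier V \<Longrightarrow> h x \<in> carrier W"
  and vlin_add: "h \<in> vlin V W \<Longrightarrow> x \<in> carrier V \<Longrightarrow> y \<in> carrier V
    \<Longrightarrow> h (x \<oplus>\<^bsub>V\<^esub> y) = h x \<oplus>\<^bsub>W\<^esub> h y"
  and vlin_smult: "h \<in> vlin V W \<Longrightarrow> x \<in> carrier V \<Longrightarrow> h (a \<odot>\<^bsub>V\<^esub> x) = a \<odot>\<^bsub>W\<^esub> h x"
  by (auto simp: LinearCombinations.module_hom_def)

text \<open>Closure under the operations is what keeps the relators inside the free space.\<close>

definition op_closed :: "(rat, 'v) module \<Rightarrow> bool" where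
  "op_closed V \<longleftrightarrow> (\<forall>x\<in>carrier V. (\<forall>y\<in>carrier V. x \<oplus>\<^bsub>V\<^esub> y \<in> carrier V)
     \<and> (\<forall>a. a \<odot>\<^bsub>V\<^esub> x \<in> carrier V))"

lemma op_closed_add: "op_closed V \<Longrightarrow> x \<in> carrier V \<Longrightarrow> y \<in> carrier V \<Longrightarrow> x \<oplus>\<^bsub>V\<^esub> y \<in> carrier V"
  and op_closed_smult: "op_closed V \<Longrightarrow> x \<in> carrier V \<Longrightarrow> a \<odot>\<^bsub>V\<^esub> x \<in> carrier V"
  by (auto simp: op_closed_def)

lemma vectorspace_op_closed: "vectorspace rat_field V \<Longrightarrow> op_closed V"
  unfolding op_closed_def vectorspace_def Module.module_def Module.module_axioms_def
    abelian_group_def abelian_monoid_def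
  using monoid.m_closed[of "add_monoid V"] by (auto simp: comm_monoid_def)

definition lists_in :: "nat \<Rightarrow> (rat, 'v) module \<Rightarrow> 'v list set" where
  "lists_in k V = {l. length l = k \<and> set l \<subseteq> carrier V}"

text \<open>Alternation is imposed on adjacent equal entries; \<open>alt_not_distinct\<close>
  recovers arbitrary repetitions. Splitting the list, instead of updating a position, suits
  inductions along the list.\<close>

definition alt_map :: "nat \<Rightarrow> (rat, 'v) module \<Rightarrow> ('v list \<Rightarrow> ('j \<Rightarrow>\<^sub>0 rat)) \<Rightarrow> bool" where
  "alt_map k V f \<longleftrightarrow>
     (\<forall>l1 l2 x y. l1 @ x # l2 \<in> lists_in k V \<and> y \<in> carrier V \<longrightarrow>
        f (l1 @ (x \<oplus>\<^bsub>V\<^esub> y) # l2) = f (l1 @ x # l2) + f (l1 @ y # l2)) \<and>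
     (\<forall>l1 l2 x a. l1 @ x # l2 \<in> lists_in k V \<longrightarrow> f (l1 @ (a \<odot>\<^bsub>V\<^esub> x) # l2) = sc a (f (l1 @ x # l2))) \<and>
     (\<forall>l1 l2 x. l1 @ x # x # l2 \<in> lists_in k V \<longrightarrow> f (l1 @ x # x # l2) = 0)"

lemma alt_add: "alt_map k V f \<Longrightarrow> l1 @ x # l2 \<in> lists_in k V \<Longrightarrow> y \<in> carrier V
    \<Longrightarrow> f (l1 @ (x \<oplus>\<^bsub>V\<^esub> y) # l2) = f (l1 @ x # l2) + f (l1 @ y # l2)"
  and alt_smult: "alt_map k V f \<Longrightarrow> l1 @ x # l2 \<in> lists_in k V
    \<Longrightarrow> f (l1 @ (a \<odot>\<^bsub>V\<^esub> x) # l2) = sc a (f (l1 @ x # l2))"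
  and alt_adj: "alt_map k V f \<Longrightarrow> l1 @ x # x # l2 \<in> lists_in k V \<Longrightarrow> f (l1 @ x # x # l2) = 0"
  unfolding alt_map_def by blast+

text \<open>Expand the value zero on the adjacent pair \<open>x + y\<close>,
  \<open>x + y\<close>.\<close>

lemma alt_swap:
  assumes V: "op_closed V" and f: "alt_map k V f" and l: "l1 @ x # y # l2 \<in> lists_in k V"
  shows "f (l1 @ x # y # l2) = - f (l1 @ y # x # l2)"
proof -
  let ?s = "x \<oplus>\<^bsub>V\<^esub> y"
  have xy: "x \<in> carrier V" "y \<in> carrier V" "?s \<in> carrier V"
    using l V by (auto simp: lists_in_def op_closed_def)
  have "0 = f (l1 @ ?s # ?s # l2)"
    using l xy by (intro alt_adj[OF f, symmetric]) (auto simp: lists_in_def)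
  also have "\<dots> = f (l1 @ x # ?s # l2) + f (l1 @ y # ?s # l2)"
    using l xy by (intro alt_add[OF f]) (auto simp: lists_in_def)
  also have "f (l1 @ x # ?s # l2) = f (l1 @ x # x # l2) + f (l1 @ x # y # l2)"
    using alt_add[OF f, of "l1 @ [x]" x l2 y] l xy by (auto simp: lists_in_def)
  also have "f (l1 @ y # ?s # l2) = f (l1 @ y # x # l2) + f (l1 @ y # y # l2)"
    using alt_add[OF f, of "l1 @ [y]" x l2 y] l xy by (auto simp: lists_in_def)
  also have "f (l1 @ x # x # l2) = 0" using l xy by (intro alt_adj[OF f]) (auto simp: lists_in_def)
  also have "f (l1 @ y # y # l2) = 0" using l xy by (intro alt_adj[OF f]) (auto simp: lists_in_def)
  finally show ?thesis by (simp add: eq_neg_iff_add_eq_0)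
qed

text \<open>One transposition, hence one sign, for each entry of \<open>l2\<close> that
  \<open>x\<close> passes.\<close>

lemma alt_move:
  assumes V: "op_closed V" and f: "alt_map k V f" and "l1 @ x # l2 @ l3 \<in> lists_in k V"
  shows "f (l1 @ x # l2 @ l3) = sc ((-1) ^ length l2) (f (l1 @ l2 @ x # l3))"
  using assms(3)
proof (induction l2 arbitrary: l1)
  case Nil
  then show ?case by simp
next
  case (Cons y l2)
  have "f (l1 @ x # (y # l2) @ l3) = - f ((l1 @ [y]) @ x # l2 @ l3)"
    using alt_swap[OF V f, of l1 x y "l2 @ l3"] Cons.prems by simp
  also have "f ((l1 @ [y]) @ x # l2 @ l3) = sc ((-1) ^ length l2) (f ((l1 @ [y]) @ l2 @ x # l3))"
    using Cons.prems by (intro Cons.IH) (auto simp: lists_in_def)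
  finally show ?case by (simp add: sc_minus_left)
qed

lemma alt_repeat:
  assumes "op_closed V" "alt_map k V f" "l1 @ x # l2 @ x # l3 \<in> lists_in k V"
  shows "f (l1 @ x # l2 @ x # l3) = 0"
proof -
  have "f (l1 @ x # l2 @ x # l3) = sc ((-1) ^ length l2) (f ((l1 @ l2) @ x # x # l3))"
    using alt_move[OF assms] by simp
  also have "f ((l1 @ l2) @ x # x # l3) = 0"
    using assms(3) by (intro alt_adj[OF assms(2)]) (auto simp: lists_in_def)
  finally show ?thesis by simp
qed

lemma alt_not_distinct:
  assumes "op_closed V" "alt_map k V f" "l \<in> lists_in k V" "\<not> distinct l"
  shows "f l = 0"
proof -
  from not_distinct_decomp[OF assms(4)] obtain xs y ys zs where "l = xs @ [y] @ ys @ [y] @ zs"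
    by blast
  then show ?thesis using alt_repeat[OF assms(1,2), of xs y ys zs] assms(3) by simp
qed

lemma alt_post: "lin g \<Longrightarrow> alt_map k V f \<Longrightarrow> alt_map k V (\<lambda>l. g (f l))"
  unfolding alt_map_def by (simp add: lin_add lin_sc lin_0)

lemma alt_pre:
  assumes h: "h \<in> vlin V W" and f: "alt_map k W f"
  shows "alt_map k V (\<lambda>l. f (map h l))"
  unfolding alt_map_def
proof (intro conjI allI impI)
  fix l1 l2 x y assume *: "l1 @ x # l2 \<in> lists_in k V \<and> y \<in> carrier V"
  then have "map h l1 @ h x # map h l2 \<in> lists_in k W" "h y \<in> carrier W" "x \<in> carrier V" "y \<in> carrier V"
    using vlin_closed[OF h] by (auto simp: lists_in_def)
  with alt_add[OF f this(1,2)] vlin_add[OF h this(3,4)]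
  show "f (map h (l1 @ (x \<oplus>\<^bsub>V\<^esub> y) # l2)) = f (map h (l1 @ x # l2)) + f (map h (l1 @ y # l2))"
    by simp
next
  fix l1 l2 x a assume "l1 @ x # l2 \<in> lists_in k V"
  then have "map h l1 @ h x # map h l2 \<in> lists_in k W" "x \<in> carrier V"
    using vlin_closed[OF h] by (auto simp: lists_in_def)
  with alt_smult[OF f this(1)] vlin_smult[OF h this(2)]
  show "f (map h (l1 @ (a \<odot>\<^bsub>V\<^esub> x) # l2)) = sc a (f (map h (l1 @ x # l2)))" by simp
next
  fix l1 l2 x assume "l1 @ x # x # l2 \<in> lists_in k V"
  then have "map h l1 @ h x # h x # map h l2 \<in> lists_in k W"
    using vlin_closed[OF h] by (auto simp: lists_in_def)
  with alt_adj[OF f this] show "f (map h (l1 @ x # x # l2)) = 0" by simp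
qed

lemma ext_free_pmsp: "ext_free k V = pmsp {c. keys c \<subseteq> lists_in k V}"
  by (simp add: ext_free_def free_space_pmsp lists_in_def)

lemma lists_in_update: "l \<in> lists_in k V \<Longrightarrow> x \<in> carrier V \<Longrightarrow> l[j := x] \<in> lists_in k V"
  using set_update_subset_insert[of l j x] by (auto simp: lists_in_def)

definition ext_gens :: "nat \<Rightarrow> (rat, 'v) module \<Rightarrow> ('v list \<Rightarrow>\<^sub>0 rat) set" where
  "ext_gens k V =
     ({single (l[j := x \<oplus>\<^bsub>V\<^esub> y]) 1 - single (l[j := x]) 1 - single (l[j := y]) 1 | l j x y.
         length l = k \<and> set l \<subseteq> carrier V \<and> j < k \<and> x \<in> carrier V \<and> y \<in> carrier V}
    \<union> {single (l[j := a \<odot>\<^bsub>V\<^esub> x]) 1 - single (l[j := x]) a | l j a x.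
         length l = k \<and> set l \<subseteq> carrier V \<and> j < k \<and> x \<in> carrier V}
    \<union> {single l 1 | l. length l = k \<and> set l \<subseteq> carrier V \<and> \<not> distinct l})"

lemma ext_rel_span: "ext_rel k V = LinearCombinations.module.span rat_field (pmsp {c. keys c \<subseteq> lists_in k V}) (ext_gens k V)"
  by (simp add: ext_rel_def ext_gens_def ext_free_pmsp)

lemma single_in_keys: "i \<in> I \<Longrightarrow> single i a \<in> {c. keys c \<subseteq> I}"
  by auto

lemma ext_gens_in: "op_closed V \<Longrightarrow> ext_gens k V \<subseteq> {c. keys c \<subseteq> lists_in k V}"
  unfolding ext_gens_def
  by (intro Un_least subsetI; elim CollectE exE conjE)
    (simp_all only:, (intro subsp_diff[OF subsp_keys] single_in_keys lists_in_update op_closed_add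
      op_closed_smult; simp add: lists_in_def)+)

lemma ext_rel_subsp: "op_closed V \<Longrightarrow> subsp (ext_rel k V)"
  and ext_rel_in: "op_closed V \<Longrightarrow> ext_rel k V \<subseteq> {c. keys c \<subseteq> lists_in k V}"
  and ext_gens_rel: "op_closed V \<Longrightarrow> ext_gens k V \<subseteq> ext_rel k V"
  unfolding ext_rel_span by (intro span_pmsp subsp_keys ext_gens_in; assumption)+

lemma ext_rel_least: "op_closed V \<Longrightarrow> subsp N \<Longrightarrow> ext_gens k V \<subseteq> N \<Longrightarrow> ext_rel k V \<subseteq> N"
  unfolding ext_rel_span by (intro span_pmsp subsp_keys ext_gens_in)

text \<open>The universal alternating map, with values in normal forms instead of classes.\<close>

definition wnf :: "nat \<Rightarrow> (rat, 'v) module \<Rightarrow> 'v list \<Rightarrow> ('v list \<Rightarrow>\<^sub>0 rat)" where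
  "wnf k V l = nf (ext_rel k V) (single l 1)"

lemma nf_ext_rel:
  "op_closed V \<Longrightarrow> nf (ext_rel k V) c = lin_ext (wnf k V) c"
  by (rule lin_eq_on[OF lin_nf[OF ext_rel_subsp] lin_lin_ext]) (simp_all add: wnf_def)

text \<open>Each axiom is the statement that \<open>nf\<close> kills one of the three kinds of
  relators.\<close>

lemma alt_wnf:
  assumes V: "op_closed V"
  shows "alt_map k V (wnf k V)"
  unfolding alt_map_def
proof (intro conjI allI impI)
  note S = ext_rel_subsp[OF V, of k] and R = subsetD[OF ext_gens_rel[OF V, of k]]
  fix l1 l2 x y assume *: "l1 @ x # l2 \<in> lists_in k V \<and> y \<in> carrier V"
  have "single (l1 @ (x \<oplus>\<^bsub>V\<^esub> y) # l2) 1 - single (l1 @ x # l2) 1 - single (l1 @ y # l2) 1 \<in> ext_rel k V"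
    using *
    by (intro R[unfolded ext_gens_def] UnI1 CollectI exI[of _ "l1 @ x # l2"] exI[of _ "length l1"]
        exI[of _ x] exI[of _ y]) (auto simp: lists_in_def)
  then have "nf (ext_rel k V) (single (l1 @ (x \<oplus>\<^bsub>V\<^esub> y) # l2) 1 - single (l1 @ x # l2) 1
      - single (l1 @ y # l2) 1) = 0"
    by (simp add: nf_eq_0_iff[OF S])
  then show "wnf k V (l1 @ (x \<oplus>\<^bsub>V\<^esub> y) # l2) = wnf k V (l1 @ x # l2) + wnf k V (l1 @ y # l2)"
    by (simp only: wnf_def lin_diff[OF lin_nf[OF S]] lin_add[OF lin_nf[OF S]] diff_diff_eq right_minus_eq)
next
  note S = ext_rel_subsp[OF V, of k] and R = subsetD[OF ext_gens_rel[OF V, of k]]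
  fix l1 l2 x a assume *: "l1 @ x # l2 \<in> lists_in k V"
  have "single (l1 @ (a \<odot>\<^bsub>V\<^esub> x) # l2) 1 - single (l1 @ x # l2) a \<in> ext_rel k V"
    using * by (intro R[unfolded ext_gens_def] UnI1 UnI2 CollectI exI[of _ "l1 @ x # l2"]
        exI[of _ "length l1"] exI[of _ a] exI[of _ x]) (auto simp: lists_in_def)
  then have "nf (ext_rel k V) (single (l1 @ (a \<odot>\<^bsub>V\<^esub> x) # l2) 1 - sc a (single (l1 @ x # l2) 1)) = 0"
    by (simp add: nf_eq_0_iff[OF S])
  then show "wnf k V (l1 @ (a \<odot>\<^bsub>V\<^esub> x) # l2) = sc a (wnf k V (l1 @ x # l2))"
    by (simp add: wnf_def lin_diff[OF lin_nf[OF S]] lin_sc[OF lin_nf[OF S], symmetric])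
next
  note S = ext_rel_subsp[OF V, of k] and R = subsetD[OF ext_gens_rel[OF V, of k]]
  fix l1 l2 x assume "l1 @ x # x # l2 \<in> lists_in k V"
  then have "single (l1 @ x # x # l2) 1 \<in> ext_rel k V"
    by (intro R[unfolded ext_gens_def] UnI2 CollectI exI[of _ "l1 @ x # x # l2"]) (auto simp: lists_in_def)
  then show "wnf k V (l1 @ x # x # l2) = 0" by (simp add: wnf_def nf_eq_0_iff[OF S])
qed

text \<open>The universal property of the exterior power: the kernel of \<open>lin_ext f\<close> is
  a subspace and contains every relator.\<close>

lemma alt_ext_rel:
  fixes V :: "(rat, 'v) module"
  assumes V: "op_closed V" and f: "alt_map k V f" and c: "c \<in> ext_rel k V"
  shows "lin_ext f c = 0"
proof -
  \<comment> \<open>The relators update a position of a list, whereas \<open>alt_map\<close> splits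
    the list there; this translates between the two.\<close>
  have split: "l[j := x] = take j l @ x # drop (Suc j) l"
    "take j l @ x # drop (Suc j) l \<in> lists_in k V"
    if "length l = k" "set l \<subseteq> carrier V" "j < k" "x \<in> carrier V" for l j x
    using that upd_conv_take_nth_drop[of j l x] lists_in_update[of l k V x j] by (auto simp: lists_in_def)
  have N: "subsp {c. lin_ext f c = 0}"
    by (rule subspI) (simp_all add: lin_ext_add lin_ext_scale)
  have "ext_gens k V \<subseteq> {c. lin_ext f c = 0}"
    unfolding ext_gens_def
  proof (intro Un_least subsetI; elim CollectE exE conjE)
    fix c :: "'v list \<Rightarrow>\<^sub>0 rat" and l j x y assume c: "c = single (l[j := x \<oplus>\<^bsub>V\<^esub> y]) 1 - single (l[j := x]) 1 - single (l[j := y]) 1"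
      and l: "length l = k" "set l \<subseteq> carrier V" "j < k" and xy: "x \<in> carrier V" "y \<in> carrier V"
    show "c \<in> {c. lin_ext f c = 0}"
      using alt_add[OF f split(2)[OF l xy(1)] xy(2)]
      by (simp add: c lin_ext_diff split(1)[OF l] xy op_closed_add[OF V])
  next
    fix c :: "'v list \<Rightarrow>\<^sub>0 rat" and l j a x assume c: "c = single (l[j := a \<odot>\<^bsub>V\<^esub> x]) 1 - single (l[j := x]) a"
      and l: "length l = k" "set l \<subseteq> carrier V" "j < k" and x: "x \<in> carrier V"
    show "c \<in> {c. lin_ext f c = 0}"
      using alt_smult[OF f split(2)[OF l x]]
      by (simp add: c lin_ext_diff split(1)[OF l] x op_closed_smult[OF V])
  next
    fix c :: "'v list \<Rightarrow>\<^sub>0 rat" and l assume c: "c = single l 1" and l: "length l = k" "set l \<subseteq> carrier V" "\<not> distinct l"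
    show "c \<in> {c. lin_ext f c = 0}"
      using alt_not_distinct[OF V f _ l(3)] l by (simp add: c lists_in_def)
  qed
  from ext_rel_least[OF V N this] show ?thesis using c by blast
qed

text \<open>An alternating map may be evaluated on any representative. Nearly every computation with
  wedges below removes a normal form in this way.\<close>

lemma alt_repr:
  assumes V: "op_closed V" and f: "alt_map k V f"
  shows "lin_ext f (nf (ext_rel k V) c) = lin_ext f c"
  using alt_ext_rel[OF V f nf_diff_in[OF ext_rel_subsp[OF V], of k c]] by (simp add: lin_ext_diff)

lemma carrier_ext_pow: "carrier (ext_pow k V) = cst (ext_rel k V) ` {c. keys c \<subseteq> lists_in k V}"
  by (simp add: ext_pow_def ext_free_pmsp carrier_quot_pmsp)

lemma add_ext_pow: "op_closed V \<Longrightarrow>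
    cst (ext_rel k V) x \<oplus>\<^bsub>ext_pow k V\<^esub> cst (ext_rel k V) y = cst (ext_rel k V) (x + y)"
  and smult_ext_pow: "op_closed V \<Longrightarrow>
    a \<odot>\<^bsub>ext_pow k V\<^esub> cst (ext_rel k V) x = cst (ext_rel k V) (sc a x)"
  and zero_ext_pow: "\<zero>\<^bsub>ext_pow k V\<^esub> = cst (ext_rel k V) 0"
  and vectorspace_ext_pow: "op_closed V \<Longrightarrow> vectorspace rat_field (ext_pow k V)"
  by (simp_all add: ext_pow_def ext_free_pmsp add_quot_pmsp smult_quot_pmsp zero_quot_pmsp cst_0
      ext_rel_subsp vectorspace_quot)

lemma op_closed_ext_pow: "op_closed V \<Longrightarrow> op_closed (ext_pow k V)"
  by (rule vectorspace_op_closed[OF vectorspace_ext_pow])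

lemma wedge_cst: "length l = k \<Longrightarrow> wedge V l = cst (ext_rel k V) (single l 1)"
  by (simp add: wedge_def ext_free_pmsp a_r_coset_pmsp)

text \<open>Relations go to relations because \<open>wnf\<close> after \<open>map h\<close> is an
  alternating map on \<open>V\<close>.\<close>

lemma ext_map_cst:
  assumes V: "op_closed V" and W: "op_closed W" and h: "h \<in> vlin V W"
  shows "ext_map k W h (cst (ext_rel k V) c)
    = cst (ext_rel k W) (lin_ext (\<lambda>l. single (map h l) 1) c)"
  unfolding ext_map_def ext_free_pmsp
proof (rule quot_map_cst[OF ext_rel_subsp[OF W] ext_rel_subsp[OF V] lin_lin_ext])
  fix s assume s: "s \<in> ext_rel k V"
  have "nf (ext_rel k W) (lin_ext (\<lambda>l. single (map h l) 1) s) = lin_ext (\<lambda>l. wnf k W (map h l)) s"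
    by (rule lin_eq_on[OF lin_comp[OF lin_nf[OF ext_rel_subsp[OF W]] lin_lin_ext] lin_lin_ext])
      (simp add: wnf_def)
  also have "\<dots> = 0" by (rule alt_ext_rel[OF V alt_pre[OF h alt_wnf[OF W]] s])
  finally show "lin_ext (\<lambda>l. single (map h l) 1) s \<in> ext_rel k W"
    by (simp add: nf_eq_0_iff[OF ext_rel_subsp[OF W]])
qed

lemma lin_ext_map_in:
  assumes h: "h \<in> vlin V W" and c: "keys c \<subseteq> lists_in k V"
  shows "keys (lin_ext (\<lambda>l. single (map h l) a) c) \<subseteq> lists_in k W"
proof -
  have "lin_ext (\<lambda>l. single (map h l) a) c \<in> {c. keys c \<subseteq> lists_in k W}"
    using c vlin_closed[OF h]
    by (intro lin_ext_in[OF subsp_keys] single_in_keys) (fastforce simp: lists_in_def)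
  then show ?thesis by simp
qed

lemma ext_map_vlin:
  assumes V: "op_closed V" and W: "op_closed W" and h: "h \<in> vlin V W"
  shows "ext_map k W h \<in> vlin (ext_pow k V) (ext_pow k W)"
  by (rule vlinI) (auto simp: carrier_ext_pow ext_map_cst[OF V W h] add_ext_pow[OF V] add_ext_pow[OF W]
      smult_ext_pow[OF V] smult_ext_pow[OF W] lin_ext_add lin_ext_scale
      intro!: imageI lin_ext_map_in[OF h, THEN subsetD])

text \<open>Laplace expansion: the alternating sum over the entries \<open>x\<close> of
  \<open>g x\<close> applied to the list with that entry removed. The argument \<open>pre\<close>
  keeps the entries already passed.\<close>

fun laplace :: "('v \<Rightarrow> 'v list \<Rightarrow> ('j \<Rightarrow>\<^sub>0 rat)) \<Rightarrow> 'v list \<Rightarrow> 'v list \<Rightarrow> ('j \<Rightarrow>\<^sub>0 rat)" where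
  "laplace g pre [] = 0"
| "laplace g pre (x # l) = g x (pre @ l) - laplace g (pre @ [x]) l"

text \<open>As for determinants: replacing an entry affects one summand through the first argument
  of \<open>g\<close> and all others through the alternating second argument. For two equal
  neighbours the summands that remove one of them cancel, and all others vanish.\<close>

lemma alt_laplace:
  assumes alt: "\<And>x. x \<in> carrier V \<Longrightarrow> alt_map k V (g x)"
    and add: "\<And>x y l. x \<in> carrier V \<Longrightarrow> y \<in> carrier V \<Longrightarrow> l \<in> lists_in k V \<Longrightarrow> g (x \<oplus>\<^bsub>V\<^esub> y) l = g x l + g y l"
    and smult: "\<And>a x l. x \<in> carrier V \<Longrightarrow> l \<in> lists_in k V \<Longrightarrow> g (a \<odot>\<^bsub>V\<^esub> x) l = sc a (g x l)"
  shows "alt_map (Suc k) V (laplace g [])"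
proof -
  \<comment> \<open>First the changed entry already lies in the prefix, so that every remaining
    summand sees it in the second argument of \<open>g\<close>.\<close>
  have A1: "laplace g (p1 @ (x \<oplus>\<^bsub>V\<^esub> y) # p2) l = laplace g (p1 @ x # p2) l + laplace g (p1 @ y # p2) l"
    if "p1 @ x # p2 @ l \<in> lists_in (Suc k) V" "y \<in> carrier V" for p1 p2 x y l
    using that
  proof (induction l arbitrary: p2)
    case (Cons z l)
    have "g z (p1 @ (x \<oplus>\<^bsub>V\<^esub> y) # p2 @ l) = g z (p1 @ x # p2 @ l) + g z (p1 @ y # p2 @ l)"
      using Cons.prems by (intro alt_add[OF alt]) (auto simp: lists_in_def)
    moreover have "p1 @ x # (p2 @ [z]) @ l \<in> lists_in (Suc k) V" using Cons.prems by simp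
    note Cons.IH[OF this Cons.prems(2)]
    ultimately show ?case by simp
  qed simp
  have A2: "laplace g (p1 @ (a \<odot>\<^bsub>V\<^esub> x) # p2) l = sc a (laplace g (p1 @ x # p2) l)"
    if "p1 @ x # p2 @ l \<in> lists_in (Suc k) V" for p1 p2 x a l
    using that
  proof (induction l arbitrary: p2)
    case (Cons z l)
    have "g z (p1 @ (a \<odot>\<^bsub>V\<^esub> x) # p2 @ l) = sc a (g z (p1 @ x # p2 @ l))"
      using Cons.prems by (intro alt_smult[OF alt]) (auto simp: lists_in_def)
    moreover have "p1 @ x # (p2 @ [z]) @ l \<in> lists_in (Suc k) V" using Cons.prems by simp
    note Cons.IH[OF this]
    ultimately show ?case by (simp add: sc_diff_right)
  qed simp
  have A3: "laplace g (p1 @ x # x # p2) l = 0"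
    if "p1 @ x # x # p2 @ l \<in> lists_in (Suc k) V" for p1 p2 x l
    using that
  proof (induction l arbitrary: p2)
    case (Cons z l)
    have "g z (p1 @ x # x # p2 @ l) = 0"
      using Cons.prems by (intro alt_adj[OF alt]) (auto simp: lists_in_def)
    moreover have "p1 @ x # x # (p2 @ [z]) @ l \<in> lists_in (Suc k) V" using Cons.prems by simp
    note Cons.IH[OF this]
    ultimately show ?case by simp
  qed simp
  \<comment> \<open>Now the changed entry is still ahead; the induction walks up to it and then
    hands over to the prefix case.\<close>
  have B1: "laplace g pre (l1 @ (x \<oplus>\<^bsub>V\<^esub> y) # l2) = laplace g pre (l1 @ x # l2) + laplace g pre (l1 @ y # l2)"
    if "pre @ l1 @ x # l2 \<in> lists_in (Suc k) V" "y \<in> carrier V" for pre l1 x y l2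
    using that
  proof (induction l1 arbitrary: pre)
    case Nil
    have "g (x \<oplus>\<^bsub>V\<^esub> y) (pre @ l2) = g x (pre @ l2) + g y (pre @ l2)"
      using Nil by (intro add) (auto simp: lists_in_def)
    moreover have "laplace g (pre @ (x \<oplus>\<^bsub>V\<^esub> y) # []) l2 = laplace g (pre @ x # []) l2 + laplace g (pre @ y # []) l2"
      using Nil by (intro A1) auto
    ultimately show ?case by simp
  next
    case (Cons z l1)
    have "g z ((pre @ l1) @ (x \<oplus>\<^bsub>V\<^esub> y) # l2) = g z ((pre @ l1) @ x # l2) + g z ((pre @ l1) @ y # l2)"
      using Cons.prems by (intro alt_add[OF alt]) (auto simp: lists_in_def)
    moreover have "(pre @ [z]) @ l1 @ x # l2 \<in> lists_in (Suc k) V" using Cons.prems by simp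
    note Cons.IH[OF this Cons.prems(2)]
    ultimately show ?case by simp
  qed
  have B2: "laplace g pre (l1 @ (a \<odot>\<^bsub>V\<^esub> x) # l2) = sc a (laplace g pre (l1 @ x # l2))"
    if "pre @ l1 @ x # l2 \<in> lists_in (Suc k) V" for pre l1 x a l2
    using that
  proof (induction l1 arbitrary: pre)
    case Nil
    have "g (a \<odot>\<^bsub>V\<^esub> x) (pre @ l2) = sc a (g x (pre @ l2))"
      using Nil by (intro smult) (auto simp: lists_in_def)
    moreover have "laplace g (pre @ (a \<odot>\<^bsub>V\<^esub> x) # []) l2 = sc a (laplace g (pre @ x # []) l2)"
      using Nil by (intro A2) auto
    ultimately show ?case by (simp add: sc_diff_right)
  next
    case (Cons z l1)
    have "g z ((pre @ l1) @ (a \<odot>\<^bsub>V\<^esub> x) # l2) = sc a (g z ((pre @ l1) @ x # l2))"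
      using Cons.prems by (intro alt_smult[OF alt]) (auto simp: lists_in_def)
    moreover have "(pre @ [z]) @ l1 @ x # l2 \<in> lists_in (Suc k) V" using Cons.prems by simp
    note Cons.IH[OF this]
    ultimately show ?case by (simp add: sc_diff_right)
  qed
  \<comment> \<open>Removing the first or the second of the equal neighbours leaves the same list,
    with opposite signs.\<close>
  have B3: "laplace g pre (l1 @ x # x # l2) = 0"
    if "pre @ l1 @ x # x # l2 \<in> lists_in (Suc k) V" for pre l1 x l2
    using that
  proof (induction l1 arbitrary: pre)
    case Nil
    have "laplace g (pre @ x # x # []) l2 = 0" using Nil by (intro A3) auto
    then show ?case by simp
  next
    case (Cons z l1)
    have "g z ((pre @ l1) @ x # x # l2) = 0"
      using Cons.prems by (intro alt_adj[OF alt]) (auto simp: lists_in_def)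
    moreover have "(pre @ [z]) @ l1 @ x # x # l2 \<in> lists_in (Suc k) V" using Cons.prems by simp
    note Cons.IH[OF this]
    ultimately show ?case by simp
  qed
  show ?thesis
    unfolding alt_map_def using B1[of "[]"] B2[of "[]"] B3[of "[]"] by simp
qed

section \<open>Tensor products\<close>

definition bil_map :: "(rat, 'v) module \<Rightarrow> (rat, 'w) module \<Rightarrow> ('v \<times> 'w \<Rightarrow> ('j \<Rightarrow>\<^sub>0 rat)) \<Rightarrow> bool" where
  "bil_map V W f \<longleftrightarrow>
     (\<forall>x\<in>carrier V. \<forall>x'\<in>carrier V. \<forall>y\<in>carrier W. f (x \<oplus>\<^bsub>V\<^esub> x', y) = f (x, y) + f (x', y)) \<and>
     (\<forall>x\<in>carrier V. \<forall>y\<in>carrier W. \<forall>y'\<in>carrier W. f (x, y \<oplus>\<^bsub>W\<^esub> y') = f (x, y) + f (x, y')) \<and>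
     (\<forall>a. \<forall>x\<in>carrier V. \<forall>y\<in>carrier W. f (a \<odot>\<^bsub>V\<^esub> x, y) = sc a (f (x, y))) \<and>
     (\<forall>a. \<forall>x\<in>carrier V. \<forall>y\<in>carrier W. f (x, a \<odot>\<^bsub>W\<^esub> y) = sc a (f (x, y)))"

definition ten_gens :: "(rat, 'v) module \<Rightarrow> (rat, 'w) module \<Rightarrow> ('v \<times> 'w \<Rightarrow>\<^sub>0 rat) set" where
  "ten_gens V W =
     ({single (x \<oplus>\<^bsub>V\<^esub> x', y) 1 - single (x, y) 1 - single (x', y) 1 | x x' y.
         x \<in> carrier V \<and> x' \<in> carrier V \<and> y \<in> carrier W}
    \<union> {single (x, y \<oplus>\<^bsub>W\<^esub> y') 1 - single (x, y) 1 - single (x, y') 1 | x y y'.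
         x \<in> carrier V \<and> y \<in> carrier W \<and> y' \<in> carrier W}
    \<union> {single (a \<odot>\<^bsub>V\<^esub> x, y) 1 - single (x, y) a | a x y. x \<in> carrier V \<and> y \<in> carrier W}
    \<union> {single (x, a \<odot>\<^bsub>W\<^esub> y) 1 - single (x, y) a | a x y. x \<in> carrier V \<and> y \<in> carrier W})"

lemma tensor_free_pmsp: "tensor_free V W = pmsp {c. keys c \<subseteq> carrier V \<times> carrier W}"
  by (simp add: tensor_free_def free_space_pmsp)

lemma tensor_rel_span: "tensor_rel V W
    = LinearCombinations.module.span rat_field (pmsp {c. keys c \<subseteq> carrier V \<times> carrier W}) (ten_gens V W)"
  by (simp add: tensor_rel_def ten_gens_def tensor_free_pmsp)

lemma ten_gens_in: "op_closed V \<Longrightarrow> op_closed W \<Longrightarrow> ten_gens V W \<subseteq> {c. keys c \<subseteq> carrier V \<times> carrier W}"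
  unfolding ten_gens_def
  by (intro Un_least subsetI; elim CollectE exE conjE)
    (simp_all only:, (intro subsp_diff[OF subsp_keys] single_in_keys SigmaI op_closed_add
      op_closed_smult; simp)+)

lemma tensor_rel_subsp: "op_closed V \<Longrightarrow> op_closed W \<Longrightarrow> subsp (tensor_rel V W)"
  and tensor_rel_in: "op_closed V \<Longrightarrow> op_closed W \<Longrightarrow> tensor_rel V W \<subseteq> {c. keys c \<subseteq> carrier V \<times> carrier W}"
  and ten_gens_rel: "op_closed V \<Longrightarrow> op_closed W \<Longrightarrow> ten_gens V W \<subseteq> tensor_rel V W"
  unfolding tensor_rel_span by (intro span_pmsp subsp_keys ten_gens_in; assumption)+

lemma tensor_rel_least: "op_closed V \<Longrightarrow> op_closed W \<Longrightarrow> subsp N \<Longrightarrow> ten_gens V W \<subseteq> N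
    \<Longrightarrow> tensor_rel V W \<subseteq> N"
  unfolding tensor_rel_span by (intro span_pmsp subsp_keys ten_gens_in)

definition ten_nf :: "(rat, 'v) module \<Rightarrow> (rat, 'w) module \<Rightarrow> 'v \<times> 'w \<Rightarrow> ('v \<times> 'w \<Rightarrow>\<^sub>0 rat)" where
  "ten_nf V W p = nf (tensor_rel V W) (single p 1)"

lemma bil_ten_nf:
  assumes "op_closed V" "op_closed W"
  shows "bil_map V W (ten_nf V W)"
proof -
  note S = tensor_rel_subsp[OF assms] and R = subsetD[OF ten_gens_rel[OF assms]]
  note L = lin_nf[OF S]
  have *: "nf (tensor_rel V W) c = 0" if "c \<in> ten_gens V W" for c
    using R[OF that] by (simp add: nf_eq_0_iff[OF S])
  show ?thesis
    unfolding bil_map_def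
  proof (intro conjI ballI allI)
    fix x x' y assume "x \<in> carrier V" "x' \<in> carrier V" "y \<in> carrier W"
    then have "nf (tensor_rel V W) (single (x \<oplus>\<^bsub>V\<^esub> x', y) 1 - single (x, y) 1 - single (x', y) 1) = 0"
      by (intro *) (unfold ten_gens_def, blast)
    then show "ten_nf V W (x \<oplus>\<^bsub>V\<^esub> x', y) = ten_nf V W (x, y) + ten_nf V W (x', y)"
      by (simp only: ten_nf_def lin_diff[OF L] lin_add[OF L] diff_diff_eq right_minus_eq)
  next
    fix x y y' assume "x \<in> carrier V" "y \<in> carrier W" "y' \<in> carrier W"
    then have "nf (tensor_rel V W) (single (x, y \<oplus>\<^bsub>W\<^esub> y') 1 - single (x, y) 1 - single (x, y') 1) = 0"
      by (intro *) (unfold ten_gens_def, blast)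
    then show "ten_nf V W (x, y \<oplus>\<^bsub>W\<^esub> y') = ten_nf V W (x, y) + ten_nf V W (x, y')"
      by (simp only: ten_nf_def lin_diff[OF L] lin_add[OF L] diff_diff_eq right_minus_eq)
  next
    fix a x y assume "x \<in> carrier V" "y \<in> carrier W"
    then have "nf (tensor_rel V W) (single (a \<odot>\<^bsub>V\<^esub> x, y) 1 - single (x, y) a) = 0"
      by (intro *) (unfold ten_gens_def, blast)
    then have "nf (tensor_rel V W) (single (a \<odot>\<^bsub>V\<^esub> x, y) 1 - sc a (single (x, y) 1)) = 0"
      by simp
    then show "ten_nf V W (a \<odot>\<^bsub>V\<^esub> x, y) = sc a (ten_nf V W (x, y))"
      by (simp only: ten_nf_def lin_diff[OF L] lin_sc[OF L] right_minus_eq)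
  next
    fix a x y assume "x \<in> carrier V" "y \<in> carrier W"
    then have "nf (tensor_rel V W) (single (x, a \<odot>\<^bsub>W\<^esub> y) 1 - single (x, y) a) = 0"
      by (intro *) (unfold ten_gens_def, blast)
    then have "nf (tensor_rel V W) (single (x, a \<odot>\<^bsub>W\<^esub> y) 1 - sc a (single (x, y) 1)) = 0"
      by simp
    then show "ten_nf V W (x, a \<odot>\<^bsub>W\<^esub> y) = sc a (ten_nf V W (x, y))"
      by (simp only: ten_nf_def lin_diff[OF L] lin_sc[OF L] right_minus_eq)
  qed
qed

text \<open>The universal property of the tensor product, again because the kernel of
  \<open>lin_ext f\<close> is a subspace that contains the relators.\<close>

lemma bil_tensor_rel:
  assumes "op_closed V" "op_closed W" and f: "bil_map V W f" and c: "c \<in> tensor_rel V W"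
  shows "lin_ext f c = 0"
proof -
  have N: "subsp {c. lin_ext f c = 0}"
    by (rule subspI) (simp_all add: lin_ext_add lin_ext_scale)
  have "ten_gens V W \<subseteq> {c. lin_ext f c = 0}"
    unfolding ten_gens_def using f
    by (intro Un_least subsetI; elim CollectE exE conjE) (simp_all add: bil_map_def lin_ext_diff)
  from tensor_rel_least[OF assms(1,2) N this] show ?thesis using c by blast
qed

lemma carrier_tensor: "carrier (tensor V W) = cst (tensor_rel V W) ` {c. keys c \<subseteq> carrier V \<times> carrier W}"
  by (simp add: tensor_def tensor_free_pmsp carrier_quot_pmsp)

lemma add_tensor: "op_closed V \<Longrightarrow> op_closed W \<Longrightarrow>
    cst (tensor_rel V W) x \<oplus>\<^bsub>tensor V W\<^esub> cst (tensor_rel V W) y = cst (tensor_rel V W) (x + y)"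
  and smult_tensor: "op_closed V \<Longrightarrow> op_closed W \<Longrightarrow>
    a \<odot>\<^bsub>tensor V W\<^esub> cst (tensor_rel V W) x = cst (tensor_rel V W) (sc a x)"
  and vectorspace_tensor: "op_closed V \<Longrightarrow> op_closed W \<Longrightarrow> vectorspace rat_field (tensor V W)"
  by (simp_all add: tensor_def tensor_free_pmsp add_quot_pmsp smult_quot_pmsp
      tensor_rel_subsp vectorspace_quot)

lemma tensor_map_cst:
  assumes V: "op_closed V" "op_closed V'" and W: "op_closed W" "op_closed W'"
    and h: "h \<in> vlin V V'" and g: "g \<in> vlin W W'"
  shows "tensor_map V' W' h g (cst (tensor_rel V W) c)
    = cst (tensor_rel V' W') (lin_ext (\<lambda>(x, y). single (h x, g y) 1) c)"
  unfolding tensor_map_def tensor_free_pmsp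
proof (rule quot_map_cst[OF tensor_rel_subsp[OF V(2) W(2)] tensor_rel_subsp[OF V(1) W(1)] lin_lin_ext])
  fix s assume s: "s \<in> tensor_rel V W"
  note S' = tensor_rel_subsp[OF V(2) W(2)]
  have "nf (tensor_rel V' W') (lin_ext (\<lambda>(x, y). single (h x, g y) 1) s)
      = lin_ext (\<lambda>(x, y). ten_nf V' W' (h x, g y)) s"
    by (rule lin_eq_on[OF lin_comp[OF lin_nf[OF S'] lin_lin_ext] lin_lin_ext])
      (auto simp: ten_nf_def split: prod.splits)
  also have "\<dots> = 0"
  proof (rule bil_tensor_rel[OF V(1) W(1) _ s])
    show "bil_map V W (\<lambda>(x, y). ten_nf V' W' (h x, g y))"
      using bil_ten_nf[OF V(2) W(2)] unfolding bil_map_def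
      by (simp add: vlin_add[OF h] vlin_add[OF g] vlin_smult[OF h] vlin_smult[OF g]
          vlin_closed[OF h] vlin_closed[OF g])
  qed
  finally show "lin_ext (\<lambda>(x, y). single (h x, g y) 1) s \<in> tensor_rel V' W'"
    by (simp add: nf_eq_0_iff[OF S'])
qed

section \<open>Finitary linear maps\<close>

abbreviation invf where "invf \<equiv> inv_into UNIV"

lemma H_inf_pmsp: "H_inf = pmsp UNIV"
  by (simp add: H_inf_def free_space_pmsp)

lemma H_inf_simps [simp]: "carrier H_inf = UNIV" "x \<oplus>\<^bsub>H_inf\<^esub> y = x + y" "a \<odot>\<^bsub>H_inf\<^esub> x = sc a x"
  by (simp_all add: H_inf_pmsp)

lemma op_closed_H_inf [simp]: "op_closed H_inf"
  by (simp add: op_closed_def)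

lemma lists_in_H_inf: "lists_in k H_inf = {l. length l = k}"
  by (simp add: lists_in_def)

lemma vlin_H_inf: "A \<in> vlin H_inf H_inf \<longleftrightarrow> lin A"
  by (auto simp: LinearCombinations.module_hom_def lin_def)

lemma lin_e_expand: "lin f \<Longrightarrow> f x = (\<Sum>j\<in>keys x. sc (lookup x j) (f (e j)))"
proof -
  assume f: "lin f"
  have "f x = f (\<Sum>j\<in>keys x. sc (lookup x j) (e j))"
    using pm_expand[of x] by (simp add: e_def)
  then show ?thesis using f by (simp only: lin_sum lin_sc)
qed

lemma lin_e_expand_superset: "lin f \<Longrightarrow> finite M \<Longrightarrow> keys x \<subseteq> M
    \<Longrightarrow> f x = (\<Sum>j\<in>M. sc (lookup x j) (f (e j)))"
  by (subst lin_e_expand) (auto intro!: sum.mono_neutral_left simp: in_keys_iff)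

lemma lin_eq_e: "lin f \<Longrightarrow> lin g \<Longrightarrow> (\<And>j. f (e j) = g (e j)) \<Longrightarrow> f = g"
  by (rule ext, rule lin_eq_on) (simp_all flip: e_def)

lemma carrier_H: "carrier (H n) = {c. keys c \<subseteq> {..<n}}"
  by (simp add: H_def free_space_pmsp)

lemma keys_e [simp]: "keys (e j) = {j}" and lookup_e: "lookup (e j) k = (if j = k then 1 else 0)"
  by (simp_all add: e_def lookup_single when_def)

text \<open>The copy of the general linear group of rank \<open>n\<close> inside
  \<open>GL_inf\<close>; the explicit rank bounds all coordinate sums.\<close>

definition level :: "nat \<Rightarrow> ((nat \<Rightarrow>\<^sub>0 rat) \<Rightarrow> (nat \<Rightarrow>\<^sub>0 rat)) \<Rightarrow> bool" where
  "level n A \<longleftrightarrow> lin A \<and> bij A \<and> A ` carrier (H n) = carrier (H n) \<and> (\<forall>j\<ge>n. A (e j) = e j)"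

lemma GL_inf_level: "GL_inf = {A. \<exists>n. level n A}"
  by (auto simp: GL_inf_def level_def vlin_H_inf)

lemma level_lin: "level n A \<Longrightarrow> lin A" and lev_bij: "level n A \<Longrightarrow> bij A"
  and level_fix: "level n A \<Longrightarrow> n \<le> j \<Longrightarrow> A (e j) = e j"
  and level_keys: "level n A \<Longrightarrow> keys x \<subseteq> {..<n} \<Longrightarrow> keys (A x) \<subseteq> {..<n}"
  by (auto simp: level_def carrier_H)

lemma lin_inv: "lin A \<Longrightarrow> bij A \<Longrightarrow> lin (invf A)"
proof (rule linI)
  assume A: "lin A" "bij A"
  have s: "A (invf A x) = x" for x using A(2) by (simp add: bij_is_surj surj_f_inv_f)
  have i: "invf A (A x) = x" for x using A(2) by (simp add: bij_is_inj)
  show "invf A (x + y) = invf A x + invf A y" for x y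
    using i[of "invf A x + invf A y"] by (simp add: lin_add[OF A(1)] s)
  show "invf A (sc a x) = sc a (invf A x)" for a x
    using i[of "sc a (invf A x)"] by (simp add: lin_sc[OF A(1)] s)
qed

lemma level_inv: "level n A \<Longrightarrow> level n (invf A)"
  unfolding level_def
  by (metis bij_imp_bij_inv bij_is_inj image_inv_f_f inv_f_f lin_inv)

lemma level_comp: "level n A \<Longrightarrow> level n B \<Longrightarrow> level n (A \<circ> B)"
  unfolding level_def image_comp[symmetric] by (auto simp: bij_comp lin_comp[of A B, folded comp_def])

lemma level_sub:
  assumes "level n A" "n \<le> m" "keys x \<subseteq> {..<m}"
  shows "keys (A x) \<subseteq> {..<m}"
proof -
  have "x \<in> A -` {c. keys c \<subseteq> {..<m}}"
  proof (rule subsp_induct[OF subsp_vimage[OF level_lin[OF assms(1)] subsp_keys]])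
    fix i assume "i \<in> keys x"
    then have "i < m" using assms(3) by auto
    then show "single i 1 \<in> A -` {c. keys c \<subseteq> {..<m}}"
      using level_keys[OF assms(1), of "e i"] level_fix[OF assms(1), of i] assms(2)
      by (cases "i < n") (auto simp: e_def)
  qed
  then show ?thesis by simp
qed

lemma level_mono:
  assumes A: "level n A" and nm: "n \<le> m"
  shows "level m A"
proof -
  have "A ` carrier (H m) \<subseteq> carrier (H m)" "invf A ` carrier (H m) \<subseteq> carrier (H m)"
    using level_sub[OF A nm] level_sub[OF level_inv[OF A] nm] by (auto simp: carrier_H)
  moreover have "A (invf A x) = x" for x
    using lev_bij[OF A] by (simp add: bij_is_surj surj_f_inv_f)
  ultimately have "A ` carrier (H m) = carrier (H m)" by (metis image_subset_iff rev_image_eqI subsetI subset_antisym)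
  then show ?thesis using A nm by (auto simp: level_def)
qed

lemma inv_level: "level n A \<Longrightarrow> A (invf A x) = x" "level n A \<Longrightarrow> invf A (A x) = x"
  using lev_bij[of n A] by (simp_all add: bij_is_surj surj_f_inv_f bij_is_inj)

text \<open>Basis vectors from \<open>n\<close> on are fixed, so they contribute nothing to a
  coordinate below \<open>n\<close>.\<close>

lemma level_coord:
  assumes B: "level n B" and k: "k < n"
  shows "lookup (B y) k = (\<Sum>m<n. lookup y m * lookup (B (e m)) k)"
proof -
  let ?M = "keys y \<union> {..<n}"
  have "lookup (B y) k = (\<Sum>m\<in>?M. lookup y m * lookup (B (e m)) k)"
    by (subst lin_e_expand_superset[OF level_lin[OF B], of ?M]) (auto simp: lookup_sum)
  also have "\<dots> = (\<Sum>m<n. lookup y m * lookup (B (e m)) k)"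
    by (rule sum.mono_neutral_right) (use k in \<open>auto simp: level_fix[OF B] lookup_e\<close>)
  finally show ?thesis .
qed

section \<open>The dual space\<close>

lemma rat_line_simps [simp]: "carrier rat_line = UNIV" "x \<oplus>\<^bsub>rat_line\<^esub> y = x + y"
    "a \<odot>\<^bsub>rat_line\<^esub> x = a * x" "\<zero>\<^bsub>rat_line\<^esub> = 0"
  by (simp_all add: rat_line_def)

lemma vectorspace_rat_line: "vectorspace rat_field rat_line"
proof (rule vectorspaceI)
  show "\<exists>w\<in>carrier rat_line. v \<oplus>\<^bsub>rat_line\<^esub> w = \<zero>\<^bsub>rat_line\<^esub>" for v
    by (intro bexI[of _ "- v"]) simp_all
qed (simp_all add: algebra_simps)

lemma fin_hom_simps: "carrier (fin_hom W) = {u \<in> vlin H_inf W. finite {j. u (e j) \<noteq> \<zero>\<^bsub>W\<^esub>}}"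
    "u \<oplus>\<^bsub>fin_hom W\<^esub> v = (\<lambda>x. u x \<oplus>\<^bsub>W\<^esub> v x)" "a \<odot>\<^bsub>fin_hom W\<^esub> u = (\<lambda>x. a \<odot>\<^bsub>W\<^esub> u x)"
  by (simp_all add: fin_hom_def)

lemma op_closed_fin_hom:
  assumes "vectorspace rat_field W"
  shows "op_closed (fin_hom W)"
proof -
  interpret vectorspace rat_field W by (rule assms)
  have *: "u x \<in> carrier W" if "u \<in> carrier (fin_hom W)" for u x
    using that vlin_closed[of u H_inf W x] by (simp add: fin_hom_simps)
  show ?thesis
    unfolding op_closed_def
  proof (intro ballI conjI allI)
    fix u v assume u: "u \<in> carrier (fin_hom W)" and v: "v \<in> carrier (fin_hom W)"
    have uW: "u \<in> vlin H_inf W" and vW: "v \<in> vlin H_inf W" using u v by (auto simp: fin_hom_simps)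
    have "finite ({j. u (e j) \<noteq> \<zero>\<^bsub>W\<^esub>} \<union> {j. v (e j) \<noteq> \<zero>\<^bsub>W\<^esub>})"
      using u v by (simp add: fin_hom_simps)
    then have "finite {j. u (e j) \<oplus>\<^bsub>W\<^esub> v (e j) \<noteq> \<zero>\<^bsub>W\<^esub>}"
      by (rule rev_finite_subset) auto
    moreover have "(\<lambda>x. u x \<oplus>\<^bsub>W\<^esub> v x) \<in> vlin H_inf W"
    proof (rule vlinI)
      fix x y a
      show "u x \<oplus>\<^bsub>W\<^esub> v x \<in> carrier W" using *[OF u] *[OF v] by simp
      show "u (x \<oplus>\<^bsub>H_inf\<^esub> y) \<oplus>\<^bsub>W\<^esub> v (x \<oplus>\<^bsub>H_inf\<^esub> y) = (u x \<oplus>\<^bsub>W\<^esub> v x) \<oplus>\<^bsub>W\<^esub> (u y \<oplus>\<^bsub>W\<^esub> v y)"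
        using vlin_add[OF uW, of x y] vlin_add[OF vW, of x y] *[OF u] *[OF v]
        by (simp add: M.a_ac)
      show "u (a \<odot>\<^bsub>H_inf\<^esub> x) \<oplus>\<^bsub>W\<^esub> v (a \<odot>\<^bsub>H_inf\<^esub> x) = a \<odot>\<^bsub>W\<^esub> (u x \<oplus>\<^bsub>W\<^esub> v x)"
        using vlin_smult[OF uW, of x a] vlin_smult[OF vW, of x a] *[OF u] *[OF v]
        by (simp add: smult_r_distr)
    qed
    ultimately show "u \<oplus>\<^bsub>fin_hom W\<^esub> v \<in> carrier (fin_hom W)" by (simp add: fin_hom_simps)
  next
    fix u a assume u: "u \<in> carrier (fin_hom W)"
    have uW: "u \<in> vlin H_inf W" using u by (auto simp: fin_hom_simps)
    have "finite {j. u (e j) \<noteq> \<zero>\<^bsub>W\<^esub>}" using u by (simp add: fin_hom_simps)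
    then have "finite {j. a \<odot>\<^bsub>W\<^esub> u (e j) \<noteq> \<zero>\<^bsub>W\<^esub>}"
      by (rule rev_finite_subset) auto
    moreover have "(\<lambda>x. a \<odot>\<^bsub>W\<^esub> u x) \<in> vlin H_inf W"
    proof (rule vlinI)
      fix x y b
      show "a \<odot>\<^bsub>W\<^esub> u x \<in> carrier W" using *[OF u] by simp
      show "a \<odot>\<^bsub>W\<^esub> u (x \<oplus>\<^bsub>H_inf\<^esub> y) = a \<odot>\<^bsub>W\<^esub> u x \<oplus>\<^bsub>W\<^esub> a \<odot>\<^bsub>W\<^esub> u y"
        using vlin_add[OF uW, of x y] *[OF u] by (simp add: smult_r_distr)
      show "a \<odot>\<^bsub>W\<^esub> u (b \<odot>\<^bsub>H_inf\<^esub> x) = b \<odot>\<^bsub>W\<^esub> (a \<odot>\<^bsub>W\<^esub> u x)"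
        using vlin_smult[OF uW, of x b] *[OF u] smult_assoc1[of a b "u x"] smult_assoc1[of b a "u x"]
        by (simp add: mult.commute)
    qed
    ultimately show "a \<odot>\<^bsub>fin_hom W\<^esub> u \<in> carrier (fin_hom W)" by (simp add: fin_hom_simps)
  qed
qed

lemma op_closed_H_dual [simp]: "op_closed H_dual"
  unfolding H_dual_def by (rule op_closed_fin_hom[OF vectorspace_rat_line])

lemma H_dual_simps: "carrier H_dual = {u \<in> vlin H_inf rat_line. finite {j. u (e j) \<noteq> 0}}"
    "u \<oplus>\<^bsub>H_dual\<^esub> v = (\<lambda>x. u x + v x)" "a \<odot>\<^bsub>H_dual\<^esub> u = (\<lambda>x. a * u x)"
  by (simp_all add: H_dual_def fin_hom_simps)

lemma H_dual_add: "u \<in> carrier H_dual \<Longrightarrow> u (x + y) = u x + u y"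
  and H_dual_sc: "u \<in> carrier H_dual \<Longrightarrow> u (sc a x) = a * u x"
  using vlin_add[of u H_inf rat_line x y] vlin_smult[of u H_inf rat_line x a]
  by (simp_all add: H_dual_simps)

lemma H_dual_sum:
  assumes "u \<in> carrier H_dual"
  shows "u (sum f M) = (\<Sum>i\<in>M. u (f i))"
proof -
  have "u 0 = 0" using H_dual_sc[OF assms, of 0 0] by simp
  then show ?thesis
    by (induction M rule: infinite_finite_induct) (auto simp: H_dual_add[OF assms])
qed

definition edual :: "nat \<Rightarrow> (nat \<Rightarrow>\<^sub>0 rat) \<Rightarrow> rat" where
  "edual m x = lookup x m"

lemma H_dualI: "(\<And>x y :: nat \<Rightarrow>\<^sub>0 rat. u (x + y) = u x + u y) \<Longrightarrow> (\<And>a (x :: nat \<Rightarrow>\<^sub>0 rat). u (sc a x) = a * u x)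
    \<Longrightarrow> finite {j. u (e j) \<noteq> 0} \<Longrightarrow> u \<in> carrier H_dual"
  by (auto simp: H_dual_simps intro!: vlinI)

lemma edual_in [simp]: "edual m \<in> carrier H_dual"
  by (rule H_dualI) (auto simp: edual_def lookup_add lookup_e)

lemma edual_sum_in: "(\<lambda>x. \<Sum>m\<in>M. c m * lookup x m) \<in> carrier H_dual" if "finite M"
proof (rule H_dualI)
  show "finite {j. (\<Sum>m\<in>M. c m * lookup (e j) m) \<noteq> 0}"
    by (rule finite_subset[OF _ that]) (auto simp: lookup_e intro!: sum.neutral)
qed (simp_all add: lookup_add distrib_left sum.distrib sum_distrib_left mult_ac)

lemma H_dual_expand:
  assumes u: "u \<in> carrier H_dual"
  shows "u = (\<lambda>x. \<Sum>m | u (e m) \<noteq> 0. u (e m) * lookup x m)"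
proof
  fix x :: "nat \<Rightarrow>\<^sub>0 rat"
  let ?M = "keys x \<union> {m. u (e m) \<noteq> 0}"
  have fin: "finite ?M" using u by (simp add: H_dual_simps)
  have "u x = u (\<Sum>j\<in>keys x. sc (lookup x j) (e j))"
    using pm_expand[of x] by (simp add: e_def)
  also have "\<dots> = (\<Sum>j\<in>keys x. u (e j) * lookup x j)"
    by (simp add: H_dual_sum[OF u] H_dual_sc[OF u] mult.commute)
  also have "\<dots> = (\<Sum>j\<in>?M. u (e j) * lookup x j)"
    using fin by (intro sum.mono_neutral_left) (auto simp: in_keys_iff)
  also have "\<dots> = (\<Sum>m | u (e m) \<noteq> 0. u (e m) * lookup x m)"
    using fin by (intro sum.mono_neutral_right) auto
  finally show "u x = (\<Sum>m | u (e m) \<noteq> 0. u (e m) * lookup x m)" .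
qed

lemma dual_act_vlin:
  assumes A: "level n A"
  shows "dual_act A \<in> vlin H_dual H_dual"
proof (rule vlinI)
  note B = level_inv[OF A]
  fix u assume u: "u \<in> carrier H_dual"
  show "dual_act A u \<in> carrier H_dual"
  proof (rule H_dualI)
    have "finite ({..<n} \<union> {j. u (e j) \<noteq> 0})" using u by (simp add: H_dual_simps)
    then show "finite {j. dual_act A u (e j) \<noteq> 0}"
      by (rule rev_finite_subset) (auto simp: dual_act_def not_less level_fix[OF B] intro: leI)
  qed (simp_all add: dual_act_def lin_add[OF level_lin[OF B]] lin_sc[OF level_lin[OF B]] H_dual_add[OF u]
      H_dual_sc[OF u])
qed (simp_all add: dual_act_def H_dual_simps fun_eq_iff)

text \<open>The coefficients form row \<open>k\<close> of the matrix of the inverse of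
  \<open>A\<close>.\<close>

lemma dual_act_edual:
  assumes A: "level n A" and k: "k < n"
  shows "dual_act A (edual k) = (\<lambda>x. \<Sum>m<n. lookup (invf A (e m)) k * lookup x m)"
proof
  fix x
  have "dual_act A (edual k) x = lookup (invf A x) k" by (simp add: dual_act_def edual_def)
  also have "\<dots> = (\<Sum>m<n. lookup x m * lookup (invf A (e m)) k)"
    by (rule level_coord[OF level_inv[OF A] k])
  finally show "dual_act A (edual k) x = (\<Sum>m<n. lookup (invf A (e m)) k * lookup x m)"
    by (simp only: mult.commute)
qed

section \<open>The representation U\<close>

abbreviation R2 where "R2 \<equiv> ext_rel 2 H_inf"

lemma subsp_R [simp]: "subsp (ext_rel k H_inf)"
  by (rule ext_rel_subsp) simp

text \<open>Values as normal forms: linearity in \<open>u\<close> and in \<open>x\<close> becomes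
  linearity of finitely supported functions.\<close>

definition uval :: "U_elt \<Rightarrow> (nat \<Rightarrow>\<^sub>0 rat) \<Rightarrow> ((nat \<Rightarrow>\<^sub>0 rat) list \<Rightarrow>\<^sub>0 rat)" where
  "uval u x = repr R2 (u x)"

lemma op_closed_U [simp]: "op_closed U_inf"
  unfolding U_inf_def by (rule op_closed_fin_hom[OF vectorspace_ext_pow]) simp

lemma U_simps: "carrier U_inf = {u \<in> vlin H_inf (ext_pow 2 H_inf). finite {j. u (e j) \<noteq> \<zero>\<^bsub>ext_pow 2 H_inf\<^esub>}}"
    "u \<oplus>\<^bsub>U_inf\<^esub> v = (\<lambda>x. u x \<oplus>\<^bsub>ext_pow 2 H_inf\<^esub> v x)"
    "a \<odot>\<^bsub>U_inf\<^esub> u = (\<lambda>x. a \<odot>\<^bsub>ext_pow 2 H_inf\<^esub> u x)"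
  by (simp_all add: U_inf_def fin_hom_simps)

lemma U_value:
  assumes "u \<in> carrier U_inf"
  obtains c where "u x = cst R2 c" "keys c \<subseteq> lists_in 2 H_inf"
  using assms vlin_closed[of u H_inf "ext_pow 2 H_inf" x] by (auto simp: U_simps carrier_ext_pow)

lemma uval_cst: "u \<in> carrier U_inf \<Longrightarrow> u x = cst R2 (uval u x)"
  by (rule U_value[of u x]) (simp_all add: uval_def cst_nf)

lemma nf_uval: "u \<in> carrier U_inf \<Longrightarrow> nf R2 (uval u x) = uval u x"
  by (rule U_value[of u x]) (simp_all add: uval_def nf_nf)

lemma keys_nf:
  assumes "op_closed V" "keys c \<subseteq> lists_in k V"
  shows "keys (nf (ext_rel k V) c) \<subseteq> lists_in k V"
proof -
  have "nf (ext_rel k V) c - c \<in> {c. keys c \<subseteq> lists_in k V}"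
    using nf_diff_in[OF ext_rel_subsp] ext_rel_in assms(1) by blast
  from subsp_add[OF subsp_keys this, of c] show ?thesis using assms(2) by simp
qed

lemma keys_uval: "u \<in> carrier U_inf \<Longrightarrow> keys (uval u x) \<subseteq> lists_in 2 H_inf"
  by (rule U_value[of u x]) (simp_all add: uval_def keys_nf)

lemma uval_add: "u \<in> carrier U_inf \<Longrightarrow> v \<in> carrier U_inf \<Longrightarrow> uval (u \<oplus>\<^bsub>U_inf\<^esub> v) x = uval u x + uval v x"
  by (rule U_value[of u x], assumption, rule U_value[of v x], assumption)
    (simp add: uval_def U_simps add_ext_pow lin_add[OF lin_nf])

lemma uval_smult: "u \<in> carrier U_inf \<Longrightarrow> uval (a \<odot>\<^bsub>U_inf\<^esub> u) x = sc a (uval u x)"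
  by (rule U_value[of u x], assumption) (simp add: uval_def U_simps smult_ext_pow lin_sc[OF lin_nf])

lemma lin_uval:
  assumes u: "u \<in> carrier U_inf"
  shows "lin (uval u)"
proof (rule linI)
  have u': "u \<in> vlin H_inf (ext_pow 2 H_inf)" using u by (simp add: U_simps)
  fix x y a
  obtain c where c: "u x = cst R2 c" using U_value[OF u] by blast
  obtain d where d: "u y = cst R2 d" using U_value[OF u] by blast
  show "uval u (x + y) = uval u x + uval u y"
    using vlin_add[OF u', of x y] by (simp add: uval_def c d add_ext_pow lin_add[OF lin_nf])
  show "uval u (sc a x) = sc a (uval u x)"
    using vlin_smult[OF u', of x a] by (simp add: uval_def c smult_ext_pow lin_sc[OF lin_nf])
qed

lemma uval_finite: "u \<in> carrier U_inf \<Longrightarrow> finite {j. uval u (e j) \<noteq> 0}"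
proof -
  assume u: "u \<in> carrier U_inf"
  have "finite {j. u (e j) \<noteq> \<zero>\<^bsub>ext_pow 2 H_inf\<^esub>}" using u by (simp add: U_simps)
  then show ?thesis
    by (rule rev_finite_subset) (auto simp: uval_def zero_ext_pow lin_0[OF lin_nf])
qed

lemma U_I:
  assumes "lin h" "\<And>x. keys (h x) \<subseteq> lists_in 2 H_inf" "finite {j. h (e j) \<noteq> 0}"
  shows "(\<lambda>x. cst R2 (h x)) \<in> carrier U_inf"
proof -
  have "finite {j. cst R2 (h (e j)) \<noteq> cst R2 0}"
    by (rule finite_subset[OF _ assms(3)]) auto
  then show ?thesis
    using assms(1,2)
    by (auto simp: U_simps zero_ext_pow carrier_ext_pow add_ext_pow smult_ext_pow lin_add lin_sc
        intro!: vlinI)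
qed

lemma U_eqI:
  assumes "u \<in> carrier U_inf" "v \<in> carrier U_inf" "\<And>j. uval u (e j) = uval v (e j)"
  shows "u = v"
proof
  fix x
  have "uval u = uval v" by (rule lin_eq_e) (use assms lin_uval in auto)
  then show "u x = v x" using uval_cst[OF assms(1), of x] uval_cst[OF assms(2), of x] by simp
qed

text \<open>The exterior square of \<open>A\<close>, from representatives to normal forms.\<close>

definition Lam :: "((nat \<Rightarrow>\<^sub>0 rat) \<Rightarrow> (nat \<Rightarrow>\<^sub>0 rat)) \<Rightarrow> ((nat \<Rightarrow>\<^sub>0 rat) list \<Rightarrow>\<^sub>0 rat) \<Rightarrow> ((nat \<Rightarrow>\<^sub>0 rat) list \<Rightarrow>\<^sub>0 rat)" where
  "Lam A = lin_ext (\<lambda>l. wnf 2 H_inf (map A l))"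

lemma lin_Lam: "lin (Lam A)"
  by (simp add: Lam_def)

lemma nf_lin_ext_map:
  assumes W: "op_closed W"
  shows "nf (ext_rel k W) (lin_ext (\<lambda>l. single (f l) a) c) = sc a (lin_ext (\<lambda>l. wnf k W (f l)) c)"
  by (rule lin_eq_on[OF lin_comp[OF lin_nf[OF ext_rel_subsp[OF W]] lin_lin_ext] lin_scale[OF lin_lin_ext]])
    (simp add: wnf_def flip: lin_sc[OF lin_nf[OF ext_rel_subsp[OF W]]])

lemma keys_wnf: "op_closed V \<Longrightarrow> l \<in> lists_in k V \<Longrightarrow> keys (wnf k V l) \<subseteq> lists_in k V"
  unfolding wnf_def by (rule keys_nf) auto

lemma nf_wnf: "op_closed V \<Longrightarrow> nf (ext_rel k V) (wnf k V l) = wnf k V l"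
  unfolding wnf_def by (rule nf_nf[OF ext_rel_subsp])

lemma uval_U_act:
  assumes "lin A" "u \<in> carrier U_inf"
  shows "uval (U_act A u) x = Lam A (uval u (invf A x))"
    and "U_act A u = (\<lambda>x. cst R2 (Lam A (uval u (invf A x))))"
proof -
  have "ext_map 2 H_inf A (u (invf A x)) = ext_map 2 H_inf A (cst R2 (uval u (invf A x)))" for x
    using uval_cst[OF assms(2), of "invf A x"] by simp
  then have *: "U_act A u x = cst R2 (lin_ext (\<lambda>l. single (map A l) 1) (uval u (invf A x)))" for x
    by (simp add: U_act_def ext_map_cst vlin_H_inf assms(1))
  then show 1: "uval (U_act A u) x = Lam A (uval u (invf A x))" for x
    by (simp add: uval_def[of "U_act A u"] nf_lin_ext_map Lam_def)
  have "U_act A u x = cst R2 (uval (U_act A u) x)" for x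
    by (simp add: uval_def[of "U_act A u"] * cst_nf)
  then have "U_act A u x = cst R2 (Lam A (uval u (invf A x)))" for x
    by (simp only: 1)
  then show "U_act A u = (\<lambda>x. cst R2 (Lam A (uval u (invf A x))))" by blast
qed

lemma keys_Lam: "keys c \<subseteq> lists_in 2 H_inf \<Longrightarrow> keys (Lam A c) \<subseteq> lists_in 2 H_inf"
proof -
  assume c: "keys c \<subseteq> lists_in 2 H_inf"
  have "Lam A c \<in> {c. keys c \<subseteq> lists_in 2 H_inf}"
    unfolding Lam_def
  proof (rule lin_ext_in[OF subsp_keys])
    fix l assume "l \<in> keys c"
    then have "map A l \<in> lists_in 2 H_inf" using c by (auto simp: lists_in_H_inf)
    then show "wnf 2 H_inf (map A l) \<in> {c. keys c \<subseteq> lists_in 2 H_inf}" by (simp add: keys_wnf)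
  qed
  then show ?thesis by simp
qed

lemma U_act_in:
  assumes A: "level n A" and u: "u \<in> carrier U_inf"
  shows "U_act A u \<in> carrier U_inf"
  unfolding uval_U_act(2)[OF level_lin[OF A] u]
proof (rule U_I)
  note B = level_inv[OF A]
  show "lin (\<lambda>x. Lam A (uval u (invf A x)))"
    by (intro lin_comp[OF lin_Lam] lin_comp[OF lin_uval[OF u]] level_lin[OF B])
  show "keys (Lam A (uval u (invf A x))) \<subseteq> lists_in 2 H_inf" for x
    by (intro keys_Lam keys_uval u)
  have "finite ({..<n} \<union> {j. uval u (e j) \<noteq> 0})" using uval_finite[OF u] by simp
  then show "finite {j. Lam A (uval u (invf A (e j))) \<noteq> 0}"
    by (rule rev_finite_subset) (auto simp: not_less level_fix[OF B] lin_0[OF lin_Lam] intro: leI)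
qed

lemma U_act_vlin:
  assumes A: "level n A"
  shows "U_act A \<in> vlin U_inf U_inf"
proof (rule vlinI)
  fix u v a assume u: "u \<in> carrier U_inf"
  show "U_act A u \<in> carrier U_inf" by (rule U_act_in[OF A u])
  show "U_act A (a \<odot>\<^bsub>U_inf\<^esub> u) = a \<odot>\<^bsub>U_inf\<^esub> U_act A u"
    by (rule U_eqI) (simp_all add: U_act_in[OF A] op_closed_smult u uval_U_act(1) level_lin[OF A] uval_smult
        lin_sc[OF lin_Lam])
  assume v: "v \<in> carrier U_inf"
  show "U_act A (u \<oplus>\<^bsub>U_inf\<^esub> v) = U_act A u \<oplus>\<^bsub>U_inf\<^esub> U_act A v"
    by (rule U_eqI) (simp_all add: U_act_in[OF A] op_closed_add u v uval_U_act(1) level_lin[OF A] uval_add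
        lin_add[OF lin_Lam])
qed

text \<open>The inner normal form may be dropped by \<open>alt_repr\<close>, since the outer map is
  alternating.\<close>

lemma Lam_Lam:
  assumes "lin A" "lin B"
  shows "Lam A (Lam B c) = Lam (A \<circ> B) c"
  unfolding Lam_def
proof (rule lin_eq_on[OF lin_comp[OF lin_lin_ext lin_lin_ext] lin_lin_ext])
  fix l
  have "alt_map 2 H_inf (\<lambda>l. wnf 2 H_inf (map A l))"
    by (rule alt_pre[OF _ alt_wnf]) (simp_all add: vlin_H_inf assms)
  from alt_repr[OF op_closed_H_inf this, of "single (map B l) 1"]
  show "lin_ext (\<lambda>l. wnf 2 H_inf (map A l)) (lin_ext (\<lambda>l. wnf 2 H_inf (map B l)) (single l 1))
      = lin_ext (\<lambda>l. wnf 2 H_inf (map (A \<circ> B) l)) (single l 1)"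
    by (simp flip: wnf_def)
qed

lemma U_act_comp:
  assumes A: "level n A" and B: "level m B" and u: "u \<in> carrier U_inf"
  shows "U_act A (U_act B u) = U_act (A \<circ> B) u"
proof -
  have "invf (A \<circ> B) = invf B \<circ> invf A"
    by (rule o_inv_distrib) (use A B lev_bij in auto)
  then show ?thesis
    using U_act_in[OF B u]
    by (simp add: uval_U_act(2)[OF level_lin[OF A]] uval_U_act(2)[of "A \<circ> B"] uval_U_act(1)[OF level_lin[OF B]] u
        Lam_Lam level_lin[OF A] level_lin[OF B] lin_comp[of A B, folded comp_def])
qed

section \<open>Transvections and dilatations\<close>

text \<open>The elementary matrix that sends \<open>e a\<close> to \<open>e a + t e b\<close> and
  fixes the other basis vectors, provided that \<open>a\<close> and \<open>b\<close> differ.\<close>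

definition transv :: "nat \<Rightarrow> nat \<Rightarrow> rat \<Rightarrow> (nat \<Rightarrow>\<^sub>0 rat) \<Rightarrow> (nat \<Rightarrow>\<^sub>0 rat)" where
  "transv a b t x = x + sc (t * lookup x a) (e b)"

definition dil :: "nat \<Rightarrow> rat \<Rightarrow> (nat \<Rightarrow>\<^sub>0 rat) \<Rightarrow> (nat \<Rightarrow>\<^sub>0 rat)" where
  "dil a s x = x + sc ((s - 1) * lookup x a) (e a)"

lemma levI:
  assumes "lin A" "\<And>x. A (B x) = x" "\<And>x. B (A x) = x"
    and "\<And>x. keys x \<subseteq> {..<n} \<Longrightarrow> keys (A x) \<subseteq> {..<n}"
    and "\<And>x. keys x \<subseteq> {..<n} \<Longrightarrow> keys (B x) \<subseteq> {..<n}"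
    and "\<And>j. n \<le> j \<Longrightarrow> A (e j) = e j"
  shows "level n A"
proof -
  have "bij A" by (rule o_bij[of B]) (auto simp: assms)
  moreover have "A ` carrier (H n) = carrier (H n)"
  proof (intro subset_antisym subsetI)
    fix x assume "x \<in> carrier (H n)"
    then have "B x \<in> carrier (H n)" using assms(5) by (simp add: carrier_H)
    then show "x \<in> A ` carrier (H n)" using assms(2)[of x] by (metis imageI)
  qed (use assms(4) in \<open>auto simp: carrier_H\<close>)
  ultimately show ?thesis using assms by (simp add: level_def)
qed

lemma invf_eqI: "(\<And>x. A (B x) = x) \<Longrightarrow> (\<And>x. B (A x) = x) \<Longrightarrow> invf A = B"
  by (rule inv_equality) auto

lemma lookup_transv: "lookup (transv a b t x) k = lookup x k + (if k = b then t * lookup x a else 0)"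
  and lookup_dil: "lookup (dil a s x) k = (if k = a then s * lookup x k else lookup x k)"
  by (simp_all add: transv_def dil_def lookup_add lookup_minus lookup_e left_diff_distrib)

lemma lin_transv: "lin (transv a b t)" and lin_dil: "lin (dil a s)"
  by (rule linI; rule poly_mapping_eqI; simp add: lookup_transv lookup_dil lookup_add algebra_simps)+

lemma transv_add: "a \<noteq> b \<Longrightarrow> transv a b s (transv a b t x) = transv a b (s + t) x"
  by (rule poly_mapping_eqI) (simp add: lookup_transv algebra_simps)

lemma transv_0 [simp]: "transv a b 0 x = x"
  by (simp add: transv_def)

lemma dil_mult: "dil a s (dil a t x) = dil a (s * t) x"
  by (rule poly_mapping_eqI) (simp add: lookup_dil)

lemma dil_1 [simp]: "dil a 1 x = x"
  by (simp add: dil_def)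

lemma keys_transv: "b < n \<Longrightarrow> keys x \<subseteq> {..<n} \<Longrightarrow> keys (transv a b t x) \<subseteq> {..<n}"
  and keys_dil: "b < n \<Longrightarrow> keys x \<subseteq> {..<n} \<Longrightarrow> keys (dil b s x) \<subseteq> {..<n}"
  by (auto simp: lookup_transv lookup_dil in_keys_iff subset_iff split: if_splits)

lemma level_transv: "a < n \<Longrightarrow> b < n \<Longrightarrow> a \<noteq> b \<Longrightarrow> level n (transv a b t)"
  by (rule levI[of _ "transv a b (- t)"])
    (simp_all add: lin_transv transv_add keys_transv, simp add: transv_def lookup_e)

lemma level_dil: "a < n \<Longrightarrow> s \<noteq> 0 \<Longrightarrow> level n (dil a s)"
  by (rule levI[of _ "dil a (1 / s)"])
    (simp_all add: lin_dil dil_mult keys_dil, simp add: dil_def lookup_e)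

lemma invf_transv: "a \<noteq> b \<Longrightarrow> invf (transv a b t) = transv a b (- t)"
  by (rule invf_eqI) (simp_all add: transv_add)

lemma invf_dil: "s \<noteq> 0 \<Longrightarrow> invf (dil a s) = dil a (1 / s)"
  by (rule invf_eqI) (simp_all add: dil_mult)

text \<open>The product \<open>w(s) w(-1)\<close>, where \<open>w(s)\<close> alternates upper and
  lower transvections with parameters \<open>s\<close>, \<open>-1/s\<close>, \<open>s\<close>; each
  factor is a monomial matrix, and together they are diagonal with entries \<open>s\<close> and
  \<open>1/s\<close>.\<close>

lemma whitehead:
  assumes "a \<noteq> m" "s \<noteq> 0"
  shows "dil a s (dil m (1 / s) x) = transv m a s (transv a m (- 1 / s) (transv m a s
    (transv m a (- 1) (transv a m 1 (transv m a (- 1) x)))))"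
proof (rule poly_mapping_eqI)
  fix k
  show "lookup (dil a s (dil m (1 / s) x)) k = lookup (transv m a s (transv a m (- 1 / s)
     (transv m a s (transv m a (- 1) (transv a m 1 (transv m a (- 1) x)))))) k"
    using assms by (cases "k = a"; cases "k = m")
      (simp_all add: lookup_transv lookup_dil field_simps)
qed

section \<open>Gaussian elimination: generation by transvections and dilatations\<close>

inductive_set elem_gl :: "nat \<Rightarrow> ((nat \<Rightarrow>\<^sub>0 rat) \<Rightarrow> (nat \<Rightarrow>\<^sub>0 rat)) set" for n where
  elem_id: "(\<lambda>x. x) \<in> elem_gl n"
| elem_transv: "a < n \<Longrightarrow> b < n \<Longrightarrow> a \<noteq> b \<Longrightarrow> g \<in> elem_gl n \<Longrightarrow> (\<lambda>x. transv a b t (g x)) \<in> elem_gl n"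
| elem_dil: "a < n \<Longrightarrow> s \<noteq> 0 \<Longrightarrow> g \<in> elem_gl n \<Longrightarrow> (\<lambda>x. dil a s (g x)) \<in> elem_gl n"

lemma elem_comp: "g \<in> elem_gl n \<Longrightarrow> h \<in> elem_gl n \<Longrightarrow> (\<lambda>x. g (h x)) \<in> elem_gl n"
  by (induction g rule: elem_gl.induct) (auto intro: elem_gl.intros)

lemma elem_mono: "g \<in> elem_gl n \<Longrightarrow> n \<le> m \<Longrightarrow> g \<in> elem_gl m"
  by (induction g rule: elem_gl.induct) (auto intro: elem_gl.intros)

lemma elem_level: "g \<in> elem_gl n \<Longrightarrow> level n g"
proof (induction g rule: elem_gl.induct)
  case elem_id
  show ?case by (rule levI[of _ "\<lambda>x. x"]) (auto simp: lin_id)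
next
  case (elem_transv a b g t)
  then show ?case using level_comp[OF level_transv] by (simp add: comp_def)
next
  case (elem_dil a s g)
  then show ?case using level_comp[OF level_dil] by (simp add: comp_def)
qed

lemma elem_inv: "g \<in> elem_gl n \<Longrightarrow> \<exists>h\<in>elem_gl n. \<forall>x. h (g x) = x \<and> g (h x) = x"
proof (induction g rule: elem_gl.induct)
  case elem_id
  show ?case by (intro bexI[of _ "\<lambda>x. x"]) (simp_all add: elem_gl.elem_id)
next
  case (elem_transv a b g t)
  then obtain h where h: "h \<in> elem_gl n" "\<And>x. h (g x) = x" "\<And>x. g (h x) = x" by blast
  have "(\<lambda>x. transv a b (- t) x) \<in> elem_gl n"
    using elem_transv elem_gl.elem_transv[OF _ _ _ elem_gl.elem_id] by blast
  from elem_comp[OF h(1) this] show ?case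
    by (rule bexI[rotated]) (simp add: h transv_add elem_transv)
next
  case (elem_dil a s g)
  then obtain h where h: "h \<in> elem_gl n" "\<And>x. h (g x) = x" "\<And>x. g (h x) = x" by blast
  have "(\<lambda>x. dil a (1 / s) x) \<in> elem_gl n"
    using elem_dil elem_gl.elem_dil[OF _ _ elem_gl.elem_id] by auto
  from elem_comp[OF h(1) this] show ?case
    by (rule bexI[rotated]) (simp add: h dil_mult elem_dil)
qed

lemma elem_row: "m \<le> n \<Longrightarrow> (\<lambda>x. x + sc (\<Sum>k<m. c k * lookup x k) (e n)) \<in> elem_gl (Suc n)"
proof (induction m)
  case 0
  then show ?case by (simp add: elem_id)
next
  case (Suc m)
  then have IH: "(\<lambda>x. x + sc (\<Sum>k<m. c k * lookup x k) (e n)) \<in> elem_gl (Suc n)" by simp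
  have "(\<lambda>x. transv m n (c m) (x + sc (\<Sum>k<m. c k * lookup x k) (e n))) \<in> elem_gl (Suc n)"
    using Suc.prems by (intro elem_transv IH) auto
  also have "(\<lambda>x. transv m n (c m) (x + sc (\<Sum>k<m. c k * lookup x k) (e n)))
      = (\<lambda>x. x + sc (\<Sum>k<Suc m. c k * lookup x k) (e n))"
    using Suc.prems by (auto simp: transv_def lookup_add lookup_e sc_add_left algebra_simps fun_eq_iff)
  finally show ?case .
qed

lemma elem_col: "m \<le> n \<Longrightarrow> (\<lambda>x. x + (\<Sum>k<m. sc (c k * lookup x n) (e k))) \<in> elem_gl (Suc n)"
proof (induction m)
  case 0
  then show ?case by (simp add: elem_id)
next
  case (Suc m)
  then have IH: "(\<lambda>x. x + (\<Sum>k<m. sc (c k * lookup x n) (e k))) \<in> elem_gl (Suc n)" by simp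
  have "(\<lambda>x. transv n m (c m) (x + (\<Sum>k<m. sc (c k * lookup x n) (e k)))) \<in> elem_gl (Suc n)"
    using Suc.prems by (intro elem_transv IH) auto
  also have "(\<lambda>x. transv n m (c m) (x + (\<Sum>k<m. sc (c k * lookup x n) (e k))))
      = (\<lambda>x. x + (\<Sum>k<Suc m. sc (c k * lookup x n) (e k)))"
  proof
    fix x :: "nat \<Rightarrow>\<^sub>0 rat"
    \<comment> \<open>The vectors added so far leave coordinate \<open>n\<close> unchanged, so the
      next transvection still reads the original value.\<close>
    have "(\<Sum>k<m. c k * lookup x n * lookup (e k) n) = 0"
      by (rule sum.neutral) (use Suc.prems in \<open>auto simp: lookup_e\<close>)
    then have "lookup (x + (\<Sum>k<m. sc (c k * lookup x n) (e k))) n = lookup x n"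
      by (simp add: lookup_add lookup_sum)
    then show "transv n m (c m) (x + (\<Sum>k<m. sc (c k * lookup x n) (e k)))
      = x + (\<Sum>k<Suc m. sc (c k * lookup x n) (e k))"
      by (simp only: transv_def sum.lessThan_Suc add.assoc)
  qed
  finally show ?case .
qed

lemma keys_less_Suc: "keys x \<subseteq> {..<Suc n} \<Longrightarrow> lookup x n = 0 \<Longrightarrow> keys x \<subseteq> {..<n}"
  by (auto simp: in_keys_iff less_Suc_eq subset_iff)

text \<open>Under the hypotheses \<open>C\<close> preserves coordinate \<open>n\<close> on vectors
  supported up to \<open>n\<close>; hence both \<open>C\<close> and its inverse preserve the span of
  the earlier basis vectors.\<close>

lemma level_descend:
  assumes C: "level (Suc n) C" and n: "C (e n) = e n" and k: "\<And>k. k < n \<Longrightarrow> lookup (C (e k)) n = 0"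
  shows "level n C"
proof -
  have co: "lookup (C x) n = lookup x n" if "keys x \<subseteq> {..<Suc n}" for x
    using that k
    by (subst lin_e_expand_superset[OF level_lin[OF C] _ that])
      (auto simp: lookup_sum lookup_add n lookup_e intro!: sum.neutral)
  have *: "keys (C x) \<subseteq> {..<n}" if "keys x \<subseteq> {..<n}" for x
  proof -
    have x: "keys x \<subseteq> {..<Suc n}" using that by auto
    moreover have "lookup x n = 0" using that by (auto simp: in_keys_iff)
    ultimately show ?thesis using level_keys[OF C x] co[OF x] by (metis keys_less_Suc)
  qed
  have **: "keys (invf C x) \<subseteq> {..<n}" if "keys x \<subseteq> {..<n}" for x
  proof (rule keys_less_Suc)
    have x: "keys x \<subseteq> {..<Suc n}" using that by auto
    show ix: "keys (invf C x) \<subseteq> {..<Suc n}" by (rule level_keys[OF level_inv[OF C] x])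
    have "lookup x n = 0" using that by (auto simp: in_keys_iff)
    then show "lookup (invf C x) n = 0" using co[OF ix] inv_level(1)[OF C] by simp
  qed
  show ?thesis
  proof (rule levI[of _ "invf C"])
    show "C (e j) = e j" if "n \<le> j" for j
      using that n level_fix[OF C, of j] by (cases "j = n") auto
  qed (simp_all add: level_lin[OF C] inv_level[OF C] * **)
qed

text \<open>Elimination by induction on the rank: operations on the left turn the last column into
  \<open>e n\<close>, operations on the right clear the last row, and a block of smaller rank
  remains.\<close>

lemma level_elem: "level n A \<Longrightarrow> A \<in> elem_gl n"
proof (induction n arbitrary: A)
  case 0
  have "A = (\<lambda>x. x)"
    by (rule lin_eq_e[OF level_lin[OF 0] lin_id]) (simp add: level_fix[OF 0])
  then show ?case by (simp add: elem_id)
next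
  case (Suc n)
  let ?v = "A (e n)"
  have v: "keys ?v \<subseteq> {..<Suc n}" by (rule level_keys[OF Suc.prems]) simp
  have "?v \<noteq> 0"
  proof
    assume "?v = 0"
    then have "e n = invf A 0" using inv_level(2)[OF Suc.prems, of "e n"] by simp
    also have "\<dots> = 0" by (rule lin_0[OF level_lin[OF level_inv[OF Suc.prems]]])
    finally show False using lookup_e[of n n] by simp
  qed
  \<comment> \<open>A pivot in the last coordinate: if it vanishes, a transvection copies some
    nonzero coordinate there.\<close>
  obtain g1 where g1: "g1 \<in> elem_gl (Suc n)" "lookup (g1 ?v) n \<noteq> 0"
  proof (cases "lookup ?v n = 0")
    case True
    obtain k where k: "lookup ?v k \<noteq> 0" using \<open>?v \<noteq> 0\<close> by (metis lookup_zero poly_mapping_eqI)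
    then have "k < Suc n" using v by (auto simp: in_keys_iff)
    moreover have "k \<noteq> n" using True k by auto
    ultimately have "(\<lambda>x. transv k n 1 x) \<in> elem_gl (Suc n)"
      using elem_gl.elem_transv[OF _ _ _ elem_gl.elem_id] by simp
    moreover have "lookup (transv k n 1 ?v) n \<noteq> 0"
      using True k by (simp add: transv_def lookup_add lookup_e)
    ultimately show ?thesis using that by blast
  next
    case False
    then show ?thesis using that[OF elem_id] by simp
  qed
  let ?s = "lookup (g1 ?v) n"
  define v' where "v' = dil n (1 / ?s) (g1 ?v)"
  have g2: "(\<lambda>x. dil n (1 / ?s) (g1 x)) \<in> elem_gl (Suc n)"
    using g1 by (intro elem_dil) auto
  have v'n: "lookup v' n = 1" using g1(2) by (simp add: v'_def dil_def lookup_add lookup_e field_simps)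
  have v'k: "keys v' \<subseteq> {..<Suc n}" using level_keys[OF elem_level[OF g2] v] by (simp add: v'_def)
  \<comment> \<open>With the pivot scaled to 1, these multiples clear the rest of the
    column.\<close>
  define g3 where "g3 = (\<lambda>x. x + (\<Sum>k<n. sc (- lookup v' k * lookup x n) (e k)))"
  have g3: "g3 \<in> elem_gl (Suc n)" unfolding g3_def by (rule elem_col) simp
  have g3v: "g3 v' = e n"
  proof -
    have "v' = (\<Sum>k<Suc n. sc (lookup v' k) (e k))"
      using lin_e_expand_superset[OF lin_id _ v'k] by simp
    then have "v' = (\<Sum>k<n. sc (lookup v' k) (e k)) + e n" by (simp add: v'n)
    then have "v' - (\<Sum>k<n. sc (lookup v' k) (e k)) = e n" by (metis add_diff_cancel_left')
    then show ?thesis unfolding g3_def by (simp add: v'n sc_minus_left sum_negf)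
  qed
  define g where "g = (\<lambda>x. g3 (dil n (1 / ?s) (g1 x)))"
  have g: "g \<in> elem_gl (Suc n)" unfolding g_def by (rule elem_comp[OF g3 g2])
  define C where "C = g \<circ> A"
  have C: "level (Suc n) C" unfolding C_def by (rule level_comp[OF elem_level[OF g] Suc.prems])
  have Cn: "C (e n) = e n" using g3v by (simp add: C_def g_def v'_def)
  \<comment> \<open>Composition on the right clears the last row. Since \<open>g4\<close> fixes
    \<open>e n\<close>, the column cleared before survives.\<close>
  define g4 where "g4 = (\<lambda>x. x + sc (\<Sum>k<n. - lookup (C (e k)) n * lookup x k) (e n))"
  have g4: "g4 \<in> elem_gl (Suc n)" unfolding g4_def by (rule elem_row) simp
  have C4: "C (g4 x) = C x + sc (\<Sum>k<n. - lookup (C (e k)) n * lookup x k) (e n)" for x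
    by (simp add: g4_def lin_add[OF level_lin[OF C]] lin_sc[OF level_lin[OF C]] Cn)
  have "level n (C \<circ> g4)"
  proof (rule level_descend[OF level_comp[OF C elem_level[OF g4]]])
    show "(C \<circ> g4) (e n) = e n" by (simp add: C4 Cn lookup_e)
    fix k assume "k < n"
    have "(\<Sum>j<n. - lookup (C (e j)) n * lookup (e k) j) = (\<Sum>j<n. if k = j then - lookup (C (e j)) n else 0)"
      by (intro sum.cong) (auto simp: lookup_e)
    also have "\<dots> = - lookup (C (e k)) n" using \<open>k < n\<close> by simp
    finally have "(\<Sum>j<n. - lookup (C (e j)) n * lookup (e k) j) = - lookup (C (e k)) n" .
    then show "lookup ((C \<circ> g4) (e k)) n = 0" by (simp only: comp_apply C4 lookup_add lookup_sc lookup_e) simp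
  qed
  then have C': "C \<circ> g4 \<in> elem_gl (Suc n)" by (rule elem_mono[OF Suc.IH]) simp
  obtain h where h: "h \<in> elem_gl (Suc n)" "\<And>x. h (g x) = x" using elem_inv[OF g] by blast
  obtain h4 where h4: "h4 \<in> elem_gl (Suc n)" "\<And>x. g4 (h4 x) = x" using elem_inv[OF g4] by blast
  have "(\<lambda>x. h ((C \<circ> g4) (h4 x))) \<in> elem_gl (Suc n)"
    by (intro elem_comp[OF h(1)] elem_comp[OF C'] h4(1))
  also have "(\<lambda>x. h ((C \<circ> g4) (h4 x))) = A" by (simp add: h h4 C_def)
  finally show ?case .
qed

section \<open>Polynomial dependence on a transvection parameter\<close>

definition polyf :: "(rat \<Rightarrow> ('i \<Rightarrow>\<^sub>0 rat)) \<Rightarrow> bool" where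
  "polyf f \<longleftrightarrow> (\<exists>d w. \<forall>t. f t = (\<Sum>k\<le>d. sc (t ^ k) (w k)))"

lemma polyf_const: "polyf (\<lambda>_. c)"
  unfolding polyf_def by (intro exI[of _ 0] exI[of _ "\<lambda>_. c"]) simp

lemma polyf_add:
  assumes "polyf f" "polyf g"
  shows "polyf (\<lambda>t. f t + g t)"
proof -
  \<comment> \<open>Padding by zero coefficients lets both polynomials be written up to a common
    degree.\<close>
  have pad: "\<exists>w. \<forall>D\<ge>d. \<forall>t. h t = (\<Sum>k\<le>D. sc (t ^ k) (w k))"
    if "\<forall>t. h t = (\<Sum>k\<le>d. sc (t ^ k) (v k))" for h :: "rat \<Rightarrow> ('a \<Rightarrow>\<^sub>0 rat)" and d v
  proof (intro exI[of _ "\<lambda>k. if k \<le> d then v k else 0"] allI impI)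
    fix D t assume "d \<le> D"
    have "h t = (\<Sum>k\<le>d. sc (t ^ k) (v k))" using that by simp
    also have "\<dots> = (\<Sum>k\<le>D. sc (t ^ k) (if k \<le> d then v k else 0))"
      using \<open>d \<le> D\<close> by (intro sum.mono_neutral_cong_left) auto
    finally show "h t = (\<Sum>k\<le>D. sc (t ^ k) (if k \<le> d then v k else 0))" .
  qed
  obtain d1 v1 where f: "\<forall>t. f t = (\<Sum>k\<le>d1. sc (t ^ k) (v1 k))"
    using assms(1) unfolding polyf_def by (elim exE)
  obtain d2 v2 where g: "\<forall>t. g t = (\<Sum>k\<le>d2. sc (t ^ k) (v2 k))"
    using assms(2) unfolding polyf_def by (elim exE)
  obtain w1 where w1: "\<forall>D\<ge>d1. \<forall>t. f t = (\<Sum>k\<le>D. sc (t ^ k) (w1 k))"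
    using pad[OF f] by (elim exE)
  obtain w2 where w2: "\<forall>D\<ge>d2. \<forall>t. g t = (\<Sum>k\<le>D. sc (t ^ k) (w2 k))"
    using pad[OF g] by (elim exE)
  have "f t + g t = (\<Sum>k\<le>max d1 d2. sc (t ^ k) (w1 k + w2 k))" for t
    using w1[rule_format, of "max d1 d2" t] w2[rule_format, of "max d1 d2" t]
    by (simp add: sc_add_right sum.distrib)
  then show ?thesis unfolding polyf_def by (intro exI allI)
qed

lemma polyf_sc:
  assumes "polyf f"
  shows "polyf (\<lambda>t. sc c (f t))"
proof -
  obtain d w where w: "\<And>t. f t = (\<Sum>k\<le>d. sc (t ^ k) (w k))" using assms unfolding polyf_def by (elim exE) auto
  have "sc c (f t) = (\<Sum>k\<le>d. sc (t ^ k) (sc c (w k)))" for t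
    by (simp add: w sc_sum_right mult.commute)
  then show ?thesis by (auto simp: polyf_def intro!: exI[of _ d] exI[of _ "\<lambda>k. sc c (w k)"])
qed

lemma polyf_times:
  assumes "polyf f"
  shows "polyf (\<lambda>t. sc t (f t))"
proof -
  obtain d w where w: "\<And>t. f t = (\<Sum>k\<le>d. sc (t ^ k) (w k))" using assms unfolding polyf_def by (elim exE) auto
  have "sc t (f t) = (\<Sum>k\<le>Suc d. sc (t ^ k) (case k of 0 \<Rightarrow> 0 | Suc k \<Rightarrow> w k))" for t
    by (subst sum.atMost_Suc_shift) (simp add: w sc_sum_right)
  then show ?thesis unfolding polyf_def by (intro exI allI)
qed

lemma polyf_sum: "(\<And>i. i \<in> I \<Longrightarrow> polyf (f i)) \<Longrightarrow> polyf (\<lambda>t. \<Sum>i\<in>I. f i t)"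
  by (induction I rule: infinite_finite_induct) (auto simp: polyf_const polyf_add)

text \<open>Vandermonde: passing from \<open>p(n)\<close> to \<open>2\<^sup>d p(n) - p(2 n)\<close> lowers the degree \<open>d\<close> of \<open>p\<close>.\<close>

lemma polyf_stable:
  assumes N: "subsp N" and f: "polyf f" and "\<And>n :: nat. f (of_nat n) \<in> N"
  shows "f t \<in> N"
proof -
  have *: "\<forall>k\<le>d. w k \<in> N"
    if "\<And>n :: nat. (\<Sum>k\<le>d. sc (of_nat n ^ k) (w k)) \<in> N" for d and w :: "nat \<Rightarrow> 'a \<Rightarrow>\<^sub>0 rat"
    using that
  proof (induction d arbitrary: w)
    case 0
    from 0[of 0] show ?case by simp
  next
    case (Suc d)
    \<comment> \<open>This factor vanishes at \<open>k = Suc d\<close> and at no smaller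
      \<open>k\<close>, so the leading term disappears and the others can be recovered by
      division.\<close>
    let ?c = "\<lambda>k. 2 ^ Suc d - 2 ^ k :: rat"
    have "(\<Sum>k\<le>d. sc (of_nat n ^ k) (sc (?c k) (w k))) \<in> N" for n :: nat
    proof -
      have "sc (2 ^ Suc d) (\<Sum>k\<le>Suc d. sc (of_nat n ^ k) (w k))
          - (\<Sum>k\<le>Suc d. sc (of_nat (2 * n) ^ k) (w k)) \<in> N"
        by (intro subsp_diff[OF N] subsp_sc[OF N] Suc.prems)
      also have "sc (2 ^ Suc d) (\<Sum>k\<le>Suc d. sc (of_nat n ^ k) (w k))
          - (\<Sum>k\<le>Suc d. sc (of_nat (2 * n) ^ k) (w k))
          = (\<Sum>k\<le>Suc d. sc (2 ^ Suc d) (sc (of_nat n ^ k) (w k)) - sc (of_nat (2 * n) ^ k) (w k))"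
        by (simp only: sc_sum_right sum_subtractf)
      also have "\<dots> = (\<Sum>k\<le>Suc d. sc (of_nat n ^ k) (sc (?c k) (w k)))"
        by (intro sum.cong refl) (simp add: power_mult_distrib right_diff_distrib mult.commute flip: sc_diff_left)
      also have "\<dots> = (\<Sum>k\<le>d. sc (of_nat n ^ k) (sc (?c k) (w k)))" by simp
      finally show ?thesis .
    qed
    from Suc.IH[OF this] have cN: "sc (?c k) (w k) \<in> N" if "k \<le> d" for k using that by blast
    have low: "w k \<in> N" if "k \<le> d" for k
    proof -
      have "(2::rat) ^ k < 2 ^ Suc d" by (rule power_strict_increasing) (use that in auto)
      then have "w k = sc (1 / ?c k) (sc (?c k) (w k))" by simp
      then show ?thesis using subsp_sc[OF N cN[OF that], of "1 / ?c k"] by simp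
    qed
    \<comment> \<open>The value at 1 is the sum of all coefficients; subtracting the lower ones
      isolates the leading one.\<close>
    have "(\<Sum>k\<le>Suc d. w k) - (\<Sum>k\<le>d. w k) \<in> N"
    proof (rule subsp_diff[OF N _ subsp_sum[OF N]])
      show "(\<Sum>k\<le>Suc d. w k) \<in> N" using Suc.prems[of 1] by simp
    qed (use low in auto)
    then have "w (Suc d) \<in> N" by simp
    then show ?case using low by (auto simp: le_Suc_eq)
  qed
  obtain d w where w: "\<And>t. f t = (\<Sum>k\<le>d. sc (t ^ k) (w k))" using f unfolding polyf_def by (elim exE) auto
  have "\<forall>k\<le>d. w k \<in> N" by (rule *) (use assms(3) w in simp)
  then show ?thesis unfolding w by (intro subsp_sum[OF N] subsp_sc[OF N]) auto
qed

section \<open>Polynomial dependence on the parameter for \<open>U_inf\<close> and its exterior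
  powers\<close>

abbreviation wnfH where "wnfH \<equiv> wnf 2 H_inf"

lemma wnfH_bilinear:
  "wnfH [x + x', y] = wnfH [x, y] + wnfH [x', y]" "wnfH [x, y + y'] = wnfH [x, y] + wnfH [x, y']"
  "wnfH [sc a x, y] = sc a (wnfH [x, y])" "wnfH [x, sc a y] = sc a (wnfH [x, y])" "wnfH [x, x] = 0"
  using alt_add[OF alt_wnf[OF op_closed_H_inf], of "[]" x "[y]" 2 x']
    alt_add[OF alt_wnf[OF op_closed_H_inf], of "[x]" y "[]" 2 y']
    alt_smult[OF alt_wnf[OF op_closed_H_inf], of "[]" x "[y]" 2 a]
    alt_smult[OF alt_wnf[OF op_closed_H_inf], of "[x]" y "[]" 2 a]
    alt_adj[OF alt_wnf[OF op_closed_H_inf], of "[]" x "[]" 2]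
  by (simp_all add: lists_in_H_inf)

lemma lists_in_2E: "l \<in> lists_in 2 V \<Longrightarrow> \<exists>y\<in>carrier V. \<exists>z\<in>carrier V. l = [y, z]"
  by (auto simp: lists_in_def numeral_2_eq_2 length_Suc_conv)

text \<open>With the transvection \<open>1 + t E\<close>, the argument is moved by
  \<open>1 - t E\<close>, and the exterior square is affine in \<open>t\<close>; the composite is
  thus quadratic in \<open>t\<close>. The nested form suits \<open>polyf_times\<close>.\<close>

lemma transv_U_act:
  assumes ab: "a \<noteq> b" and u: "u \<in> carrier U_inf"
  obtains u1 u2 where "u1 \<in> carrier U_inf" "u2 \<in> carrier U_inf"
    "\<And>t. U_act (transv a b t) u = u \<oplus>\<^bsub>U_inf\<^esub> t \<odot>\<^bsub>U_inf\<^esub> (u1 \<oplus>\<^bsub>U_inf\<^esub> t \<odot>\<^bsub>U_inf\<^esub> u2)"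
proof -
  define E where "E = (\<lambda>x :: nat \<Rightarrow>\<^sub>0 rat. sc (lookup x a) (e b))"
  \<comment> \<open>The derivation of the exterior square induced by \<open>E\<close>, that is, the
    coefficient of \<open>t\<close>.\<close>
  define Dn where "Dn = lin_ext (\<lambda>l. wnfH [E (l ! 0), l ! 1] + wnfH [l ! 0, E (l ! 1)])"
  have linE: "lin E" by (rule linI) (simp_all add: E_def lookup_add sc_add_left)
  have linD: "lin Dn" by (simp add: Dn_def)
  have T: "transv a b t x = x + sc t (E x)" for t x by (simp add: transv_def E_def)
  have Lam: "Lam (transv a b t) c = nf R2 c + sc t (Dn c)" if kc: "keys c \<subseteq> lists_in 2 H_inf" for c t
  proof (rule lin_eq_on[OF lin_Lam lin_plus[OF lin_nf[OF subsp_R] lin_scale[OF linD]]])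
    fix l assume "l \<in> keys c"
    then obtain y z where l: "l = [y, z]" using kc lists_in_2E[of l H_inf] by blast
    \<comment> \<open>\<open>E\<close> has rank one, so both entries are multiples of
      \<open>e b\<close> and the term in \<open>t\<close> squared drops out.\<close>
    have "wnfH [E y, E z] = 0" by (simp add: E_def wnfH_bilinear)
    then show "Lam (transv a b t) (single l 1) = nf R2 (single l 1) + sc t (Dn (single l 1))"
      by (simp add: Lam_def Dn_def T l wnfH_bilinear sc_add_right flip: wnf_def)
  qed
  have keysD: "keys (Dn c) \<subseteq> lists_in 2 H_inf" if "keys c \<subseteq> lists_in 2 H_inf" for c
  proof -
    have "Dn c \<in> {c. keys c \<subseteq> lists_in 2 H_inf}"
      unfolding Dn_def
    proof (rule lin_ext_in[OF subsp_keys], rule subsp_add[OF subsp_keys])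
      show "wnfH [E (l ! 0), l ! 1] \<in> {c. keys c \<subseteq> lists_in 2 H_inf}" for l
        using keys_wnf[of H_inf "[E (l ! 0), l ! 1]" 2] by (simp add: lists_in_H_inf)
      show "wnfH [l ! 0, E (l ! 1)] \<in> {c. keys c \<subseteq> lists_in 2 H_inf}" for l
        using keys_wnf[of H_inf "[l ! 0, E (l ! 1)]" 2] by (simp add: lists_in_H_inf)
    qed
    then show ?thesis by simp
  qed
  have nfD: "nf R2 (Dn c) = Dn c" for c
    by (rule lin_eq_on[OF lin_comp[OF lin_nf[OF subsp_R] linD] linD])
      (simp add: Dn_def lin_add[OF lin_nf[OF subsp_R]] nf_wnf)
  note uval = lin_uval[OF u] keys_uval[OF u] nf_uval[OF u]
  \<comment> \<open>The coefficients of \<open>t\<close> and of \<open>t\<close> squared in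
    \<open>(1 + t Dn) u (1 - t E)\<close>.\<close>
  define h1 where "h1 = (\<lambda>x. Dn (uval u x) - uval u (E x))"
  define h2 where "h2 = (\<lambda>x. - Dn (uval u (E x)))"
  have fin: "finite ({j. uval u (e j) \<noteq> 0} \<union> {a})" using uval_finite[OF u] by simp
  have u1: "(\<lambda>x. cst R2 (h1 x)) \<in> carrier U_inf"
  proof (rule U_I)
    show "lin h1" unfolding h1_def by (intro lin_minus_fun lin_comp[OF linD] uval lin_comp[OF uval(1) linE])
    show "keys (h1 x) \<subseteq> lists_in 2 H_inf" for x
      using subsp_diff[OF subsp_keys, of "Dn (uval u x)" "lists_in 2 H_inf" "uval u (E x)"] keysD[OF uval(2)] uval(2)
      by (simp add: h1_def)
    show "finite {j. h1 (e j) \<noteq> 0}"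
      by (rule finite_subset[OF _ fin]) (auto simp: h1_def E_def lookup_e lin_0[OF linD] lin_0[OF uval(1)] split: if_splits)
  qed
  have u2: "(\<lambda>x. cst R2 (h2 x)) \<in> carrier U_inf"
  proof (rule U_I)
    have "lin (\<lambda>x. sc (- 1) (Dn (uval u (E x))))"
      by (intro lin_scale lin_comp[OF linD] lin_comp[OF uval(1) linE])
    then show "lin h2" unfolding h2_def by (simp add: sc_minus_left)
    show "keys (h2 x) \<subseteq> lists_in 2 H_inf" for x
      using keysD[OF uval(2)] by (simp add: h2_def)
    show "finite {j. h2 (e j) \<noteq> 0}"
      by (rule finite_subset[OF _ fin]) (auto simp: h2_def E_def lookup_e lin_0[OF linD] lin_0[OF uval(1)] split: if_splits)
  qed
  have uu1: "uval (\<lambda>x. cst R2 (h1 x)) x = h1 x" for x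
    by (simp add: uval_def h1_def lin_diff[OF lin_nf[OF subsp_R]] nfD) (simp add: uval(3)[unfolded uval_def])
  have uu2: "uval (\<lambda>x. cst R2 (h2 x)) x = h2 x" for x
    by (simp add: uval_def h2_def lin_minus[OF lin_nf[OF subsp_R]] nfD)
  show ?thesis
  proof (rule that[OF u1 u2])
    fix t
    let ?u12 = "(\<lambda>x. cst R2 (h1 x)) \<oplus>\<^bsub>U_inf\<^esub> t \<odot>\<^bsub>U_inf\<^esub> (\<lambda>x. cst R2 (h2 x))"
    have level: "level (Suc (max a b)) (transv a b t)" by (rule level_transv) (use ab in auto)
    have u12: "?u12 \<in> carrier U_inf" by (intro op_closed_add op_closed_smult u1 u2 op_closed_U)
    have "u \<oplus>\<^bsub>U_inf\<^esub> t \<odot>\<^bsub>U_inf\<^esub> ?u12 \<in> carrier U_inf"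
      by (intro op_closed_add op_closed_smult u u12 op_closed_U)
    then show "U_act (transv a b t) u = u \<oplus>\<^bsub>U_inf\<^esub> t \<odot>\<^bsub>U_inf\<^esub> ?u12"
    proof (rule U_eqI[OF U_act_in[OF level u]])
      fix j
      have "uval (u \<oplus>\<^bsub>U_inf\<^esub> t \<odot>\<^bsub>U_inf\<^esub> ?u12) (e j) = uval u (e j) + sc t (h1 (e j) + sc t (h2 (e j)))"
        using u u1 u2 u12 by (simp add: uval_add uval_smult uu1 uu2 op_closed_smult)
      moreover have "uval (U_act (transv a b t) u) (e j)
          = Lam (transv a b t) (uval u (e j) - sc t (uval u (E (e j))))"
        by (simp add: uval_U_act(1)[OF lin_transv u] invf_transv[OF ab] T lin_add[OF uval(1)] lin_diff[OF uval(1)] lin_sc[OF uval(1)]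
            sc_minus_left)
      moreover have "\<dots> = uval u (e j) + sc t (h1 (e j) + sc t (h2 (e j)))"
        by (simp add: lin_diff[OF lin_Lam] lin_sc[OF lin_Lam] Lam uval(2,3) h1_def h2_def
            sc_add_right sc_diff_right sc_minus_right algebra_simps)
      ultimately show "uval (U_act (transv a b t) u) (e j) = uval (u \<oplus>\<^bsub>U_inf\<^esub> t \<odot>\<^bsub>U_inf\<^esub> ?u12) (e j)"
        by simp
    qed
  qed
qed

abbreviation wnfU where "wnfU i \<equiv> wnf i U_inf"

text \<open>Its values are normal forms, so that it depends only on the class of its argument when
  \<open>A\<close> lies in \<open>GL_inf\<close>.\<close>

definition ext_act :: "nat \<Rightarrow> ((nat \<Rightarrow>\<^sub>0 rat) \<Rightarrow> (nat \<Rightarrow>\<^sub>0 rat)) \<Rightarrow> (U_elt list \<Rightarrow>\<^sub>0 rat) \<Rightarrow> (U_elt list \<Rightarrow>\<^sub>0 rat)" where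
  "ext_act i A = lin_ext (\<lambda>l. wnfU i (map (U_act A) l))"

text \<open>Multilinearity expands the wedge entry by entry, and each entry is quadratic in the
  parameter.\<close>

lemma polyf_ext_act:
  assumes ab: "a \<noteq> b" and c: "keys c \<subseteq> lists_in i U_inf"
  shows "polyf (\<lambda>t. ext_act i (transv a b t) c)"
proof -
  \<comment> \<open>The prefix \<open>pre\<close> collects the constant coefficients of the entries
    that have already been expanded.\<close>
  have *: "polyf (\<lambda>t. wnfU i (pre @ map (U_act (transv a b t)) l))" if "pre @ l \<in> lists_in i U_inf" for pre l
    using that
  proof (induction l arbitrary: pre)
    case Nil
    show ?case by (simp add: polyf_const)
  next
    case (Cons u l)
    have u: "u \<in> carrier U_inf" using Cons.prems by (simp add: lists_in_def)
    obtain u1 u2 where u12: "u1 \<in> carrier U_inf" "u2 \<in> carrier U_inf"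
      and act: "\<And>t. U_act (transv a b t) u = u \<oplus>\<^bsub>U_inf\<^esub> t \<odot>\<^bsub>U_inf\<^esub> (u1 \<oplus>\<^bsub>U_inf\<^esub> t \<odot>\<^bsub>U_inf\<^esub> u2)"
      using transv_U_act[OF ab u] by blast
    have lists_in: "pre @ v # map (U_act (transv a b t)) l \<in> lists_in i U_inf" if "v \<in> carrier U_inf" for v t
    proof -
      have "level (Suc (max a b)) (transv a b t)" by (rule level_transv) (use ab in auto)
      then show ?thesis using Cons.prems that U_act_in by (auto simp: lists_in_def)
    qed
    note alt = alt_wnf[OF op_closed_U, of i]
    have "wnfU i (pre @ map (U_act (transv a b t)) (u # l))
        = wnfU i ((pre @ [u]) @ map (U_act (transv a b t)) l)
          + sc t (wnfU i ((pre @ [u1]) @ map (U_act (transv a b t)) l)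
            + sc t (wnfU i ((pre @ [u2]) @ map (U_act (transv a b t)) l)))" for t
      using u u12 by (simp add: act alt_add[OF alt lists_in] alt_smult[OF alt lists_in] op_closed_add op_closed_smult)
    moreover have "(pre @ [v]) @ l \<in> lists_in i U_inf" if "v \<in> carrier U_inf" for v
      using Cons.prems that by (auto simp: lists_in_def)
    ultimately show ?case
      using u u12 by (simp only:) (intro polyf_add polyf_times Cons.IH)
  qed
  have "polyf (\<lambda>t. \<Sum>l\<in>keys c. sc (lookup c l) (wnfU i (map (U_act (transv a b t)) l)))"
    using *[of "[]"] c by (intro polyf_sum polyf_sc) auto
  then show ?thesis by (simp add: ext_act_def lin_ext_sc)
qed

lemma subsp_RU [simp]: "subsp (ext_rel i U_inf)"
  by (rule ext_rel_subsp) simp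

lemma ext_act_comp:
  assumes A: "level n A" and B: "level m B" and c: "keys c \<subseteq> lists_in i U_inf"
  shows "ext_act i A (ext_act i B c) = ext_act i (A \<circ> B) c"
  unfolding ext_act_def
proof (rule lin_eq_on[OF lin_comp[OF lin_lin_ext lin_lin_ext] lin_lin_ext])
  fix l assume "l \<in> keys c"
  then have l: "set l \<subseteq> carrier U_inf" using c by (auto simp: lists_in_def)
  have "alt_map i U_inf (\<lambda>l. wnfU i (map (U_act A) l))"
    by (rule alt_pre[OF U_act_vlin[OF A] alt_wnf[OF op_closed_U]])
  from alt_repr[OF op_closed_U this, of "single (map (U_act B) l) 1"]
  have "lin_ext (\<lambda>l. wnfU i (map (U_act A) l)) (wnfU i (map (U_act B) l))
      = wnfU i (map (U_act A) (map (U_act B) l))"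
    by (simp flip: wnf_def)
  also have "map (U_act A) (map (U_act B) l) = map (U_act (A \<circ> B)) l"
    using l U_act_comp[OF A B] by auto
  finally show "lin_ext (\<lambda>l. wnfU i (map (U_act A) l)) (lin_ext (\<lambda>l. wnfU i (map (U_act B) l)) (single l 1))
      = lin_ext (\<lambda>l. wnfU i (map (U_act (A \<circ> B)) l)) (single l 1)"
    by simp
qed

lemma ext_act_nf:
  assumes A: "level n A"
  shows "ext_act i A (nf (ext_rel i U_inf) c) = ext_act i A c"
  unfolding ext_act_def
  by (rule alt_repr[OF op_closed_U alt_pre[OF U_act_vlin[OF A] alt_wnf[OF op_closed_U]]])

lemma ext_act_trivial:
  assumes "\<And>l u. l \<in> keys c \<Longrightarrow> u \<in> set l \<Longrightarrow> U_act A u = u"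
  shows "ext_act i A c = nf (ext_rel i U_inf) c"
  unfolding ext_act_def
proof (rule lin_eq_on[OF lin_lin_ext lin_nf[OF subsp_RU]])
  fix l assume "l \<in> keys c"
  then have "map (U_act A) l = l" using assms by (simp add: map_idI)
  then show "lin_ext (\<lambda>l. wnfU i (map (U_act A) l)) (single l 1) = nf (ext_rel i U_inf) (single l 1)"
    by (simp add: wnf_def)
qed

lemma U_act_id: "u \<in> carrier U_inf \<Longrightarrow> U_act (\<lambda>x. x) u = u"
proof -
  assume u: "u \<in> carrier U_inf"
  have "invf (\<lambda>x :: nat \<Rightarrow>\<^sub>0 rat. x) = (\<lambda>x. x)" by (rule invf_eqI) auto
  moreover have "Lam (\<lambda>x. x) c = nf R2 c" for c
    by (rule lin_eq_on[OF lin_Lam lin_nf[OF subsp_R]]) (simp add: Lam_def wnf_def)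
  moreover have "(\<lambda>x. cst R2 (uval u x)) = u" by (intro ext) (rule uval_cst[OF u, symmetric])
  ultimately show ?thesis by (simp add: uval_U_act(2)[OF lin_id u] cst_nf)
qed

text \<open>The index \<open>m\<close> is absent both from the arguments where \<open>u\<close> is
  nonzero and from all vectors in its values, so the dilatation acts trivially on either
  side.\<close>

lemma U_act_dil_fresh:
  assumes u: "u \<in> carrier U_inf" and s: "s \<noteq> 0"
    and m1: "uval u (e m) = 0"
    and m2: "\<And>j l x. l \<in> keys (uval u (e j)) \<Longrightarrow> x \<in> set l \<Longrightarrow> lookup x m = 0"
  shows "U_act (dil m s) u = u"
proof (rule U_eqI)
  have level: "level (Suc m) (dil m s)" using s by (intro level_dil) auto
  show "U_act (dil m s) u \<in> carrier U_inf" "u \<in> carrier U_inf" using U_act_in[OF level u] u by auto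
  fix j
  have "uval u (dil m (1 / s) (e j)) = uval u (e j)"
    using m1 by (simp add: dil_def lookup_e lin_add[OF lin_uval[OF u]] lin_sc[OF lin_uval[OF u]])
  then have "uval (U_act (dil m s) u) (e j) = Lam (dil m s) (uval u (e j))"
    by (simp add: uval_U_act(1)[OF lin_dil u] invf_dil[OF s])
  also have "\<dots> = nf R2 (uval u (e j))"
  proof (rule lin_eq_on[OF lin_Lam lin_nf[OF subsp_R]])
    fix l assume "l \<in> keys (uval u (e j))"
    then have "map (dil m s) l = l" using m2 by (auto intro!: map_idI simp: dil_def)
    then show "Lam (dil m s) (single l 1) = nf R2 (single l 1)" by (simp add: Lam_def wnf_def)
  qed
  finally show "uval (U_act (dil m s) u) (e j) = uval u (e j)" by (simp add: nf_uval[OF u])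
qed

text \<open>Finitely many arguments have nonzero value, each value is a finite combination of lists,
  and each vector in them has finite support.\<close>

lemma U_fresh:
  assumes u: "u \<in> carrier U_inf"
  shows "finite {m. uval u (e m) \<noteq> 0 \<or> (\<exists>j. \<exists>l\<in>keys (uval u (e j)). \<exists>x\<in>set l. lookup x m \<noteq> 0)}"
proof (rule finite_subset)
  let ?S = "{j. uval u (e j) \<noteq> 0}"
  show "{m. uval u (e m) \<noteq> 0 \<or> (\<exists>j. \<exists>l\<in>keys (uval u (e j)). \<exists>x\<in>set l. lookup x m \<noteq> 0)}
      \<subseteq> ?S \<union> (\<Union>j\<in>?S. \<Union>l\<in>keys (uval u (e j)). \<Union>x\<in>set l. keys x)"
    by (auto simp: in_keys_iff) (metis in_keys_iff lookup_zero)+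
  show "finite (?S \<union> (\<Union>j\<in>?S. \<Union>l\<in>keys (uval u (e j)). \<Union>x\<in>set l. keys x))"
    using uval_finite[OF u] by auto
qed

text \<open>A dilatation at \<open>a\<close> is made unimodular by a compensating dilatation at a fresh index,
  which acts trivially on a given vector; hence transvections suffice.\<close>

theorem GL_stable:
  assumes N: "subsp N" "ext_rel i U_inf \<subseteq> N" "N \<subseteq> {c. keys c \<subseteq> lists_in i U_inf}"
    and T: "\<And>a b c. a \<noteq> b \<Longrightarrow> c \<in> N \<Longrightarrow> ext_act i (transv a b 1) c \<in> N"
    and A: "A \<in> GL_inf" and c: "c \<in> N"
  shows "ext_act i A c \<in> N"
proof -
  have keysN: "keys c \<subseteq> lists_in i U_inf" if "c \<in> N" for c using N(3) that by auto
  have nfN: "nf (ext_rel i U_inf) c \<in> N" if "c \<in> N" for c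
    using subsp_add[OF N(1) _ that, of "nf (ext_rel i U_inf) c - c"] nf_diff_in[OF subsp_RU, of i c] N(2)
    by auto
  have id: "ext_act i (\<lambda>x. x) c \<in> N" if "c \<in> N" for c
  proof (subst ext_act_trivial)
    fix l u assume "l \<in> keys c" "u \<in> set l"
    then have "u \<in> carrier U_inf" using keysN[OF that] by (auto simp: lists_in_def)
    then show "U_act (\<lambda>x. x) u = u" by (rule U_act_id)
  qed (rule nfN[OF that])
  have level: "level (Suc (max a b)) (transv a b t)" if "a \<noteq> b" for a b t
    by (rule level_transv) (use that in auto)
  \<comment> \<open>Iterating parameter 1 gives all natural parameters, because parameters of
    transvections add.\<close>
  have nat: "ext_act i (transv a b (of_nat n)) c \<in> N" if "a \<noteq> b" "c \<in> N" for a b n c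
  proof (induction n)
    case 0
    have "transv a b (of_nat 0) = (\<lambda>x. x)" by (simp add: fun_eq_iff)
    then show ?case using id[OF that(2)] by simp
  next
    case (Suc n)
    have "transv a b (of_nat (Suc n)) = transv a b 1 \<circ> transv a b (of_nat n)"
      using that(1) by (simp add: fun_eq_iff transv_add)
    then show ?case
      using T[OF that(1) Suc] ext_act_comp[OF level level keysN[OF that(2)]] that(1) by metis
  qed
  \<comment> \<open>Polynomial dependence extends stability from natural to rational
    parameters.\<close>
  have utrace: "ext_act i (transv a b t) c \<in> N" if "a \<noteq> b" "c \<in> N" for a b t c
    by (rule polyf_stable[OF N(1) polyf_ext_act[OF that(1) keysN[OF that(2)]] nat[OF that]])
  have cm: "ext_act i (\<lambda>x. A (B x)) c \<in> N"
    if "\<And>c. c \<in> N \<Longrightarrow> ext_act i A c \<in> N" "ext_act i B c \<in> N" "level n A" "level m B" "c \<in> N" for A B c n m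
    using that(1)[OF that(2)] ext_act_comp[OF that(3,4) keysN[OF that(5)]] by (simp add: comp_def)
  have di: "ext_act i (dil a s) c \<in> N" if s: "s \<noteq> 0" and c: "c \<in> N" for a s c
  proof -
    \<comment> \<open>The indices that occur anywhere in \<open>c\<close>; a fresh \<open>m\<close>
      is taken outside them and different from \<open>a\<close>.\<close>
    have "finite ({a} \<union> (\<Union>l\<in>keys c. \<Union>u\<in>set l. {m. uval u (e m) \<noteq> 0 \<or>
        (\<exists>j. \<exists>l\<in>keys (uval u (e j)). \<exists>x\<in>set l. lookup x m \<noteq> 0)}))"
      by (intro finite_UnI finite_UN_I finite_set U_fresh) (use keysN[OF c] in \<open>auto simp: lists_in_def\<close>)
    then obtain m where m: "m \<notin> {a} \<union> (\<Union>l\<in>keys c. \<Union>u\<in>set l. {m. uval u (e m) \<noteq> 0 \<or>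
        (\<exists>j. \<exists>l\<in>keys (uval u (e j)). \<exists>x\<in>set l. lookup x m \<noteq> 0)})"
      using ex_new_if_finite[OF infinite_UNIV_nat] by blast
    then have am: "a \<noteq> m" by auto
    have triv: "U_act (dil m (1 / s)) u = u" if "l \<in> keys c" "u \<in> set l" for l u
      by (rule U_act_dil_fresh) (use that m s keysN[OF c] in \<open>auto simp: lists_in_def\<close>)
    \<comment> \<open>The factorization from \<open>whitehead\<close>, whose six factors are peeled
      off one at a time.\<close>
    let ?W = "\<lambda>x. transv m a s (transv a m (- 1 / s) (transv m a s
      (transv m a (- 1) (transv a m 1 (transv m a (- 1) x)))))"
    have l: "level (Suc (max a m)) (transv a m t)" "level (Suc (max a m)) (transv m a t)" for t
      using am by (auto intro!: level_transv)
    note lc = level_comp[unfolded comp_def]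
    have W: "ext_act i ?W c \<in> N"
      by (rule cm[OF utrace _ l(2) lc[OF l(1) lc[OF l(2) lc[OF l(2) lc[OF l(1) l(2)]]]] c],
          use am in simp, assumption,
          rule cm[OF utrace _ l(1) lc[OF l(2) lc[OF l(2) lc[OF l(1) l(2)]]] c], use am in simp, assumption,
          rule cm[OF utrace _ l(2) lc[OF l(2) lc[OF l(1) l(2)]] c], use am in simp, assumption,
          rule cm[OF utrace _ l(2) lc[OF l(1) l(2)] c], use am in simp, assumption,
          rule cm[OF utrace _ l(1) l(2) c], use am in simp, assumption, rule utrace[OF _ c], use am in simp)
    have ld: "level (Suc a) (dil a s)" "level (Suc m) (dil m (1 / s))" using s by (auto intro!: level_dil)
    have "?W = dil a s \<circ> dil m (1 / s)"
      by (rule ext) (simp only: whitehead[OF am s] comp_apply)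
    then have "ext_act i ?W c = ext_act i (dil a s \<circ> dil m (1 / s)) c" by simp
    also have "\<dots> = ext_act i (dil a s) (ext_act i (dil m (1 / s)) c)"
      by (rule ext_act_comp[OF ld keysN[OF c], symmetric])
    also have "\<dots> = ext_act i (dil a s) c"
      by (simp add: ext_act_trivial triv ext_act_nf[OF ld(1)])
    finally show ?thesis using W by simp
  qed
  obtain n where n: "level n A" using A by (auto simp: GL_inf_level)
  have "A \<in> elem_gl n \<Longrightarrow> ext_act i A c \<in> N"
  proof (induction A rule: elem_gl.induct)
    case elem_id
    show ?case by (rule id[OF c])
  next
    case (elem_transv a b g t)
    then show ?case
      by (intro cm[OF utrace _ level_transv[of a n b] elem_level[of g n] c]) auto
  next
    case (elem_dil a s g)
    then show ?case
      by (intro cm[OF di _ level_dil[of a n] elem_level[of g n] c]) auto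
  qed
  then show ?thesis using level_elem[OF n] by simp
qed

section \<open>The contraction\<close>

lemma alt_sum:
  assumes "\<And>i. i \<in> I \<Longrightarrow> alt_map k V (f i)"
  shows "alt_map k V (\<lambda>l. \<Sum>i\<in>I. sc (c i) (f i l))"
  unfolding alt_map_def
proof (intro conjI allI impI)
  fix l1 l2 x y assume *: "l1 @ x # l2 \<in> lists_in k V \<and> y \<in> carrier V"
  have "(\<Sum>i\<in>I. sc (c i) (f i (l1 @ (x \<oplus>\<^bsub>V\<^esub> y) # l2)))
      = (\<Sum>i\<in>I. sc (c i) (f i (l1 @ x # l2)) + sc (c i) (f i (l1 @ y # l2)))"
    using * by (intro sum.cong refl) (simp add: alt_add[OF assms] sc_add_right)
  then show "(\<Sum>i\<in>I. sc (c i) (f i (l1 @ (x \<oplus>\<^bsub>V\<^esub> y) # l2)))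
      = (\<Sum>i\<in>I. sc (c i) (f i (l1 @ x # l2))) + (\<Sum>i\<in>I. sc (c i) (f i (l1 @ y # l2)))"
    by (simp add: sum.distrib)
next
  fix l1 l2 x a assume "l1 @ x # l2 \<in> lists_in k V"
  then show "(\<Sum>i\<in>I. sc (c i) (f i (l1 @ (a \<odot>\<^bsub>V\<^esub> x) # l2))) = sc a (\<Sum>i\<in>I. sc (c i) (f i (l1 @ x # l2)))"
    unfolding sc_sum_right by (intro sum.cong refl) (simp add: alt_smult[OF assms] mult.commute)
next
  fix l1 l2 x assume "l1 @ x # x # l2 \<in> lists_in k V"
  then show "(\<Sum>i\<in>I. sc (c i) (f i (l1 @ x # x # l2))) = 0"
    by (intro sum.neutral) (simp add: alt_adj[OF assms])
qed

lemma alt_prefix: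
  assumes f: "alt_map k V f" and l: "length l + k' = k" "set l \<subseteq> carrier V"
  shows "alt_map k' V (\<lambda>\<beta>. f (l @ \<beta>))"
  unfolding alt_map_def
proof (intro conjI allI impI)
  fix l1 l2 x y assume "l1 @ x # l2 \<in> lists_in k' V \<and> y \<in> carrier V"
  then show "f (l @ l1 @ (x \<oplus>\<^bsub>V\<^esub> y) # l2) = f (l @ l1 @ x # l2) + f (l @ l1 @ y # l2)"
    using alt_add[OF f, of "l @ l1" x l2 y] l by (auto simp: lists_in_def)
next
  fix l1 l2 x a assume "l1 @ x # l2 \<in> lists_in k' V"
  then show "f (l @ l1 @ (a \<odot>\<^bsub>V\<^esub> x) # l2) = sc a (f (l @ l1 @ x # l2))"
    using alt_smult[OF f, of "l @ l1" x l2 a] l by (auto simp: lists_in_def)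
next
  fix l1 l2 x assume "l1 @ x # x # l2 \<in> lists_in k' V"
  then show "f (l @ l1 @ x # x # l2) = 0"
    using alt_adj[OF f, of "l @ l1" x l2] l by (auto simp: lists_in_def)
qed

lemma alt_suffix:
  assumes f: "alt_map k V f" and l: "k' + length l = k" "set l \<subseteq> carrier V"
  shows "alt_map k' V (\<lambda>\<beta>. f (\<beta> @ l))"
  unfolding alt_map_def
proof (intro conjI allI impI)
  fix l1 l2 x y assume "l1 @ x # l2 \<in> lists_in k' V \<and> y \<in> carrier V"
  then show "f ((l1 @ (x \<oplus>\<^bsub>V\<^esub> y) # l2) @ l) = f ((l1 @ x # l2) @ l) + f ((l1 @ y # l2) @ l)"
    using alt_add[OF f, of l1 x "l2 @ l" y] l by (auto simp: lists_in_def)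
next
  fix l1 l2 x a assume "l1 @ x # l2 \<in> lists_in k' V"
  then show "f ((l1 @ (a \<odot>\<^bsub>V\<^esub> x) # l2) @ l) = sc a (f ((l1 @ x # l2) @ l))"
    using alt_smult[OF f, of l1 x "l2 @ l" a] l by (auto simp: lists_in_def)
next
  fix l1 l2 x assume "l1 @ x # x # l2 \<in> lists_in k' V"
  then show "f ((l1 @ x # x # l2) @ l) = 0"
    using alt_adj[OF f, of l1 x "l2 @ l"] l by (auto simp: lists_in_def)
qed

abbreviation EH where "EH k \<equiv> ext_pow k H_inf"
abbreviation TR where "TR k \<equiv> tensor_rel (EH k) H_dual"

lemma op_closed_EH [simp]: "op_closed (EH k)"
  by (rule op_closed_ext_pow) simp

lemma subsp_TR [simp]: "subsp (TR k)"
  by (rule tensor_rel_subsp) simp_all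

text \<open>The pure tensor of the wedge of \<open>l\<close> with \<open>\<mu>\<close>, as a normal
  form.\<close>

definition wten :: "nat \<Rightarrow> ((nat \<Rightarrow>\<^sub>0 rat) \<Rightarrow> rat) \<Rightarrow> (nat \<Rightarrow>\<^sub>0 rat) list
    \<Rightarrow> (((nat \<Rightarrow>\<^sub>0 rat) list \<Rightarrow>\<^sub>0 rat) set \<times> ((nat \<Rightarrow>\<^sub>0 rat) \<Rightarrow> rat) \<Rightarrow>\<^sub>0 rat)" where
  "wten k \<mu> l = ten_nf (EH k) H_dual (wedge H_inf l, \<mu>)"

lemmas bil_tnH = bil_ten_nf[OF op_closed_EH op_closed_H_dual]

lemma wedge_in: "length l = k \<Longrightarrow> wedge H_inf l \<in> carrier (EH k)"
  by (auto simp: wedge_cst carrier_ext_pow lists_in_H_inf)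

lemma alt_wten:
  assumes "\<mu> \<in> carrier H_dual"
  shows "alt_map k H_inf (wten k \<mu>)"
proof -
  note alt = alt_wnf[OF op_closed_H_inf, of k]
  have eq: "cst (ext_rel k H_inf) c = cst (ext_rel k H_inf) d"
    if "lin_ext (wnf k H_inf) c = lin_ext (wnf k H_inf) d" for c d
    using that by (simp add: cst_eq_nf nf_ext_rel)
  have w: "wedge H_inf l = cst (ext_rel k H_inf) (single l 1)" if "length l = k" for l
    using that by (rule wedge_cst)
  show ?thesis
    unfolding alt_map_def
  proof (intro conjI allI impI)
    fix l1 l2 x y assume "l1 @ x # l2 \<in> lists_in k H_inf \<and> y \<in> carrier H_inf"
    then have l: "length (l1 @ z # l2) = k" "l1 @ z # l2 \<in> lists_in k H_inf" for z by (auto simp: lists_in_H_inf)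
    have "wedge H_inf (l1 @ (x \<oplus>\<^bsub>H_inf\<^esub> y) # l2)
        = wedge H_inf (l1 @ x # l2) \<oplus>\<^bsub>EH k\<^esub> wedge H_inf (l1 @ y # l2)"
      unfolding w[OF l(1)] add_ext_pow[OF op_closed_H_inf]
      by (rule eq) (use alt_add[OF alt l(2), of y] in \<open>simp add: lin_ext_add\<close>)
    then show "wten k \<mu> (l1 @ (x \<oplus>\<^bsub>H_inf\<^esub> y) # l2) = wten k \<mu> (l1 @ x # l2) + wten k \<mu> (l1 @ y # l2)"
      using bil_tnH[of k] assms wedge_in[OF l(1)] by (simp add: wten_def bil_map_def)
  next
    fix l1 l2 x a assume "l1 @ x # l2 \<in> lists_in k H_inf"
    then have l: "length (l1 @ z # l2) = k" "l1 @ z # l2 \<in> lists_in k H_inf" for z by (auto simp: lists_in_H_inf)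
    have "wedge H_inf (l1 @ (a \<odot>\<^bsub>H_inf\<^esub> x) # l2) = a \<odot>\<^bsub>EH k\<^esub> wedge H_inf (l1 @ x # l2)"
      unfolding w[OF l(1)] smult_ext_pow[OF op_closed_H_inf]
      by (rule eq) (use alt_smult[OF alt l(2), of a] in \<open>simp add: lin_ext_scale\<close>)
    then show "wten k \<mu> (l1 @ (a \<odot>\<^bsub>H_inf\<^esub> x) # l2) = sc a (wten k \<mu> (l1 @ x # l2))"
      using bil_tnH[of k] assms wedge_in[OF l(1)] by (simp add: wten_def bil_map_def)
  next
    fix l1 l2 x assume "l1 @ x # x # l2 \<in> lists_in k H_inf"
    then have l: "length (l1 @ x # x # l2) = k" "l1 @ x # x # l2 \<in> lists_in k H_inf" by (auto simp: lists_in_H_inf)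
    \<comment> \<open>The zero class is written as a multiple by 0, so that homogeneity of the
      tensor in its first factor applies.\<close>
    have "wedge H_inf (l1 @ x # x # l2) = cst (ext_rel k H_inf) (sc 0 (single (l1 @ x # x # l2) 1))"
      unfolding w[OF l(1)] by (rule eq) (use alt_adj[OF alt l(2)] in simp)
    also have "\<dots> = 0 \<odot>\<^bsub>EH k\<^esub> wedge H_inf (l1 @ x # x # l2)"
      unfolding w[OF l(1)] by (rule smult_ext_pow[OF op_closed_H_inf, symmetric])
    finally have "wten k \<mu> (l1 @ x # x # l2) = ten_nf (EH k) H_dual (0 \<odot>\<^bsub>EH k\<^esub> wedge H_inf (l1 @ x # x # l2), \<mu>)"
      unfolding wten_def by (rule arg_cong[of _ _ "\<lambda>X. ten_nf (EH k) H_dual (X, \<mu>)"])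
    also have "\<dots> = sc 0 (wten k \<mu> (l1 @ x # x # l2))"
      using bil_tnH[of k] assms wedge_in[OF l(1)] by (simp add: wten_def bil_map_def)
    finally have "wten k \<mu> (l1 @ x # x # l2) = sc 0 (wten k \<mu> (l1 @ x # x # l2))" .
    then show "wten k \<mu> (l1 @ x # x # l2) = 0" by simp
  qed
qed

lemma wten_sum:
  assumes l: "length l = k" and M: "finite M"
  shows "wten k (\<lambda>x. \<Sum>m\<in>M. c m * lookup x m) l = (\<Sum>m\<in>M. sc (c m) (wten k (edual m) l))"
  using M
proof (induction M)
  case empty
  \<comment> \<open>Likewise the zero functional is 0 times a coordinate functional.\<close>
  have "(\<lambda>x :: nat \<Rightarrow>\<^sub>0 rat. 0 :: rat) = 0 \<odot>\<^bsub>H_dual\<^esub> edual 0" by (simp add: H_dual_simps)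
  then have "wten k (\<lambda>x. 0) l = sc 0 (wten k (edual 0) l)"
    using bil_tnH[of k] wedge_in[OF l] by (simp add: wten_def bil_map_def)
  then show ?case by simp
next
  case (insert m M)
  have "(\<lambda>x. \<Sum>m\<in>insert m M. c m * lookup x m)
      = (c m \<odot>\<^bsub>H_dual\<^esub> edual m) \<oplus>\<^bsub>H_dual\<^esub> (\<lambda>x. \<Sum>m\<in>M. c m * lookup x m)"
    using insert by (simp add: H_dual_simps edual_def fun_eq_iff)
  moreover have "c m \<odot>\<^bsub>H_dual\<^esub> edual m \<in> carrier H_dual"
    by (rule op_closed_smult) simp_all
  ultimately have "wten k (\<lambda>x. \<Sum>m\<in>insert m M. c m * lookup x m) l
      = wten k (c m \<odot>\<^bsub>H_dual\<^esub> edual m) l + wten k (\<lambda>x. \<Sum>m\<in>M. c m * lookup x m) l"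
    using bil_tnH[of k] wedge_in[OF l] edual_sum_in[OF insert(1), of c] by (simp add: wten_def bil_map_def)
  moreover have "wten k (c m \<odot>\<^bsub>H_dual\<^esub> edual m) l = sc (c m) (wten k (edual m) l)"
    using bil_tnH[of k] wedge_in[OF l] by (simp add: wten_def bil_map_def)
  ultimately show ?case using insert by simp
qed

lemma nf_wten: "nf (TR k) (wten k \<mu> l) = wten k \<mu> l"
  by (simp add: wten_def ten_nf_def nf_nf)

lemma nf_TR: "nf (TR k) c = lin_ext (ten_nf (EH k) H_dual) c"
  by (rule lin_eq_on[OF lin_nf[OF subsp_TR] lin_lin_ext]) (simp add: ten_nf_def)

lemma keys_wten:
  assumes "length l = k" "\<mu> \<in> carrier H_dual"
  shows "keys (wten k \<mu> l) \<subseteq> carrier (EH k) \<times> carrier H_dual"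
proof -
  let ?S = "{c. keys c \<subseteq> carrier (EH k) \<times> carrier H_dual}" and ?s = "single (wedge H_inf l, \<mu>) 1"
  have "nf (TR k) ?s - ?s \<in> ?S"
    using nf_diff_in[OF subsp_TR] tensor_rel_in[OF op_closed_EH op_closed_H_dual] by blast
  moreover have "?s \<in> ?S" using assms wedge_in by auto
  ultimately have "nf (TR k) ?s - ?s + ?s \<in> ?S" by (rule subsp_add[OF subsp_keys])
  then show ?thesis by (simp add: wten_def ten_nf_def)
qed

abbreviation usupp where "usupp u \<equiv> {m. uval u (e m) \<noteq> 0}"

text \<open>Under the identification of homomorphisms with tensors, \<open>u\<close> is the sum of
  \<open>u(e_m)\<close> tensored with the dual of \<open>e_m\<close>; here the first factor is
  wedged with \<open>\<beta>\<close>. Finite support of \<open>u\<close> makes the sum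
  finite.\<close>

definition ctr_at :: "nat \<Rightarrow> U_elt \<Rightarrow> (nat \<Rightarrow>\<^sub>0 rat) list
    \<Rightarrow> (((nat \<Rightarrow>\<^sub>0 rat) list \<Rightarrow>\<^sub>0 rat) set \<times> ((nat \<Rightarrow>\<^sub>0 rat) \<Rightarrow> rat) \<Rightarrow>\<^sub>0 rat)" where
  "ctr_at k u \<beta> = (\<Sum>m\<in>usupp u. lin_ext (\<lambda>l. wten k (edual m) (l @ \<beta>)) (uval u (e m)))"

text \<open>Interior product of a bivector with \<open>\<mu>\<close>.\<close>

definition ctr2 :: "((nat \<Rightarrow>\<^sub>0 rat) \<Rightarrow> rat) \<Rightarrow> ((nat \<Rightarrow>\<^sub>0 rat) list \<Rightarrow>\<^sub>0 rat) \<Rightarrow> (nat \<Rightarrow>\<^sub>0 rat)" where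
  "ctr2 \<mu> = lin_ext (laplace (\<lambda>x l. sc (\<mu> x) (hd l)) [])"

text \<open>The trace from \<open>U_inf\<close> to \<open>H_inf\<close>, which pairs the argument of
  \<open>u\<close> with the first factor of its value.\<close>

definition utrace :: "U_elt \<Rightarrow> (nat \<Rightarrow>\<^sub>0 rat)" where
  "utrace u = (\<Sum>m\<in>usupp u. ctr2 (edual m) (uval u (e m)))"

lemma ctr_at_superset: "finite M \<Longrightarrow> usupp u \<subseteq> M
    \<Longrightarrow> ctr_at k u \<beta> = (\<Sum>m\<in>M. lin_ext (\<lambda>l. wten k (edual m) (l @ \<beta>)) (uval u (e m)))"
  unfolding ctr_at_def by (rule sum.mono_neutral_left) auto

lemma lin_ctr2: "lin (ctr2 \<mu>)"
  by (simp add: ctr2_def)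

lemma utrace_superset: "finite M \<Longrightarrow> usupp u \<subseteq> M \<Longrightarrow> utrace u = (\<Sum>m\<in>M. ctr2 (edual m) (uval u (e m)))"
  unfolding utrace_def by (rule sum.mono_neutral_left) (auto simp: lin_0[OF lin_ctr2])

lemma alt_ctr2:
  assumes "\<And>x y. \<mu> (x + y) = \<mu> x + \<mu> y" "\<And>a x. \<mu> (sc a x) = a * \<mu> x"
  shows "alt_map 2 H_inf (laplace (\<lambda>x l. sc (\<mu> x) (hd l)) [] :: _ \<Rightarrow> (nat \<Rightarrow>\<^sub>0 rat))"
  unfolding numeral_2_eq_2
proof (rule alt_laplace)
  fix x :: "nat \<Rightarrow>\<^sub>0 rat"
  show "alt_map (Suc 0) H_inf (\<lambda>l. sc (\<mu> x) (hd l))"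
    by (auto simp: alt_map_def lists_in_H_inf sc_add_right mult.commute)
qed (simp_all add: assms sc_add_left)

lemma ctr2_wnf:
  assumes "\<mu> \<in> carrier H_dual"
  shows "ctr2 \<mu> (wnfH [y, z]) = sc (\<mu> y) z - sc (\<mu> z) y"
proof -
  have "ctr2 \<mu> (wnfH [y, z]) = lin_ext (laplace (\<lambda>x l. sc (\<mu> x) (hd l)) []) (single [y, z] 1)"
    unfolding ctr2_def wnf_def
    by (rule alt_repr[OF op_closed_H_inf alt_ctr2]) (simp_all add: H_dual_add H_dual_sc assms)
  then show ?thesis by simp
qed

lemma utrace_vlin: "utrace \<in> vlin U_inf H_inf"
proof (rule vlinI)
  fix u v a assume u: "u \<in> carrier U_inf"
  have cl: "a \<odot>\<^bsub>U_inf\<^esub> u \<in> carrier U_inf" by (intro op_closed_smult op_closed_U u)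
  have "usupp (a \<odot>\<^bsub>U_inf\<^esub> u) \<subseteq> usupp u" by (auto simp: uval_smult[OF u])
  then show "utrace (a \<odot>\<^bsub>U_inf\<^esub> u) = a \<odot>\<^bsub>H_inf\<^esub> utrace u"
    by (simp add: utrace_superset[OF uval_finite[OF u]] uval_smult[OF u] lin_sc[OF lin_ctr2] sc_sum_right)
  assume v: "v \<in> carrier U_inf"
  have fin: "finite (usupp u \<union> usupp v)" using uval_finite u v by simp
  have "usupp (u \<oplus>\<^bsub>U_inf\<^esub> v) \<subseteq> usupp u \<union> usupp v" by (auto simp: uval_add[OF u v])
  then show "utrace (u \<oplus>\<^bsub>U_inf\<^esub> v) = utrace u \<oplus>\<^bsub>H_inf\<^esub> utrace v"
    by (simp add: utrace_superset[OF fin] uval_add[OF u v] lin_add[OF lin_ctr2] sum.distrib)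
qed simp

text \<open>One distinguished element keeps its whole value and its dual factor, and all others
  enter only through their traces.\<close>

definition ctr_head :: "nat \<Rightarrow> U_elt \<Rightarrow> U_elt list
    \<Rightarrow> (((nat \<Rightarrow>\<^sub>0 rat) list \<Rightarrow>\<^sub>0 rat) set \<times> ((nat \<Rightarrow>\<^sub>0 rat) \<Rightarrow> rat) \<Rightarrow>\<^sub>0 rat)" where
  "ctr_head k u l = ctr_at k u (map utrace l)"

lemma alt_ctr_head:
  assumes u: "u \<in> carrier U_inf"
  shows "alt_map k U_inf (ctr_head (Suc (Suc k)) u)"
  unfolding ctr_head_def
proof (rule alt_pre[OF utrace_vlin])
  have "alt_map k H_inf (\<lambda>\<beta>. \<Sum>l\<in>keys (uval u (e m)). sc (lookup (uval u (e m)) l) (wten (Suc (Suc k)) (edual m) (l @ \<beta>)))" for m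
  proof (rule alt_sum)
    fix l assume "l \<in> keys (uval u (e m))"
    then have "length l = 2" using keys_uval[OF u, of "e m"] by (auto simp: lists_in_H_inf)
    then show "alt_map k H_inf (\<lambda>\<beta>. wten (Suc (Suc k)) (edual m) (l @ \<beta>))"
      by (intro alt_prefix[OF alt_wten]) simp_all
  qed
  then have "alt_map k H_inf (\<lambda>\<beta>. \<Sum>m\<in>usupp u. sc 1 (\<Sum>l\<in>keys (uval u (e m)).
      sc (lookup (uval u (e m)) l) (wten (Suc (Suc k)) (edual m) (l @ \<beta>))))"
    by (rule alt_sum)
  then show "alt_map k H_inf (ctr_at (Suc (Suc k)) u)"
    by (simp add: ctr_at_def[abs_def] lin_ext_sc)
qed

definition Phi_list :: "nat \<Rightarrow> U_elt list
    \<Rightarrow> (((nat \<Rightarrow>\<^sub>0 rat) list \<Rightarrow>\<^sub>0 rat) set \<times> ((nat \<Rightarrow>\<^sub>0 rat) \<Rightarrow> rat) \<Rightarrow>\<^sub>0 rat)" where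
  "Phi_list k = laplace (ctr_head k) []"

text \<open>The distinguished element fills two slots of the wedge and the other \<open>k\<close>
  one slot each. This is why degree \<open>Suc k\<close> on the side of \<open>U_inf\<close> meets
  degree \<open>Suc (Suc k)\<close> on the side of \<open>H_inf\<close>.\<close>

lemma alt_Phi_list: "alt_map (Suc k) U_inf (Phi_list (Suc (Suc k)))"
  unfolding Phi_list_def
proof (rule alt_laplace[OF alt_ctr_head])
  fix u v a l assume u: "u \<in> carrier U_inf"
  have "usupp (a \<odot>\<^bsub>U_inf\<^esub> u) \<subseteq> usupp u" by (auto simp: uval_smult[OF u])
  then show "ctr_head (Suc (Suc k)) (a \<odot>\<^bsub>U_inf\<^esub> u) l = sc a (ctr_head (Suc (Suc k)) u l)"
    by (simp add: ctr_head_def ctr_at_superset[OF uval_finite[OF u]] uval_smult[OF u] lin_ext_scale sc_sum_right)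
  assume v: "v \<in> carrier U_inf"
  have fin: "finite (usupp u \<union> usupp v)" using uval_finite u v by simp
  have "usupp (u \<oplus>\<^bsub>U_inf\<^esub> v) \<subseteq> usupp u \<union> usupp v" by (auto simp: uval_add[OF u v])
  then show "ctr_head (Suc (Suc k)) (u \<oplus>\<^bsub>U_inf\<^esub> v) l = ctr_head (Suc (Suc k)) u l + ctr_head (Suc (Suc k)) v l"
    by (simp add: ctr_head_def ctr_at_superset[OF fin] uval_add[OF u v] lin_ext_add sum.distrib)
qed

lemma laplace_in:
  assumes "subsp S" "\<And>x l. x \<in> C \<Longrightarrow> set l \<subseteq> C \<Longrightarrow> length l = k \<Longrightarrow> g x l \<in> S"
    and "set (pre @ l) \<subseteq> C" "length (pre @ l) = Suc k"
  shows "laplace g pre l \<in> S"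
  using assms(3,4)
proof (induction l arbitrary: pre)
  case Nil
  then show ?case by (simp add: subsp_0 assms(1))
next
  case (Cons x l)
  then show ?case using Cons.IH[of "pre @ [x]"] by (auto intro!: subsp_diff assms(1,2))
qed

lemma Phi_list_in:
  assumes "l \<in> lists_in (Suc k) U_inf"
  shows "keys (Phi_list (Suc (Suc k)) l) \<subseteq> carrier (EH (Suc (Suc k))) \<times> carrier H_dual"
    and "nf (TR (Suc (Suc k))) (Phi_list (Suc (Suc k)) l) = Phi_list (Suc (Suc k)) l"
proof -
  let ?K = "Suc (Suc k)"
  let ?S = "{c. keys c \<subseteq> carrier (EH ?K) \<times> carrier H_dual} \<inter> {c. nf (TR ?K) c = c}"
  have "subsp {c. nf (TR ?K) c = c}"
    by (rule subspI) (simp_all add: lin_0 lin_add lin_sc lin_nf)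
  then have S: "subsp ?S" by (intro subsp_Int subsp_keys)
  have "Phi_list ?K l \<in> ?S"
    unfolding Phi_list_def
  proof (rule laplace_in[OF S, of "carrier U_inf"])
    fix u l assume u: "u \<in> carrier U_inf" and l: "set l \<subseteq> carrier U_inf" "length l = k"
    show "ctr_head ?K u l \<in> ?S"
      unfolding ctr_head_def ctr_at_def
    proof (intro subsp_sum[OF S] lin_ext_in[OF S])
      fix m l' assume "l' \<in> keys (uval u (e m))"
      then have "length l' = 2" using keys_uval[OF u] by (auto simp: lists_in_H_inf)
      then show "wten ?K (edual m) (l' @ map utrace l) \<in> ?S"
        using keys_wten[of "l' @ map utrace l" ?K "edual m"] l(2) by (simp add: nf_wten)
    qed
  qed (use assms in \<open>auto simp: lists_in_def\<close>)
  then show "keys (Phi_list ?K l) \<subseteq> carrier (EH ?K) \<times> carrier H_dual" "nf (TR ?K) (Phi_list ?K l) = Phi_list ?K l"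
    by auto
qed

subsection \<open>Equivariance\<close>

definition ten_act :: "nat \<Rightarrow> ((nat \<Rightarrow>\<^sub>0 rat) \<Rightarrow> (nat \<Rightarrow>\<^sub>0 rat))
    \<Rightarrow> (((nat \<Rightarrow>\<^sub>0 rat) list \<Rightarrow>\<^sub>0 rat) set \<times> ((nat \<Rightarrow>\<^sub>0 rat) \<Rightarrow> rat) \<Rightarrow>\<^sub>0 rat)
    \<Rightarrow> (((nat \<Rightarrow>\<^sub>0 rat) list \<Rightarrow>\<^sub>0 rat) set \<times> ((nat \<Rightarrow>\<^sub>0 rat) \<Rightarrow> rat) \<Rightarrow>\<^sub>0 rat)" where
  "ten_act k A = lin_ext (\<lambda>(X, \<mu>). ten_nf (EH k) H_dual (ext_map k H_inf A X, dual_act A \<mu>))"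

lemma ten_act_nf:
  assumes A: "level n A"
  shows "ten_act k A (nf (TR k) c) = ten_act k A c"
proof -
  have h: "ext_map k H_inf A \<in> vlin (EH k) (EH k)"
    by (rule ext_map_vlin) (simp_all add: vlin_H_inf level_lin[OF A])
  note g = dual_act_vlin[OF A]
  have "bil_map (EH k) H_dual (\<lambda>(X, \<mu>). ten_nf (EH k) H_dual (ext_map k H_inf A X, dual_act A \<mu>))"
    using bil_tnH[of k] unfolding bil_map_def
    by (simp add: vlin_add[OF h] vlin_add[OF g] vlin_smult[OF h] vlin_smult[OF g]
        vlin_closed[OF h] vlin_closed[OF g])
  from bil_tensor_rel[OF op_closed_EH op_closed_H_dual this nf_diff_in[OF subsp_TR, of k c]]
  show ?thesis by (simp add: ten_act_def lin_ext_diff)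
qed

lemma ext_map_wedge:
  assumes "lin A" "length l = k"
  shows "ext_map k H_inf A (wedge H_inf l) = wedge H_inf (map A l)"
  using assms by (simp add: wedge_cst ext_map_cst vlin_H_inf)

lemma ten_act_wten:
  assumes "level n A" "length l = k"
  shows "ten_act k A (wten k \<mu> l) = wten k (dual_act A \<mu>) (map A l)"
  unfolding wten_def ten_nf_def[of _ _ "(wedge H_inf l, \<mu>)"] ten_act_nf[OF assms(1)]
  using ext_map_wedge[OF level_lin[OF assms(1)] assms(2)] by (simp add: ten_act_def)

lemma lin_ten_act: "lin (ten_act k A)"
  by (simp add: ten_act_def)

lemma level_bound:
  assumes "level n A" "u \<in> carrier U_inf"
  obtains N where "level N A" "usupp u \<subseteq> {..<N}" "usupp (U_act A u) \<subseteq> {..<N}"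
proof -
  have "finite (usupp u)" "finite (usupp (U_act A u))"
    using uval_finite assms(2) U_act_in[OF assms] by auto
  then obtain N1 N2 where "usupp u \<subseteq> {..<N1}" "usupp (U_act A u) \<subseteq> {..<N2}"
    using finite_nat_iff_bounded by metis
  then show ?thesis
    using level_mono[OF assms(1), of "n + N1 + N2"] by (intro that[of "n + N1 + N2"]) auto
qed

lemma uval_invf_expand:
  assumes "level N A" "u \<in> carrier U_inf" "m < N"
  shows "uval u (invf A (e m)) = (\<Sum>j<N. sc (lookup (invf A (e m)) j) (uval u (e j)))"
  using level_keys[OF level_inv[OF assms(1)], of "e m"] assms(3)
  by (intro lin_e_expand_superset[OF lin_uval[OF assms(2)]]) auto

text \<open>Naturality of the interior product: contracting the image of a bivector with a
  functional amounts to contracting with the functional composed with \<open>A\<close>, and then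
  applying \<open>A\<close>.\<close>

lemma ctr2_Lam:
  assumes A: "lin A" and c: "keys c \<subseteq> lists_in 2 H_inf"
  shows "ctr2 (edual m) (Lam A c) = A (ctr2 (\<lambda>x. lookup (A x) m) c)"
proof (rule lin_eq_on[OF lin_comp[OF lin_ctr2 lin_Lam] lin_comp[OF A lin_ctr2]])
  fix l assume "l \<in> keys c"
  then obtain y z where l: "l = [y, z]" using lists_in_2E[of l H_inf] c by blast
  show "ctr2 (edual m) (Lam A (single l 1)) = A (ctr2 (\<lambda>x. lookup (A x) m) (single l 1))"
    by (simp add: l Lam_def ctr2_wnf) (simp add: ctr2_def edual_def lin_diff[OF A] lin_sc[OF A])
qed

lemma ctr2_sum:
  assumes "finite M" "keys c \<subseteq> lists_in 2 H_inf"
  shows "(\<Sum>m\<in>M. sc (a m) (ctr2 (\<lambda>x. f m x) c)) = ctr2 (\<lambda>x. \<Sum>m\<in>M. a m * f m x) c"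
  unfolding ctr2_def
proof (rule lin_eq_on[where f = "\<lambda>c. \<Sum>m\<in>M. sc (a m) (lin_ext (laplace (\<lambda>x l. sc (f m x) (hd l)) []) c)"])
  show "lin (\<lambda>c. \<Sum>m\<in>M. sc (a m) (lin_ext (laplace (\<lambda>x l. sc (f m x) (hd l)) []) c))"
    by (rule linI) (simp_all add: lin_ext_add lin_ext_scale sc_add_right sum.distrib sc_sum_right mult.commute)
  fix l assume "l \<in> keys c"
  then obtain y z where l: "l = [y, z]" using lists_in_2E[of l H_inf] assms(2) by blast
  show "(\<Sum>m\<in>M. sc (a m) (lin_ext (laplace (\<lambda>x l. sc (f m x) (hd l)) []) (single l 1)))
      = lin_ext (laplace (\<lambda>x l. sc (\<Sum>m\<in>M. a m * f m x) (hd l)) []) (single l 1)"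
    by (simp add: l sc_sum_left sc_diff_right sum_subtractf)
qed simp

text \<open>Invariance of the trace: the matrix of the inverse, coming from the argument, meets the
  matrix of \<open>A\<close>, coming from the value, and they cancel after the sums are
  exchanged.\<close>

lemma utrace_U_act:
  assumes A: "level n A" and u: "u \<in> carrier U_inf"
  shows "utrace (U_act A u) = A (utrace u)"
proof -
  obtain N where N: "level N A" "usupp u \<subseteq> {..<N}" "usupp (U_act A u) \<subseteq> {..<N}" using level_bound[OF A u] .
  note lA = level_lin[OF A]
  \<comment> \<open>The inverse of \<open>A\<close> times \<open>A\<close> is the identity, in
    coordinates.\<close>
  have coord: "(\<Sum>m<N. lookup (invf A (e m)) j * lookup (A x) m) = lookup x j" if "j < N" for j x
    using level_coord[OF level_inv[OF N(1)] that, of "A x"] inv_level(2)[OF A, of x] by (simp add: mult.commute)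
  have "utrace (U_act A u) = (\<Sum>m<N. ctr2 (edual m) (Lam A (uval u (invf A (e m)))))"
    using N(3) by (simp add: utrace_superset[of "{..<N}"] uval_U_act(1)[OF lA u])
  also have "\<dots> = (\<Sum>m<N. \<Sum>j<N. sc (lookup (invf A (e m)) j) (ctr2 (edual m) (Lam A (uval u (e j)))))"
    by (intro sum.cong refl)
      (simp add: uval_invf_expand[OF N(1) u] lin_sum[OF lin_Lam] lin_sc[OF lin_Lam] lin_sum[OF lin_ctr2] lin_sc[OF lin_ctr2])
  also have "\<dots> = (\<Sum>j<N. \<Sum>m<N. sc (lookup (invf A (e m)) j) (ctr2 (edual m) (Lam A (uval u (e j)))))"
    by (rule sum.swap)
  also have "\<dots> = (\<Sum>j<N. A (\<Sum>m<N. sc (lookup (invf A (e m)) j) (ctr2 (\<lambda>x. lookup (A x) m) (uval u (e j)))))"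
    by (simp add: lin_sum[OF lA] lin_sc[OF lA] ctr2_Lam[OF lA keys_uval[OF u]])
  also have "\<dots> = (\<Sum>j<N. A (ctr2 (edual j) (uval u (e j))))"
  proof (intro sum.cong refl)
    fix j assume "j \<in> {..<N}"
    then have "(\<lambda>x. \<Sum>m<N. lookup (invf A (e m)) j * lookup (A x) m) = edual j"
      using coord by (auto simp: edual_def)
    then show "A (\<Sum>m<N. sc (lookup (invf A (e m)) j) (ctr2 (\<lambda>x. lookup (A x) m) (uval u (e j)))) = A (ctr2 (edual j) (uval u (e j)))"
      by (simp add: ctr2_sum[OF finite_lessThan keys_uval[OF u]])
  qed
  also have "\<dots> = A (utrace u)" using N(2) by (simp add: utrace_superset[of "{..<N}"] lin_sum[OF lA])
  finally show ?thesis .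
qed

lemma alt_wten_head:
  assumes "length \<beta> = k"
  shows "alt_map 2 H_inf (\<lambda>l. wten (Suc (Suc k)) (edual m) (l @ \<beta>))"
  by (rule alt_suffix[OF alt_wten]) (simp_all add: assms)

text \<open>The coefficients of the inverse that arise from the argument of \<open>u\<close> are
  exactly those by which the coordinate functionals transform, so here they are absorbed by the dual
  factor instead of cancelling.\<close>

lemma ctr_at_U_act:
  assumes A: "level n A" and u: "u \<in> carrier U_inf" and \<beta>: "length \<beta> = k"
  shows "ctr_at (Suc (Suc k)) (U_act A u) (map A \<beta>) = ten_act (Suc (Suc k)) A (ctr_at (Suc (Suc k)) u \<beta>)"
proof -
  let ?K = "Suc (Suc k)"
  obtain N where N: "level N A" "usupp u \<subseteq> {..<N}" "usupp (U_act A u) \<subseteq> {..<N}" using level_bound[OF A u] .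
  note lA = level_lin[OF A]
  define q where "q = (\<lambda>m. lin_ext (\<lambda>l. wten ?K (edual m) (map A (l @ \<beta>))))"
  have lq: "lin (q m)" for m by (simp add: q_def)
  have LamA: "lin_ext (\<lambda>l. wten ?K (edual m) (l @ map A \<beta>)) (Lam A c) = q m c" for m c
    unfolding q_def
  proof (rule lin_eq_on[OF lin_comp[OF lin_lin_ext lin_Lam] lin_lin_ext])
    fix l
    have "lin_ext (\<lambda>l. wten ?K (edual m) (l @ map A \<beta>)) (wnfH (map A l)) = wten ?K (edual m) (map A l @ map A \<beta>)"
      using alt_repr[OF op_closed_H_inf alt_wten_head[of "map A \<beta>" k m], of "single (map A l) 1"] \<beta>
      by (simp add: wnf_def)
    then show "lin_ext (\<lambda>l. wten ?K (edual m) (l @ map A \<beta>)) (Lam A (single l 1))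
        = lin_ext (\<lambda>l. wten ?K (edual m) (map A (l @ \<beta>))) (single l 1)"
      by (simp add: Lam_def)
  qed
  have "ctr_at ?K (U_act A u) (map A \<beta>) = (\<Sum>m<N. q m (uval u (invf A (e m))))"
    using N(3) by (simp add: ctr_at_superset[of "{..<N}"] uval_U_act(1)[OF lA u] LamA)
  also have "\<dots> = (\<Sum>m<N. \<Sum>j<N. sc (lookup (invf A (e m)) j) (q m (uval u (e j))))"
    by (intro sum.cong refl) (simp add: uval_invf_expand[OF N(1) u] lin_sum[OF lq] lin_sc[OF lq])
  also have "\<dots> = (\<Sum>j<N. \<Sum>m<N. sc (lookup (invf A (e m)) j) (q m (uval u (e j))))"
    by (rule sum.swap)
  also have "\<dots> = (\<Sum>j<N. ten_act ?K A (lin_ext (\<lambda>l. wten ?K (edual j) (l @ \<beta>)) (uval u (e j))))"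
  proof (intro sum.cong refl)
    fix j assume j: "j \<in> {..<N}"
    have "lin (\<lambda>c. \<Sum>m<N. sc (lookup (invf A (e m)) j) (q m c))"
      by (rule linI) (simp_all add: lin_add[OF lq] lin_sc[OF lq] sc_add_right sum.distrib sc_sum_right mult.commute)
    then show "(\<Sum>m<N. sc (lookup (invf A (e m)) j) (q m (uval u (e j))))
        = ten_act ?K A (lin_ext (\<lambda>l. wten ?K (edual j) (l @ \<beta>)) (uval u (e j)))"
    proof (rule lin_eq_on[OF _ lin_comp[OF lin_ten_act lin_lin_ext]])
      fix l assume "l \<in> keys (uval u (e j))"
      then have "length (l @ \<beta>) = ?K" using keys_uval[OF u] \<beta> by (auto simp: lists_in_H_inf)
      then show "(\<Sum>m<N. sc (lookup (invf A (e m)) j) (q m (single l 1)))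
          = ten_act ?K A (lin_ext (\<lambda>l. wten ?K (edual j) (l @ \<beta>)) (single l 1))"
        using j by (simp add: q_def ten_act_wten[OF A] dual_act_edual[OF N(1)] wten_sum)
    qed
  qed
  also have "\<dots> = ten_act ?K A (ctr_at ?K u \<beta>)"
    using N(2) by (simp add: ctr_at_superset[of "{..<N}"] lin_sum[OF lin_ten_act])
  finally show ?thesis .
qed

lemma Phi_list_U_act:
  assumes A: "level n A" and l: "l \<in> lists_in (Suc k) U_inf"
  shows "Phi_list (Suc (Suc k)) (map (U_act A) l) = ten_act (Suc (Suc k)) A (Phi_list (Suc (Suc k)) l)"
proof -
  let ?K = "Suc (Suc k)"
  have "laplace (ctr_head ?K) (map (U_act A) pre) (map (U_act A) l) = ten_act ?K A (laplace (ctr_head ?K) pre l)"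
    if "pre @ l \<in> lists_in (Suc k) U_inf" for pre l
    using that
  proof (induction l arbitrary: pre)
    case Nil
    show ?case by (simp add: lin_0[OF lin_ten_act])
  next
    case (Cons u l)
    have u: "u \<in> carrier U_inf" and len: "length (map utrace (pre @ l)) = k"
      using Cons.prems by (auto simp: lists_in_def)
    have *: "map utrace (map (U_act A) (pre @ l)) = map A (map utrace (pre @ l))"
      using Cons.prems utrace_U_act[OF A] by (auto simp: lists_in_def)
    have "ctr_head ?K (U_act A u) (map (U_act A) (pre @ l)) = ten_act ?K A (ctr_head ?K u (pre @ l))"
      unfolding ctr_head_def * by (rule ctr_at_U_act[OF A u len])
    then show ?case
      using Cons.IH[of "pre @ [u]"] Cons.prems by (simp add: lin_diff[OF lin_ten_act])
  qed
  from this[of "[]" l] show ?thesis using l by (simp add: Phi_list_def)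
qed

text \<open>The canonical representative makes this a function of the class; \<open>Phi_cst\<close>
  shows that any representative gives the same value.\<close>

definition Phi :: "nat \<Rightarrow> (U_elt list \<Rightarrow>\<^sub>0 rat) set
    \<Rightarrow> (((nat \<Rightarrow>\<^sub>0 rat) list \<Rightarrow>\<^sub>0 rat) set \<times> ((nat \<Rightarrow>\<^sub>0 rat) \<Rightarrow> rat) \<Rightarrow>\<^sub>0 rat) set" where
  "Phi i X = cst (TR (Suc i)) (lin_ext (Phi_list (Suc i)) (repr (ext_rel i U_inf) X))"

lemma Phi_cst: "Phi (Suc k) (cst (ext_rel (Suc k) U_inf) c)
    = cst (TR (Suc (Suc k))) (lin_ext (Phi_list (Suc (Suc k))) c)"
  by (simp add: Phi_def alt_repr[OF op_closed_U alt_Phi_list])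

lemma Phi_vlin: "Phi (Suc k) \<in> vlin (ext_pow (Suc k) U_inf) (tensor (EH (Suc (Suc k))) H_dual)"
proof (rule vlinI)
  fix X Y a assume "X \<in> carrier (ext_pow (Suc k) U_inf)"
  then obtain c where c: "X = cst (ext_rel (Suc k) U_inf) c" "keys c \<subseteq> lists_in (Suc k) U_inf"
    by (auto simp: carrier_ext_pow)
  have "lin_ext (Phi_list (Suc (Suc k))) c \<in> {c. keys c \<subseteq> carrier (EH (Suc (Suc k))) \<times> carrier H_dual}"
    using c(2) Phi_list_in(1) by (intro lin_ext_in[OF subsp_keys]) blast
  then show "Phi (Suc k) X \<in> carrier (tensor (EH (Suc (Suc k))) H_dual)"
    by (auto simp: c(1) Phi_cst carrier_tensor)
  show "Phi (Suc k) (a \<odot>\<^bsub>ext_pow (Suc k) U_inf\<^esub> X) = a \<odot>\<^bsub>tensor (EH (Suc (Suc k))) H_dual\<^esub> Phi (Suc k) X"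
    by (simp add: c(1) Phi_cst smult_ext_pow smult_tensor lin_ext_scale)
  assume "Y \<in> carrier (ext_pow (Suc k) U_inf)"
  then obtain d where d: "Y = cst (ext_rel (Suc k) U_inf) d" by (auto simp: carrier_ext_pow)
  show "Phi (Suc k) (X \<oplus>\<^bsub>ext_pow (Suc k) U_inf\<^esub> Y)
      = Phi (Suc k) X \<oplus>\<^bsub>tensor (EH (Suc (Suc k))) H_dual\<^esub> Phi (Suc k) Y"
    by (simp add: c(1) d Phi_cst add_ext_pow add_tensor lin_ext_add)
qed

lemma tensor_map_H:
  assumes "level n A"
  shows "tensor_map (EH k) H_dual (ext_map k H_inf A) (dual_act A) (cst (TR k) c) = cst (TR k) (ten_act k A c)"
proof -
  have "tensor_map (EH k) H_dual (ext_map k H_inf A) (dual_act A) (cst (TR k) c)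
      = cst (TR k) (lin_ext (\<lambda>(X, \<mu>). single (ext_map k H_inf A X, dual_act A \<mu>) 1) c)" (is "_ = cst _ (?f c)")
    by (rule tensor_map_cst[OF _ _ _ _ ext_map_vlin dual_act_vlin[OF assms]])
      (simp_all add: vlin_H_inf level_lin[OF assms])
  also have "nf (TR k) (?f c) = ten_act k A c"
    by (rule lin_eq_on[OF lin_comp[OF lin_nf[OF subsp_TR] lin_lin_ext] lin_ten_act])
      (auto simp: ten_act_def ten_nf_def split: prod.splits)
  then have "cst (TR k) (?f c) = cst (TR k) (ten_act k A c)" by (metis cst_nf subsp_TR)
  finally show ?thesis .
qed

lemma Phi_equivariant:
  assumes A: "level n A" and X: "X \<in> carrier (ext_pow (Suc k) U_inf)"
  shows "Phi (Suc k) (ext_map (Suc k) U_inf (U_act A) X)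
    = tensor_map (EH (Suc (Suc k))) H_dual (ext_map (Suc (Suc k)) H_inf A) (dual_act A) (Phi (Suc k) X)"
proof -
  obtain c where c: "X = cst (ext_rel (Suc k) U_inf) c" "keys c \<subseteq> lists_in (Suc k) U_inf"
    using X by (auto simp: carrier_ext_pow)
  have "lin_ext (Phi_list (Suc (Suc k))) (lin_ext (\<lambda>l. single (map (U_act A) l) 1) c)
      = ten_act (Suc (Suc k)) A (lin_ext (Phi_list (Suc (Suc k))) c)"
    by (rule lin_eq_on[OF lin_comp[OF lin_lin_ext lin_lin_ext] lin_comp[OF lin_ten_act lin_lin_ext]])
      (use c(2) Phi_list_U_act[OF A] in auto)
  then show ?thesis
    by (simp add: c(1) ext_map_cst U_act_vlin[OF A] Phi_cst tensor_map_H[OF A])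
qed

section \<open>The value of the contraction on a chain of conjugations\<close>

lemma alt_scaled:
  assumes f: "alt_map k H_inf f" and "length pre + length ps = k"
  shows "f (pre @ map (\<lambda>p. sc (r p) (v p)) ps) = sc (prod_list (map r ps)) (f (pre @ map v ps))"
  using assms(2)
proof (induction ps arbitrary: pre)
  case (Cons p ps)
  have "f (pre @ map (\<lambda>p. sc (r p) (v p)) (p # ps))
      = sc (r p) (f ((pre @ [v p]) @ map (\<lambda>p. sc (r p) (v p)) ps))"
    using alt_smult[OF f, of pre "v p" "map (\<lambda>p. sc (r p) (v p)) ps" "r p"] Cons.prems
    by (simp add: lists_in_H_inf)
  also have "\<dots> = sc (r p) (sc (prod_list (map r ps)) (f ((pre @ [v p]) @ map v ps)))"
    using Cons.prems by (subst Cons.IH) simp_all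
  finally show ?case by simp
qed simp

text \<open>The Johnson images of the commuting conjugations, described abstractly:
  \<open>us q\<close> wedges each of \<open>c 0\<close>, ..., \<open>c q\<close> with the next basis
  vector of the chain.\<close>

locale chain =
  fixes k :: nat and c :: "nat \<Rightarrow> nat" and us :: "nat \<Rightarrow> U_elt"
  assumes c: "inj_on c {..Suc k}"
    and us: "\<And>q. q \<le> k \<Longrightarrow> us q \<in> carrier U_inf"
    and uu_us: "\<And>q m. q \<le> k \<Longrightarrow> uval (us q) (e m)
      = (if m \<in> c ` {..q} then wnfH [e m, e (c (Suc q))] else 0)"
begin

abbreviation "K \<equiv> Suc (Suc k)"
abbreviation "v p \<equiv> e (c (Suc p))"

definition "om = wten K (edual (c 0)) (map (\<lambda>p. e (c p)) [0..<K])"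

lemma c_neq: "a \<le> Suc k \<Longrightarrow> b \<le> Suc k \<Longrightarrow> a \<noteq> b \<Longrightarrow> c a \<noteq> c b"
  using c by (auto simp: inj_on_def)

text \<open>The functional at each of the \<open>Suc q\<close> conjugated indices kills
  \<open>v q\<close>, so every index contributes one copy of \<open>v q\<close>.\<close>

lemma utrace_us:
  assumes q: "q \<le> k"
  shows "utrace (us q) = sc (of_nat (Suc q)) (v q)"
proof -
  have "utrace (us q) = (\<Sum>m\<in>c ` {..q}. ctr2 (edual m) (uval (us q) (e m)))"
    by (rule utrace_superset) (auto simp: uu_us[OF q])
  also have "\<dots> = (\<Sum>m\<in>c ` {..q}. sc 1 (v q))"
  proof (intro sum.cong refl)
    fix m assume m: "m \<in> c ` {..q}"
    then have "c (Suc q) \<noteq> m" using c_neq q by fastforce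
    then show "ctr2 (edual m) (uval (us q) (e m)) = sc 1 (v q)"
      using m by (simp add: uu_us[OF q] ctr2_wnf edual_def lookup_e)
  qed
  also have "\<dots> = sc (of_nat (card (c ` {..q}))) (v q)"
    by (simp only: sc_sum_left[symmetric] sum_constant mult_1_right)
  also have "card (c ` {..q}) = Suc q"
    using q by (subst card_image) (auto intro: inj_on_subset[OF c])
  finally show ?thesis .
qed

text \<open>The other traces are positive multiples of the vectors \<open>v p\<close> with
  \<open>p\<close> different from \<open>q\<close>. Among the summands of \<open>us q\<close> only
  the one at \<open>c 0\<close> avoids a repetition, and sorting its entries costs \<open>q\<close>
  transpositions.\<close>

lemma ctr_head_us:
  assumes q: "q \<le> k" and ps: "ps = [0..<q] @ [Suc q..<Suc k]"
  shows "ctr_head K (us q) (map us ps) = sc ((- 1) ^ q * prod_list (map (\<lambda>p. of_nat (Suc p)) ps)) om"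
proof -
  let ?r = "\<lambda>p. of_nat (Suc p) :: rat"
  have lps: "length ps = k" using q by (simp add: ps)
  have "map utrace (map us ps) = map (\<lambda>p. sc (?r p) (v p)) ps" (is "_ = ?\<beta>")
    using q by (auto simp: ps utrace_us)
  then have "ctr_head K (us q) (map us ps) = ctr_at K (us q) ?\<beta>" by (simp only: ctr_head_def)
  also have "\<dots> = (\<Sum>m\<in>c ` {..q}. lin_ext (\<lambda>l. wten K (edual m) (l @ ?\<beta>)) (uval (us q) (e m)))"
    by (rule ctr_at_superset) (auto simp: uu_us[OF q])
  also have "\<dots> = (\<Sum>m\<in>c ` {..q}. wten K (edual m) ([e m, v q] @ ?\<beta>))"
  proof (intro sum.cong refl)
    fix m assume "m \<in> c ` {..q}"
    then have "uval (us q) (e m) = nf R2 (single [e m, v q] 1)" by (simp add: uu_us[OF q] wnf_def)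
    then show "lin_ext (\<lambda>l. wten K (edual m) (l @ ?\<beta>)) (uval (us q) (e m)) = wten K (edual m) ([e m, v q] @ ?\<beta>)"
      by (simp only:) (subst alt_repr[OF op_closed_H_inf alt_wten_head], simp_all add: lps)
  qed
  also have "\<dots> = (\<Sum>a\<le>q. wten K (edual (c a)) ([e (c a), v q] @ ?\<beta>))"
    using q by (subst sum.reindex) (auto intro: inj_on_subset[OF c])
  also have "\<dots> = (\<Sum>a\<le>q. sc (prod_list (map ?r ps)) (wten K (edual (c a)) ([e (c a), v q] @ map v ps)))"
    by (intro sum.cong refl alt_scaled[OF alt_wten]) (simp_all add: lps)
  \<comment> \<open>For positive \<open>a\<close> the vector at \<open>c a\<close> is
    \<open>v (a - 1)\<close>, which already occurs as the direction of another trace.\<close>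
  also have "\<dots> = (\<Sum>a\<in>{0}. sc (prod_list (map ?r ps)) (wten K (edual (c a)) ([e (c a), v q] @ map v ps)))"
  proof (rule sum.mono_neutral_right)
    show "\<forall>a\<in>{..q} - {0}. sc (prod_list (map ?r ps)) (wten K (edual (c a)) ([e (c a), v q] @ map v ps)) = 0"
    proof
      fix a assume a: "a \<in> {..q} - {0}"
      then have "a - 1 \<in> set ps" "c (Suc (a - 1)) = c a" by (auto simp: ps)
      then have "e (c a) \<in> set (map v ps)"
        unfolding set_map by (intro image_eqI[of _ _ "a - 1"]) (simp_all only:)
      then have "wten K (edual (c a)) ([e (c a), v q] @ map v ps) = 0"
        by (intro alt_not_distinct[OF op_closed_H_inf alt_wten]) (auto simp: lists_in_H_inf lps)
      then show "sc (prod_list (map ?r ps)) (wten K (edual (c a)) ([e (c a), v q] @ map v ps)) = 0" by simp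
    qed
  qed auto
  also have "\<dots> = sc (prod_list (map ?r ps)) (wten K (edual (c 0)) ([e (c 0)] @ v q # map v [0..<q] @ map v [Suc q..<Suc k]))"
    by (simp add: ps)
  \<comment> \<open>The vector \<open>v q\<close> is moved past the \<open>q\<close> vectors that
    precede it in the chain.\<close>
  also have "wten K (edual (c 0)) ([e (c 0)] @ v q # map v [0..<q] @ map v [Suc q..<Suc k])
      = sc ((- 1) ^ length (map v [0..<q])) (wten K (edual (c 0)) ([e (c 0)] @ map v [0..<q] @ v q # map v [Suc q..<Suc k]))"
    by (rule alt_move[OF op_closed_H_inf alt_wten]) (use q in \<open>simp_all add: lists_in_H_inf\<close>)
  also have "[e (c 0)] @ map v [0..<q] @ v q # map v [Suc q..<Suc k] = map (\<lambda>p. e (c p)) [0..<K]"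
  proof -
    have "[0..<q] @ q # [Suc q..<Suc k] = [0..<Suc k]"
      using q upt_add_eq_append[of 0 q "Suc k - q"] upt_conv_Cons[of q "Suc k"] by simp
    then have "map v [0..<q] @ v q # map v [Suc q..<Suc k] = map v [0..<Suc k]"
      by (metis list.simps(9) map_append)
    also have "\<dots> = map (\<lambda>p. e (c p)) (map Suc [0..<Suc k])" by simp
    also have "map Suc [0..<Suc k] = [1..<K]" by (simp only: map_Suc_upt One_nat_def)
    finally have "[e (c 0)] @ map v [0..<q] @ v q # map v [Suc q..<Suc k] = map (\<lambda>p. e (c p)) (0 # [1..<K])"
      by simp
    also have "0 # [1..<K] = [0..<K]" using upt_conv_Cons[of 0 K] by simp
    finally show ?thesis .
  qed
  finally show ?thesis by (simp add: om_def mult.commute)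
qed

text \<open>The sorting sign of the summand at \<open>q\<close> equals its sign in the Laplace
  expansion, so all summands are positive multiples of \<open>om\<close>. Positivity is all that is
  kept of the coefficient.\<close>

lemma Phi_list_us: "\<exists>\<rho>>0. Phi_list K (map us [0..<Suc k]) = sc \<rho> om"
proof -
  \<comment> \<open>Backward induction on the number of entries passed; the coefficient is 0 at the
    end of the list and positive as soon as one entry remains.\<close>
  have "\<exists>\<rho>\<ge>0. (q \<le> k \<longrightarrow> \<rho> > 0) \<and>
      laplace (ctr_head K) (map us [0..<q]) (map us [q..<Suc k]) = sc ((- 1) ^ q * \<rho>) om"
    if "q \<le> Suc k" for q
    using that
  proof (induction "Suc k - q" arbitrary: q)
    case 0
    then show ?case by (intro exI[of _ 0]) auto
  next
    case (Suc n)
    then have q: "q \<le> k" by simp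
    have eq: "[q..<Suc k] = q # [Suc q..<Suc k]" using q by (simp add: upt_conv_Cons)
    have "n = Suc k - Suc q" "Suc q \<le> Suc k" using Suc.hyps(2) q by auto
    from Suc.hyps(1)[OF this] obtain \<rho> where r: "\<rho> \<ge> 0"
      "laplace (ctr_head K) (map us [0..<Suc q]) (map us [Suc q..<Suc k]) = sc ((- 1) ^ Suc q * \<rho>) om"
      by blast
    let ?p = "prod_list (map (\<lambda>p. of_nat (Suc p)) ([0..<q] @ [Suc q..<Suc k])) :: rat"
    have pos: "prod_list (map (\<lambda>p. of_nat (Suc p)) xs) > (0 :: rat)" for xs
      by (induction xs) (auto intro!: mult_pos_pos)
    have "laplace (ctr_head K) (map us [0..<q]) (map us [q..<Suc k])
        = ctr_head K (us q) (map us ([0..<q] @ [Suc q..<Suc k]))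
          - laplace (ctr_head K) (map us [0..<Suc q]) (map us [Suc q..<Suc k])"
      unfolding eq by simp
    also have "\<dots> = sc ((- 1) ^ q * (?p + \<rho>)) om"
      by (simp only: ctr_head_us[OF q refl] r sc_diff_left[symmetric]) (simp add: algebra_simps)
    finally show ?case using r(1) pos by (intro exI[of _ "?p + \<rho>"]) (simp add: add_pos_nonneg less_imp_le)
  qed
  from this[of 0] show ?thesis by (auto simp: Phi_list_def)
qed

end

section \<open>Spanning and infinite dimension of the target\<close>

text \<open>Expand the entries one after another in the basis, with \<open>cs\<close> recording the
  indices already chosen; lists with a repeated index contribute zero.\<close>

lemma alt_span:
  assumes f: "alt_map k H_inf f" and S: "subsp S"
    and gens: "\<And>cs. length cs = k \<Longrightarrow> distinct cs \<Longrightarrow> f (map e cs) \<in> S"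
    and l: "length l = k"
  shows "f l \<in> S"
proof -
  have "f (map e cs @ l) \<in> S" if "length cs + length l = k" for cs l
    using that
  proof (induction l arbitrary: cs)
    case Nil
    show ?case
    proof (cases "distinct cs")
      case True
      then show ?thesis using gens Nil by simp
    next
      case False
      then have "\<not> distinct (map e cs)" by (simp add: distinct_map)
      then have "f (map e cs) = 0"
        using Nil by (intro alt_not_distinct[OF op_closed_H_inf f]) (auto simp: lists_in_H_inf)
      then show ?thesis using subsp_0[OF S] by simp
    qed
  next
    case (Cons x l)
    have lists_in: "map e cs @ y # l \<in> lists_in k H_inf" for y using Cons.prems by (simp add: lists_in_H_inf)
    have "subsp {y. f (map e cs @ y # l) \<in> S}"
    proof (rule subspI)
      show "0 \<in> {y. f (map e cs @ y # l) \<in> S}"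
        using alt_smult[OF f lists_in, of 0 0] subsp_0[OF S] by simp
      show "y + z \<in> {y. f (map e cs @ y # l) \<in> S}"
        if "y \<in> {y. f (map e cs @ y # l) \<in> S}" "z \<in> {y. f (map e cs @ y # l) \<in> S}" for y z
        using alt_add[OF f lists_in, of z y] that subsp_add[OF S] by simp
      show "sc a y \<in> {y. f (map e cs @ y # l) \<in> S}"
        if "y \<in> {y. f (map e cs @ y # l) \<in> S}" for a y
        using alt_smult[OF f lists_in, of a y] that subsp_sc[OF S] by simp
    qed
    then have "x \<in> {y. f (map e cs @ y # l) \<in> S}"
    proof (rule subsp_induct)
      fix j
      have "f (map e (cs @ [j]) @ l) \<in> S" using Cons.prems by (intro Cons.IH) simp
      then show "single j 1 \<in> {y. f (map e cs @ y # l) \<in> S}" by (simp add: e_def)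
    qed
    then show ?case by simp
  qed
  from this[of "[]" l] show ?thesis using l by simp
qed

text \<open>Reduces surjectivity to tensors of basis wedges with coordinate functionals: first the
  functional is expanded, then the wedge, and finally the general element of the free space.\<close>

lemma tensor_span:
  assumes S: "subsp S"
    and gens: "\<And>cs d. length cs = k \<Longrightarrow> distinct cs \<Longrightarrow> wten k (edual d) (map e cs) \<in> S"
    and c: "keys c \<subseteq> carrier (EH k) \<times> carrier H_dual"
  shows "nf (TR k) c \<in> S"
proof -
  have 1: "wten k \<mu> l \<in> S" if "length l = k" "\<mu> \<in> carrier H_dual" for l \<mu>
  proof -
    have "finite {m. \<mu> (e m) \<noteq> 0}" using that by (simp add: H_dual_simps)
    then have "wten k \<mu> l = (\<Sum>m | \<mu> (e m) \<noteq> 0. sc (\<mu> (e m)) (wten k (edual m) l))"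
      by (subst H_dual_expand[OF that(2)]) (simp add: wten_sum[OF that(1)])
    also have "\<dots> \<in> S"
      by (intro subsp_sum[OF S] subsp_sc[OF S] alt_span[OF alt_wten S gens that(1)]) simp_all
    finally show ?thesis .
  qed
  have 2: "ten_nf (EH k) H_dual (cst (ext_rel k H_inf) x, \<mu>) \<in> S"
    if x: "keys x \<subseteq> lists_in k H_inf" and \<mu>: "\<mu> \<in> carrier H_dual" for x \<mu>
  proof -
    let ?f = "\<lambda>x. ten_nf (EH k) H_dual (cst (ext_rel k H_inf) x, \<mu>)"
    let ?N = "{x. keys x \<subseteq> lists_in k H_inf \<and> ?f x \<in> S}"
    have add: "?f (x + y) = ?f x + ?f y" if "keys x \<subseteq> lists_in k H_inf" "keys y \<subseteq> lists_in k H_inf" for x y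
      using bil_tnH[of k] that \<mu> by (simp add: bil_map_def carrier_ext_pow flip: add_ext_pow)
    have scl: "?f (sc a x) = sc a (?f x)" if "keys x \<subseteq> lists_in k H_inf" for a x
      using bil_tnH[of k] that \<mu> by (simp add: bil_map_def carrier_ext_pow flip: smult_ext_pow)
    have "subsp ?N"
    proof (rule subspI)
      show "0 \<in> ?N" using scl[of 0 0] subsp_0[OF S] by simp
      show "y + z \<in> ?N" if "y \<in> ?N" "z \<in> ?N" for y z
        using that add[of y z] subsp_add[OF S] subsp_add[OF subsp_keys, of y "lists_in k H_inf" z] by auto
      show "sc a y \<in> ?N" if "y \<in> ?N" for a y
        using that scl[of y a] subsp_sc[OF S] subsp_sc[OF subsp_keys, of y "lists_in k H_inf" a] by auto
    qed
    then have "x \<in> ?N"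
    proof (rule subsp_induct)
      fix l assume "l \<in> keys x"
      then have l: "length l = k" using x by (auto simp: lists_in_H_inf)
      then show "single l 1 \<in> ?N" using 1[OF l \<mu>] by (simp add: wten_def wedge_cst lists_in_H_inf)
    qed
    then show ?thesis by simp
  qed
  show ?thesis
    unfolding nf_TR
  proof (rule lin_ext_in[OF S])
    fix p assume "p \<in> keys c"
    then obtain X \<mu> where p: "p = (X, \<mu>)" "X \<in> carrier (EH k)" "\<mu> \<in> carrier H_dual" using c by auto
    then show "ten_nf (EH k) H_dual p \<in> S" using 2 by (auto simp: carrier_ext_pow)
  qed
qed

text \<open>The determinant of the coordinates below \<open>k\<close>, expanded along the highest
  one. Scalars are encoded as functions on \<open>unit\<close> so that the results on alternating
  maps into finitely supported functions apply.\<close>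

fun minor :: "nat \<Rightarrow> (nat \<Rightarrow>\<^sub>0 rat) list \<Rightarrow> (unit \<Rightarrow>\<^sub>0 rat)" where
  "minor 0 l = single () 1"
| "minor (Suc k) l = laplace (\<lambda>x r. sc (lookup x k) (minor k r)) [] l"

lemma alt_minor: "alt_map k H_inf (minor k)"
proof (induction k)
  case 0
  show ?case by (simp add: alt_map_def lists_in_H_inf)
next
  case (Suc k)
  have "alt_map (Suc k) H_inf (laplace (\<lambda>x r. sc (lookup x k) (minor k r)) [])"
    by (rule alt_laplace) (simp_all add: alt_post[OF lin_scale[OF lin_id] Suc] lookup_add sc_add_left)
  then show ?case by (simp add: minor.simps[abs_def])
qed

text \<open>In reversed order the pivot comes first in every expansion, so no sign appears.\<close>

lemma minor_e: "minor k (map e (rev [0..<k])) = single () 1"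
proof (induction k)
  case (Suc k)
  have "laplace (\<lambda>x r. sc (lookup x k) (minor k r)) pre l = 0" if "\<forall>x\<in>set l. lookup x k = 0" for pre l
    using that by (induction l arbitrary: pre) auto
  then show ?case using Suc by (auto simp: lookup_e)
qed simp

text \<open>Identifies a functional in \<open>H_dual\<close> with the vector of its
  coordinates.\<close>

definition dual_vec :: "((nat \<Rightarrow>\<^sub>0 rat) \<Rightarrow> rat) \<Rightarrow> (nat \<Rightarrow>\<^sub>0 rat)" where
  "dual_vec \<mu> = (\<Sum>m | \<mu> (e m) \<noteq> 0. single m (\<mu> (e m)))"

lemma lookup_dual_vec: "\<mu> \<in> carrier H_dual \<Longrightarrow> lookup (dual_vec \<mu>) j = \<mu> (e j)"
proof -
  assume "\<mu> \<in> carrier H_dual"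
  then have fin: "finite {m. \<mu> (e m) \<noteq> 0}" by (simp add: H_dual_simps)
  have "lookup (dual_vec \<mu>) j = (\<Sum>m | \<mu> (e m) \<noteq> 0. if m = j then \<mu> (e m) else 0)"
    by (simp add: dual_vec_def lookup_sum lookup_single when_def)
  then show ?thesis using fin by simp
qed

text \<open>Evaluates the wedge factor by a fixed determinant and keeps the functional. Its values
  reach every coordinate, as \<open>vdim_infinite\<close> demands.\<close>

definition Psi :: "nat \<Rightarrow> (((nat \<Rightarrow>\<^sub>0 rat) list \<Rightarrow>\<^sub>0 rat) set \<times> ((nat \<Rightarrow>\<^sub>0 rat) \<Rightarrow> rat) \<Rightarrow>\<^sub>0 rat) set \<Rightarrow> (nat \<Rightarrow>\<^sub>0 rat)" where
  "Psi k Z = lin_ext (\<lambda>(X, \<mu>). sc (lookup (lin_ext (minor k) (repr (ext_rel k H_inf) X)) ()) (dual_vec \<mu>)) (repr (TR k) Z)"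

lemma Psi_cst: "Psi k (cst (TR k) c)
  = lin_ext (\<lambda>(X, \<mu>). sc (lookup (lin_ext (minor k) (repr (ext_rel k H_inf) X)) ()) (dual_vec \<mu>)) c" (is "_ = lin_ext ?f c")
proof -
  have "bil_map (EH k) H_dual ?f"
    unfolding bil_map_def
  proof (intro conjI ballI allI)
    fix X Y \<mu> \<nu> a assume "X \<in> carrier (EH k)"
    then obtain x where x: "X = cst (ext_rel k H_inf) x" by (auto simp: carrier_ext_pow)
    show "?f (a \<odot>\<^bsub>EH k\<^esub> X, \<mu>) = sc a (?f (X, \<mu>))"
      by (simp add: x smult_ext_pow alt_repr[OF op_closed_H_inf alt_minor] lin_ext_scale)
    show "?f (X \<oplus>\<^bsub>EH k\<^esub> Y, \<mu>) = ?f (X, \<mu>) + ?f (Y, \<mu>)" if Y: "Y \<in> carrier (EH k)"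
    proof -
      obtain y where y: "Y = cst (ext_rel k H_inf) y" using Y by (auto simp: carrier_ext_pow)
      show ?thesis
        by (simp add: x y add_ext_pow alt_repr[OF op_closed_H_inf alt_minor] lin_ext_add lookup_add sc_add_left)
    qed
    assume \<mu>: "\<mu> \<in> carrier H_dual"
    have "dual_vec (a \<odot>\<^bsub>H_dual\<^esub> \<mu>) = sc a (dual_vec \<mu>)"
      using \<mu> op_closed_smult[OF op_closed_H_dual \<mu>, of a]
      by (intro poly_mapping_eqI) (simp add: lookup_dual_vec, simp add: H_dual_simps)
    then show "?f (X, a \<odot>\<^bsub>H_dual\<^esub> \<mu>) = sc a (?f (X, \<mu>))" by (simp add: mult.commute)
    assume \<nu>: "\<nu> \<in> carrier H_dual"
    have "dual_vec (\<mu> \<oplus>\<^bsub>H_dual\<^esub> \<nu>) = dual_vec \<mu> + dual_vec \<nu>"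
      using \<mu> \<nu> op_closed_add[OF op_closed_H_dual \<mu> \<nu>]
      by (intro poly_mapping_eqI) (simp add: lookup_dual_vec lookup_add, simp add: H_dual_simps)
    then show "?f (X, \<mu> \<oplus>\<^bsub>H_dual\<^esub> \<nu>) = ?f (X, \<mu>) + ?f (X, \<nu>)" by (simp add: sc_add_right)
  qed
  from bil_tensor_rel[OF op_closed_EH op_closed_H_dual this nf_diff_in[OF subsp_TR, of k c]]
  show ?thesis by (simp add: Psi_def lin_ext_diff)
qed

lemma Psi_hit: "\<exists>Z\<in>carrier (tensor (EH k) H_dual). lookup (Psi k Z) m \<noteq> 0"
proof (rule bexI)
  let ?l = "map e (rev [0..<k])"
  let ?Z = "cst (TR k) (single (wedge H_inf ?l, edual m) 1)"
  have "Psi k ?Z = sc (lookup (minor k ?l) ()) (dual_vec (edual m))"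
    by (simp add: Psi_cst wedge_cst alt_repr[OF op_closed_H_inf alt_minor])
  then show "lookup (Psi k ?Z) m \<noteq> 0"
    by (simp add: minor_e lookup_dual_vec lookup_single, simp add: edual_def lookup_e)
  show "?Z \<in> carrier (tensor (EH k) H_dual)"
    unfolding carrier_tensor by (intro imageI single_in_keys SigmaI wedge_in) simp_all
qed

section \<open>The bar complex\<close>

definition bar_basis :: "('g, 'b) monoid_scheme \<Rightarrow> nat \<Rightarrow> 'g list set" where
  "bar_basis G n = {l. length l = n \<and> set l \<subseteq> carrier G}"

definition cyc_set :: "('g, 'b) monoid_scheme \<Rightarrow> nat \<Rightarrow> ('g list \<Rightarrow>\<^sub>0 rat) set" where
  "cyc_set G n = {c. keys c \<subseteq> bar_basis G n \<and> bar_boundary G c = 0}"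

lemma lin_bar_boundary: "lin (bar_boundary G)"
  by (simp add: bar_boundary_def)

lemma bar_boundary_single: "l \<noteq> [] \<Longrightarrow>
    bar_boundary G (single l 1) = (\<Sum>j\<le>length l. sc ((- 1) ^ j) (single (bar_face G j l) 1))"
  and bar_boundary_Nil: "bar_boundary G (single [] a) = 0"
  by (simp_all add: bar_boundary_def)

lemma bar_chains_pmsp: "bar_chains G n = pmsp {c. keys c \<subseteq> bar_basis G n}"
  by (simp add: bar_chains_def free_space_pmsp bar_basis_def)

lemma bar_cycles_pmsp: "bar_cycles G n = pmsp (cyc_set G n)"
  by (simp add: bar_cycles_def bar_chains_pmsp cyc_set_def)

lemma subsp_cyc_set: "subsp (cyc_set G n)"
proof -
  have eq: "cyc_set G n = {c. keys c \<subseteq> bar_basis G n} \<inter> bar_boundary G -` {0}" by (auto simp: cyc_set_def)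
  have "subsp {0}" by (simp add: subsp_def)
  then show ?thesis unfolding eq by (intro subsp_Int subsp_keys subsp_vimage[OF lin_bar_boundary])
qed

lemma bar_boundaries_image: "bar_boundaries G n = bar_boundary G ` {c. keys c \<subseteq> bar_basis G (Suc n)}"
  by (simp add: bar_boundaries_def bar_chains_pmsp)

lemma subsp_bar_boundaries: "subsp (bar_boundaries G n)"
  unfolding bar_boundaries_image by (intro subsp_image lin_bar_boundary subsp_keys)

lemma homology_quot: "homology G n = quot_space (pmsp (cyc_set G n)) (bar_boundaries G n)"
  by (simp add: homology_def bar_cycles_pmsp)

lemma vectorspace_homology: "vectorspace rat_field (homology G n)"
  unfolding homology_quot by (intro vectorspace_quot subsp_cyc_set subsp_bar_boundaries)

lemma bar_face_mid: "bar_face G (Suc (length p)) (p @ x # y # s) = p @ (x \<otimes>\<^bsub>G\<^esub> y) # s"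
  by (simp add: bar_face_def nth_append)

lemma bar_face_0: "bar_face G 0 l = tl l"
  by (simp add: bar_face_def)

lemma bar_face_last: "length l = Suc n \<Longrightarrow> bar_face G (Suc n) l = butlast l"
  by (simp add: bar_face_def)

lemma split_two:
  assumes "0 < j" "j < length l"
  shows "\<exists>p x y s. l = p @ x # y # s \<and> length p = j - 1"
proof (intro exI conjI)
  show "l = take (j - 1) l @ l ! (j - 1) # l ! j # drop (Suc j) l"
    using assms id_take_nth_drop[of "j - 1" l] Cons_nth_drop_Suc[of j l] by simp
qed (use assms in simp)

section \<open>Functoriality of the bar complex\<close>

definition chain_map :: "('g \<Rightarrow> 'h) \<Rightarrow> ('g list \<Rightarrow>\<^sub>0 rat) \<Rightarrow> ('h list \<Rightarrow>\<^sub>0 rat)" where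
  "chain_map h = lin_ext (\<lambda>l. single (map h l) 1)"

lemma lin_chain_map: "lin (chain_map h)"
  by (simp add: chain_map_def)

lemma chain_map_keys:
  assumes "\<And>g. g \<in> carrier G \<Longrightarrow> h g \<in> carrier K" "keys c \<subseteq> bar_basis G n"
  shows "keys (chain_map h c) \<subseteq> bar_basis K n"
proof -
  have "chain_map h c \<in> {c. keys c \<subseteq> bar_basis K n}"
    unfolding chain_map_def
  proof (rule lin_ext_in[OF subsp_keys])
    fix l assume "l \<in> keys c"
    then have "map h l \<in> bar_basis K n" using assms by (force simp: bar_basis_def)
    then show "single (map h l) 1 \<in> {c. keys c \<subseteq> bar_basis K n}" by simp
  qed
  then show ?thesis by simp
qed

lemma bar_face_map:
  assumes h: "h \<in> hom G K" and l: "l \<in> bar_basis G n" and j: "j \<le> n"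
  shows "bar_face K j (map h l) = map h (bar_face G j l)"
proof -
  consider "j = 0" | "j = length l" | "0 < j" "j < length l" using j l by (fastforce simp: bar_basis_def)
  then show ?thesis
  proof cases
    case 1
    then show ?thesis by (simp add: bar_face_0 map_tl)
  next
    case 2
    then show ?thesis by (simp add: bar_face_def map_tl map_butlast)
  next
    case 3
    then obtain p x y s where d: "l = p @ x # y # s" "length p = j - 1" using split_two by blast
    have "h (x \<otimes>\<^bsub>G\<^esub> y) = h x \<otimes>\<^bsub>K\<^esub> h y" using h l d by (auto simp: hom_def bar_basis_def)
    moreover have "j = Suc (length p)" "j = Suc (length (map h p))" using 3 d by auto
    ultimately show ?thesis
      using bar_face_mid[of G p x y s] bar_face_mid[of K "map h p" "h x" "h y" "map h s"] by (simp add: d(1))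
  qed
qed

lemma bar_boundary_chain_map:
  assumes h: "h \<in> hom G K" and c: "keys c \<subseteq> bar_basis G n"
  shows "bar_boundary K (chain_map h c) = chain_map h (bar_boundary G c)"
proof (rule lin_eq_on[OF lin_comp[OF lin_bar_boundary lin_chain_map] lin_comp[OF lin_chain_map lin_bar_boundary]])
  fix l assume "l \<in> keys c"
  then have l: "l \<in> bar_basis G n" using c by auto
  show "bar_boundary K (chain_map h (single l 1)) = chain_map h (bar_boundary G (single l 1))"
  proof (cases "l = []")
    case True
    then show ?thesis by (simp add: chain_map_def bar_boundary_Nil)
  next
    case False
    have len: "length l = n" using l by (simp add: bar_basis_def)
    have "bar_boundary K (chain_map h (single l 1)) = bar_boundary K (single (map h l) 1)" by (simp add: chain_map_def)
    also have "\<dots> = (\<Sum>j\<le>n. sc ((- 1) ^ j) (single (map h (bar_face G j l)) 1))"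
      using False len bar_face_map[OF h l] by (subst bar_boundary_single) (auto intro!: sum.cong)
    also have "\<dots> = chain_map h (bar_boundary G (single l 1))"
      using False len by (subst bar_boundary_single) (simp_all add: chain_map_def lin_ext_sum)
    finally show ?thesis .
  qed
qed

lemma chain_map_cyc_set:
  assumes h: "h \<in> hom G K" and c: "c \<in> cyc_set G n"
  shows "chain_map h c \<in> cyc_set K n"
  using c bar_boundary_chain_map[OF h, of c n] chain_map_keys[of G h K c n] h
  by (auto simp: cyc_set_def hom_def lin_0[OF lin_chain_map])

lemma homology_map_cst:
  assumes h: "h \<in> hom G K"
  shows "homology_map K n h (cst (bar_boundaries G n) z) = cst (bar_boundaries K n) (chain_map h z)"
  unfolding homology_map_def bar_cycles_pmsp chain_map_def[symmetric]
proof (rule quot_map_cst[OF subsp_bar_boundaries subsp_bar_boundaries lin_chain_map])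
  fix s assume "s \<in> bar_boundaries G n"
  then obtain c where c: "keys c \<subseteq> bar_basis G (Suc n)" "s = bar_boundary G c"
    by (auto simp: bar_boundaries_image)
  have "keys (chain_map h c) \<subseteq> bar_basis K (Suc n)" by (rule chain_map_keys[OF _ c(1)]) (use h in \<open>auto simp: hom_def\<close>)
  then show "chain_map h s \<in> bar_boundaries K n"
    using bar_boundary_chain_map[OF h c(1)] by (auto simp: c(2) bar_boundaries_image intro!: image_eqI[of _ _ "chain_map h c"])
qed

text \<open>The image of the homology map consists of the classes of pushed-forward cycles, and the
  coset operations do not depend on the carrier. Thus Albanese homology has again the form to which
  the results on quotients apply.\<close>

lemma albanese_quot:
  assumes "ab_proj G \<in> hom G (abelianization G)"
  shows "albanese G n = quot_space (pmsp (chain_map (ab_proj G) ` cyc_set G n)) (bar_boundaries (abelianization G) n)"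
proof -
  have "homology_map (abelianization G) n (ab_proj G) ` carrier (homology G n)
      = cst (bar_boundaries (abelianization G) n) ` chain_map (ab_proj G) ` cyc_set G n"
    by (simp add: homology_quot carrier_quot_pmsp image_image homology_map_cst[OF assms])
  moreover have "quot_space (pmsp C) B\<lparr>carrier := cst B ` D\<rparr> = quot_space (pmsp D) B"
    for C D B :: "('a set list \<Rightarrow>\<^sub>0 rat) set"
  proof -
    have "a_rcosets\<^bsub>pmsp D\<^esub> B = cst B ` D"
      using carrier_quot_pmsp[of D B] by (simp add: quot_space_def)
    moreover have "(\<lambda>X Y. X <+>\<^bsub>pmsp C\<^esub> Y) = (\<lambda>X Y. X <+>\<^bsub>pmsp D\<^esub> Y)"
      by (simp add: set_add_def set_mult_def)
    ultimately show ?thesis by (simp add: quot_space_def a_r_coset_pmsp)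
  qed
  ultimately show ?thesis
    unfolding albanese_def homology_quot[of "abelianization G"] by simp
qed

text \<open>The partial signed sums reduce to their last \<open>r\<close>, which the final term
  removes.\<close>

lemma alternating_telescope:
  assumes "s 0 = r 0" "s (Suc n) = r n" "\<And>j. 0 < j \<Longrightarrow> j \<le> n \<Longrightarrow> s j = r j + r (j - 1)"
  shows "(\<Sum>j\<le>Suc n. sc ((- 1) ^ j) (s j)) = 0"
proof -
  have "(\<Sum>j\<le>m. sc ((- 1) ^ j) (s j)) = sc ((- 1) ^ m) (r m)" if "m \<le> n" for m
    using that
  proof (induction m)
    case 0
    then show ?case using assms(1) by simp
  next
    case (Suc m)
    then show ?case using assms(3)[of "Suc m"] by (simp add: sc_add_right sc_minus_left)
  qed
  from this[of n] show ?thesis using assms(2) by (simp add: sc_minus_left)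
qed

text \<open>An inner face multiplies two neighbours, and additivity splits its value into the values
  with one or the other deleted; the signed sum of faces then telescopes. This makes
  \<open>alb_embed\<close> well defined.\<close>

lemma alt_bar_boundary:
  assumes V: "op_closed V" and f: "alt_map n V f"
    and j: "\<And>a. a \<in> carrier K \<Longrightarrow> j a \<in> carrier V"
      "\<And>a b. a \<in> carrier K \<Longrightarrow> b \<in> carrier K \<Longrightarrow> j (a \<otimes>\<^bsub>K\<^esub> b) = j a \<oplus>\<^bsub>V\<^esub> j b"
    and c: "keys c \<subseteq> bar_basis K (Suc n)"
  shows "lin_ext (\<lambda>l. f (map j l)) (bar_boundary K c) = 0"
proof -
  have "lin_ext (\<lambda>l. f (map j l)) (bar_boundary K c) = (\<lambda>_. 0) c"
  proof (rule lin_eq_on[OF lin_comp[OF lin_lin_ext lin_bar_boundary]])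
    show "lin (\<lambda>_. 0)" by (simp add: lin_def)
    fix l assume "l \<in> keys c"
    then have l: "length l = Suc n" "set l \<subseteq> carrier K" using c by (auto simp: bar_basis_def)
    \<comment> \<open>The value on the list with its entry number \<open>m\<close> deleted.\<close>
    let ?r = "\<lambda>m. f (map j (take m l @ drop (Suc m) l))"
    have "(\<Sum>i\<le>Suc n. sc ((- 1) ^ i) (f (map j (bar_face K i l)))) = 0"
    proof (rule alternating_telescope[of _ ?r])
      show "f (map j (bar_face K 0 l)) = ?r 0" by (simp add: bar_face_0 drop_Suc)
      have "bar_face K (Suc n) l = butlast l" using l by (simp add: bar_face_last)
      then show "f (map j (bar_face K (Suc n) l)) = ?r n" using l by (simp add: butlast_conv_take)
      fix i assume i: "0 < i" "i \<le> n"
      then obtain p x y s where d: "l = p @ x # y # s" "length p = i - 1"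
        using split_two[of i l] l by auto
      have "bar_face K i l = p @ (x \<otimes>\<^bsub>K\<^esub> y) # s" using bar_face_mid[of K p x y s] i d by simp
      moreover have "j (x \<otimes>\<^bsub>K\<^esub> y) = j x \<oplus>\<^bsub>V\<^esub> j y" using l d by (intro j(2)) auto
      moreover have "f (map j p @ (j x \<oplus>\<^bsub>V\<^esub> j y) # map j s)
          = f (map j p @ j x # map j s) + f (map j p @ j y # map j s)"
        using l d i j(1) by (intro alt_add[OF f]) (auto simp: lists_in_def)
      moreover have "take i l @ drop (Suc i) l = p @ x # s" "take (i - 1) l @ drop (Suc (i - 1)) l = p @ y # s"
        using d i by (auto simp: take_Cons' drop_Cons')
      ultimately show "f (map j (bar_face K i l)) = ?r i + ?r (i - 1)" by simp
    qed
    then show "lin_ext (\<lambda>l. f (map j l)) (bar_boundary K (single l 1)) = 0"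
      using l by (subst bar_boundary_single) (auto simp: lin_ext_sum simp del: sum.atMost_Suc)
  qed
  then show ?thesis by simp
qed

section \<open>Cycles from commuting elements\<close>

definition ins_at :: "'g \<Rightarrow> nat \<Rightarrow> 'g list \<Rightarrow> 'g list" where
  "ins_at h k l = take k l @ h # drop k l"

text \<open>The shuffle product with the one-element chain \<open>[h]\<close>.\<close>

definition shuffle :: "'g \<Rightarrow> ('g list \<Rightarrow>\<^sub>0 rat) \<Rightarrow> ('g list \<Rightarrow>\<^sub>0 rat)" where
  "shuffle h = lin_ext (\<lambda>l. \<Sum>k\<le>length l. sc ((- 1) ^ k) (single (ins_at h k l) 1))"

lemma lin_shuffle: "lin (shuffle h)"
  by (simp add: shuffle_def)

lemma length_ins_at [simp]: "k \<le> length l \<Longrightarrow> length (ins_at h k l) = Suc (length l)"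
  by (simp add: ins_at_def)

lemma ins_at_append: "ins_at h (length p) (p @ s) = p @ h # s"
  by (simp add: ins_at_def)

text \<open>The face acts strictly to the left of the inserted element and shortens the part before
  it, so the insertion position drops by one.\<close>

lemma face_ins_at_less:
  assumes "j < k" "k \<le> length l"
  shows "bar_face G j (ins_at h k l) = ins_at h (k - 1) (bar_face G j l)"
proof (cases "j = 0")
  case True
  then show ?thesis using assms by (cases l; cases k) (auto simp: bar_face_0 ins_at_def)
next
  case False
  then obtain p x y s where d: "l = p @ x # y # s" "length p = j - 1"
    using split_two[of j l] assms by auto
  define m where "m = take (k - (j + 1)) s"
  define t where "t = drop (k - (j + 1)) s"
  have s: "s = m @ t" by (simp add: m_def t_def)
  have k: "k = length (p @ x # y # m)" "k - 1 = length (p @ (x \<otimes>\<^bsub>G\<^esub> y) # m)" "j = Suc (length p)"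
    using assms d False by (auto simp: m_def)
  have "ins_at h k l = (p @ x # y # m) @ h # t" unfolding d(1) s k(1) using ins_at_append[of h "p @ x # y # m" t] by simp
  then have "bar_face G j (ins_at h k l) = p @ (x \<otimes>\<^bsub>G\<^esub> y) # m @ h # t"
    using bar_face_mid[of G p x y "m @ h # t"] k(3) by simp
  moreover have "bar_face G j l = (p @ (x \<otimes>\<^bsub>G\<^esub> y) # m) @ t"
    using bar_face_mid[of G p x y s] k(3) d(1) s by simp
  ultimately show ?thesis unfolding k(2) using ins_at_append[of h "p @ (x \<otimes>\<^bsub>G\<^esub> y) # m" t] by simp
qed

lemma face_ins_at_greater:
  assumes "Suc k < j" "j \<le> Suc (length l)"
  shows "bar_face G j (ins_at h k l) = ins_at h k (bar_face G (j - 1) l)"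
proof (cases "j = Suc (length l)")
  case True
  have "bar_face G j (ins_at h k l) = butlast (ins_at h k l)"
    using True assms by (simp add: bar_face_last ins_at_def)
  moreover have "bar_face G (j - 1) l = butlast l"
    using True assms bar_face_last[of l "length l - 1" G] by simp
  ultimately show ?thesis
    using True assms by (auto simp: ins_at_def butlast_append butlast_conv_take take_Cons' drop_take)
next
  case False
  then have "0 < j - 1" "j - 1 < length l" using assms by auto
  from split_two[OF this] obtain p x y s where d: "l = p @ x # y # s" "length p = j - 1 - 1"
    by blast
  define a where "a = take k p"
  define m where "m = drop k p"
  have p: "p = a @ m" by (simp add: a_def m_def)
  have k: "k = length a" "j = Suc (length (a @ h # m))" "j - 1 = Suc (length p)"
    using assms d by (auto simp: a_def m_def)
  have "ins_at h k l = (a @ h # m) @ x # y # s" unfolding d(1) p k(1) using ins_at_append[of h a "m @ x # y # s"] by simp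
  then have "bar_face G j (ins_at h k l) = (a @ h # m) @ (x \<otimes>\<^bsub>G\<^esub> y) # s"
    unfolding k(2) by (simp only: bar_face_mid)
  moreover have "bar_face G (j - 1) l = a @ m @ (x \<otimes>\<^bsub>G\<^esub> y) # s"
    unfolding k(3) using bar_face_mid[of G p x y s] d(1) p by simp
  ultimately show ?thesis unfolding k(1) using ins_at_append[of h a "m @ (x \<otimes>\<^bsub>G\<^esub> y) # s"] by simp
qed

text \<open>Inserting \<open>h\<close> before or after the entry number \<open>k\<close> and then
  multiplying the two gives products in opposite order, which agree by commutation.\<close>

lemma face_ins_at_same:
  assumes "k < length l" "l ! k \<otimes>\<^bsub>G\<^esub> h = h \<otimes>\<^bsub>G\<^esub> l ! k"
  shows "bar_face G (Suc k) (ins_at h k l) = bar_face G (Suc k) (ins_at h (Suc k) l)"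
proof -
  let ?p = "take k l" and ?s = "drop (Suc k) l"
  have l: "l = ?p @ l ! k # ?s" using assms by (simp add: id_take_nth_drop)
  have len: "length ?p = k" using assms by simp
  have "ins_at h k l = ?p @ h # l ! k # ?s"
    using assms by (simp add: ins_at_def Cons_nth_drop_Suc)
  moreover have "ins_at h (Suc k) l = ?p @ l ! k # h # ?s"
    using assms by (simp add: ins_at_def take_Suc_conv_app_nth)
  ultimately show ?thesis
    using bar_face_mid[of G ?p h "l ! k" ?s, unfolded len] bar_face_mid[of G ?p "l ! k" h ?s, unfolded len]
      assms(2) by simp
qed

lemma face_ins_at_ends:
  "bar_face G 0 (ins_at h 0 l) = l" "bar_face G (Suc (length l)) (ins_at h (length l) l) = l"
  by (simp_all add: bar_face_0 bar_face_last ins_at_def)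

text \<open>Bookkeeping for the boundary of a shuffle: away from the diagonal the terms are
  insertions into faces, while the two kinds of terms at the inserted element have opposite signs
  and telescope.\<close>

lemma insertion_sum:
  fixes t g :: "nat \<Rightarrow> nat \<Rightarrow> ('i \<Rightarrow>\<^sub>0 rat)"
  assumes lt: "\<And>j k. j < k \<Longrightarrow> k \<le> n \<Longrightarrow> t j k = g j (k - 1)"
    and gt: "\<And>j k. Suc k < j \<Longrightarrow> j \<le> Suc n \<Longrightarrow> t j k = g (j - 1) k"
    and m1: "\<And>k. k \<le> n \<Longrightarrow> t k k = m k" and m2: "\<And>k. k \<le> n \<Longrightarrow> t (Suc k) k = m (Suc k)"
    and m: "m 0 = m (Suc n)"
  shows "(\<Sum>k\<le>n. \<Sum>j\<le>Suc n. sc ((- 1) ^ (j + k)) (t j k)) = - (\<Sum>k<n. \<Sum>j\<le>n. sc ((- 1) ^ (j + k)) (g j k))"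
proof -
  let ?s = "\<lambda>j k. (- 1 :: rat) ^ (j + k)"
  have "(\<Sum>k\<le>n. \<Sum>j\<le>Suc n. sc (?s j k) (t j k)) = (\<Sum>k\<le>n. \<Sum>j\<le>Suc n.
      (if j < k then sc (?s j k) (g j (k - 1)) else 0) + (if j = k then m k else 0)
      + (if j = Suc k then - m (Suc k) else 0) + (if Suc k < j then sc (?s j k) (g (j - 1) k) else 0))"
  proof (intro sum.cong refl)
    fix k j assume kj: "k \<in> {..n}" "j \<in> {..Suc n}"
    consider "j < k" | "j = k" | "j = Suc k" | "Suc k < j" by linarith
    then show "sc (?s j k) (t j k) = (if j < k then sc (?s j k) (g j (k - 1)) else 0) + (if j = k then m k else 0)
      + (if j = Suc k then - m (Suc k) else 0) + (if Suc k < j then sc (?s j k) (g (j - 1) k) else 0)"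
      by cases (use kj in \<open>auto simp: lt gt m1 m2 sc_minus_left simp flip: mult_2 power_mult\<close>)
  qed
  also have "\<dots> = (\<Sum>k\<le>n. (\<Sum>j\<le>Suc n. if j < k then sc (?s j k) (g j (k - 1)) else 0)
      + (m k - m (Suc k)) + (\<Sum>j\<le>Suc n. if Suc k < j then sc (?s j k) (g (j - 1) k) else 0))"
    by (intro sum.cong refl) (simp add: sum.distrib del: sum.atMost_Suc)
  also have "\<dots> = (\<Sum>k\<le>n. \<Sum>j\<le>Suc n. if j < k then sc (?s j k) (g j (k - 1)) else 0)
      + (\<Sum>k\<le>n. m k - m (Suc k)) + (\<Sum>k\<le>n. \<Sum>j\<le>Suc n. if Suc k < j then sc (?s j k) (g (j - 1) k) else 0)"
    by (simp only: sum.distrib)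
  \<comment> \<open>What remains of the telescoping is the difference of the two extreme faces,
    which both delete the inserted element.\<close>
  also have "(\<Sum>k\<le>n. m k - m (Suc k)) = 0" using m by (simp add: sum_telescope)
  also have "(\<Sum>k\<le>n. \<Sum>j\<le>Suc n. if j < k then sc (?s j k) (g j (k - 1)) else 0)
      = (\<Sum>k<n. \<Sum>j\<le>n. if j \<le> k then - sc (?s j k) (g j k) else 0)"
  proof -
    have "(\<Sum>k\<le>n. \<Sum>j\<le>Suc n. if j < k then sc (?s j k) (g j (k - 1)) else 0)
        = (\<Sum>k<n. \<Sum>j\<le>Suc n. if j < Suc k then sc (?s j (Suc k)) (g j k) else 0)"
      using sum.atMost_shift[of "\<lambda>k. \<Sum>j\<le>Suc n. if j < k then sc (?s j k) (g j (k - 1)) else 0" n]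
      by (simp cong: if_cong del: sum.atMost_Suc)
    also have "\<dots> = (\<Sum>k<n. \<Sum>j\<le>n. if j \<le> k then - sc (?s j k) (g j k) else 0)"
      by (rule sum.cong[OF refl]) (simp add: sc_minus_left less_Suc_eq_le cong: if_cong)
    finally show ?thesis .
  qed
  also have "(\<Sum>k\<le>n. \<Sum>j\<le>Suc n. if Suc k < j then sc (?s j k) (g (j - 1) k) else 0)
      = (\<Sum>k<n. \<Sum>j\<le>n. if k < j then - sc (?s j k) (g j k) else 0)"
  proof -
    have "(\<Sum>k\<le>n. \<Sum>j\<le>Suc n. if Suc k < j then sc (?s j k) (g (j - 1) k) else 0)
        = (\<Sum>k\<le>n. \<Sum>j\<le>n. if k < j then - sc (?s j k) (g j k) else 0)"
      by (rule sum.cong[OF refl], subst sum.atMost_Suc_shift) (simp add: sc_minus_left cong: if_cong)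
    also have "\<dots> = (\<Sum>k<n. \<Sum>j\<le>n. if k < j then - sc (?s j k) (g j k) else 0)"
      by (rule sum.mono_neutral_right) (auto intro!: sum.neutral simp: not_less)
    finally show ?thesis .
  qed
  also have "(\<Sum>k<n. \<Sum>j\<le>n. if j \<le> k then - sc (?s j k) (g j k) else 0) + 0
      + (\<Sum>k<n. \<Sum>j\<le>n. if k < j then - sc (?s j k) (g j k) else 0)
      = (\<Sum>k<n. \<Sum>j\<le>n. - sc (?s j k) (g j k))"
    unfolding add_0_right sum.distrib[symmetric] by (intro sum.cong refl) auto
  finally show ?thesis by (simp add: sum_negf)
qed

text \<open>The boundary is a derivation for the shuffle product with commuting elements, and the
  boundary of \<open>[h]\<close> is zero.\<close>

lemma bar_boundary_shuffle:
  assumes G: "group G" and comm: "\<And>x. x \<in> set l \<Longrightarrow> x \<otimes>\<^bsub>G\<^esub> h = h \<otimes>\<^bsub>G\<^esub> x"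
  shows "bar_boundary G (shuffle h (single l 1)) = - shuffle h (bar_boundary G (single l 1))"
proof (cases "l = []")
  case True
  \<comment> \<open>Both faces of \<open>[h]\<close> are the empty list, with opposite
    signs.\<close>
  have "bar_boundary G (single [h] 1) = 0"
    by (subst bar_boundary_single) (simp_all add: bar_face_def flip: single_add)
  then show ?thesis using True by (simp add: shuffle_def ins_at_def bar_boundary_Nil)
next
  case False
  define n where "n = length l"
  have n: "n > 0" using False by (simp add: n_def)
  have len: "length (bar_face G j l) = n - 1" if "j \<le> n" for j
    using that n by (auto simp: bar_face_def n_def)
  let ?t = "\<lambda>j k. single (bar_face G j (ins_at h k l)) (1 :: rat)"
  let ?g = "\<lambda>j k. single (ins_at h k (bar_face G j l)) (1 :: rat)"
  have "bar_boundary G (shuffle h (single l 1)) = (\<Sum>k\<le>n. sc ((- 1) ^ k) (bar_boundary G (single (ins_at h k l) 1)))"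
    by (simp add: shuffle_def n_def lin_sum[OF lin_bar_boundary] lin_sc[OF lin_bar_boundary] flip: sc_single)
  also have "\<dots> = (\<Sum>k\<le>n. \<Sum>j\<le>Suc n. sc ((- 1) ^ (j + k)) (?t j k))"
  proof (intro sum.cong refl)
    fix k assume k: "k \<in> {..n}"
    then have "ins_at h k l \<noteq> []" "length (ins_at h k l) = Suc n" by (simp_all add: ins_at_def n_def)
    then show "sc ((- 1) ^ k) (bar_boundary G (single (ins_at h k l) 1)) = (\<Sum>j\<le>Suc n. sc ((- 1) ^ (j + k)) (?t j k))"
      by (subst bar_boundary_single) (simp_all only: sc_sum_right sc_sc power_add mult.commute not_False_eq_True)
  qed
  also have "\<dots> = - (\<Sum>k<n. \<Sum>j\<le>n. sc ((- 1) ^ (j + k)) (?g j k))"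
  \<comment> \<open>Past the last position \<open>m\<close> is set to the list itself, the common
    value of both extreme faces.\<close>
  proof (rule insertion_sum[where m = "\<lambda>k. if k \<le> n then ?t k k else single l 1"])
    show "?t j k = ?g j (k - 1)" if "j < k" "k \<le> n" for j k
      using face_ins_at_less[of j k l G h] that by (simp add: n_def)
    show "?t j k = ?g (j - 1) k" if "Suc k < j" "j \<le> Suc n" for j k
      using face_ins_at_greater[of k j l G h] that by (simp add: n_def)
    show "?t (Suc k) k = (if Suc k \<le> n then ?t (Suc k) (Suc k) else single l 1)" if "k \<le> n" for k
    proof (cases "Suc k \<le> n")
      case True
      then have "k < length l" by (simp add: n_def)
      then have "bar_face G (Suc k) (ins_at h k l) = bar_face G (Suc k) (ins_at h (Suc k) l)"
        by (intro face_ins_at_same comm) simp_all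
      then show ?thesis using True by simp
    next
      case False
      then have "k = n" using that by simp
      then show ?thesis using face_ins_at_ends(2)[of G l h] by (simp add: n_def)
    qed
  qed (simp_all add: face_ins_at_ends)
  also have "(\<Sum>k<n. \<Sum>j\<le>n. sc ((- 1) ^ (j + k)) (?g j k)) = (\<Sum>j\<le>n. \<Sum>k<n. sc ((- 1) ^ (j + k)) (?g j k))"
    by (rule sum.swap)
  also have "\<dots> = (\<Sum>j\<le>n. sc ((- 1) ^ j) (shuffle h (single (bar_face G j l) 1)))"
  proof (intro sum.cong refl)
    fix j assume "j \<in> {..n}"
    then have "{..length (bar_face G j l)} = {..<n}" using len n by auto
    then show "(\<Sum>k<n. sc ((- 1) ^ (j + k)) (?g j k)) = sc ((- 1) ^ j) (shuffle h (single (bar_face G j l) 1))"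
      by (simp only: shuffle_def lin_ext_single sc_one sc_sum_right sc_sc power_add mult_1_left)
  qed
  also have "\<dots> = shuffle h (bar_boundary G (single l 1))"
    using False by (subst bar_boundary_single) (simp_all only: n_def lin_sum[OF lin_shuffle] lin_sc[OF lin_shuffle], simp)
  finally show ?thesis .
qed

text \<open>The signed sum over all orderings of the list. For commuting elements it represents the
  image of the fundamental class of a torus.\<close>

fun comm_cyc :: "'g list \<Rightarrow> ('g list \<Rightarrow>\<^sub>0 rat)" where
  "comm_cyc [] = single [] 1"
| "comm_cyc (h # hs) = shuffle h (comm_cyc hs)"

lemma keys_comm_cyc: "keys (comm_cyc hs) \<subseteq> {l. length l = length hs \<and> set l \<subseteq> set hs}"
proof (induction hs)
  case (Cons h hs)
  have "shuffle h (comm_cyc hs) \<in> {c. keys c \<subseteq> {l. length l = length (h # hs) \<and> set l \<subseteq> set (h # hs)}}"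
    unfolding shuffle_def
  proof (intro lin_ext_in[OF subsp_keys] subsp_sum[OF subsp_keys] subsp_sc[OF subsp_keys] single_in_keys)
    fix l k assume "l \<in> keys (comm_cyc hs)" "k \<in> {..length l}"
    then have "length l = length hs" "set l \<subseteq> set hs" "k \<le> length l" using Cons.IH by auto
    then show "ins_at h k l \<in> {l. length l = length (h # hs) \<and> set l \<subseteq> set (h # hs)}"
      by (auto simp: ins_at_def dest: in_set_takeD in_set_dropD)
  qed
  then show ?case by simp
qed simp

lemma bar_boundary_comm_cyc:
  assumes "group G" "\<And>x y. x \<in> set hs \<Longrightarrow> y \<in> set hs \<Longrightarrow> x \<otimes>\<^bsub>G\<^esub> y = y \<otimes>\<^bsub>G\<^esub> x"
  shows "bar_boundary G (comm_cyc hs) = 0"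
  using assms(2)
proof (induction hs)
  case Nil
  show ?case by (simp add: bar_boundary_Nil)
next
  case (Cons h hs)
  have "bar_boundary G (shuffle h (comm_cyc hs)) = sc (- 1) (shuffle h (bar_boundary G (comm_cyc hs)))"
  proof (rule lin_eq_on[OF lin_comp[OF lin_bar_boundary lin_shuffle] lin_scale[OF lin_comp[OF lin_shuffle lin_bar_boundary]]])
    fix l assume "l \<in> keys (comm_cyc hs)"
    then have "set l \<subseteq> set hs" using keys_comm_cyc by auto
    then show "bar_boundary G (shuffle h (single l 1)) = sc (- 1) (shuffle h (bar_boundary G (single l 1)))"
      by (subst bar_boundary_shuffle[OF assms(1)]) (use Cons.prems in \<open>auto simp: sc_minus_left\<close>)
  qed
  also have "bar_boundary G (comm_cyc hs) = 0" using Cons by simp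
  finally show ?case by (simp add: lin_0[OF lin_shuffle])
qed

text \<open>Every ordering contributes the same amount, since its sign cancels the one from sorting
  under \<open>f\<close>. The factorial later cancels the normalization in
  \<open>alb_embed\<close>.\<close>

lemma alt_comm_cyc:
  assumes V: "op_closed V" and f: "alt_map (length hs) V f"
    and j: "\<And>h. h \<in> set hs \<Longrightarrow> j h \<in> carrier V"
  shows "lin_ext (\<lambda>l. f (map j l)) (comm_cyc hs) = sc (fact (length hs)) (f (map j hs))"
  using f j
proof (induction hs arbitrary: f)
  case (Cons h hs)
  let ?n = "length hs"
  have jh: "j h \<in> carrier V" using Cons.prems by simp
  have "lin_ext (\<lambda>l. f (map j l)) (shuffle h (comm_cyc hs)) = sc (of_nat (Suc ?n)) (lin_ext (\<lambda>l. f (j h # map j l)) (comm_cyc hs))"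
  proof (rule lin_eq_on[OF lin_comp[OF lin_lin_ext lin_shuffle] lin_scale[OF lin_lin_ext]])
    fix l assume "l \<in> keys (comm_cyc hs)"
    then have l: "length l = ?n" "set l \<subseteq> set hs" using keys_comm_cyc by auto
    have "lin_ext (\<lambda>l. f (map j l)) (shuffle h (single l 1)) = (\<Sum>k\<le>?n. sc ((- 1) ^ k) (f (map j (ins_at h k l))))"
      by (simp add: shuffle_def lin_ext_sum l)
    also have "\<dots> = (\<Sum>k\<le>?n. sc 1 (f (j h # map j l)))"
    proof (intro sum.cong refl)
      fix k assume "k \<in> {..?n}"
      then have k: "length (map j (take k l)) = k" using l by simp
      have "f ([] @ j h # map j (take k l) @ map j (drop k l))
          = sc ((- 1) ^ length (map j (take k l))) (f ([] @ map j (take k l) @ j h # map j (drop k l)))"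
        using l Cons.prems(2) jh
        by (intro alt_move[OF V Cons.prems(1)]) (auto simp: lists_in_def dest!: in_set_takeD in_set_dropD)
      moreover have "map j (take k l) @ map j (drop k l) = map j l"
        by (metis append_take_drop_id map_append)
      ultimately have "f (j h # map j l) = sc ((- 1) ^ k) (f (map j (ins_at h k l)))"
        unfolding k by (simp add: ins_at_def)
      then show "sc ((- 1) ^ k) (f (map j (ins_at h k l))) = sc 1 (f (j h # map j l))"
        by simp
    qed
    also have "\<dots> = sc (of_nat (Suc ?n)) (f (j h # map j l))"
      by (simp only: sc_sum_left[symmetric] sum_constant mult_1_right card_atMost)
    finally show "lin_ext (\<lambda>l. f (map j l)) (shuffle h (single l 1))
        = sc (of_nat (Suc ?n)) (lin_ext (\<lambda>l. f (j h # map j l)) (single l 1))"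
      by simp
  qed
  also have "lin_ext (\<lambda>l. f (j h # map j l)) (comm_cyc hs) = sc (fact ?n) (f (j h # map j hs))"
  proof (rule Cons.IH)
    show "alt_map ?n V (\<lambda>l. f (j h # l))"
      using alt_prefix[OF Cons.prems(1), of "[j h]" ?n] jh by simp
  qed (use Cons.prems in auto)
  finally show ?case by (simp add: algebra_simps)
qed simp

section \<open>Free groups\<close>

lemma inv_letter_simps [simp]: "inv_letter (inv_letter a) = a" "fst (inv_letter a) = fst a"
    "snd (inv_letter a) = (\<not> snd a)" "inv_letter a \<noteq> a" "a \<noteq> inv_letter a"
  by (auto simp: inv_letter_def prod_eq_iff)

lemma reduced_Nil [simp]: "reduced []" and reduced_single [simp]: "reduced [a]"
  and reduced_Cons2: "reduced (a # b # w) \<longleftrightarrow> b \<noteq> inv_letter a \<and> reduced (b # w)"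
  by (simp_all add: reduced_def)

lemma reduced_ConsD: "reduced (a # w) \<Longrightarrow> reduced w"
  by (cases w) (simp_all add: reduced_Cons2)

lemma push_reduced_Cons: "reduced (a # w) \<Longrightarrow> push a w = a # w"
  by (cases w) (simp_all add: reduced_Cons2)

lemma reduced_push: "reduced w \<Longrightarrow> reduced (push a w)"
  by (cases w) (auto simp: reduced_Cons2 dest: reduced_ConsD)

text \<open>Van der Waerden's approach to free groups: a letter acts on reduced words as a
  permutation whose inverse is the action of the inverse letter. The group laws follow from this
  action.\<close>

lemma push_push_inv: "reduced w \<Longrightarrow> push a (push (inv_letter a) w) = w"
  by (cases w) (auto simp: push_reduced_Cons reduced_Cons2)

lemma push_inv_push: "reduced w \<Longrightarrow> push (inv_letter a) (push a w) = w"
  using push_push_inv[of w "inv_letter a"] by simp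

lemma reduced_act: "reduced w \<Longrightarrow> reduced (foldr push u w)"
  by (induction u) (auto intro: reduced_push)

lemma act_push: "reduced w \<Longrightarrow> foldr push (push a u) w = push a (foldr push u w)"
  by (cases u) (auto simp: push_push_inv reduced_act)

lemma act_assoc: "reduced w \<Longrightarrow> foldr push (foldr push u v) w = foldr push u (foldr push v w)"
  by (induction u) (auto simp: act_push)

lemma act_Nil: "reduced u \<Longrightarrow> foldr push u [] = u"
proof (induction u)
  case (Cons a u)
  then show ?case using reduced_ConsD[of a u] push_reduced_Cons[of a u] by simp
qed simp

lemma act_inverse: "reduced w \<Longrightarrow> foldr push (rev (map inv_letter u)) (foldr push u w) = w"
  by (induction u arbitrary: w) (auto simp: push_inv_push reduced_act)

lemma set_push: "fst ` set (push a w) \<subseteq> insert (fst a) (fst ` set w)"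
  by (cases w) auto

lemma set_act: "fst ` set (foldr push u w) \<subseteq> fst ` set u \<union> fst ` set w"
proof (induction u)
  case (Cons a u)
  then show ?case using set_push[of a "foldr push u w"] by simp blast
qed simp

lemma free_grp_simps [simp]: "carrier (free_grp S) = {w. reduced w \<and> fst ` set w \<subseteq> S}"
    "u \<otimes>\<^bsub>free_grp S\<^esub> v = foldr push u v" "\<one>\<^bsub>free_grp S\<^esub> = []"
  by (simp_all add: free_grp_def)

lemma group_free_grp [simp]: "group (free_grp S)"
proof (rule groupI)
  fix u v w assume u: "u \<in> carrier (free_grp S)"
  show "\<exists>y\<in>carrier (free_grp S). y \<otimes>\<^bsub>free_grp S\<^esub> u = \<one>\<^bsub>free_grp S\<^esub>"
  proof (rule bexI)
    let ?y = "foldr push (rev (map inv_letter u)) []"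
    have "foldr push ?y u = foldr push (rev (map inv_letter u)) (foldr push [] u)"
      using u by (intro act_assoc) simp
    also have "\<dots> = foldr push (rev (map inv_letter u)) (foldr push u [])" using u by (simp add: act_Nil)
    finally show "?y \<otimes>\<^bsub>free_grp S\<^esub> u = \<one>\<^bsub>free_grp S\<^esub>" by (simp add: act_inverse)
    show "?y \<in> carrier (free_grp S)"
      using u set_act[of "rev (map inv_letter u)" "[]"] by (simp add: reduced_act image_image) blast
  qed
  assume v: "v \<in> carrier (free_grp S)"
  show "u \<otimes>\<^bsub>free_grp S\<^esub> v \<in> carrier (free_grp S)"
    using u v set_act[of u v] by (simp add: reduced_act) blast
  assume "w \<in> carrier (free_grp S)"
  then show "u \<otimes>\<^bsub>free_grp S\<^esub> v \<otimes>\<^bsub>free_grp S\<^esub> w = u \<otimes>\<^bsub>free_grp S\<^esub> (v \<otimes>\<^bsub>free_grp S\<^esub> w)"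
    by (simp add: act_assoc)
qed simp_all

lemma free_induct [consumes 1, case_names Nil Cons]:
  assumes "w \<in> carrier (free_grp S)" "P []"
    and "\<And>a w. fst a \<in> S \<Longrightarrow> w \<in> carrier (free_grp S) \<Longrightarrow> P w \<Longrightarrow> P ([a] \<otimes>\<^bsub>free_grp S\<^esub> w)"
  shows "P w"
  using assms(1)
proof (induction w)
  case Nil
  show ?case by (rule assms(2))
next
  case (Cons a w)
  then have "w \<in> carrier (free_grp S)" "fst a \<in> S" by (auto dest: reduced_ConsD)
  then have "P ([a] \<otimes>\<^bsub>free_grp S\<^esub> w)" using Cons.IH by (intro assms(3))
  then show ?case using Cons.prems by (simp add: push_reduced_Cons)
qed

lemma letter_cases:
  assumes "x \<in> S"
  shows "[(x, True)] \<in> carrier (free_grp S)" "[(x, False)] = inv\<^bsub>free_grp S\<^esub> [(x, True)]"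
proof -
  show "[(x, True)] \<in> carrier (free_grp S)" using assms by simp
  show "[(x, False)] = inv\<^bsub>free_grp S\<^esub> [(x, True)]"
    by (rule group.inv_equality[OF group_free_grp, symmetric]) (use assms in \<open>simp_all add: inv_letter_def\<close>)
qed

lemma free_hom_eq:
  assumes G: "group G" and f: "f \<in> hom (free_grp S) G" and g: "g \<in> hom (free_grp S) G"
    and eq: "\<And>x. x \<in> S \<Longrightarrow> f [(x, True)] = g [(x, True)]" and w: "w \<in> carrier (free_grp S)"
  shows "f w = g w"
proof -
  interpret f: group_hom "free_grp S" G f by (intro group_hom.intro group_hom_axioms.intro group_free_grp G f)
  interpret g: group_hom "free_grp S" G g by (intro group_hom.intro group_hom_axioms.intro group_free_grp G g)
  have ltr: "f [a] = g [a]" if "fst a \<in> S" for a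
  proof (cases a)
    case (Pair x b)
    then show ?thesis
      using that eq[of x] letter_cases[of x S] f.hom_inv[of "[(x, True)]"] g.hom_inv[of "[(x, True)]"]
      by (cases b) auto
  qed
  show ?thesis
    using w
  proof (induction w rule: free_induct)
    case Nil
    show ?case using f.hom_one g.hom_one by simp
  next
    case (Cons a w)
    then have "[a] \<in> carrier (free_grp S)" by simp
    then show ?case using Cons f.hom_mult g.hom_mult ltr by metis
  qed
qed

text \<open>The homomorphism from the free group that extends \<open>\<phi>\<close>.\<close>

definition weval :: "('g, 'b) monoid_scheme \<Rightarrow> ('a \<Rightarrow> 'g) \<Rightarrow> 'a word \<Rightarrow> 'g" where
  "weval G \<phi> w = foldr (\<lambda>a g. (if snd a then \<phi> (fst a) else inv\<^bsub>G\<^esub> (\<phi> (fst a))) \<otimes>\<^bsub>G\<^esub> g) w \<one>\<^bsub>G\<^esub>"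

context
  fixes G :: "('g, 'b) monoid_scheme" and \<phi> :: "'a \<Rightarrow> 'g" and S :: "'a set"
  assumes G: "group G" and \<phi>: "\<And>x. x \<in> S \<Longrightarrow> \<phi> x \<in> carrier G"
begin

interpretation group G by (rule G)

private definition lt where "lt a = (if snd a then \<phi> (fst a) else inv\<^bsub>G\<^esub> (\<phi> (fst a)))"

private lemma lt: "fst a \<in> S \<Longrightarrow> lt a \<in> carrier G" "fst a \<in> S \<Longrightarrow> lt a \<otimes>\<^bsub>G\<^esub> lt (inv_letter a) = \<one>\<^bsub>G\<^esub>"
  using \<phi>[of "fst a"] by (auto simp: lt_def)

lemma weval_Nil: "weval G \<phi> [] = \<one>\<^bsub>G\<^esub>" by (simp add: weval_def)

private lemma weval_Cons: "weval G \<phi> (a # w) = lt a \<otimes>\<^bsub>G\<^esub> weval G \<phi> w"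
  by (simp add: weval_def lt_def)

lemma weval_closed: "fst ` set w \<subseteq> S \<Longrightarrow> weval G \<phi> w \<in> carrier G"
  by (induction w) (auto simp: weval_Nil weval_Cons lt)

lemma weval_append: "fst ` set u \<subseteq> S \<Longrightarrow> fst ` set v \<subseteq> S \<Longrightarrow> weval G \<phi> (u @ v) = weval G \<phi> u \<otimes>\<^bsub>G\<^esub> weval G \<phi> v"
  by (induction u) (auto simp: weval_Nil weval_Cons weval_closed m_assoc lt)

private lemma weval_push: "fst a \<in> S \<Longrightarrow> fst ` set w \<subseteq> S \<Longrightarrow> weval G \<phi> (push a w) = lt a \<otimes>\<^bsub>G\<^esub> weval G \<phi> w"
  by (cases w) (auto simp: weval_Nil weval_Cons weval_closed lt simp flip: m_assoc)

lemma weval_hom: "weval G \<phi> \<in> hom (free_grp S) G"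
proof (rule homI)
  fix u v assume u: "u \<in> carrier (free_grp S)" and v: "v \<in> carrier (free_grp S)"
  show "weval G \<phi> u \<in> carrier G" using u by (intro weval_closed) simp
  have "weval G \<phi> (foldr push u v) = weval G \<phi> u \<otimes>\<^bsub>G\<^esub> weval G \<phi> v" if "fst ` set u \<subseteq> S" for u
    using that
  proof (induction u)
    case Nil
    then show ?case using v by (simp add: weval_Nil weval_closed)
  next
    case (Cons a u)
    have "fst ` set (foldr push u v) \<subseteq> S" using set_act[of u v] Cons.prems v by simp blast
    then show ?case using Cons v by (simp add: weval_push weval_Cons weval_closed lt m_assoc)
  qed
  then show "weval G \<phi> (u \<otimes>\<^bsub>free_grp S\<^esub> v) = weval G \<phi> u \<otimes>\<^bsub>G\<^esub> weval G \<phi> v" using u by simp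
qed

lemma weval_gen: "x \<in> S \<Longrightarrow> weval G \<phi> [(x, True)] = \<phi> x"
  using \<phi>[of x] by (simp add: weval_def)

text \<open>In a commutative group the two letters may be brought together across
  \<open>u\<close>.\<close>

lemma weval_cancel:
  assumes comm: "comm_group G" and "fst a \<in> S" "fst ` set u \<subseteq> S" "fst ` set v \<subseteq> S"
  shows "weval G \<phi> (a # u @ inv_letter a # v) = weval G \<phi> (u @ v)"
proof -
  interpret C: comm_group G by (rule comm)
  have cl: "lt a \<in> carrier G" "lt (inv_letter a) \<in> carrier G" "weval G \<phi> u \<in> carrier G" "weval G \<phi> v \<in> carrier G"
    using assms by (auto simp: lt weval_closed)
  have "weval G \<phi> (a # u @ inv_letter a # v) = lt a \<otimes>\<^bsub>G\<^esub> (weval G \<phi> u \<otimes>\<^bsub>G\<^esub> (lt (inv_letter a) \<otimes>\<^bsub>G\<^esub> weval G \<phi> v))"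
    using assms by (simp add: weval_Cons weval_append)
  also have "\<dots> = (lt a \<otimes>\<^bsub>G\<^esub> lt (inv_letter a)) \<otimes>\<^bsub>G\<^esub> (weval G \<phi> u \<otimes>\<^bsub>G\<^esub> weval G \<phi> v)"
    using cl by (simp add: C.m_ac)
  finally show ?thesis using assms cl by (simp add: lt weval_append)
qed

end

section \<open>Exponent sums and the commutator subgroup\<close>

definition lclass :: "nat \<times> bool \<Rightarrow> (nat \<Rightarrow>\<^sub>0 rat)" where
  "lclass a = single (fst a) (if snd a then 1 else - 1)"

lemma hclass_Nil [simp]: "hclass [] = 0" and hclass_Cons [simp]: "hclass (a # w) = lclass a + hclass w"
  by (auto simp: hclass_def lclass_def split: prod.splits)

lemma lclass_inv [simp]: "lclass (inv_letter a) = - lclass a"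
  by (simp add: lclass_def single_uminus)

lemma hclass_push: "hclass (push a w) = lclass a + hclass w"
  by (cases w) auto

lemma hclass_act: "hclass (foldr push u v) = hclass u + hclass v"
  by (induction u) (auto simp: hclass_push)

text \<open>Without the inverse letter, all occurrences of the generator of \<open>a\<close> count
  with the same sign, so they cannot cancel.\<close>

lemma hclass_sign:
  assumes "inv_letter a \<notin> set w"
  shows "(if snd a then 1 else - 1) * lookup (hclass w) (fst a) \<ge> 0"
  using assms
proof (induction w)
  case (Cons b w)
  have "(if snd a then 1 else - 1) * lookup (lclass b) (fst a) \<ge> 0"
    using Cons.prems by (cases a; cases b) (auto simp: lclass_def lookup_single inv_letter_def when_def)
  then show ?case using Cons by (simp add: lookup_add distrib_left)
qed simp

lemma hclass_cancel:
  assumes "hclass (a # w) = 0"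
  shows "inv_letter a \<in> set w"
proof (rule ccontr)
  assume "inv_letter a \<notin> set w"
  from hclass_sign[OF this] have "(if snd a then 1 else - 1) * lookup (hclass (a # w)) (fst a) > 0"
    by (simp add: lookup_add lclass_def lookup_single distrib_left add_pos_nonneg split: if_splits)
  then show False using assms by simp
qed

text \<open>If all exponent sums vanish, the first letter has its inverse further on; deleting this
  pair changes neither the exponent sums nor the value in a commutative group.\<close>

lemma weval_hclass_0:
  assumes G: "comm_group G" and \<phi>: "\<And>x. x \<in> S \<Longrightarrow> \<phi> x \<in> carrier G"
    and "fst ` set w \<subseteq> S" "hclass w = 0"
  shows "weval G \<phi> w = \<one>\<^bsub>G\<^esub>"
  using assms(3,4)
proof (induction w rule: length_induct)
  case (1 w)
  show ?case
  proof (cases w)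
    case Nil
    then show ?thesis by (simp add: weval_def)
  next
    case (Cons a w')
    then obtain u v where w': "w' = u @ inv_letter a # v"
      using hclass_cancel[of a w'] "1.prems"(2) split_list[of "inv_letter a" w'] by auto
    have h: "hclass (u @ v) = hclass u + hclass v" for u v by (induction u) auto
    have "hclass (u @ v) = 0" using "1.prems"(2) by (simp add: Cons w' h)
    moreover have "fst ` set (u @ v) \<subseteq> S" using "1.prems"(1) by (auto simp: Cons w')
    ultimately have "weval G \<phi> (u @ v) = \<one>\<^bsub>G\<^esub>" using "1.IH" by (simp add: Cons w')
    moreover have "weval G \<phi> w = weval G \<phi> (u @ v)"
      unfolding Cons w'
      by (rule weval_cancel[OF comm_group.axioms(2)[OF G] \<phi> G]) (use "1.prems"(1) in \<open>auto simp: Cons w'\<close>)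
    ultimately show ?thesis by simp
  qed
qed

lemma ab_proj_hom: "group G \<Longrightarrow> ab_proj G \<in> hom G (abelianization G)"
  using normal.r_coset_hom_Mod[OF group.derived_self_is_normal] by (simp add: ab_proj_def[abs_def] abelianization_def)

lemma ab_proj_eq_iff:
  assumes "group G" "x \<in> carrier G" "y \<in> carrier G"
  shows "ab_proj G x = ab_proj G y \<longleftrightarrow> x \<otimes>\<^bsub>G\<^esub> inv\<^bsub>G\<^esub> y \<in> derived G (carrier G)"
proof -
  interpret group G by (rule assms(1))
  let ?D = "derived G (carrier G)"
  have D: "subgroup ?D G" by (rule derived_is_subgroup) simp
  have "?D #>\<^bsub>G\<^esub> x = ?D #>\<^bsub>G\<^esub> y \<longleftrightarrow> x \<in> ?D #>\<^bsub>G\<^esub> y"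
    using repr_independence[OF _ assms(3) D, of x] rcos_self[OF assms(2) D] by auto
  then show ?thesis
    using subgroup.rcos_module[OF D is_group assms(3,2)] by (simp add: ab_proj_def)
qed

lemma free_hclass_inv: "x \<in> carrier (free_grp S) \<Longrightarrow> hclass (inv\<^bsub>free_grp S\<^esub> x) = - hclass x"
  using group.l_inv[OF group_free_grp, of x S] hclass_act[of "inv\<^bsub>free_grp S\<^esub> x" x]
  by (simp add: eq_neg_iff_add_eq_0)

text \<open>Commutators have exponent sums zero. Conversely, the projection to the abelianization is
  determined on generators, and in a commutative group a word with exponent sums zero evaluates to
  the identity.\<close>

lemma derived_free_iff:
  fixes S :: "nat set"
  assumes w: "w \<in> carrier (free_grp S)"
  shows "w \<in> derived (free_grp S) (carrier (free_grp S)) \<longleftrightarrow> hclass w = 0"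
proof
  let ?G = "free_grp S"
  interpret group ?G by simp
  have sub: "subgroup {w \<in> carrier ?G. hclass w = 0} ?G"
  proof (rule subgroupI)
    show "{w \<in> carrier ?G. hclass w = 0} \<noteq> {}" using one_closed by (auto intro!: exI[of _ "[]"])
    show "inv\<^bsub>?G\<^esub> a \<in> {w \<in> carrier ?G. hclass w = 0}" if "a \<in> {w \<in> carrier ?G. hclass w = 0}" for a
      using that free_hclass_inv[of a S] inv_closed[of a] by auto
    show "a \<otimes>\<^bsub>?G\<^esub> b \<in> {w \<in> carrier ?G. hclass w = 0}"
      if "a \<in> {w \<in> carrier ?G. hclass w = 0}" "b \<in> {w \<in> carrier ?G. hclass w = 0}" for a b
      using that m_closed[of a b] by (auto simp: hclass_act)
  qed auto
  have "h1 \<otimes>\<^bsub>?G\<^esub> h2 \<otimes>\<^bsub>?G\<^esub> inv\<^bsub>?G\<^esub> h1 \<otimes>\<^bsub>?G\<^esub> inv\<^bsub>?G\<^esub> h2 \<in> {w \<in> carrier ?G. hclass w = 0}"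
    if "h1 \<in> carrier ?G" "h2 \<in> carrier ?G" for h1 h2
  proof -
    have "h1 \<otimes>\<^bsub>?G\<^esub> h2 \<otimes>\<^bsub>?G\<^esub> inv\<^bsub>?G\<^esub> h1 \<otimes>\<^bsub>?G\<^esub> inv\<^bsub>?G\<^esub> h2 \<in> carrier ?G"
      using that by (intro m_closed inv_closed)
    moreover have "hclass (h1 \<otimes>\<^bsub>?G\<^esub> h2 \<otimes>\<^bsub>?G\<^esub> inv\<^bsub>?G\<^esub> h1 \<otimes>\<^bsub>?G\<^esub> inv\<^bsub>?G\<^esub> h2) = 0"
      using that free_hclass_inv[of _ S] by (simp only: free_grp_simps(2) hclass_act) simp
    ultimately show ?thesis by blast
  qed
  then have "derived_set ?G (carrier ?G) \<subseteq> {w \<in> carrier ?G. hclass w = 0}" by blast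
  from generate_subgroup_incl[OF this sub]
  show "w \<in> derived ?G (carrier ?G) \<Longrightarrow> hclass w = 0" by (auto simp: derived_def)
next
  let ?G = "free_grp S" and ?A = "abelianization (free_grp S)"
  interpret group ?G by simp
  assume h: "hclass w = 0"
  have A: "comm_group ?A" unfolding abelianization_def by (rule derived_quot_is_comm_group)
  note gA = comm_group.axioms(2)[OF A]
  define \<phi> where "\<phi> = (\<lambda>x. ab_proj ?G [(x, True)])"
  have pr: "ab_proj ?G \<in> hom ?G ?A" by (rule ab_proj_hom) simp
  have \<phi>: "\<phi> x \<in> carrier ?A" if "x \<in> S" for x
    using pr letter_cases(1)[OF that] by (auto simp: hom_def \<phi>_def)
  \<comment> \<open>By the universal property, the projection is the evaluation of words at the
    classes of the generators.\<close>
  have "ab_proj ?G w = weval ?A \<phi> w"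
    by (rule free_hom_eq[OF gA pr weval_hom[OF gA \<phi>] _ w]) (simp_all add: weval_gen[OF gA \<phi>], simp add: \<phi>_def)
  also have "\<dots> = \<one>\<^bsub>?A\<^esub>" by (rule weval_hclass_0[OF A \<phi>]) (use w h in auto)
  also have "\<dots> = ab_proj ?G []"
    using group_hom.hom_one[of ?G ?A "ab_proj ?G"] pr gA by (simp add: group_hom_def group_hom_axioms_def)
  finally have "w \<otimes>\<^bsub>?G\<^esub> inv\<^bsub>?G\<^esub> [] \<in> derived ?G (carrier ?G)"
    by (subst ab_proj_eq_iff[symmetric]) (use w in auto)
  moreover have "w \<otimes>\<^bsub>?G\<^esub> inv\<^bsub>?G\<^esub> [] = w" using inv_one r_one[OF w] by simp
  ultimately show "w \<in> derived ?G (carrier ?G)" by simp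
qed

section \<open>The second order invariant\<close>

lemma wnfH_minus: "wnfH [- x, y] = - wnfH [x, y]" "wnfH [x, - y] = - wnfH [x, y]"
  using wnfH_bilinear(3)[of "- 1" x y] wnfH_bilinear(4)[of x "- 1" y] by (simp_all add: sc_minus_left)

lemma wnfH_0 [simp]: "wnfH [0, y] = 0" "wnfH [x, 0] = 0"
  using wnfH_bilinear(3)[of 0 0 y] wnfH_bilinear(4)[of x 0 0] by simp_all

lemma wnfH_swap: "wnfH [x, y] = - wnfH [y, x]"
proof -
  have "0 = wnfH [x + y, x + y]" by (rule wnfH_bilinear(5)[symmetric])
  also have "\<dots> = wnfH [x, y] + wnfH [y, x]" by (simp only: wnfH_bilinear(1,2)) (simp add: wnfH_bilinear(5))
  finally have "wnfH [x, y] + wnfH [y, x] = 0" by (rule sym)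
  then show ?thesis by (simp add: eq_neg_iff_add_eq_0)
qed

text \<open>The second order term of the Magnus expansion, antisymmetrized: the sum of
  \<open>[a\<^sub>i] \<and> [a\<^sub>j]\<close> over all pairs of letters with \<open>i < j\<close>.\<close>

fun quad :: "nat word \<Rightarrow> ((nat \<Rightarrow>\<^sub>0 rat) list \<Rightarrow>\<^sub>0 rat)" where
  "quad [] = 0"
| "quad (a # w) = wnfH [lclass a, hclass w] + quad w"

lemma quad_push: "quad (push a w) = wnfH [lclass a, hclass w] + quad w"
proof (cases w)
  case (Cons b u)
  then show ?thesis by (auto simp: wnfH_bilinear wnfH_minus)
qed simp

text \<open>\<open>quad\<close> fails to be additive exactly by the wedge of the two classes. It is
  therefore additive on the commutator subgroup, while on a commutator the defects add up to twice
  the wedge.\<close>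

lemma quad_act: "quad (foldr push u v) = quad u + quad v + wnfH [hclass u, hclass v]"
  by (induction u) (auto simp: quad_push hclass_act wnfH_bilinear algebra_simps)

lemma keys_quad: "keys (quad w) \<subseteq> lists_in 2 H_inf" and nf_qq: "nf R2 (quad w) = quad w"
proof -
  have "quad w \<in> {c. keys c \<subseteq> lists_in 2 H_inf}"
  proof (induction w)
    case (Cons a w)
    have "keys (wnfH [lclass a, hclass w]) \<subseteq> lists_in 2 H_inf" by (rule keys_wnf) (simp_all add: lists_in_H_inf)
    then show ?case using subsp_add[OF subsp_keys, of "wnfH [lclass a, hclass w]" _ "quad w"] Cons by simp
  qed simp
  then show "keys (quad w) \<subseteq> lists_in 2 H_inf" by simp
  show "nf R2 (quad w) = quad w"
    by (induction w) (simp_all add: lin_0[OF lin_nf] lin_add[OF lin_nf] nf_wnf)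
qed

lemma F_inf_simps: "carrier F_inf = {w. reduced w}" "u \<otimes>\<^bsub>F_inf\<^esub> v = foldr push u v" "\<one>\<^bsub>F_inf\<^esub> = []"
  by (simp_all add: F_inf_def)

lemma group_F_inf [simp]: "group F_inf" and group_F [simp]: "group (F n)"
  by (simp_all add: F_inf_def F_def)

interpretation FI: group F_inf by simp

abbreviation "CF \<equiv> carrier F_inf"
abbreviation "DF \<equiv> derived F_inf CF"

lemma DF_iff: "w \<in> CF \<Longrightarrow> w \<in> DF \<longleftrightarrow> hclass w = 0"
  using derived_free_iff[of w UNIV] by (simp add: F_inf_def)

lemma hclass_mult: "hclass (u \<otimes>\<^bsub>F_inf\<^esub> v) = hclass u + hclass v"
  and quad_mult: "quad (u \<otimes>\<^bsub>F_inf\<^esub> v) = quad u + quad v + wnfH [hclass u, hclass v]"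
  by (simp_all add: F_inf_simps hclass_act quad_act)

lemma hclass_inv: "x \<in> CF \<Longrightarrow> hclass (inv\<^bsub>F_inf\<^esub> x) = - hclass x"
  using free_hclass_inv[of x UNIV] by (simp add: F_inf_def)

lemma quad_inv: "x \<in> CF \<Longrightarrow> quad (inv\<^bsub>F_inf\<^esub> x) = - quad x"
  using quad_mult[of "inv\<^bsub>F_inf\<^esub> x" x]
  by (simp add: hclass_inv wnfH_minus wnfH_bilinear F_inf_simps(3) eq_neg_iff_add_eq_0)

lemma DF_subset: "DF \<subseteq> CF"
  by (rule FI.derived_in_carrier) simp

lemma DF_hclass: "w \<in> DF \<Longrightarrow> hclass w = 0"
  using DF_iff DF_subset by blast

text \<open>The factor 1/2 normalizes the value on a commutator to a single wedge.\<close>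

definition kappa :: "nat word \<Rightarrow> ((nat \<Rightarrow>\<^sub>0 rat) list \<Rightarrow>\<^sub>0 rat)" where
  "kappa w = sc (1 / 2) (quad w)"

lemma keys_kappa: "keys (kappa w) \<subseteq> lists_in 2 H_inf"
  using subsp_sc[OF subsp_keys, of "quad w" "lists_in 2 H_inf" "1 / 2"] keys_quad[of w] by (simp add: kappa_def)

lemma kappa_commutator:
  assumes "x \<in> CF" "y \<in> CF"
  shows "cst R2 (kappa (x \<otimes>\<^bsub>F_inf\<^esub> y \<otimes>\<^bsub>F_inf\<^esub> inv\<^bsub>F_inf\<^esub> x \<otimes>\<^bsub>F_inf\<^esub> inv\<^bsub>F_inf\<^esub> y)) = wedge H_inf [hclass x, hclass y]"
proof -
  have "quad (x \<otimes>\<^bsub>F_inf\<^esub> y \<otimes>\<^bsub>F_inf\<^esub> inv\<^bsub>F_inf\<^esub> x \<otimes>\<^bsub>F_inf\<^esub> inv\<^bsub>F_inf\<^esub> y)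
      = wnfH [hclass x, hclass y] + wnfH [hclass x, hclass y]"
    using assms wnfH_swap[of "hclass y" "hclass x"]
    by (simp add: quad_mult hclass_mult hclass_inv quad_inv wnfH_bilinear wnfH_minus)
  also have "\<dots> = sc 2 (wnfH [hclass x, hclass y])" using sc_add_left[of 1 1 "wnfH [hclass x, hclass y]"] by simp
  finally show ?thesis by (simp add: kappa_def wedge_cst[of _ 2] wnf_def cst_nf)
qed

text \<open>\<open>kappa\<close> shows that the choice in \<open>comm_class\<close> is possible, and
  commutators generate, so any choice coincides with it on the commutator subgroup.\<close>

lemma comm_class_eq:
  assumes "w \<in> DF"
  shows "comm_class w = cst R2 (kappa w)"
proof -
  let ?P = "\<lambda>\<kappa>. \<kappa> \<in> hom (F_inf\<lparr>carrier := DF\<rparr>) (add_monoid (ext_pow 2 H_inf)) \<and>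
     (\<forall>x\<in>CF. \<forall>y\<in>CF. \<kappa> (x \<otimes>\<^bsub>F_inf\<^esub> y \<otimes>\<^bsub>F_inf\<^esub> inv\<^bsub>F_inf\<^esub> x \<otimes>\<^bsub>F_inf\<^esub> inv\<^bsub>F_inf\<^esub> y)
          = wedge H_inf [hclass x, hclass y])"
  have k: "?P (\<lambda>w. cst R2 (kappa w))"
  proof (intro conjI ballI kappa_commutator)
    show "(\<lambda>w. cst R2 (kappa w)) \<in> hom (F_inf\<lparr>carrier := DF\<rparr>) (add_monoid (ext_pow 2 H_inf))"
    proof (rule homI)
      fix u v assume uv: "u \<in> carrier (F_inf\<lparr>carrier := DF\<rparr>)" "v \<in> carrier (F_inf\<lparr>carrier := DF\<rparr>)"
      show "cst R2 (kappa u) \<in> carrier (add_monoid (ext_pow 2 H_inf))"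
        using keys_kappa by (auto simp: carrier_ext_pow)
      show "cst R2 (kappa (u \<otimes>\<^bsub>F_inf\<lparr>carrier := DF\<rparr>\<^esub> v))
          = cst R2 (kappa u) \<otimes>\<^bsub>add_monoid (ext_pow 2 H_inf)\<^esub> cst R2 (kappa v)"
        using uv by (simp add: add_ext_pow kappa_def quad_mult DF_hclass sc_add_right)
    qed
  qed
  have P: "?P comm_class" unfolding comm_class_def by (rule someI[of ?P, OF k])
  have Dsub: "subgroup DF F_inf" by (rule FI.derived_is_subgroup) simp
  have one: "DF = generate F_inf (derived_set F_inf CF)" by (simp add: derived_def)
  show ?thesis
    using assms unfolding one
  proof (induction w rule: generate.induct)
    case one
    \<comment> \<open>The identity is treated as a commutator of identities, so that the prescribed
      values apply to it.\<close>
    have "comm_class (\<one>\<^bsub>F_inf\<^esub> \<otimes>\<^bsub>F_inf\<^esub> \<one>\<^bsub>F_inf\<^esub> \<otimes>\<^bsub>F_inf\<^esub> inv\<^bsub>F_inf\<^esub> \<one>\<^bsub>F_inf\<^esub> \<otimes>\<^bsub>F_inf\<^esub> inv\<^bsub>F_inf\<^esub> \<one>\<^bsub>F_inf\<^esub>)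
        = cst R2 (kappa (\<one>\<^bsub>F_inf\<^esub> \<otimes>\<^bsub>F_inf\<^esub> \<one>\<^bsub>F_inf\<^esub> \<otimes>\<^bsub>F_inf\<^esub> inv\<^bsub>F_inf\<^esub> \<one>\<^bsub>F_inf\<^esub> \<otimes>\<^bsub>F_inf\<^esub> inv\<^bsub>F_inf\<^esub> \<one>\<^bsub>F_inf\<^esub>))"
      using P kappa_commutator[OF FI.one_closed FI.one_closed] FI.one_closed by metis
    then show ?case by simp
  next
    case (incl h)
    then show ?case using P kappa_commutator by auto
  next
    case (inv h)
    then obtain x y where xy: "x \<in> CF" "y \<in> CF"
      "h = x \<otimes>\<^bsub>F_inf\<^esub> y \<otimes>\<^bsub>F_inf\<^esub> inv\<^bsub>F_inf\<^esub> x \<otimes>\<^bsub>F_inf\<^esub> inv\<^bsub>F_inf\<^esub> y" by auto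
    \<comment> \<open>The inverse of a commutator is the commutator with exchanged
      arguments.\<close>
    then have "inv\<^bsub>F_inf\<^esub> h = y \<otimes>\<^bsub>F_inf\<^esub> x \<otimes>\<^bsub>F_inf\<^esub> inv\<^bsub>F_inf\<^esub> y \<otimes>\<^bsub>F_inf\<^esub> inv\<^bsub>F_inf\<^esub> x"
      by (simp add: FI.inv_mult_group FI.m_assoc)
    then show ?case using P kappa_commutator xy by metis
  next
    case (eng u v)
    then have uv: "u \<in> DF" "v \<in> DF" unfolding one by auto
    then have "comm_class (u \<otimes>\<^bsub>F_inf\<^esub> v) = comm_class u \<oplus>\<^bsub>ext_pow 2 H_inf\<^esub> comm_class v"
      using P by (auto simp: hom_def)
    also have "\<dots> = cst R2 (kappa (u \<otimes>\<^bsub>F_inf\<^esub> v))"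
      using uv by (simp add: eng.IH add_ext_pow kappa_def quad_mult DF_hclass sc_add_right)
    finally show ?case .
  qed
qed

section \<open>IA-automorphisms\<close>

lemma gen_in [simp]: "gen j \<in> CF"
  by (simp add: gen_def F_inf_simps)

lemma carrier_F: "carrier (F n) = {w. reduced w \<and> fst ` set w \<subseteq> {..<n}}"
  by (simp add: F_def)

lemma F_subset: "carrier (F n) \<subseteq> CF" and F_mono: "n \<le> m \<Longrightarrow> carrier (F n) \<subseteq> carrier (F m)"
  and gen_in_F [simp]: "gen j \<in> carrier (F n) \<longleftrightarrow> j < n"
  by (auto simp: carrier_F F_inf_simps gen_def)

lemma F_mult: "u \<otimes>\<^bsub>F n\<^esub> v = u \<otimes>\<^bsub>F_inf\<^esub> v"
  by (simp add: F_def F_inf_def)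

lemma F_inv: "x \<in> carrier (F n) \<Longrightarrow> inv\<^bsub>F_inf\<^esub> x = inv\<^bsub>F n\<^esub> x"
  by (rule FI.inv_equality)
    (use group.l_inv[OF group_F, of x n] group.inv_closed[OF group_F, of x n] F_subset in
      \<open>auto simp: F_mult F_inf_simps(2,3) F_def\<close>)

lemma F_closed:
  "u \<in> carrier (F n) \<Longrightarrow> v \<in> carrier (F n) \<Longrightarrow> u \<otimes>\<^bsub>F_inf\<^esub> v \<in> carrier (F n)"
  "u \<in> carrier (F n) \<Longrightarrow> inv\<^bsub>F_inf\<^esub> u \<in> carrier (F n)"
  using monoid.m_closed[OF group.is_monoid[OF group_F], of u n v] group.inv_closed[OF group_F, of u n]
  by (simp_all add: F_inv F_mult)

lemma inv_gen: "[(j, False)] = inv\<^bsub>F_inf\<^esub> gen j"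
  using letter_cases(2)[of j UNIV] by (simp add: F_inf_def gen_def)

lemma hom_F_inf:
  assumes "f \<in> hom F_inf F_inf"
  shows "x \<in> CF \<Longrightarrow> f x \<in> CF" "x \<in> CF \<Longrightarrow> y \<in> CF \<Longrightarrow> f (x \<otimes>\<^bsub>F_inf\<^esub> y) = f x \<otimes>\<^bsub>F_inf\<^esub> f y"
    "x \<in> CF \<Longrightarrow> f (inv\<^bsub>F_inf\<^esub> x) = inv\<^bsub>F_inf\<^esub> f x" "f [] = []"
proof -
  interpret f: group_hom F_inf F_inf f by (intro group_hom.intro group_hom_axioms.intro assms) simp_all
  show "x \<in> CF \<Longrightarrow> f x \<in> CF" "x \<in> CF \<Longrightarrow> y \<in> CF \<Longrightarrow> f (x \<otimes>\<^bsub>F_inf\<^esub> y) = f x \<otimes>\<^bsub>F_inf\<^esub> f y"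
    "x \<in> CF \<Longrightarrow> f (inv\<^bsub>F_inf\<^esub> x) = inv\<^bsub>F_inf\<^esub> f x"
    by (rule f.hom_closed f.hom_mult f.hom_inv; assumption)+
  show "f [] = []" using f.hom_one by (simp add: F_inf_simps)
qed

lemma hom_into_F:
  assumes f: "f \<in> hom F_inf F_inf" and g: "\<And>j. j < n \<Longrightarrow> f (gen j) \<in> carrier (F m)"
    and x: "x \<in> carrier (F n)"
  shows "f x \<in> carrier (F m)"
  using x unfolding F_def[of n]
proof (induction x rule: free_induct)
  case Nil
  show ?case by (simp add: hom_F_inf(4)[OF f] carrier_F)
next
  case (Cons a w)
  have "f [a] \<in> carrier (F m)"
  proof (cases a)
    case (Pair j b)
    then have "f (gen j) \<in> carrier (F m)" using Cons(1) g by simp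
    then show ?thesis
      using hom_F_inf(3)[OF f gen_in] inv_gen[of j] F_closed(2)
      by (cases b) (simp_all add: Pair, simp add: gen_def)
  qed
  moreover have "[a] \<in> CF" "w \<in> CF" using Cons by (auto simp: F_inf_simps)
  ultimately show ?case
    using hom_F_inf(2)[OF f, of "[a]" w] F_closed(1)[of "f [a]" m "f w"] Cons by (simp add: F_inf_simps(2))
qed

lemma hom_eq_gen:
  assumes "f \<in> hom F_inf F_inf" "g \<in> hom F_inf F_inf" "\<And>j. f (gen j) = g (gen j)" "x \<in> CF"
  shows "f x = g x"
  using free_hom_eq[of F_inf f UNIV g x] assms by (simp add: F_inf_def gen_def)

text \<open>A homomorphism to a rational vector space factors through the class of the word. It is
  applied below to the class itself, to \<open>quad_diff\<close> and to the defect of naturality of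
  \<open>quad\<close>.\<close>

lemma additive_hclass:
  assumes add: "\<And>x y. x \<in> CF \<Longrightarrow> y \<in> CF \<Longrightarrow> D (x \<otimes>\<^bsub>F_inf\<^esub> y) = D x + D y" and x: "x \<in> CF"
  shows "D x = lin_ext (\<lambda>j. D (gen j)) (hclass x)"
proof -
  have D1: "D [] = 0" using add[of "[]" "[]"] by (simp add: F_inf_simps)
  have Dinv: "D (inv\<^bsub>F_inf\<^esub> y) = - D y" if "y \<in> CF" for y
    using add[of "inv\<^bsub>F_inf\<^esub> y" y] that D1 by (simp add: F_inf_simps(3) eq_neg_iff_add_eq_0)
  show ?thesis
    using x unfolding F_inf_def
  proof (induction x rule: free_induct)
    case Nil
    show ?case by (simp add: D1)
  next
    case (Cons a w)
    have "D [a] = lin_ext (\<lambda>j. D (gen j)) (lclass a)"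
    proof (cases a)
      case (Pair j b)
      then show ?thesis
        using Dinv[OF gen_in, of j] inv_gen[of j]
        by (cases b) (simp_all add: lclass_def sc_minus_left, simp add: gen_def)
    qed
    moreover have "[a] \<in> CF" "w \<in> CF" using Cons by (auto simp: F_inf_simps)
    ultimately show ?case
      using add[of "[a]" w] Cons by (simp add: F_inf_simps(2) hclass_push lin_ext_add)
  qed
qed

lemma hclass_gen [simp]: "hclass (gen j) = e j" and quad_gen [simp]: "quad (gen j) = 0"
  by (simp_all add: gen_def lclass_def e_def)

abbreviation endo :: "(nat \<Rightarrow> nat word) \<Rightarrow> nat word \<Rightarrow> nat word" where
  "endo \<equiv> weval F_inf"

lemma endo_hom: "(\<And>j. \<sigma> j \<in> CF) \<Longrightarrow> endo \<sigma> \<in> hom F_inf F_inf"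
  using weval_hom[of F_inf UNIV \<sigma>] by (simp add: F_inf_def)

lemma endo_gen: "(\<And>j. \<sigma> j \<in> CF) \<Longrightarrow> endo \<sigma> (gen j) = \<sigma> j"
  using weval_gen[of F_inf UNIV \<sigma> j] by (simp add: gen_def)

text \<open>Carries the inverse along, so that the finiteness conditions are symmetric and no
  inverse has to be constructed later.\<close>

definition aut_pair :: "(nat word \<Rightarrow> nat word) \<Rightarrow> (nat word \<Rightarrow> nat word) \<Rightarrow> nat \<Rightarrow> bool" where
  "aut_pair f g n \<longleftrightarrow> f \<in> hom F_inf F_inf \<and> g \<in> hom F_inf F_inf \<and> (\<forall>x\<in>CF. f (g x) = x \<and> g (f x) = x) \<and>
     (\<forall>j<n. f (gen j) \<in> carrier (F n) \<and> g (gen j) \<in> carrier (F n)) \<and>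
     (\<forall>j\<ge>n. f (gen j) = gen j \<and> g (gen j) = gen j)"

lemma aut_pair_sym: "aut_pair f g n \<Longrightarrow> aut_pair g f n"
  by (auto simp: aut_pair_def)

lemma aut_pair_mono:
  assumes "aut_pair f g n" "n \<le> m"
  shows "aut_pair f g m"
proof -
  have "f (gen j) \<in> carrier (F m) \<and> g (gen j) \<in> carrier (F m)" if "j < m" for j
    using assms F_mono[OF assms(2)] that by (cases "j < n") (auto simp: aut_pair_def)
  then show ?thesis using assms by (auto simp: aut_pair_def)
qed

lemma hom_comp_F_inf: "f \<in> hom F_inf F_inf \<Longrightarrow> g \<in> hom F_inf F_inf \<Longrightarrow> (\<lambda>x. f (g x)) \<in> hom F_inf F_inf"
  by (rule homI) (simp_all add: hom_F_inf)

lemma aut_pair_F: "aut_pair f g n \<Longrightarrow> x \<in> carrier (F n) \<Longrightarrow> f x \<in> carrier (F n)"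
  unfolding aut_pair_def by (rule hom_into_F[of f n n]) blast+

lemma aut_pair_comp:
  assumes "aut_pair f g n" "aut_pair f' g' n"
  shows "aut_pair (\<lambda>x. f (f' x)) (\<lambda>x. g' (g x)) n"
proof -
  have "f (f' (gen j)) \<in> carrier (F n)" "g' (g (gen j)) \<in> carrier (F n)" if "j < n" for j
    using aut_pair_F[OF assms(1), of "f' (gen j)"] aut_pair_F[OF assms(2), of "gen j"]
      aut_pair_F[OF aut_pair_sym[OF assms(2)], of "g (gen j)"] aut_pair_F[OF aut_pair_sym[OF assms(1)], of "gen j"] that
    by simp_all
  then show ?thesis
    using assms by (auto simp: aut_pair_def hom_comp_F_inf hom_F_inf(1))
qed

abbreviation "CI \<equiv> carrier IA_inf"

lemma carrier_IA_inf: "CI = {f \<in> auto F_inf. \<exists>n. restrict f (carrier (F n)) \<in> carrier (IA n) \<and> (\<forall>j\<ge>n. f (gen j) = gen j)}"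
  by (simp add: IA_inf_def)

lemma carrier_IA: "carrier (IA n) = {f \<in> auto (F n). \<forall>x\<in>carrier (F n). ab_proj (F n) (f x) = ab_proj (F n) x}"
  by (simp add: IA_def)

lemma ab_proj_F_iff:
  assumes "x \<in> carrier (F n)" "y \<in> carrier (F n)"
  shows "ab_proj (F n) x = ab_proj (F n) y \<longleftrightarrow> hclass x = hclass y"
proof -
  have "x \<otimes>\<^bsub>F_inf\<^esub> inv\<^bsub>F_inf\<^esub> y \<in> carrier (F n)" using assms by (intro F_closed)
  then have "x \<otimes>\<^bsub>F n\<^esub> inv\<^bsub>F n\<^esub> y \<in> derived (F n) (carrier (F n)) \<longleftrightarrow> hclass (x \<otimes>\<^bsub>F_inf\<^esub> inv\<^bsub>F_inf\<^esub> y) = 0"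
    using derived_free_iff[of "x \<otimes>\<^bsub>F_inf\<^esub> inv\<^bsub>F_inf\<^esub> y" "{..<n}"] assms(2)
    by (simp only: F_def[symmetric] F_mult F_inv)
  then show ?thesis
    using ab_proj_eq_iff[OF group_F assms] hclass_inv[of y] assms(2) F_subset[of n]
    by (auto simp: hclass_mult)
qed

text \<open>The restriction makes the map extensional outside the carrier, as membership in
  \<open>auto\<close> requires.\<close>

lemma IA_memI:
  assumes a: "aut_pair f g n" and h: "\<And>x. x \<in> CF \<Longrightarrow> hclass (f x) = hclass x"
  shows "restrict f CF \<in> CI"
proof -
  let ?f = "restrict f CF"
  have f: "f \<in> hom F_inf F_inf" and g: "g \<in> hom F_inf F_inf"
    and fg: "\<And>x. x \<in> CF \<Longrightarrow> f (g x) = x" "\<And>x. x \<in> CF \<Longrightarrow> g (f x) = x"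
    using a by (auto simp: aut_pair_def)
  have fn: "f x \<in> carrier (F n)" "g x \<in> carrier (F n)" if "x \<in> carrier (F n)" for x
    using aut_pair_F[OF a that] aut_pair_F[OF aut_pair_sym[OF a] that] by simp_all
  have "bij_betw ?f CF CF"
    by (rule bij_betw_byWitness[of _ g]) (auto simp: fg hom_F_inf(1)[OF f] hom_F_inf(1)[OF g])
  moreover have "?f \<in> hom F_inf F_inf"
    by (rule homI) (simp_all add: hom_F_inf[OF f])
  ultimately have "?f \<in> auto F_inf" by (simp add: auto_def Bij_def)
  moreover have "restrict ?f (carrier (F n)) \<in> carrier (IA n)"
  proof -
    have eq: "restrict ?f (carrier (F n)) = restrict f (carrier (F n))"
      using F_subset by (auto simp: restrict_def fun_eq_iff)
    have "bij_betw (restrict f (carrier (F n))) (carrier (F n)) (carrier (F n))"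
      by (rule bij_betw_byWitness[of _ g]) (use fg F_subset fn in auto)
    moreover have "restrict f (carrier (F n)) \<in> hom (F n) (F n)"
    proof (rule homI)
      fix x y assume xy: "x \<in> carrier (F n)" "y \<in> carrier (F n)"
      show "restrict f (carrier (F n)) x \<in> carrier (F n)" using xy fn by simp
      show "restrict f (carrier (F n)) (x \<otimes>\<^bsub>F n\<^esub> y)
          = restrict f (carrier (F n)) x \<otimes>\<^bsub>F n\<^esub> restrict f (carrier (F n)) y"
        using xy F_closed(1)[OF xy] F_subset hom_F_inf(2)[OF f, of x y] by (auto simp: F_mult)
    qed
    moreover have "ab_proj (F n) (f x) = ab_proj (F n) x" if "x \<in> carrier (F n)" for x
      using that fn h[OF subsetD[OF F_subset that]] by (subst ab_proj_F_iff) auto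
    ultimately show ?thesis unfolding eq by (simp add: carrier_IA auto_def Bij_def)
  qed
  moreover have "?f (gen j) = gen j" if "j \<ge> n" for j using a that by (simp add: aut_pair_def)
  ultimately show ?thesis by (auto simp: carrier_IA_inf)
qed

lemma IA_memD:
  assumes f: "f \<in> CI"
  obtains g n where "aut_pair f g n" "\<And>x. x \<in> CF \<Longrightarrow> hclass (f x) = hclass x" "f \<in> extensional CF"
proof -
  from f obtain n where n: "restrict f (carrier (F n)) \<in> carrier (IA n)" "\<And>j. j \<ge> n \<Longrightarrow> f (gen j) = gen j"
    and auto: "f \<in> auto F_inf" by (auto simp: carrier_IA_inf)
  have hom: "f \<in> hom F_inf F_inf" and bij: "bij_betw f CF CF" and ext: "f \<in> extensional CF"
    using auto by (auto simp: auto_def Bij_def)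
  define g where "g = restrict (inv_into CF f) CF"
  have g: "g \<in> hom F_inf F_inf"
    unfolding g_def using auto by (intro FI.restrict_inv_into_hom) (auto simp: auto_def)
  have fg: "f (g x) = x" "g (f x) = x" if "x \<in> CF" for x
    using bij that hom_F_inf(1)[OF hom that]
    by (simp_all add: g_def bij_betw_inv_into_right bij_betw_inv_into_left)
  have "bij_betw (restrict f (carrier (F n))) (carrier (F n)) (carrier (F n))"
    using n(1) by (simp add: carrier_IA auto_def Bij_def)
  then have im: "f ` carrier (F n) = carrier (F n)" by (simp add: bij_betw_def)
  have a: "aut_pair f g n"
    unfolding aut_pair_def
  proof (intro conjI ballI allI impI hom g fg n(2))
    fix j assume j: "j < n"
    then show "f (gen j) \<in> carrier (F n)" using im by auto
    obtain x where x: "x \<in> carrier (F n)" "gen j = f x" using im j by (metis gen_in_F imageE)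
    then show "g (gen j) \<in> carrier (F n)" using fg(2)[OF subsetD[OF F_subset x(1)]] by simp
  next
    fix j assume "n \<le> j"
    then show "g (gen j) = gen j" using fg(2)[OF gen_in, of j] n(2) by simp
  qed
  \<comment> \<open>Trivial action on the abelianization of \<open>F n\<close> is read off on
    generators below \<open>n\<close>, and the other generators are fixed.\<close>
  have hg: "hclass (f (gen j)) = e j" for j
  proof (cases "j < n")
    case True
    then have "f (gen j) \<in> carrier (F n)" "ab_proj (F n) (f (gen j)) = ab_proj (F n) (gen j)"
      using n(1) im by (auto simp: carrier_IA)
    then show ?thesis using ab_proj_F_iff[of "f (gen j)" n "gen j"] True by simp
  next
    case False
    then show ?thesis using n(2) by simp
  qed
  have "hclass (f x) = hclass x" if "x \<in> CF" for x
  proof -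
    have "hclass (f x) = lin_ext (\<lambda>j. hclass (f (gen j))) (hclass x)"
      by (rule additive_hclass[OF _ that]) (simp add: hom_F_inf[OF hom] hclass_mult)
    also have "\<dots> = lin_ext (\<lambda>j. hclass (gen j)) (hclass x)" by (simp add: hg)
    also have "\<dots> = hclass x"
      by (rule additive_hclass[OF _ that, symmetric]) (simp add: hclass_mult)
    finally show ?thesis .
  qed
  with a show ?thesis using ext by (rule that)
qed

lemma IA_inf_AutoGroup: "IA_inf = (AutoGroup F_inf)\<lparr>carrier := CI\<rparr>"
  by (simp add: IA_inf_def)

lemma IA_auto: "f \<in> CI \<Longrightarrow> f \<in> auto F_inf" "f \<in> CI \<Longrightarrow> f \<in> Bij CF" "f \<in> CI \<Longrightarrow> f \<in> hom F_inf F_inf"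
  by (auto simp: carrier_IA_inf auto_def)

lemma IA_mult_AutoGroup: "f \<otimes>\<^bsub>IA_inf\<^esub> g = f \<otimes>\<^bsub>AutoGroup F_inf\<^esub> g"
  by (simp add: IA_inf_def)

lemma IA_mult: "f \<in> CI \<Longrightarrow> g \<in> CI \<Longrightarrow> f \<otimes>\<^bsub>IA_inf\<^esub> g = restrict (\<lambda>x. f (g x)) CF"
  using IA_auto(2) by (simp add: IA_mult_AutoGroup AutoGroup_def BijGroup_def compose_def)

lemma IA_mult_closed:
  assumes "f \<in> CI" "g \<in> CI"
  shows "restrict (\<lambda>x. f (g x)) CF \<in> CI"
proof -
  obtain f' n where f: "aut_pair f f' n" "\<And>x. x \<in> CF \<Longrightarrow> hclass (f x) = hclass x" using IA_memD[OF assms(1)] by blast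
  obtain g' m where g: "aut_pair g g' m" "\<And>x. x \<in> CF \<Longrightarrow> hclass (g x) = hclass x" using IA_memD[OF assms(2)] by blast
  have "aut_pair (\<lambda>x. f (g x)) (\<lambda>x. g' (f' x)) (max n m)"
    by (rule aut_pair_comp[OF aut_pair_mono[OF f(1)] aut_pair_mono[OF g(1)]]) simp_all
  then show ?thesis
    by (rule IA_memI) (use f(2) g(2) hom_F_inf(1)[OF IA_auto(3)[OF assms(2)]] in simp)
qed

lemma group_IA_inf [simp]: "group IA_inf"
proof -
  interpret A: group "AutoGroup F_inf" by (rule FI.AutoGroup)
  have mult: "f \<otimes>\<^bsub>AutoGroup F_inf\<^esub> g = restrict (\<lambda>x. f (g x)) CF" if "f \<in> CI" "g \<in> CI" for f g
    using IA_mult[OF that] by (simp add: IA_mult_AutoGroup)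
  have "subgroup CI (AutoGroup F_inf)"
  proof (rule A.subgroupI)
    show "CI \<subseteq> carrier (AutoGroup F_inf)" using IA_auto(1) by (auto simp: AutoGroup_def)
    have "aut_pair (\<lambda>x. x) (\<lambda>x. x) 0" by (auto simp: aut_pair_def hom_def)
    from IA_memI[OF this] show "CI \<noteq> {}" by auto
    fix f assume f: "f \<in> CI"
    obtain g n where g: "aut_pair f g n" "\<And>x. x \<in> CF \<Longrightarrow> hclass (f x) = hclass x" using IA_memD[OF f] by blast
    then have g': "x \<in> CF \<Longrightarrow> g x \<in> CF" "x \<in> CF \<Longrightarrow> f (g x) = x" "x \<in> CF \<Longrightarrow> g (f x) = x" for x
      by (auto simp: aut_pair_def hom_F_inf(1))
    have gI: "restrict g CF \<in> CI"
      by (rule IA_memI[OF aut_pair_sym[OF g(1)]]) (metis g(2) g')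
    have "restrict g CF \<otimes>\<^bsub>AutoGroup F_inf\<^esub> f = \<one>\<^bsub>AutoGroup F_inf\<^esub>"
      unfolding mult[OF gI f]
      using g' hom_F_inf(1)[OF IA_auto(3)[OF f]] by (auto simp: AutoGroup_def BijGroup_def)
    then have "inv\<^bsub>AutoGroup F_inf\<^esub> f = restrict g CF"
      by (rule A.inv_equality) (use IA_auto(1) f gI in \<open>auto simp: AutoGroup_def\<close>)
    then show "inv\<^bsub>AutoGroup F_inf\<^esub> f \<in> CI" using gI by simp
  qed (simp add: mult IA_mult_closed)
  from subgroup.subgroup_is_group[OF this A.is_group] show ?thesis
    by (simp only: IA_inf_AutoGroup[symmetric])
qed

section \<open>The Johnson homomorphism\<close>

text \<open>For an IA-automorphism this equals \<open>kappa\<close> of the inverse of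
  \<open>x\<close> times \<open>f x\<close>, expressed without the inverse.\<close>

definition quad_diff :: "(nat word \<Rightarrow> nat word) \<Rightarrow> nat word \<Rightarrow> ((nat \<Rightarrow>\<^sub>0 rat) list \<Rightarrow>\<^sub>0 rat)" where
  "quad_diff f x = sc (1 / 2) (quad (f x) - quad x)"

lemma keys_quad_diff: "keys (quad_diff f x) \<subseteq> lists_in 2 H_inf"
  using subsp_sc[OF subsp_keys subsp_diff[OF subsp_keys, of "quad (f x)" "lists_in 2 H_inf" "quad x"], of "1 / 2"]
    keys_quad by (simp add: quad_diff_def)

lemma nf_quad_diff: "nf R2 (quad_diff f x) = quad_diff f x"
  by (simp add: quad_diff_def lin_sc[OF lin_nf] lin_diff[OF lin_nf] nf_qq)

lemma comm_class_quad_diff: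
  assumes f: "f \<in> CI" and x: "x \<in> CF"
  shows "comm_class (inv\<^bsub>F_inf\<^esub> x \<otimes>\<^bsub>F_inf\<^esub> f x) = cst R2 (quad_diff f x)"
proof -
  have h: "hclass (f x) = hclass x" using IA_memD[OF f] x by metis
  have fx: "f x \<in> CF" by (rule hom_F_inf(1)[OF IA_auto(3)[OF f] x])
  have "inv\<^bsub>F_inf\<^esub> x \<otimes>\<^bsub>F_inf\<^esub> f x \<in> DF"
    by (subst DF_iff) (simp_all add: fx x h hclass_mult hclass_inv)
  moreover have "kappa (inv\<^bsub>F_inf\<^esub> x \<otimes>\<^bsub>F_inf\<^esub> f x) = quad_diff f x"
    by (simp add: kappa_def quad_diff_def quad_mult quad_inv x hclass_inv h wnfH_minus wnfH_bilinear)
  ultimately show ?thesis by (simp add: comm_class_eq)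
qed

text \<open>\<open>f\<close> preserves classes, so the wedge corrections to \<open>quad\<close>
  before and after applying \<open>f\<close> agree and cancel.\<close>

lemma quad_diff_additive:
  assumes f: "f \<in> CI" and x: "x \<in> CF" "y \<in> CF"
  shows "quad_diff f (x \<otimes>\<^bsub>F_inf\<^esub> y) = quad_diff f x + quad_diff f y"
proof -
  have h: "hclass (f z) = hclass z" if "z \<in> CF" for z using IA_memD[OF f] that by metis
  show ?thesis
    by (simp add: quad_diff_def hom_F_inf(2)[OF IA_auto(3)[OF f] x] quad_mult h x flip: sc_add_right)
qed

text \<open>Additivity makes \<open>quad_diff f\<close> a linear function of the class, and
  \<open>f\<close> fixes almost all generators, so an element of \<open>U_inf\<close> with the
  defining property exists.\<close>

lemma johnson_props:
  assumes f: "f \<in> CI"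
  shows "johnson f \<in> carrier U_inf" "x \<in> CF \<Longrightarrow> uval (johnson f) (hclass x) = quad_diff f x"
proof -
  define u where "u = (\<lambda>v. cst R2 (lin_ext (\<lambda>j. quad_diff f (gen j)) v))"
  have ex: "quad_diff f x = lin_ext (\<lambda>j. quad_diff f (gen j)) (hclass x)" if "x \<in> CF" for x
    by (rule additive_hclass[OF _ that]) (rule quad_diff_additive[OF f])
  obtain g n where n: "aut_pair f g n" using IA_memD[OF f] by metis
  have u: "u \<in> carrier U_inf"
    unfolding u_def
  proof (rule U_I)
    show "keys (lin_ext (\<lambda>j. quad_diff f (gen j)) v) \<subseteq> lists_in 2 H_inf" for v
      using lin_ext_in[OF subsp_keys, of v "\<lambda>j. quad_diff f (gen j)"] keys_quad_diff by simp
    show "finite {j. lin_ext (\<lambda>j. quad_diff f (gen j)) (e j) \<noteq> 0}"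
    proof (rule finite_subset)
      show "{j. lin_ext (\<lambda>j. quad_diff f (gen j)) (e j) \<noteq> 0} \<subseteq> {..<n}"
        using n by (auto simp: aut_pair_def e_def quad_diff_def intro: leI)
    qed simp
  qed simp
  have u_eq: "u (hclass x) = comm_class (inv\<^bsub>F_inf\<^esub> x \<otimes>\<^bsub>F_inf\<^esub> f x)" if "x \<in> CF" for x
    by (simp add: u_def ex[OF that, symmetric] comm_class_quad_diff[OF f that])
  \<comment> \<open>The defining property fixes the values on all basis vectors, hence
    uniqueness.\<close>
  have v_gen: "uval v (e j) = quad_diff f (gen j)"
    if "\<forall>x\<in>CF. v (hclass x) = comm_class (inv\<^bsub>F_inf\<^esub> x \<otimes>\<^bsub>F_inf\<^esub> f x)" for v j
  proof -
    have "v (hclass (gen j)) = cst R2 (quad_diff f (gen j))"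
      using that comm_class_quad_diff[OF f gen_in] by (metis gen_in)
    then show ?thesis by (simp add: uval_def nf_quad_diff)
  qed
  have "johnson f = u"
    unfolding johnson_def
  proof (rule the_equality)
    show "u \<in> carrier U_inf \<and> (\<forall>x\<in>CF. u (hclass x) = comm_class (inv\<^bsub>F_inf\<^esub> x \<otimes>\<^bsub>F_inf\<^esub> f x))"
      using u u_eq by blast
    fix v assume "v \<in> carrier U_inf \<and> (\<forall>x\<in>CF. v (hclass x) = comm_class (inv\<^bsub>F_inf\<^esub> x \<otimes>\<^bsub>F_inf\<^esub> f x))"
    then show "v = u" using v_gen[of v] v_gen[of u] u_eq u by (intro U_eqI) auto
  qed
  then show "johnson f \<in> carrier U_inf" "x \<in> CF \<Longrightarrow> uval (johnson f) (hclass x) = quad_diff f x"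
    using u by (auto simp: uval_def u_def ex[symmetric] nf_quad_diff)
qed

lemma uval_johnson: "f \<in> CI \<Longrightarrow> uval (johnson f) (e j) = quad_diff f (gen j)"
  using johnson_props(2)[of f "gen j"] by simp

text \<open>The change made by \<open>f\<close> depends only on the class of the word, and
  \<open>g\<close> preserves this class.\<close>

lemma quad_diff_mult:
  assumes "f \<in> CI" "g \<in> CI"
  shows "quad_diff (f \<otimes>\<^bsub>IA_inf\<^esub> g) (gen j) = quad_diff f (gen j) + quad_diff g (gen j)"
proof -
  have gj: "g (gen j) \<in> CF" by (rule hom_F_inf(1)[OF IA_auto(3)[OF assms(2)] gen_in])
  have "hclass (g (gen j)) = hclass (gen j)" using IA_memD[OF assms(2)] gen_in by metis
  then have "quad_diff f (g (gen j)) = quad_diff f (gen j)"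
    using johnson_props(2)[OF assms(1) gj] johnson_props(2)[OF assms(1) gen_in, of j] by simp
  moreover have "quad_diff (f \<otimes>\<^bsub>IA_inf\<^esub> g) (gen j) = quad_diff f (g (gen j)) + quad_diff g (gen j)"
    by (simp add: IA_mult[OF assms] quad_diff_def flip: sc_add_right)
  ultimately show ?thesis by simp
qed

interpretation IA: group IA_inf by simp

lemma johnson_mult:
  assumes "f \<in> CI" "g \<in> CI"
  shows "johnson (f \<otimes>\<^bsub>IA_inf\<^esub> g) = johnson f \<oplus>\<^bsub>U_inf\<^esub> johnson g"
  using assms IA.m_closed[OF assms]
  by (intro U_eqI) (simp_all add: johnson_props(1) op_closed_add uval_add uval_johnson quad_diff_mult)

lemma quad_diff_one: "quad_diff \<one>\<^bsub>IA_inf\<^esub> (gen j) = 0"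
  using quad_diff_mult[OF IA.one_closed IA.one_closed, of j] by simp

lemma quad_diff_inv: "f \<in> CI \<Longrightarrow> quad_diff (inv\<^bsub>IA_inf\<^esub> f) (gen j) = - quad_diff f (gen j)"
  using quad_diff_mult[of "inv\<^bsub>IA_inf\<^esub> f" f j] by (simp add: quad_diff_one eq_neg_iff_add_eq_0)

text \<open>A homomorphism to an additive group is trivial on commutators; hence
  \<open>johnson\<close> is constant on the cosets that form the abelianization.\<close>

lemma quad_diff_derived:
  assumes "d \<in> derived IA_inf CI"
  shows "quad_diff d (gen j) = 0"
proof -
  let ?Z = "{f \<in> CI. \<forall>j. quad_diff f (gen j) = 0}"
  have sub: "subgroup ?Z IA_inf"
    by (rule IA.subgroupI) (auto simp: quad_diff_mult quad_diff_inv quad_diff_one intro!: exI[of _ "\<one>\<^bsub>IA_inf\<^esub>"])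
  have "derived_set IA_inf CI \<subseteq> ?Z" by (auto simp: quad_diff_mult quad_diff_inv)
  from IA.generate_subgroup_incl[OF this sub] show ?thesis using assms by (auto simp: derived_def)
qed

lemma johnson_ab_proj:
  assumes f: "f \<in> CI"
  shows "johnson_ab (ab_proj IA_inf f) = johnson f"
proof -
  have D: "derived IA_inf CI \<subseteq> CI" by (rule IA.derived_in_carrier) simp
  have "johnson g = johnson f" if g: "g \<in> ab_proj IA_inf f" for g
  proof -
    obtain d where d: "d \<in> derived IA_inf CI" "g = d \<otimes>\<^bsub>IA_inf\<^esub> f"
      using g by (auto simp: ab_proj_def r_coset_def)
    then have "d \<in> CI" "g \<in> CI" using D f by auto
    then show ?thesis
      using f d by (intro U_eqI) (simp_all add: johnson_props(1) uval_johnson quad_diff_mult quad_diff_derived)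
  qed
  moreover have "f \<in> ab_proj IA_inf f"
    unfolding ab_proj_def by (rule IA.rcos_self[OF f IA.derived_is_subgroup]) simp
  ultimately have "johnson ` ab_proj IA_inf f = {johnson f}" by blast
  then show ?thesis by (simp add: johnson_ab_def)
qed

abbreviation "AI \<equiv> abelianization IA_inf"

lemma carrier_AI: "carrier AI = ab_proj IA_inf ` CI"
  by (auto simp: abelianization_def FactGroup_def RCOSETS_def ab_proj_def)

lemma ab_proj_IA_hom: "ab_proj IA_inf \<in> hom IA_inf AI"
  by (rule ab_proj_hom) simp

lemma johnson_ab_in: "C \<in> carrier AI \<Longrightarrow> johnson_ab C \<in> carrier U_inf"
  by (auto simp: carrier_AI johnson_ab_proj johnson_props(1))

lemma johnson_ab_mult:
  assumes "C \<in> carrier AI" "C' \<in> carrier AI"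
  shows "johnson_ab (C \<otimes>\<^bsub>AI\<^esub> C') = johnson_ab C \<oplus>\<^bsub>U_inf\<^esub> johnson_ab C'"
proof -
  obtain f g where fg: "f \<in> CI" "g \<in> CI" "C = ab_proj IA_inf f" "C' = ab_proj IA_inf g"
    using assms by (auto simp: carrier_AI)
  then have "C \<otimes>\<^bsub>AI\<^esub> C' = ab_proj IA_inf (f \<otimes>\<^bsub>IA_inf\<^esub> g)"
    using ab_proj_IA_hom by (simp add: hom_def)
  then show ?thesis using fg by (simp add: johnson_ab_proj johnson_mult)
qed

section \<open>Conjugation by automorphisms\<close>

definition conj_aut :: "(nat word \<Rightarrow> nat word) \<Rightarrow> (nat word \<Rightarrow> nat word) \<Rightarrow> (nat word \<Rightarrow> nat word) \<Rightarrow> nat word \<Rightarrow> nat word" where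
  "conj_aut \<tau> \<tau>' f = restrict (\<lambda>x. \<tau> (f (\<tau>' x))) CF"

text \<open>An automorphism of the free group that induces \<open>A\<close> on classes. The ranks
  \<open>N\<close> and \<open>n\<close> at which the two become trivial are kept separate.\<close>

locale lift =
  fixes \<tau> \<tau>' :: "nat word \<Rightarrow> nat word" and N n :: nat and A
  assumes tau: "aut_pair \<tau> \<tau>' N" and A: "level n A" and hA: "\<And>x. x \<in> CF \<Longrightarrow> hclass (\<tau> x) = A (hclass x)"
begin

lemma tau_hom: "\<tau> \<in> hom F_inf F_inf" "\<tau>' \<in> hom F_inf F_inf"
  and tau_inv: "x \<in> CF \<Longrightarrow> \<tau> (\<tau>' x) = x" "x \<in> CF \<Longrightarrow> \<tau>' (\<tau> x) = x"
  using tau by (auto simp: aut_pair_def)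

lemma conj_aut_in:
  assumes f: "f \<in> CI"
  shows "conj_aut \<tau> \<tau>' f \<in> CI"
proof -
  obtain g m where g: "aut_pair f g m" "\<And>x. x \<in> CF \<Longrightarrow> hclass (f x) = hclass x" using IA_memD[OF f] by blast
  have "aut_pair (\<lambda>x. \<tau> (f (\<tau>' x))) (\<lambda>x. \<tau> (g (\<tau>' x))) (max N m)"
    using aut_pair_comp[OF aut_pair_mono[OF tau, of "max N m"]
        aut_pair_comp[OF aut_pair_mono[OF g(1), of "max N m"] aut_pair_mono[OF aut_pair_sym[OF tau], of "max N m"]]] by simp
  moreover have "hclass (\<tau> (f (\<tau>' x))) = hclass x" if "x \<in> CF" for x
    using hA[of "f (\<tau>' x)"] hA[of "\<tau>' x"] g(2)[of "\<tau>' x"] tau_inv(1)[OF that] that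
      hom_F_inf(1)[OF tau_hom(2)] hom_F_inf(1)[OF IA_auto(3)[OF f]] by simp
  ultimately show ?thesis unfolding conj_aut_def by (rule IA_memI)
qed

lemma conj_aut_hom: "conj_aut \<tau> \<tau>' \<in> hom IA_inf IA_inf"
proof (rule homI[OF conj_aut_in])
  fix f g assume fg: "f \<in> CI" "g \<in> CI"
  show "conj_aut \<tau> \<tau>' (f \<otimes>\<^bsub>IA_inf\<^esub> g) = conj_aut \<tau> \<tau>' f \<otimes>\<^bsub>IA_inf\<^esub> conj_aut \<tau> \<tau>' g"
    unfolding IA_mult[OF fg] IA_mult[OF conj_aut_in[OF fg(1)] conj_aut_in[OF fg(2)]]
    using hom_F_inf(1)[OF tau_hom(1)] hom_F_inf(1)[OF tau_hom(2)] hom_F_inf(1)[OF IA_auto(3)[OF fg(2)]] tau_inv(2)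
    by (auto simp: conj_aut_def)
qed

lemma Lam_wnfH: "Lam A (wnfH [x, y]) = wnfH [A x, A y]"
proof -
  have "alt_map 2 H_inf (\<lambda>l. wnfH (map A l))"
    by (rule alt_pre[OF _ alt_wnf]) (simp_all add: vlin_H_inf level_lin[OF A])
  from alt_repr[OF op_closed_H_inf this, of "single [x, y] 1"] show ?thesis
    by (simp add: Lam_def wnf_def)
qed

text \<open>\<open>quad\<close> is not natural in \<open>\<tau>\<close>, but the defect is additive in the word, so it depends only on its class
  and cancels in \<open>quad_diff\<close>.\<close>

lemma johnson_conj_aut:
  assumes f: "f \<in> CI"
  shows "johnson (conj_aut \<tau> \<tau>' f) = U_act A (johnson f)"
proof (rule U_eqI[OF johnson_props(1)[OF conj_aut_in[OF f]] U_act_in[OF A johnson_props(1)[OF f]]])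
  fix j
  define \<delta> where "\<delta> = (\<lambda>x. quad (\<tau> x) - Lam A (quad x))"
  have "\<delta> (x \<otimes>\<^bsub>F_inf\<^esub> y) = \<delta> x + \<delta> y" if "x \<in> CF" "y \<in> CF" for x y
    using that hom_F_inf(1)[OF tau_hom(1)]
    by (simp add: \<delta>_def hom_F_inf(2)[OF tau_hom(1)] quad_mult hA lin_add[OF lin_Lam] Lam_wnfH)
  from additive_hclass[of \<delta>, OF this] have \<delta>: "\<delta> x = lin_ext (\<lambda>j. \<delta> (gen j)) (hclass x)" if "x \<in> CF" for x
    using that by blast
  let ?y = "\<tau>' (gen j)"
  have y: "?y \<in> CF" "f ?y \<in> CF" by (simp_all add: hom_F_inf(1)[OF tau_hom(2)] hom_F_inf(1)[OF IA_auto(3)[OF f]])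
  have "hclass (f ?y) = hclass ?y" using IA_memD[OF f] y by metis
  then have dd: "\<delta> (f ?y) = \<delta> ?y" using \<delta>[OF y(1)] \<delta>[OF y(2)] by simp
  have "hclass ?y = invf A (A (hclass ?y))" using inv_level(2)[OF A] by simp
  also have "A (hclass ?y) = e j" using hA[OF y(1)] tau_inv(1)[OF gen_in, of j] by simp
  finally have hy: "hclass ?y = invf A (e j)" .
  have "uval (johnson (conj_aut \<tau> \<tau>' f)) (e j) = sc (1 / 2) (quad (\<tau> (f ?y)) - quad (\<tau> ?y))"
    using tau_inv(1)[OF gen_in, of j] by (simp add: uval_johnson[OF conj_aut_in[OF f]] quad_diff_def) (simp add: conj_aut_def)
  also have "quad (\<tau> (f ?y)) - quad (\<tau> ?y) = Lam A (quad (f ?y) - quad ?y)"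
    using dd by (simp add: \<delta>_def lin_diff[OF lin_Lam] algebra_simps)
  also have "sc (1 / 2) (Lam A (quad (f ?y) - quad ?y)) = Lam A (quad_diff f ?y)"
    by (simp add: quad_diff_def lin_sc[OF lin_Lam])
  also have "\<dots> = Lam A (uval (johnson f) (invf A (e j)))"
    using johnson_props(2)[OF f y(1)] hy by simp
  also have "\<dots> = uval (U_act A (johnson f)) (e j)"
    by (simp add: uval_U_act(1)[OF level_lin[OF A] johnson_props(1)[OF f]])
  finally show "uval (johnson (conj_aut \<tau> \<tau>' f)) (e j) = uval (U_act A (johnson f)) (e j)" .
qed

end

lemma FI_cancel [simp]: "x \<in> CF \<Longrightarrow> z \<in> CF \<Longrightarrow> inv\<^bsub>F_inf\<^esub> x \<otimes>\<^bsub>F_inf\<^esub> (x \<otimes>\<^bsub>F_inf\<^esub> z) = z"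
    "x \<in> CF \<Longrightarrow> z \<in> CF \<Longrightarrow> x \<otimes>\<^bsub>F_inf\<^esub> (inv\<^bsub>F_inf\<^esub> x \<otimes>\<^bsub>F_inf\<^esub> z) = z"
  by (simp_all flip: FI.m_assoc)

lemma aut_pair_endoI:
  assumes s: "\<And>j. \<sigma> j \<in> CF" "\<And>j. \<sigma>' j \<in> CF"
    and inv: "\<And>j. endo \<sigma> (\<sigma>' j) = gen j" "\<And>j. endo \<sigma>' (\<sigma> j) = gen j"
    and level: "\<And>j. j < n \<Longrightarrow> \<sigma> j \<in> carrier (F n)" "\<And>j. j < n \<Longrightarrow> \<sigma>' j \<in> carrier (F n)"
    and fx: "\<And>j. n \<le> j \<Longrightarrow> \<sigma> j = gen j" "\<And>j. n \<le> j \<Longrightarrow> \<sigma>' j = gen j"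
  shows "aut_pair (endo \<sigma>) (endo \<sigma>') n"
proof -
  note h = endo_hom[OF s(1)] endo_hom[OF s(2)]
  have id: "(\<lambda>x. x) \<in> hom F_inf F_inf" by (simp add: hom_def)
  have "endo \<sigma> (endo \<sigma>' x) = x" if "x \<in> CF" for x
    by (rule hom_eq_gen[OF hom_comp_F_inf[OF h] id _ that]) (simp add: endo_gen s inv)
  moreover have "endo \<sigma>' (endo \<sigma> x) = x" if "x \<in> CF" for x
    by (rule hom_eq_gen[OF hom_comp_F_inf[OF h(2,1)] id _ that]) (simp add: endo_gen s inv)
  ultimately show ?thesis using h level fx by (simp add: aut_pair_def endo_gen s)
qed

text \<open>The Nielsen automorphism that multiplies generator \<open>a\<close> on the right by
  generator \<open>b\<close> induces the transvection.\<close>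

lemma transv_lift:
  assumes ab: "a \<noteq> b"
  shows "\<exists>\<tau> \<tau>' N n. lift \<tau> \<tau>' N n (transv a b 1)"
proof -
  let ?n = "Suc (max a b)"
  let ?\<sigma> = "\<lambda>j. if j = a then gen a \<otimes>\<^bsub>F_inf\<^esub> gen b else gen j"
  let ?\<sigma>' = "\<lambda>j. if j = a then gen a \<otimes>\<^bsub>F_inf\<^esub> inv\<^bsub>F_inf\<^esub> gen b else gen j"
  have s: "?\<sigma> j \<in> CF" "?\<sigma>' j \<in> CF" for j by simp_all
  note h = endo_hom[of ?\<sigma>, OF s(1)] endo_hom[of ?\<sigma>', OF s(2)]
  have aut: "aut_pair (endo ?\<sigma>) (endo ?\<sigma>') ?n"
  proof (rule aut_pair_endoI)
    show "endo ?\<sigma> (?\<sigma>' j) = gen j" for j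
      using ab by (simp add: hom_F_inf[OF h(1)] endo_gen FI.m_assoc)
    show "endo ?\<sigma>' (?\<sigma> j) = gen j" for j
      using ab by (simp add: hom_F_inf[OF h(2)] endo_gen FI.m_assoc)
  qed (auto intro!: F_closed)
  have "hclass (endo ?\<sigma> x) = transv a b 1 (hclass x)" if x: "x \<in> CF" for x
  proof -
    have "hclass (endo ?\<sigma> x) = lin_ext (\<lambda>j. hclass (endo ?\<sigma> (gen j))) (hclass x)"
      by (rule additive_hclass[OF _ x]) (simp add: hom_F_inf[OF h(1)] hclass_mult)
    also have "lin_ext (\<lambda>j. hclass (endo ?\<sigma> (gen j))) = transv a b 1"
    proof (rule lin_eq_e[OF lin_lin_ext lin_transv])
      show "lin_ext (\<lambda>j. hclass (endo ?\<sigma> (gen j))) (e j) = transv a b 1 (e j)" for j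
        by (subst (1) e_def) (auto simp: endo_gen[of ?\<sigma>, OF s(1)] hclass_mult transv_def lookup_e)
    qed
    finally show ?thesis .
  qed
  moreover have "level ?n (transv a b 1)" using ab by (intro level_transv) auto
  ultimately have "lift (endo ?\<sigma>) (endo ?\<sigma>') ?n ?n (transv a b 1)" using aut by (intro lift.intro)
  then show ?thesis by blast
qed

section \<open>A chain of commuting conjugations\<close>

text \<open>The next generator in the chain conjugates all earlier ones; injectivity of
  \<open>c\<close> makes it fixed by its own conjugation and by those before it.\<close>

locale conj_chain =
  fixes k :: nat and c :: "nat \<Rightarrow> nat"
  assumes c: "inj_on c {..Suc k}"
begin

definition "y q = gen (c (Suc q))"
definition "sg q m = (if m \<in> c ` {..q} then inv\<^bsub>F_inf\<^esub> y q \<otimes>\<^bsub>F_inf\<^esub> (gen m \<otimes>\<^bsub>F_inf\<^esub> y q) else gen m)"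
definition "sg' q m = (if m \<in> c ` {..q} then y q \<otimes>\<^bsub>F_inf\<^esub> (gen m \<otimes>\<^bsub>F_inf\<^esub> inv\<^bsub>F_inf\<^esub> y q) else gen m)"
definition "h q = restrict (endo (sg q)) CF"

lemma y_in [simp]: "y q \<in> CF" by (simp add: y_def)

lemma sg_in [simp]: "sg q m \<in> CF" "sg' q m \<in> CF" by (simp_all add: sg_def sg'_def)

lemma sg_hom: "endo (sg q) \<in> hom F_inf F_inf" "endo (sg' q) \<in> hom F_inf F_inf"
  by (simp_all add: endo_hom)

lemma y_fixed:
  assumes "q \<le> p" "p \<le> k"
  shows "endo (sg q) (y p) = y p" "endo (sg' q) (y p) = y p"
proof -
  have "c (Suc p) \<notin> c ` {..q}" using c assms by (force simp: inj_on_def)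
  then show "endo (sg q) (y p) = y p" "endo (sg' q) (y p) = y p"
    by (simp_all add: y_def endo_gen, simp_all add: sg_def sg'_def)
qed

lemma aut_pair_sg:
  assumes q: "q \<le> k"
  shows "\<exists>n. aut_pair (endo (sg q)) (endo (sg' q)) n"
proof -
  let ?n = "Suc (Max (c ` {..Suc k}))"
  have b: "c p < ?n" if "p \<le> Suc k" for p using that by (simp add: less_Suc_eq_le)
  have "aut_pair (endo (sg q)) (endo (sg' q)) ?n"
  proof (rule aut_pair_endoI)
    show "endo (sg q) (sg' q j) = gen j" for j
      unfolding sg'_def
      by (auto simp: hom_F_inf[OF sg_hom(1)] y_fixed(1)[OF order_refl q] endo_gen, auto simp: sg_def FI.m_assoc)
    show "endo (sg' q) (sg q j) = gen j" for j
      unfolding sg_def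
      by (auto simp: hom_F_inf[OF sg_hom(2)] y_fixed(2)[OF order_refl q] endo_gen, auto simp: sg'_def FI.m_assoc)
    show "sg q j \<in> carrier (F ?n)" "sg' q j \<in> carrier (F ?n)" if "j < ?n" for j
      using that b[of "Suc q"] q by (auto simp: sg_def sg'_def y_def intro!: F_closed simp del: Max_less_iff)
    show "sg q j = gen j" "sg' q j = gen j" if "?n \<le> j" for j
    proof -
      have "j \<notin> c ` {..q}" using that b q by (metis atMost_iff imageE le_SucI le_trans not_less)
      then show "sg q j = gen j" "sg' q j = gen j" by (simp_all add: sg_def sg'_def)
    qed
  qed simp_all
  then show ?thesis by blast
qed

lemma h_in:
  assumes q: "q \<le> k"
  shows "h q \<in> CI"
proof -
  have "hclass (endo (sg q) x) = hclass x" if x: "x \<in> CF" for x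
  proof -
    have "hclass (endo (sg q) x) = lin_ext (\<lambda>j. hclass (endo (sg q) (gen j))) (hclass x)"
      by (rule additive_hclass[OF _ x]) (simp add: hom_F_inf[OF sg_hom(1)] hclass_mult)
    also have "lin_ext (\<lambda>j. hclass (endo (sg q) (gen j))) (hclass x) = lin_ext (\<lambda>j. hclass (gen j)) (hclass x)"
      by (rule lin_eq_on) (simp_all add: endo_gen, simp add: sg_def hclass_mult hclass_inv)
    also have "\<dots> = hclass x"
      by (rule additive_hclass[OF _ x, symmetric]) (simp add: hclass_mult)
    finally show ?thesis .
  qed
  then show ?thesis using aut_pair_sg[OF q] IA_memI unfolding h_def by blast
qed

text \<open>On everything that \<open>h q\<close> involves, including \<open>y q\<close>, the later
  \<open>h p\<close> is conjugation by \<open>y p\<close>, and \<open>h q\<close> fixes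
  \<open>y p\<close>. Hence the two orders of composition agree.\<close>

lemma h_comm_less:
  assumes "q < p" "p \<le> k"
  shows "h q \<otimes>\<^bsub>IA_inf\<^esub> h p = h p \<otimes>\<^bsub>IA_inf\<^esub> h q"
proof -
  have "endo (sg q) (endo (sg p) x) = endo (sg p) (endo (sg q) x)" if "x \<in> CF" for x
  proof (rule hom_eq_gen[OF hom_comp_F_inf[OF sg_hom(1) sg_hom(1)] hom_comp_F_inf[OF sg_hom(1) sg_hom(1)] _ that])
    fix m
    have yp: "endo (sg q) (y p) = y p" using assms by (intro y_fixed) auto
    have "c (Suc q) \<in> c ` {..p}" using assms by auto
    \<comment> \<open>The conjugator of the earlier automorphism is itself among the generators
      conjugated by the later one.\<close>
    then have yq: "endo (sg p) (y q) = inv\<^bsub>F_inf\<^esub> y p \<otimes>\<^bsub>F_inf\<^esub> (y q \<otimes>\<^bsub>F_inf\<^esub> y p)"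
      by (simp add: y_def[of q] endo_gen) (simp add: sg_def)
    consider "m \<in> c ` {..q}" "m \<in> c ` {..p}" | "m \<notin> c ` {..q}" "m \<in> c ` {..p}" | "m \<notin> c ` {..q}" "m \<notin> c ` {..p}"
      using assms by fastforce
    then show "endo (sg q) (endo (sg p) (gen m)) = endo (sg p) (endo (sg q) (gen m))"
    proof cases
      case 1
      then have "sg q m = inv\<^bsub>F_inf\<^esub> y q \<otimes>\<^bsub>F_inf\<^esub> (gen m \<otimes>\<^bsub>F_inf\<^esub> y q)"
        "sg p m = inv\<^bsub>F_inf\<^esub> y p \<otimes>\<^bsub>F_inf\<^esub> (gen m \<otimes>\<^bsub>F_inf\<^esub> y p)" by (simp_all add: sg_def)
      then show ?thesis
        by (simp add: endo_gen hom_F_inf[OF sg_hom(1)] yp yq FI.m_assoc FI.inv_mult_group)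
    next
      case 2
      then have "sg q m = gen m" "sg p m = inv\<^bsub>F_inf\<^esub> y p \<otimes>\<^bsub>F_inf\<^esub> (gen m \<otimes>\<^bsub>F_inf\<^esub> y p)" by (simp_all add: sg_def)
      then show ?thesis by (simp add: endo_gen hom_F_inf[OF sg_hom(1)] yp)
    next
      case 3
      then have "sg q m = gen m" "sg p m = gen m" by (simp_all add: sg_def)
      then show ?thesis by (simp add: endo_gen)
    qed
  qed
  then show ?thesis
    using assms h_in hom_F_inf(1)[OF sg_hom(1)]
    by (simp add: IA_mult) (auto simp: h_def fun_eq_iff)
qed

lemma h_comm: "q \<le> k \<Longrightarrow> p \<le> k \<Longrightarrow> h q \<otimes>\<^bsub>IA_inf\<^esub> h p = h p \<otimes>\<^bsub>IA_inf\<^esub> h q"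
  using h_comm_less[of q p] h_comm_less[of p q] by (cases q p rule: linorder_cases) auto

text \<open>Conjugating \<open>x\<close> by \<open>y\<close> changes \<open>quad\<close> by twice
  the wedge of \<open>x\<close> and \<open>y\<close>, which the factor in \<open>quad_diff\<close>
  halves.\<close>

lemma chain_h: "chain k c (\<lambda>q. johnson (h q))"
proof
  show "inj_on c {..Suc k}" by (rule c)
  fix q assume q: "q \<le> k"
  show "johnson (h q) \<in> carrier U_inf" by (rule johnson_props(1)[OF h_in[OF q]])
  fix m
  show "uval (johnson (h q)) (e m) = (if m \<in> c ` {..q} then wnfH [e m, e (c (Suc q))] else 0)"
  proof (cases "m \<in> c ` {..q}")
    case True
    have "quad (inv\<^bsub>F_inf\<^esub> y q \<otimes>\<^bsub>F_inf\<^esub> (gen m \<otimes>\<^bsub>F_inf\<^esub> y q)) = wnfH [e m, e (c (Suc q))] + wnfH [e m, e (c (Suc q))]"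
      using wnfH_swap[of "e (c (Suc q))" "e m"]
      by (simp add: y_def quad_mult hclass_mult hclass_inv quad_inv wnfH_minus wnfH_bilinear)
    also have "\<dots> = sc 2 (wnfH [e m, e (c (Suc q))])"
      using sc_add_left[of 1 1 "wnfH [e m, e (c (Suc q))]"] by simp
    finally show ?thesis
      unfolding uval_johnson[OF h_in[OF q]] using True by (simp add: quad_diff_def h_def endo_gen) (simp add: sg_def)
  next
    case False
    then show ?thesis
      unfolding uval_johnson[OF h_in[OF q]] by (simp add: quad_diff_def h_def endo_gen) (simp add: sg_def)
  qed
qed

end

section \<open>Albanese homology inside the exterior power\<close>

abbreviation "ZI i \<equiv> cyc_set IA_inf i"
abbreviation "BA i \<equiv> bar_boundaries AI i"
abbreviation "prA \<equiv> chain_map (ab_proj IA_inf)"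

text \<open>\<open>alb_embed\<close> lifted to chains of \<open>IA_inf\<close> itself, with the same
  normalization by the factorial.\<close>

definition joh_chain :: "nat \<Rightarrow> ((nat word \<Rightarrow> nat word) list \<Rightarrow>\<^sub>0 rat) \<Rightarrow> (U_elt list \<Rightarrow>\<^sub>0 rat)" where
  "joh_chain i = lin_ext (\<lambda>l. single (map johnson l) (1 / fact i))"

lemma lin_joh_chain: "lin (joh_chain i)"
  by (simp add: joh_chain_def)

lemma ZI_keys: "z \<in> ZI i \<Longrightarrow> keys z \<subseteq> bar_basis IA_inf i"
  by (simp add: cyc_set_def)

lemma keys_joh_chain: "keys z \<subseteq> bar_basis IA_inf i \<Longrightarrow> keys (joh_chain i z) \<subseteq> lists_in i U_inf"
proof -
  assume z: "keys z \<subseteq> bar_basis IA_inf i"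
  have "joh_chain i z \<in> {c. keys c \<subseteq> lists_in i U_inf}"
    unfolding joh_chain_def
  proof (intro lin_ext_in[OF subsp_keys] single_in_keys)
    fix l assume "l \<in> keys z"
    then have "length l = i" "set l \<subseteq> CI" using z by (auto simp: bar_basis_def)
    then show "map johnson l \<in> lists_in i U_inf" using johnson_props(1) by (auto simp: lists_in_def)
  qed
  then show ?thesis by simp
qed

text \<open>Well defined because an alternating function of an additive map vanishes on boundaries,
  by \<open>alt_bar_boundary\<close>.\<close>

lemma alb_embed_cst:
  assumes z: "keys z \<subseteq> bar_basis IA_inf i"
  shows "alb_embed i (cst (BA i) (prA z)) = cst (ext_rel i U_inf) (joh_chain i z)"
proof -
  let ?g = "lin_ext (\<lambda>l. single (map johnson_ab l) (1 / fact i)) :: _ \<Rightarrow> (U_elt list \<Rightarrow>\<^sub>0 rat)"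
  have "alb_embed i (cst (BA i) (prA z)) = cst (ext_rel i U_inf) (?g (prA z))"
    unfolding alb_embed_def ext_free_pmsp
  proof (rule quot_map_cst[OF subsp_RU subsp_bar_boundaries lin_lin_ext])
    fix s assume "s \<in> BA i"
    then obtain c where c: "keys c \<subseteq> bar_basis AI (Suc i)" "s = bar_boundary AI c"
      by (auto simp: bar_boundaries_image)
    have "lin_ext (\<lambda>l. wnfU i (map johnson_ab l)) s = 0"
      unfolding c(2)
      by (rule alt_bar_boundary[OF op_closed_U alt_wnf[OF op_closed_U] johnson_ab_in johnson_ab_mult c(1)])
    then have "nf (ext_rel i U_inf) (?g s) = 0" by (simp add: nf_lin_ext_map)
    then show "?g s \<in> ext_rel i U_inf" by (simp add: nf_eq_0_iff)
  qed
  also have "?g (prA z) = joh_chain i z"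
  proof (rule lin_eq_on[OF lin_comp[OF lin_lin_ext lin_chain_map] lin_joh_chain])
    fix l assume "l \<in> keys z"
    then have "set l \<subseteq> CI" using z by (auto simp: bar_basis_def)
    then have eq: "map (johnson_ab \<circ> ab_proj IA_inf) l = map johnson l" by (auto simp: johnson_ab_proj)
    show "?g (prA (single l 1)) = joh_chain i (single l 1)" by (simp add: chain_map_def joh_chain_def) (simp only: eq)
  qed
  finally show ?thesis .
qed

lemma albanese_IA: "albanese IA_inf i = quot_space (pmsp (prA ` ZI i)) (BA i)"
  by (rule albanese_quot[OF ab_proj_IA_hom])

lemma carrier_albanese: "carrier (albanese IA_inf i) = (\<lambda>z. cst (BA i) (prA z)) ` ZI i"
  by (simp add: albanese_IA carrier_quot_pmsp image_image)

lemma vectorspace_albanese: "vectorspace rat_field (albanese IA_inf i)"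
  unfolding albanese_IA
  by (intro vectorspace_quot subsp_image[OF lin_chain_map] subsp_cyc_set subsp_bar_boundaries)

lemma add_albanese: "cst (BA i) x \<oplus>\<^bsub>albanese IA_inf i\<^esub> cst (BA i) y = cst (BA i) (x + y)"
  and smult_albanese: "a \<odot>\<^bsub>albanese IA_inf i\<^esub> cst (BA i) x = cst (BA i) (sc a x)"
  unfolding albanese_IA by (rule add_quot_pmsp smult_quot_pmsp, rule subsp_bar_boundaries)+

text \<open>All representatives of classes in the image of Albanese homology. The form as preimage
  of an image makes it visibly a subspace.\<close>

definition alb_image :: "nat \<Rightarrow> (U_elt list \<Rightarrow>\<^sub>0 rat) set" where
  "alb_image i = {x. keys x \<subseteq> lists_in i U_inf} \<inter> nf (ext_rel i U_inf) -` (\<lambda>z. nf (ext_rel i U_inf) (joh_chain i z)) ` ZI i"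

lemma alb_image_iff: "x \<in> alb_image i \<longleftrightarrow> keys x \<subseteq> lists_in i U_inf \<and> (\<exists>z\<in>ZI i. x - joh_chain i z \<in> ext_rel i U_inf)"
  by (auto simp: alb_image_def nf_eq_iff)

lemma subsp_alb_image: "subsp (alb_image i)"
  unfolding alb_image_def
  by (intro subsp_Int subsp_keys subsp_vimage subsp_image lin_comp[OF _ lin_joh_chain] lin_nf subsp_RU subsp_cyc_set)

lemma joh_chain_alb_image: "z \<in> ZI i \<Longrightarrow> joh_chain i z \<in> alb_image i"
  by (simp add: alb_image_def keys_joh_chain ZI_keys)

lemma ext_rel_alb_image: "ext_rel i U_inf \<subseteq> alb_image i"
proof
  fix x assume x: "x \<in> ext_rel i U_inf"
  then have "keys x \<subseteq> lists_in i U_inf" using ext_rel_in[OF op_closed_U] by blast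
  then show "x \<in> alb_image i"
    using x subsp_0[OF subsp_cyc_set, of IA_inf i] by (auto simp: alb_image_iff lin_0[OF lin_joh_chain] intro!: bexI[of _ 0])
qed

lemma nf_lin_ext_U_act: "nf (ext_rel i U_inf) (lin_ext (\<lambda>l. single (map (U_act A) l) 1) x) = ext_act i A x"
  using nf_lin_ext_map[OF op_closed_U, of i "map (U_act A)" 1 x] by (simp add: ext_act_def)

text \<open>Conjugation by a lift of the transvection is an endomorphism of \<open>IA_inf\<close>,
  so it maps cycles to cycles, and \<open>johnson\<close> turns it into the action of the
  transvection.\<close>

lemma ext_act_transv_alb_image:
  assumes ab: "a \<noteq> b" and x: "x \<in> alb_image i"
  shows "ext_act i (transv a b 1) x \<in> alb_image i"
proof -
  obtain \<tau> \<tau>' N n where "lift \<tau> \<tau>' N n (transv a b 1)" using transv_lift[OF ab] by blast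
  then interpret lift \<tau> \<tau>' N n "transv a b 1" .
  obtain z where z: "z \<in> ZI i" "x - joh_chain i z \<in> ext_rel i U_inf" using x by (auto simp: alb_image_iff)
  let ?z = "chain_map (conj_aut \<tau> \<tau>') z"
  have z': "?z \<in> ZI i" by (rule chain_map_cyc_set[OF conj_aut_hom z(1)])
  have "ext_act i (transv a b 1) x = ext_act i (transv a b 1) (joh_chain i z)"
    using z(2) ext_act_nf[OF A] nf_eq_iff[OF subsp_RU] by metis
  also have "\<dots> = nf (ext_rel i U_inf) (lin_ext (\<lambda>l. single (map (U_act (transv a b 1)) l) 1) (joh_chain i z))"
    by (rule nf_lin_ext_U_act[symmetric])
  also have "lin_ext (\<lambda>l. single (map (U_act (transv a b 1)) l) 1) (joh_chain i z) = joh_chain i ?z"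
  proof (rule lin_eq_on[OF lin_comp[OF lin_lin_ext lin_joh_chain] lin_comp[OF lin_joh_chain lin_chain_map]])
    fix l assume "l \<in> keys z"
    then have "set l \<subseteq> CI" using ZI_keys[OF z(1)] by (auto simp: bar_basis_def)
    then have eq: "map (johnson \<circ> conj_aut \<tau> \<tau>') l = map (U_act (transv a b 1) \<circ> johnson) l"
      by (auto simp: johnson_conj_aut)
    show "lin_ext (\<lambda>l. single (map (U_act (transv a b 1)) l) 1) (joh_chain i (single l 1)) = joh_chain i (chain_map (conj_aut \<tau> \<tau>') (single l 1))"
      by (simp add: chain_map_def joh_chain_def) (simp only: eq)
  qed
  finally have eq: "ext_act i (transv a b 1) x = nf (ext_rel i U_inf) (joh_chain i ?z)" .
  show ?thesis
    unfolding eq alb_image_iff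
    using keys_nf[OF op_closed_U keys_joh_chain[OF ZI_keys[OF z']]] nf_diff_in[OF subsp_RU] z' by blast
qed

lemma ext_act_alb_image: "A \<in> GL_inf \<Longrightarrow> x \<in> alb_image i \<Longrightarrow> ext_act i A x \<in> alb_image i"
  by (rule GL_stable[OF subsp_alb_image ext_rel_alb_image _ ext_act_transv_alb_image]) (auto simp: alb_image_iff)

text \<open>Stability of the image puts the transformed element in the range of
  \<open>alb_embed\<close>, so the chosen preimage is a genuine one.\<close>

lemma alb_act_props:
  assumes A: "A \<in> GL_inf" and v: "v \<in> carrier (albanese IA_inf i)"
  shows "alb_act i A v \<in> carrier (albanese IA_inf i)"
    and "alb_embed i (alb_act i A v) = ext_map i U_inf (U_act A) (alb_embed i v)"
proof -
  obtain n where n: "level n A" using A by (auto simp: GL_inf_level)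
  obtain z where z: "z \<in> ZI i" "v = cst (BA i) (prA z)" using v by (auto simp: carrier_albanese)
  have "ext_map i U_inf (U_act A) (alb_embed i v)
      = cst (ext_rel i U_inf) (lin_ext (\<lambda>l. single (map (U_act A) l) 1) (joh_chain i z))"
    by (simp add: z(2) alb_embed_cst[OF ZI_keys[OF z(1)]] ext_map_cst U_act_vlin[OF n])
  also have "\<dots> = cst (ext_rel i U_inf) (ext_act i A (joh_chain i z))"
    using cst_nf[OF subsp_RU] nf_lin_ext_U_act by metis
  also obtain z' where z': "z' \<in> ZI i" "ext_act i A (joh_chain i z) - joh_chain i z' \<in> ext_rel i U_inf"
    using ext_act_alb_image[OF A joh_chain_alb_image[OF z(1)]] by (auto simp: alb_image_iff)
  have "cst (ext_rel i U_inf) (ext_act i A (joh_chain i z)) = alb_embed i (cst (BA i) (prA z'))"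
    using z'(2) by (simp add: alb_embed_cst[OF ZI_keys[OF z'(1)]] cst_eq_iff)
  finally have "ext_map i U_inf (U_act A) (alb_embed i v) \<in> alb_embed i ` carrier (albanese IA_inf i)"
    using z'(1) by (auto simp: carrier_albanese)
  then show "alb_act i A v \<in> carrier (albanese IA_inf i)"
    "alb_embed i (alb_act i A v) = ext_map i U_inf (U_act A) (alb_embed i v)"
    unfolding alb_act_def by (rule inv_into_into, rule f_inv_into_f)
qed

section \<open>The surjection\<close>

definition alb_surj :: "nat \<Rightarrow> ((nat word \<Rightarrow> nat word) set list \<Rightarrow>\<^sub>0 rat) set
    \<Rightarrow> (((nat \<Rightarrow>\<^sub>0 rat) list \<Rightarrow>\<^sub>0 rat) set \<times> ((nat \<Rightarrow>\<^sub>0 rat) \<Rightarrow> rat) \<Rightarrow>\<^sub>0 rat) set" where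
  "alb_surj i v = Phi i (alb_embed i v)"

abbreviation "TT k \<equiv> tensor (EH (Suc (Suc k))) H_dual"

lemma alb_surj_cst: "z \<in> ZI (Suc k) \<Longrightarrow> alb_surj (Suc k) (cst (BA (Suc k)) (prA z))
    = cst (TR (Suc (Suc k))) (lin_ext (Phi_list (Suc (Suc k))) (joh_chain (Suc k) z))"
  by (simp add: alb_surj_def alb_embed_cst ZI_keys Phi_cst)

lemma alb_embed_in: "v \<in> carrier (albanese IA_inf i) \<Longrightarrow> alb_embed i v \<in> carrier (ext_pow i U_inf)"
  using keys_joh_chain[OF ZI_keys] by (auto simp: carrier_albanese alb_embed_cst ZI_keys carrier_ext_pow)

lemma alb_surj_linear: "linear_map rat_field (albanese IA_inf (Suc k)) (TT k) (alb_surj (Suc k))"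
proof (rule linear_mapI[OF vectorspace_albanese vectorspace_tensor])
  fix v w a assume v: "v \<in> carrier (albanese IA_inf (Suc k))"
  show "alb_surj (Suc k) v \<in> carrier (TT k)"
    unfolding alb_surj_def by (rule vlin_closed[OF Phi_vlin alb_embed_in[OF v]])
  obtain z where z: "z \<in> ZI (Suc k)" "v = cst (BA (Suc k)) (prA z)" using v by (auto simp: carrier_albanese)
  have "a \<odot>\<^bsub>albanese IA_inf (Suc k)\<^esub> v = cst (BA (Suc k)) (prA (sc a z))"
    by (simp add: z smult_albanese lin_sc[OF lin_chain_map])
  then show "alb_surj (Suc k) (a \<odot>\<^bsub>albanese IA_inf (Suc k)\<^esub> v) = a \<odot>\<^bsub>TT k\<^esub> alb_surj (Suc k) v"
    using subsp_sc[OF subsp_cyc_set z(1), of a]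
    by (simp add: alb_surj_cst z smult_tensor lin_sc[OF lin_joh_chain] lin_ext_scale)
  assume "w \<in> carrier (albanese IA_inf (Suc k))"
  then obtain y where y: "y \<in> ZI (Suc k)" "w = cst (BA (Suc k)) (prA y)" by (auto simp: carrier_albanese)
  have "v \<oplus>\<^bsub>albanese IA_inf (Suc k)\<^esub> w = cst (BA (Suc k)) (prA (z + y))"
    by (simp add: z y add_albanese lin_add[OF lin_chain_map])
  then show "alb_surj (Suc k) (v \<oplus>\<^bsub>albanese IA_inf (Suc k)\<^esub> w) = alb_surj (Suc k) v \<oplus>\<^bsub>TT k\<^esub> alb_surj (Suc k) w"
    using subsp_add[OF subsp_cyc_set z(1) y(1)]
    by (simp add: alb_surj_cst z y add_tensor lin_add[OF lin_joh_chain] lin_ext_add)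
qed simp_all

lemma alb_surj_equivariant:
  assumes A: "A \<in> GL_inf" and v: "v \<in> carrier (albanese IA_inf (Suc k))"
  shows "alb_surj (Suc k) (alb_act (Suc k) A v)
    = tensor_map (EH (Suc (Suc k))) H_dual (ext_map (Suc (Suc k)) H_inf A) (dual_act A) (alb_surj (Suc k) v)"
proof -
  obtain n where n: "level n A" using A by (auto simp: GL_inf_level)
  show ?thesis
    unfolding alb_surj_def alb_act_props(2)[OF A v] by (rule Phi_equivariant[OF n alb_embed_in[OF v]])
qed

text \<open>All representatives of values of the map \<open>alb_surj\<close>; surjectivity is shown
  by collecting spanning tensors in this subspace.\<close>

definition Phi_image :: "nat \<Rightarrow> (((nat \<Rightarrow>\<^sub>0 rat) list \<Rightarrow>\<^sub>0 rat) set \<times> ((nat \<Rightarrow>\<^sub>0 rat) \<Rightarrow> rat) \<Rightarrow>\<^sub>0 rat) set" where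
  "Phi_image k = nf (TR (Suc (Suc k))) -` (\<lambda>z. nf (TR (Suc (Suc k))) (lin_ext (Phi_list (Suc (Suc k))) (joh_chain (Suc k) z))) ` ZI (Suc k)"

lemma Phi_image_iff: "x \<in> Phi_image k \<longleftrightarrow>
    (\<exists>z\<in>ZI (Suc k). x - lin_ext (Phi_list (Suc (Suc k))) (joh_chain (Suc k) z) \<in> TR (Suc (Suc k)))"
  by (auto simp: Phi_image_def nf_eq_iff)

lemma subsp_Phi_image: "subsp (Phi_image k)"
  unfolding Phi_image_def
  by (intro subsp_vimage subsp_image lin_nf subsp_TR lin_comp[OF lin_nf[OF subsp_TR]]
      lin_comp[OF lin_lin_ext lin_joh_chain] subsp_cyc_set)

text \<open>Follows from equivariance of the contraction together with stability of the image of
  Albanese homology.\<close>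

lemma ten_act_Phi_image:
  assumes A: "A \<in> GL_inf" and x: "x \<in> Phi_image k"
  shows "ten_act (Suc (Suc k)) A x \<in> Phi_image k"
proof -
  let ?K = "Suc (Suc k)" and ?i = "Suc k"
  obtain n where n: "level n A" using A by (auto simp: GL_inf_level)
  obtain z where z: "z \<in> ZI ?i" "x - lin_ext (Phi_list ?K) (joh_chain ?i z) \<in> TR ?K"
    using x by (auto simp: Phi_image_iff)
  obtain z' where z': "z' \<in> ZI ?i" "ext_act ?i A (joh_chain ?i z) - joh_chain ?i z' \<in> ext_rel ?i U_inf"
    using ext_act_alb_image[OF A joh_chain_alb_image[OF z(1)]] by (auto simp: alb_image_iff)
  have "ten_act ?K A x = ten_act ?K A (lin_ext (Phi_list ?K) (joh_chain ?i z))"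
    using z(2) ten_act_nf[OF n] nf_eq_iff[OF subsp_TR] by metis
  also have "\<dots> = lin_ext (Phi_list ?K) (lin_ext (\<lambda>l. single (map (U_act A) l) 1) (joh_chain ?i z))"
    by (rule lin_eq_on[OF lin_comp[OF lin_ten_act lin_lin_ext] lin_comp[OF lin_lin_ext lin_lin_ext]])
      (use keys_joh_chain[OF ZI_keys[OF z(1)]] Phi_list_U_act[OF n] in auto)
  also have "\<dots> = lin_ext (Phi_list ?K) (ext_act ?i A (joh_chain ?i z))"
    unfolding nf_lin_ext_U_act[symmetric] by (rule alt_repr[OF op_closed_U alt_Phi_list, symmetric])
  also have "\<dots> = lin_ext (Phi_list ?K) (joh_chain ?i z')"
    using alt_ext_rel[OF op_closed_U alt_Phi_list z'(2)] by (simp add: lin_ext_diff)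
  finally show ?thesis using z'(1) subsp_0[OF subsp_TR] by (auto simp: Phi_image_iff intro!: bexI[of _ z'])
qed

lemma (in conj_chain) chain_in_Phi_image: "wten (Suc (Suc k)) (edual (c 0)) (map (\<lambda>p. e (c p)) [0..<Suc (Suc k)]) \<in> Phi_image k"
proof -
  let ?K = "Suc (Suc k)"
  interpret chain k c "\<lambda>q. johnson (h q)" by (rule chain_h)
  let ?hs = "map h [0..<Suc k]"
  have hs: "set ?hs \<subseteq> CI" "length ?hs = Suc k" using h_in by auto
  have z: "comm_cyc ?hs \<in> ZI (Suc k)"
    unfolding cyc_set_def
  proof (intro CollectI conjI)
    show "keys (comm_cyc ?hs) \<subseteq> bar_basis IA_inf (Suc k)"
    proof
      fix l assume "l \<in> keys (comm_cyc ?hs)"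
      then have l: "length l = length ?hs" "set l \<subseteq> set ?hs" using keys_comm_cyc[of ?hs] by blast+
      show "l \<in> bar_basis IA_inf (Suc k)"
        unfolding bar_basis_def by (intro CollectI conjI order_trans[OF l(2) hs(1)] trans[OF l(1) hs(2)])
    qed
    show "bar_boundary IA_inf (comm_cyc ?hs) = 0"
      by (rule bar_boundary_comm_cyc) (auto intro!: h_comm)
  qed
  obtain \<rho> where \<rho>: "\<rho> > 0" "Phi_list ?K (map (\<lambda>q. johnson (h q)) [0..<Suc k]) = sc \<rho> om"
    using Phi_list_us by blast
  have "lin_ext (Phi_list ?K) (joh_chain (Suc k) (comm_cyc ?hs))
      = sc (1 / fact (Suc k)) (lin_ext (\<lambda>l. Phi_list ?K (map johnson l)) (comm_cyc ?hs))"
    by (rule lin_eq_on[OF lin_comp[OF lin_lin_ext lin_joh_chain] lin_scale[OF lin_lin_ext]]) (simp add: joh_chain_def)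
  \<comment> \<open>All orderings in the cycle contribute equally; the resulting factorial cancels
    the normalization of \<open>joh_chain\<close>.\<close>
  also have "lin_ext (\<lambda>l. Phi_list ?K (map johnson l)) (comm_cyc ?hs) = sc (fact (length ?hs)) (Phi_list ?K (map johnson ?hs))"
    by (rule alt_comm_cyc[OF op_closed_U]) (use hs johnson_props(1) alt_Phi_list[of k] in auto)
  also have "sc (1 / fact (Suc k)) (sc (fact (length ?hs)) (Phi_list ?K (map johnson ?hs))) = Phi_list ?K (map johnson ?hs)"
    by (simp only: hs(2) sc_sc) simp
  also have "map johnson ?hs = map (\<lambda>q. johnson (h q)) [0..<Suc k]" by simp
  finally have eq: "lin_ext (Phi_list ?K) (joh_chain (Suc k) (comm_cyc ?hs)) = sc \<rho> om" using \<rho>(2) by simp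
  have "sc \<rho> om \<in> Phi_image k"
    using z subsp_0[OF subsp_TR] unfolding Phi_image_iff eq[symmetric] by (auto intro!: bexI[of _ "comm_cyc ?hs"])
  \<comment> \<open>Positivity of the coefficient allows the division.\<close>
  from subsp_sc[OF subsp_Phi_image this, of "1 / \<rho>"] show ?thesis using \<rho>(1) by (simp add: om_def)
qed

lemma wten_head_in_Phi_image:
  assumes "distinct cs" "length cs = Suc (Suc k)"
  shows "wten (Suc (Suc k)) (edual (cs ! 0)) (map e cs) \<in> Phi_image k"
proof -
  have "conj_chain k (\<lambda>p. cs ! p)"
    using assms by unfold_locales (auto simp: inj_on_def nth_eq_iff_index_eq less_Suc_eq_le)
  then have "wten (Suc (Suc k)) (edual (cs ! 0)) (map (\<lambda>p. e (cs ! p)) [0..<Suc (Suc k)]) \<in> Phi_image k"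
    by (rule conj_chain.chain_in_Phi_image)
  also have "map (\<lambda>p. e (cs ! p)) [0..<Suc (Suc k)] = map e cs"
    unfolding assms(2)[symmetric] by (rule nth_equalityI) simp_all
  finally show ?thesis .
qed

text \<open>If the dual index occurs in the wedge, it can be brought to the front up to sign.
  Otherwise a transvection creates its functional from one that does occur.\<close>

lemma wten_in_Phi_image:
  assumes cs: "length cs = Suc (Suc k)" "distinct cs"
  shows "wten (Suc (Suc k)) (edual d) (map e cs) \<in> Phi_image k"
proof (cases "d \<in> set cs")
  case True
  let ?K = "Suc (Suc k)"
  obtain l1 l2 where l: "cs = l1 @ d # l2" using split_list[OF True] by blast
  have "wten ?K (edual d) (map e (d # l1 @ l2)) \<in> Phi_image k"
    using wten_head_in_Phi_image[of "d # l1 @ l2" k] cs by (simp add: l)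
  moreover have "wten ?K (edual d) ([] @ e d # map e l1 @ map e l2)
      = sc ((- 1) ^ length (map e l1)) (wten ?K (edual d) ([] @ map e l1 @ e d # map e l2))"
    by (rule alt_move[OF op_closed_H_inf alt_wten]) (use cs in \<open>simp_all add: l lists_in_H_inf\<close>)
  ultimately have "sc ((- 1) ^ length l1) (wten ?K (edual d) (map e cs)) \<in> Phi_image k" by (simp add: l)
  from subsp_sc[OF subsp_Phi_image this, of "(- 1) ^ length l1"] show ?thesis
    by (simp flip: power_mult_distrib)
next
  case False
  let ?K = "Suc (Suc k)"
  define c0 where "c0 = cs ! 0"
  have c0: "c0 \<in> set cs" "d \<noteq> c0" using cs(1) False by (auto simp: c0_def)
  \<comment> \<open>This transvection fixes every \<open>e j\<close> with \<open>j\<close> in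
    \<open>cs\<close>, since \<open>d\<close> is not among them, and sends the functional at
    \<open>c0\<close> to the sum of those at \<open>c0\<close> and \<open>d\<close>; subtracting the
    known tensor leaves the desired one.\<close>
  define A where "A = transv d c0 (- 1)"
  have level: "level (Suc (max d c0)) A" unfolding A_def using c0 by (intro level_transv) auto
  then have A: "A \<in> GL_inf" by (auto simp: GL_inf_level)
  have "wten ?K (edual c0) (map e cs) \<in> Phi_image k" unfolding c0_def by (rule wten_head_in_Phi_image[OF cs(2,1)])
  then have "ten_act ?K A (wten ?K (edual c0) (map e cs)) \<in> Phi_image k" by (rule ten_act_Phi_image[OF A])
  also have "ten_act ?K A (wten ?K (edual c0) (map e cs)) = wten ?K (dual_act A (edual c0)) (map A (map e cs))"
    by (rule ten_act_wten[OF level]) (simp add: cs)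
  also have "map A (map e cs) = map e cs"
    using False by (auto simp: A_def transv_def lookup_e)
  also have "dual_act A (edual c0) = (\<lambda>x. \<Sum>m\<in>{c0, d}. 1 * lookup x m)"
    using c0(2) by (auto simp: dual_act_def A_def invf_transv edual_def lookup_transv fun_eq_iff)
  also have "wten ?K (\<lambda>x. \<Sum>m\<in>{c0, d}. 1 * lookup x m) (map e cs)
      = (\<Sum>m\<in>{c0, d}. sc 1 (wten ?K (edual m) (map e cs)))"
    by (rule wten_sum) (simp_all add: cs)
  also have "\<dots> = wten ?K (edual c0) (map e cs) + wten ?K (edual d) (map e cs)" using c0(2) by simp
  finally have "wten ?K (edual c0) (map e cs) + wten ?K (edual d) (map e cs) \<in> Phi_image k" .
  from subsp_diff[OF subsp_Phi_image this \<open>wten ?K (edual c0) (map e cs) \<in> Phi_image k\<close>] show ?thesis by simp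
qed

lemma alb_surj_surj: "alb_surj (Suc k) ` carrier (albanese IA_inf (Suc k)) = carrier (TT k)"
proof (intro subset_antisym subsetI)
  fix t assume "t \<in> alb_surj (Suc k) ` carrier (albanese IA_inf (Suc k))"
  then show "t \<in> carrier (TT k)"
    using vlin_closed[OF Phi_vlin alb_embed_in] by (auto simp: alb_surj_def)
next
  fix t assume "t \<in> carrier (TT k)"
  then obtain c where c: "t = cst (TR (Suc (Suc k))) c" "keys c \<subseteq> carrier (EH (Suc (Suc k))) \<times> carrier H_dual"
    by (auto simp: carrier_tensor)
  have "nf (TR (Suc (Suc k))) c \<in> Phi_image k"
    by (rule tensor_span[OF subsp_Phi_image wten_in_Phi_image c(2)])
  then obtain z where z: "z \<in> ZI (Suc k)"
    "nf (TR (Suc (Suc k))) c - lin_ext (Phi_list (Suc (Suc k))) (joh_chain (Suc k) z) \<in> TR (Suc (Suc k))"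
    by (auto simp: Phi_image_iff)
  have "t = cst (TR (Suc (Suc k))) (nf (TR (Suc (Suc k))) c)" by (simp add: c cst_nf)
  also have "\<dots> = alb_surj (Suc k) (cst (BA (Suc k)) (prA z))"
    using z by (simp add: alb_surj_cst cst_eq_iff)
  finally show "t \<in> alb_surj (Suc k) ` carrier (albanese IA_inf (Suc k))"
    using z(1) by (auto simp: carrier_albanese)
qed

section \<open>Infinite dimension\<close>

lemma Psi_alb_surj:
  assumes "z \<in> ZI (Suc k)"
  shows "Psi (Suc (Suc k)) (alb_surj (Suc k) (cst (BA (Suc k)) (prA z)))
    = lin_ext (\<lambda>(X, \<mu>). sc (lookup (lin_ext (minor (Suc (Suc k))) (repr (ext_rel (Suc (Suc k)) H_inf) X)) ()) (dual_vec \<mu>))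
        (lin_ext (Phi_list (Suc (Suc k))) (joh_chain (Suc k) z))"
  by (simp add: alb_surj_cst[OF assms] Psi_cst)

text \<open>Surjectivity carries the nonzero coordinates of \<open>Psi\<close> back to cycles of
  \<open>IA_inf\<close>, which serves Albanese homology and ordinary homology alike.\<close>

lemma Psi_alb_surj_hit: "\<exists>z\<in>ZI (Suc k). lookup (Psi (Suc (Suc k)) (alb_surj (Suc k) (cst (BA (Suc k)) (prA z)))) m \<noteq> 0"
proof -
  obtain t where t: "t \<in> carrier (TT k)" "lookup (Psi (Suc (Suc k)) t) m \<noteq> 0" using Psi_hit by blast
  then have "t \<in> alb_surj (Suc k) ` carrier (albanese IA_inf (Suc k))" by (simp only: alb_surj_surj)
  then show ?thesis using t(2) by (auto simp: carrier_albanese)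
qed

lemma vdim_albanese: "vdim (albanese IA_inf (Suc k)) = \<infinity>"
proof (rule vdim_infinite[OF vectorspace_albanese, of _ "\<lambda>v. Psi (Suc (Suc k)) (alb_surj (Suc k) v)"])
  fix v w a m assume "v \<in> carrier (albanese IA_inf (Suc k))"
  then obtain z where z: "z \<in> ZI (Suc k)" "v = cst (BA (Suc k)) (prA z)" by (auto simp: carrier_albanese)
  show "Psi (Suc (Suc k)) (alb_surj (Suc k) (a \<odot>\<^bsub>albanese IA_inf (Suc k)\<^esub> v)) = sc a (Psi (Suc (Suc k)) (alb_surj (Suc k) v))"
    using subsp_sc[OF subsp_cyc_set z(1), of a]
    by (simp add: z smult_albanese Psi_alb_surj lin_sc[OF lin_joh_chain] lin_ext_scale flip: lin_sc[OF lin_chain_map])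
  assume "w \<in> carrier (albanese IA_inf (Suc k))"
  then obtain y where y: "y \<in> ZI (Suc k)" "w = cst (BA (Suc k)) (prA y)" by (auto simp: carrier_albanese)
  show "Psi (Suc (Suc k)) (alb_surj (Suc k) (v \<oplus>\<^bsub>albanese IA_inf (Suc k)\<^esub> w))
      = Psi (Suc (Suc k)) (alb_surj (Suc k) v) + Psi (Suc (Suc k)) (alb_surj (Suc k) w)"
    using subsp_add[OF subsp_cyc_set z(1) y(1)]
    by (simp add: z y add_albanese Psi_alb_surj lin_add[OF lin_joh_chain] lin_ext_add flip: lin_add[OF lin_chain_map])
next
  show "\<exists>v\<in>carrier (albanese IA_inf (Suc k)). lookup (Psi (Suc (Suc k)) (alb_surj (Suc k) v)) m \<noteq> 0" for m
    using Psi_alb_surj_hit[of k m] by (auto simp: carrier_albanese)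
qed

text \<open>The same functional, pulled back further along the map from homology to Albanese
  homology.\<close>

lemma vdim_homology: "vdim (homology IA_inf (Suc k)) = \<infinity>"
proof (rule vdim_infinite[OF vectorspace_homology,
    of _ _ "\<lambda>v. Psi (Suc (Suc k)) (alb_surj (Suc k) (homology_map AI (Suc k) (ab_proj IA_inf) v))"])
  let ?V = "homology IA_inf (Suc k)" and ?B = "bar_boundaries IA_inf (Suc k)"
  have hc: "carrier ?V = cst ?B ` ZI (Suc k)" by (simp add: homology_quot carrier_quot_pmsp)
  have ops: "cst ?B x \<oplus>\<^bsub>?V\<^esub> cst ?B y = cst ?B (x + y)" "a \<odot>\<^bsub>?V\<^esub> cst ?B x = cst ?B (sc a x)" for x y a
    unfolding homology_quot by (rule add_quot_pmsp smult_quot_pmsp, rule subsp_bar_boundaries)+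
  note hm = homology_map_cst[OF ab_proj_IA_hom]
  fix v w a m assume "v \<in> carrier ?V"
  then obtain z where z: "z \<in> ZI (Suc k)" "v = cst ?B z" by (auto simp: hc)
  show "Psi (Suc (Suc k)) (alb_surj (Suc k) (homology_map AI (Suc k) (ab_proj IA_inf) (a \<odot>\<^bsub>?V\<^esub> v)))
      = sc a (Psi (Suc (Suc k)) (alb_surj (Suc k) (homology_map AI (Suc k) (ab_proj IA_inf) v)))"
    using subsp_sc[OF subsp_cyc_set z(1), of a]
    by (simp add: z ops hm Psi_alb_surj lin_sc[OF lin_joh_chain] lin_ext_scale)
  assume "w \<in> carrier ?V"
  then obtain y where y: "y \<in> ZI (Suc k)" "w = cst ?B y" by (auto simp: hc)
  show "Psi (Suc (Suc k)) (alb_surj (Suc k) (homology_map AI (Suc k) (ab_proj IA_inf) (v \<oplus>\<^bsub>?V\<^esub> w)))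
      = Psi (Suc (Suc k)) (alb_surj (Suc k) (homology_map AI (Suc k) (ab_proj IA_inf) v))
        + Psi (Suc (Suc k)) (alb_surj (Suc k) (homology_map AI (Suc k) (ab_proj IA_inf) w))"
    using subsp_add[OF subsp_cyc_set z(1) y(1)]
    by (simp add: z y ops hm Psi_alb_surj lin_add[OF lin_joh_chain] lin_ext_add)
next
  fix m
  obtain z where z: "z \<in> ZI (Suc k)" "lookup (Psi (Suc (Suc k)) (alb_surj (Suc k) (cst (BA (Suc k)) (prA z)))) m \<noteq> 0"
    using Psi_alb_surj_hit by blast
  then show "\<exists>v\<in>carrier (homology IA_inf (Suc k)).
      lookup (Psi (Suc (Suc k)) (alb_surj (Suc k) (homology_map AI (Suc k) (ab_proj IA_inf) v))) m \<noteq> 0"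
    by (intro bexI[of _ "cst (bar_boundaries IA_inf (Suc k)) z"])
      (simp_all add: homology_map_cst[OF ab_proj_IA_hom] homology_quot carrier_quot_pmsp)
qed

theorem corollary1p3:
  fixes i :: nat
  assumes "i \<ge> 1"
  shows "(\<exists>\<phi>. GL_inf_hom (albanese IA_inf i) (alb_act i)
              (tensor (ext_pow (i + 1) H_inf) H_dual)
              (\<lambda>A. tensor_map (ext_pow (i + 1) H_inf) H_dual (ext_map (i + 1) H_inf A) (dual_act A)) \<phi> \<and>
            \<phi> ` carrier (albanese IA_inf i) = carrier (tensor (ext_pow (i + 1) H_inf) H_dual)) \<and>
         vdim (albanese IA_inf i) = vdim (homology IA_inf i) \<and>
         vdim (homology IA_inf i) = \<infinity>"
proof -
  \<comment> \<open>Positivity of \<open>i\<close> provides the distinguished element whose dual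
    factor survives in the contraction.\<close>
  obtain k where i: "i = Suc k" using assms by (cases i) auto
  have i1: "i + 1 = Suc (Suc k)" by (simp add: i)
  have "GL_inf_hom (albanese IA_inf (Suc k)) (alb_act (Suc k)) (TT k)
      (\<lambda>A. tensor_map (EH (Suc (Suc k))) H_dual (ext_map (Suc (Suc k)) H_inf A) (dual_act A)) (alb_surj (Suc k))"
    unfolding GL_inf_hom_def
    by (intro conjI ballI alb_surj_linear alb_act_props(1) alb_surj_equivariant)
  then show ?thesis
    unfolding i1 unfolding i using alb_surj_surj[of k] vdim_albanese[of k] vdim_homology[of k] by auto
qed

end
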